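(* Let $X$ be either an Inoue surface of type $S^0$ or an Oeljeklaus--Toma manifold $X(K,U)$ with $r_1=r_2=1$. For $n\ge 1$ let $X_n\to X$ be the degree $n$ covering corresponding to the subgroup $q^{-1}(n\mathbb{Z})\subseteq \pi_1(X,* )$, and let $f$ be the associated minimal polynomial (where $q$ and $f$ are as defined in the context). Then, as $n\to+\infty$, $$\log\left|H_r(X_n,\mathbb{Z})_{tor}\right| \sim \begin{cases} n\log M(f) & \text{for } r=1,2,\\ 0 & \text{for } r=0,3,4,\end{cases}$$ where $M(f)$ denotes the Mahler measure of $f$. Moreover $M(f)>1$, so that the orders of the torsion parts of both $H_1(X_n,\mathbb{Z})$ and $H_2(X_n,\mathbb{Z})$ grow exponentially with $n$.
   Context: Notation: $\mathbb{H}$ is the upper half plane; $A_{tor}$ is the torsion subgroup of an abelian group $A$; for sequences, $a_n\sim b_n$ means $a_n=(1+o(1))\,b_n$ as $n\to\infty$ (in particular $a_n\sim 0$ means $a_n=0$ for all sufficiently large $n$). The Mahler measure of $f=c\prod_i(x-\alpha_i)\in\mathbb{C}[x]$ is $M(f)=|c|\prod_i\max(1,|\alpha_i|)$. Inoue surfaces of type $S^0$: let $M\in \mathrm{SL}_3(\mathbb{Z})$ have one real eigenvalue $\alpha>1$ and a pair of non-real complex conjugate eigenvalues $\beta,\overline{\beta}$. Let $(a_1,a_2,a_3)\in\mathbb{R}^3$ be an eigenvector of $M$ for $\alpha$ and $(b_1,b_2,b_3)\in\mathbb{C}^3$ an eigenvector of $M$ for $\beta$. The Inoue surface is $X=(\mathbb{H}\times\mathbb{C})/G$,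 where $G$ is the group generated by $g_0:(w,z)\mapsto(\alpha w,\beta z)$ and $g_i:(w,z)\mapsto(w+a_i,z+b_i)$, $i=1,2,3$; this action is free and properly discontinuous, so $\pi_1(X,* )\cong G$. The surjection $q:\pi_1(X,* )\to\mathbb{Z}$ sends $g_0\mapsto 1$ and $g_1,g_2,g_3\mapsto 0$. Here $f$ is the minimal polynomial of the matrix $M$. Oeljeklaus--Toma manifolds with $r_1=r_2=1$: let $K$ be a cubic number field with exactly one real embedding $\sigma_1$ and one pair of complex conjugate embeddings $\sigma_2,\overline{\sigma_2}$, with ring of integers $\mathcal{O}_K$. Let $\mathcal{O}_K^{\times,+}$ be the group of units $x$ with $\sigma_1(x)>0$ (it is infinite cyclic), and let $U\subseteq\mathcal{O}_K^{\times,+}$ be a finite-index subgroup, with generator $v$. Then $X(K,U)=(\mathbb{H}\times\mathbb{C})/(\mathcal{O}_K\rtimes U)$, where $U$ acts on $\mathcal{O}_K$ by multiplication and $(h,k)\in\mathcal{O}_K\rtimes U$ acts by $(z_1,z_2)\mapsto(\sigma_1(h)+\sigma_1(k)z_1,\ \sigma_2(h)+\sigma_2(k)z_2)$. Its fundamental group is $\mathcal{O}_K\rtimes U$, and $q:\pi_1(X,* )\to U\cong\mathbb{Z}$ is the projection, with $v\mapsto 1$. Thus $X_n=X(K,\langle v^n\rangle)$. Here $f$ is the minimal polynomial of the unit $v$ over $\mathbb{Q}$. *)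

theory Defs
  imports
    "HOL-Homology.Homology"
    "HOL-Algebra.Group_Action"
    "HOL-Library.Landau_Symbols"
    "Berlekamp_Zassenhaus.Mahler_Measure"
    "Jordan_Normal_Form.Char_Poly"
begin

text \<open>Vectors and matrices are those of Jordan_Normal_Form (indices start at 0).\<close>

unbundle no vec_syntax

subsection \<open>Torsion of an abelian group, quotient spaces, and the covers attached to q\<close>

definition torsion_part :: "('a, 'b) monoid_scheme \<Rightarrow> 'a set" where
  "torsion_part G = {x \<in> carrier G. \<exists>n::nat. 0 < n \<and> x [^]\<^bsub>G\<^esub> n = \<one>\<^bsub>G\<^esub>}"

definition orbit_space ::
    "'a topology \<Rightarrow> ('g, 'b) monoid_scheme \<Rightarrow> ('g \<Rightarrow> 'a \<Rightarrow> 'a) \<Rightarrow> 'a set topology" where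
  "orbit_space T G \<phi> =
     topology (\<lambda>U. U \<subseteq> orbits G (topspace T) \<phi> \<and>
                   openin T {x \<in> topspace T. orbit G \<phi> x \<in> U})"

lemma openin_orbit_space:
  "openin (orbit_space T G \<phi>) U \<longleftrightarrow>
     U \<subseteq> orbits G (topspace T) \<phi> \<and> openin T {x \<in> topspace T. orbit G \<phi> x \<in> U}"
proof -
  have "istopology (\<lambda>U. U \<subseteq> orbits G (topspace T) \<phi> \<and>
                        openin T {x \<in> topspace T. orbit G \<phi> x \<in> U})"
    unfolding istopology_def
  proof (intro conjI allI impI)
    fix S U
    assume S: "S \<subseteq> orbits G (topspace T) \<phi> \<and> openin T {x \<in> topspace T. orbit G \<phi> x \<in> S}"
      and U: "U \<subseteq> orbits G (topspace T) \<phi> \<and> openin T {x \<in> topspace T. orbit G \<phi> x \<in> U}"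
    show "S \<inter> U \<subseteq> orbits G (topspace T) \<phi>" using S by blast
    have "{x \<in> topspace T. orbit G \<phi> x \<in> S \<inter> U} =
        {x \<in> topspace T. orbit G \<phi> x \<in> S} \<inter> {x \<in> topspace T. orbit G \<phi> x \<in> U}" by auto
    then show "openin T {x \<in> topspace T. orbit G \<phi> x \<in> S \<inter> U}" using S U by auto
  next
    fix \<K>
    assume K: "\<forall>U\<in>\<K>. U \<subseteq> orbits G (topspace T) \<phi> \<and>
                     openin T {x \<in> topspace T. orbit G \<phi> x \<in> U}"
    show "\<Union>\<K> \<subseteq> orbits G (topspace T) \<phi>" using K by blast
    have "{x \<in> topspace T. orbit G \<phi> x \<in> \<Union>\<K>} =
        (\<Union>U\<in>\<K>. {x \<in> topspace T. orbit G \<phi> x \<in> U})" by auto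
    then show "openin T {x \<in> topspace T. orbit G \<phi> x \<in> \<Union>\<K>}" using K by auto
  qed
  then show ?thesis unfolding orbit_space_def by simp
qed

lemma quotient_map_orbit_space: "quotient_map T (orbit_space T G \<phi>) (orbit G \<phi>)"
proof -
  have "openin (orbit_space T G \<phi>) (orbits G (topspace T) \<phi>)"
  proof -
    have "{x \<in> topspace T. orbit G \<phi> x \<in> orbits G (topspace T) \<phi>} = topspace T"
      by (auto simp: orbits_def)
    then show ?thesis by (simp add: openin_orbit_space)
  qed
  then have top: "topspace (orbit_space T G \<phi>) = orbits G (topspace T) \<phi>"
    by (meson openin_orbit_space openin_subset openin_topspace subset_antisym)
  show ?thesis
    unfolding quotient_map_def top by (auto simp: openin_orbit_space orbits_def)
qed

text \<open>If \<open>G\<close> acts freely and properly discontinuously on the simply connected space \<open>T\<close>, then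
  the fundamental group of the orbit space is \<open>G\<close>, and the cover corresponding to the subgroup
  \<open>q -` (n \<int>)\<close> is the orbit space of that subgroup.\<close>

definition cyclic_cover ::
    "'a topology \<Rightarrow> ('g, 'b) monoid_scheme \<Rightarrow> ('g \<Rightarrow> 'a \<Rightarrow> 'a) \<Rightarrow> ('g \<Rightarrow> int) \<Rightarrow> nat
      \<Rightarrow> 'a set topology" where
  "cyclic_cover T G \<phi> q n =
     orbit_space T (G\<lparr>carrier := {g \<in> carrier G. int n dvd q g}\<rparr>) \<phi>"

definition HxC :: "(complex \<times> complex) set" where
  "HxC = {w. 0 < Im w} \<times> UNIV"

definition torsion_order :: "int \<Rightarrow> 'a topology \<Rightarrow> nat" where
  "torsion_order r X = card (torsion_part (homology_group r X))"

subsection \<open>Minimal polynomials over the rationals\<close>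

text \<open>\<open>Z p\<close> says that \<open>p\<close> vanishes at a fixed element of a rational algebra.\<close>

definition is_minimal_poly :: "(rat poly \<Rightarrow> bool) \<Rightarrow> rat poly \<Rightarrow> bool" where
  "is_minimal_poly Z f \<longleftrightarrow>
     lead_coeff f = 1 \<and> Z f \<and> (\<forall>g. g \<noteq> 0 \<and> Z g \<longrightarrow> degree f \<le> degree g)"

definition matrix_poly :: "'a::comm_ring_1 mat \<Rightarrow> 'a poly \<Rightarrow> 'a mat" where
  "matrix_poly A p = Matrix.mat (dim_row A) (dim_row A)
     (\<lambda>rc. \<Sum>i\<le>degree p. coeff p i * (A ^\<^sub>m i) $$ rc)"

definition matrix_minimal_poly :: "int mat \<Rightarrow> rat poly \<Rightarrow> bool" where
  "matrix_minimal_poly M f \<longleftrightarrow>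
     is_minimal_poly (\<lambda>p. matrix_poly (map_mat rat_of_int M) p = 0\<^sub>m (dim_row M) (dim_row M)) f"

definition element_minimal_poly :: "'k::field_char_0 \<Rightarrow> rat poly \<Rightarrow> bool" where
  "element_minimal_poly v f \<longleftrightarrow> is_minimal_poly (\<lambda>p. poly (map_poly of_rat p) v = 0) f"

subsection \<open>Inoue surfaces of type S0\<close>

text \<open>Since \<open>M\<close> is real of size 3, having the eigenvalues \<open>\<alpha> > 1\<close> and \<open>\<beta>\<close> non-real
  means that its spectrum is \<open>\<alpha>, \<beta>, cnj \<beta>\<close>.\<close>

definition inoue_data ::
    "int mat \<Rightarrow> real \<Rightarrow> complex \<Rightarrow> real Matrix.vec \<Rightarrow> complex Matrix.vec \<Rightarrow> bool" where
  "inoue_data M \<alpha> \<beta> a b \<longleftrightarrow>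
     M \<in> carrier_mat 3 3 \<and> Determinant.det M = 1 \<and> 1 < \<alpha> \<and> \<beta> \<notin> \<real> \<and>
     eigenvector (map_mat real_of_int M) a \<alpha> \<and>
     eigenvector (map_mat complex_of_int M) b \<beta>"

definition inoue_dilation :: "real \<Rightarrow> complex \<Rightarrow> complex \<times> complex \<Rightarrow> complex \<times> complex" where
  "inoue_dilation \<alpha> \<beta> = (\<lambda>(w, z)\<in>HxC. (complex_of_real \<alpha> * w, \<beta> * z))"

definition inoue_translation ::
    "real \<Rightarrow> complex \<Rightarrow> complex \<times> complex \<Rightarrow> complex \<times> complex" where
  "inoue_translation s t = (\<lambda>(w, z)\<in>HxC. (w + complex_of_real s, z + t))"

definition inoue_group ::
    "real \<Rightarrow> complex \<Rightarrow> real Matrix.vec \<Rightarrow> complex Matrix.vec \<Rightarrow> (complex \<times> complex \<Rightarrow> complex \<times> complex) monoid"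
  where
  "inoue_group \<alpha> \<beta> a b =
     subgroup_generated (BijGroup HxC)
       (insert (inoue_dilation \<alpha> \<beta>) ((\<lambda>i. inoue_translation (a $ i) (b $ i)) ` {..<3}))"

definition inoue_q ::
    "real \<Rightarrow> complex \<Rightarrow> real Matrix.vec \<Rightarrow> complex Matrix.vec
      \<Rightarrow> ((complex \<times> complex \<Rightarrow> complex \<times> complex) \<Rightarrow> int) \<Rightarrow> bool" where
  "inoue_q \<alpha> \<beta> a b q \<longleftrightarrow>
     q \<in> hom (inoue_group \<alpha> \<beta> a b) integer_group \<and>
     q (inoue_dilation \<alpha> \<beta>) = 1 \<and>
     (\<forall>i<3. q (inoue_translation (a $ i) (b $ i)) = 0)"

subsection \<open>Oeljeklaus--Toma manifolds with r1 = r2 = 1\<close>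

text \<open>\<open>'k\<close> is a cubic number field whose complex embeddings are \<open>\<sigma>1\<close> (real) and the
  conjugate pair \<open>\<sigma>2\<close>, \<open>cnj \<circ> \<sigma>2\<close>.\<close>

definition cubic_field_data ::
    "('k::field_char_0 \<Rightarrow> real) \<Rightarrow> ('k \<Rightarrow> complex) \<Rightarrow> bool" where
  "cubic_field_data \<sigma>1 \<sigma>2 \<longleftrightarrow>
     vector_space.dim (\<lambda>(c::rat) (x::'k). of_rat c * x) UNIV = 3 \<and>
     field_hom \<sigma>1 \<and> field_hom \<sigma>2 \<and> \<sigma>2 \<noteq> cnj \<circ> \<sigma>2 \<and>
     {\<tau>. field_hom \<tau>} = {complex_of_real \<circ> \<sigma>1, \<sigma>2, cnj \<circ> \<sigma>2}"

definition positive_units :: "('k::field_char_0 \<Rightarrow> real) \<Rightarrow> 'k monoid" where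
  "positive_units \<sigma>1 =
     \<lparr>carrier = {x. x \<noteq> 0 \<and> algebraic_int x \<and> algebraic_int (inverse x) \<and> 0 < \<sigma>1 x},
      monoid.mult = (*), one = 1\<rparr>"

definition OT_unit_data :: "('k::field_char_0 \<Rightarrow> real) \<Rightarrow> 'k set \<Rightarrow> 'k \<Rightarrow> bool" where
  "OT_unit_data \<sigma>1 U v \<longleftrightarrow>
     subgroup U (positive_units \<sigma>1) \<and>
     finite (rcosets\<^bsub>positive_units \<sigma>1\<^esub> U) \<and>
     v \<in> U \<and> U = generate (positive_units \<sigma>1) {v}"

definition OT_group :: "'k::field_char_0 set \<Rightarrow> ('k \<times> 'k) monoid" where
  "OT_group U =
     \<lparr>carrier = {h. algebraic_int h} \<times> U,
      monoid.mult = (\<lambda>(h, k) (h', k'). (h + k * h', k * k')),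
      one = (0, 1)\<rparr>"

definition OT_action ::
    "('k \<Rightarrow> real) \<Rightarrow> ('k \<Rightarrow> complex) \<Rightarrow> 'k \<times> 'k \<Rightarrow> complex \<times> complex \<Rightarrow> complex \<times> complex" where
  "OT_action \<sigma>1 \<sigma>2 = (\<lambda>(h, k). \<lambda>(z1, z2)\<in>HxC.
     (complex_of_real (\<sigma>1 h) + complex_of_real (\<sigma>1 k) * z1, \<sigma>2 h + \<sigma>2 k * z2))"

definition OT_q :: "'k::field_char_0 set \<Rightarrow> 'k \<Rightarrow> ('k \<times> 'k \<Rightarrow> int) \<Rightarrow> bool" where
  "OT_q U v q \<longleftrightarrow>
     q \<in> hom (OT_group U) integer_group \<and>
     (\<forall>h j. algebraic_int h \<longrightarrow> q (h, v powi j) = j)"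

end

theory Submission
  imports Defs
begin

text \<open>Write \<open>X\<^sub>n = T / \<Gamma>\<^sub>n\<close> with \<open>T = HxC\<close> contractible and \<open>\<Gamma>\<^sub>n\<close> generated by a lattice of
  translations of rank 3 and a dilation \<open>t\<close>, which acts on the lattice by an integer matrix
  \<open>N = M^n\<close> of determinant 1. Singular simplices lift along the free, properly discontinuous
  action, so the homology of \<open>X\<^sub>n\<close> is that of the coinvariants of the singular chains of \<open>T\<close>.
  The Wang sequence of an extension by an infinite cyclic group computes it one generator at a
  time: the three translations act trivially up to equivariant homotopy and give the exterior
  algebra of the lattice, on which \<open>t\<close> acts by the exterior powers of \<open>N\<close>. The last step, for \<open>t\<close>
  itself, identifies the torsion in degrees 1 and 2 with that of the cokernels of \<open>N - 1\<close> and
  \<open>\<Lambda>\<^sup>2 N - 1\<close>, which are finite of order \<open>\<bar>det (N - 1)\<bar> = \<bar>\<alpha>^n - 1\<bar> \<bar>\<beta>^n - 1\<bar>\<^sup>2\<close>; in the other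
  degrees there is no torsion. Since \<open>\<alpha>\<close> and \<open>\<bar>\<beta>\<bar>\<close> differ from 1, the logarithm of this order grows like
  \<open>n (max 0 (ln \<alpha>) + 2 max 0 (ln \<bar>\<beta>\<bar>)) = n ln M(f)\<close>. For an Oeljeklaus--Toma manifold, \<open>M\<close> is the
  matrix of multiplication by \<open>v\<close> in an integral basis of the field.\<close>

section \<open>Coinvariants of the singular chains under a free action\<close>

text \<open>The quotient of the chains is never formed: all statements concern chains of
  \<open>T\<close> modulo \<open>null_chains\<close>, so a change of group changes only the
  submodule, while cycles, homotopies and bases stay concrete chains. Two facts carry the algebra.
  Freeness makes the chains of \<open>T\<close> a free module over the group ring, so an equivariant
  map may be prescribed on one simplex per orbit; acyclicity of \<open>T\<close> supplies the
  fillings to be prescribed. Hence an equivariant map of positive degree that commutes with the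
  boundary up to sign is zero on homology modulo the group. Additivity, anticommutation and
  vanishing squares of the prism operators, and their compatibility with \<open>t\<close>, are all
  instances of this. In the last extension torsion is confined to a cokernel, because the other term
  of the Wang sequence is a kernel inside a free group. In degrees 0 and 3 the dilation acts as the
  identity and the cokernel is infinite cyclic; degrees 1 and 2 give the same order because, for
  determinant 1, the values at 1 of the two characteristic polynomials agree up to sign.\<close>

lemma frag_kernel_induct:
  assumes "Poly_Mapping.keys c \<subseteq> S" "frag_extend (frag_of \<circ> \<pi>) c = 0"
    and zero: "P 0" and diff: "\<And>x y. P x \<Longrightarrow> P y \<Longrightarrow> P (x - y)"
    and step: "\<And>\<sigma> \<tau>. \<sigma> \<in> S \<Longrightarrow> \<tau> \<in> S \<Longrightarrow> \<pi> \<sigma> = \<pi> \<tau> \<Longrightarrow> P (frag_of \<sigma> - frag_of \<tau>)"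
  shows "P c"
proof -
  \<comment> \<open>One representative in \<open>S\<close> for each value of \<open>\<pi>\<close>.
    The chain \<open>c\<close> differs from its image under \<open>\<rho> \<circ> \<pi>\<close> by
    differences inside fibres of \<open>\<pi>\<close>, and that image is zero because it factors
    through the hypothesis on \<open>c\<close>.\<close>
  define \<rho> where "\<rho> q = (SOME \<sigma>. \<sigma> \<in> S \<and> \<pi> \<sigma> = q)" for q
  have \<rho>: "\<rho> (\<pi> \<sigma>) \<in> S \<and> \<pi> (\<rho> (\<pi> \<sigma>)) = \<pi> \<sigma>" if "\<sigma> \<in> S" for \<sigma>
    unfolding \<rho>_def by (rule someI[where x = \<sigma>]) (use that in auto)
  have "P (c - frag_extend (frag_of \<circ> (\<rho> \<circ> \<pi>)) c)"
    using assms(1)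
  proof (induction c rule: frag_induction)
    case zero
    show ?case by (simp add: assms(3))
  next
    case (one x)
    then show ?case using step[of x "\<rho> (\<pi> x)"] \<rho>[of x] by simp
  next
    case (diff a b)
    have "a - b - frag_extend (frag_of \<circ> (\<rho> \<circ> \<pi>)) (a - b)
      = (a - frag_extend (frag_of \<circ> (\<rho> \<circ> \<pi>)) a) - (b - frag_extend (frag_of \<circ> (\<rho> \<circ> \<pi>)) b)"
      by (simp add: frag_extend_diff)
    then show ?case using diff.IH assms(4) by metis
  qed
  moreover have "frag_extend (frag_of \<circ> (\<rho> \<circ> \<pi>)) c = frag_extend (frag_of \<circ> \<rho>) (frag_extend (frag_of \<circ> \<pi>) c)"
    by (simp add: frag_extend_compose o_assoc)
  ultimately show ?thesis using assms(2) by simp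
qed

lemma additive_frag_cmul:
  fixes F :: "('s \<Rightarrow>\<^sub>0 int) \<Rightarrow> ('t \<Rightarrow>\<^sub>0 int)"
  assumes "additive F"
  shows "F (frag_cmul k c) = frag_cmul k (F c)"
proof -
  interpret additive F by fact
  have n: "F (frag_cmul (int n) c) = frag_cmul (int n) (F c)" for n
    by (induction n) (simp_all add: zero add frag_cmul_distrib)
  show ?thesis
  proof (cases k rule: int_cases2)
    case (nonpos n)
    then show ?thesis using n[of n] minus[of "frag_cmul (int n) c"] by simp
  qed (use n in auto)
qed

lemma additive_frag_extend: "additive (frag_extend f)"
  by unfold_locales (rule frag_extend_add)

lemma additive_chain_map: "additive (chain_map r g)"
  by unfold_locales (rule chain_map_add)

lemma additive_eq_on_chains:
  assumes "additive F" "additive F'" "\<And>\<sigma>. singular_simplex r T \<sigma> \<Longrightarrow> F (frag_of \<sigma>) = F' (frag_of \<sigma>)"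
    and "singular_chain r T c"
  shows "F c = F' c"
proof -
  interpret F: additive F by fact
  interpret F': additive F' by fact
  have "Poly_Mapping.keys c \<subseteq> singular_simplex_set r T"
    using assms(4) by (simp add: singular_chain_def)
  then show ?thesis
    by (induction c rule: frag_induction) (auto simp: F.zero F'.zero F.diff F'.diff assms(3))
qed

text \<open>Orbits of simplices are the basis elements of the coinvariants, so extending this map to
  chains gives the projection onto them.\<close>

definition act_orbit :: "('a \<Rightarrow> 'a) set \<Rightarrow> nat \<Rightarrow> ((nat \<Rightarrow> real) \<Rightarrow> 'a) \<Rightarrow> ((nat \<Rightarrow> real) \<Rightarrow> 'a) set" where
  "act_orbit G r \<sigma> = (\<lambda>g. simplex_map r g \<sigma>) ` G"

text \<open>The kernel of the projection of the chains of \<open>T\<close> to the coinvariants under \<open>G\<close>.\<close>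

definition null_chains :: "'a topology \<Rightarrow> ('a \<Rightarrow> 'a) set \<Rightarrow> nat \<Rightarrow> 'a chain set" where
  "null_chains T G r = {c. singular_chain r T c \<and> frag_extend (frag_of \<circ> act_orbit G r) c = 0}"

text \<open>Additivity is global, but closure and equivariance are asked on chains of
  \<open>T\<close> only, since nothing is known about the action outside
  \<open>topspace T\<close>.\<close>

definition equivariant_op ::
  "'a topology \<Rightarrow> ('a \<Rightarrow> 'a) set \<Rightarrow> nat \<Rightarrow> nat \<Rightarrow> ('a chain \<Rightarrow> 'a chain) \<Rightarrow> bool" where
  "equivariant_op T G r m F \<longleftrightarrow> additive F \<and>
     (\<forall>c. singular_chain r T c \<longrightarrow> singular_chain m T (F c)) \<and>
     (\<forall>g\<in>G. \<forall>c. singular_chain r T c \<longrightarrow> F (chain_map r g c) = chain_map m g (F c))"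

text \<open>The free group on \<open>()\<close> is a copy of the integers; with this target the
  calculus of \<open>frag_extend\<close> and \<open>frag_kernel_induct\<close> apply.\<close>

definition augmentation :: "'a chain \<Rightarrow> unit \<Rightarrow>\<^sub>0 int" where
  "augmentation = frag_extend (\<lambda>_. frag_of ())"

text \<open>Every 0-chain has boundary 0 here, so in degree 0 the augmentation must single out the
  reduced cycles.\<close>

definition reduced_cycle :: "'a topology \<Rightarrow> nat \<Rightarrow> 'a chain \<Rightarrow> bool" where
  "reduced_cycle T m c \<longleftrightarrow> singular_chain m T c \<and> chain_boundary m c = 0 \<and> (m = 0 \<longrightarrow> augmentation c = 0)"

definition acyclic_space :: "'a topology \<Rightarrow> bool" where
  "acyclic_space T \<longleftrightarrow>
     (\<forall>m c. reduced_cycle T m c \<longrightarrow> (\<exists>e. singular_chain (Suc m) T e \<and> chain_boundary (Suc m) e = c))"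

lemma null_chainsD: "c \<in> null_chains T G r \<Longrightarrow> singular_chain r T c"
  by (simp add: null_chains_def)

lemma null_0 [simp]: "0 \<in> null_chains T G r"
  by (simp add: null_chains_def)

lemma null_add: "x \<in> null_chains T G r \<Longrightarrow> y \<in> null_chains T G r \<Longrightarrow> x + y \<in> null_chains T G r"
  by (simp add: null_chains_def frag_extend_add singular_chain_add)

lemma null_diff: "x \<in> null_chains T G r \<Longrightarrow> y \<in> null_chains T G r \<Longrightarrow> x - y \<in> null_chains T G r"
  by (simp add: null_chains_def frag_extend_diff singular_chain_diff)

lemma null_minus: "x \<in> null_chains T G r \<Longrightarrow> - x \<in> null_chains T G r"
  using null_diff[of 0 T G r x] by simp

lemma null_cmul: "x \<in> null_chains T G r \<Longrightarrow> frag_cmul k x \<in> null_chains T G r"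
  by (simp add: null_chains_def frag_extend_cmul singular_chain_cmul)

lemma equivariant_opD:
  assumes "equivariant_op T G r m F"
  shows "additive F" "\<And>c. singular_chain r T c \<Longrightarrow> singular_chain m T (F c)"
    "\<And>g c. g \<in> G \<Longrightarrow> singular_chain r T c \<Longrightarrow> F (chain_map r g c) = chain_map m g (F c)"
  using assms by (auto simp: equivariant_op_def)

lemma equivariant_op_compose:
  assumes "equivariant_op T G r m F" "equivariant_op T G m k F'"
  shows "equivariant_op T G r k (\<lambda>c. F' (F c))"
  using assms unfolding equivariant_op_def additive_def by simp

lemma equivariant_op_add:
  assumes "equivariant_op T G r m F" "equivariant_op T G r m F'"
  shows "equivariant_op T G r m (\<lambda>c. F c + F' c)"
  using assms unfolding equivariant_op_def additive_def by (simp add: chain_map_add singular_chain_add)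

lemma equivariant_op_diff:
  assumes "equivariant_op T G r m F" "equivariant_op T G r m F'"
  shows "equivariant_op T G r m (\<lambda>c. F c - F' c)"
  using assms unfolding equivariant_op_def additive_def by (simp add: chain_map_diff singular_chain_diff)

lemma equivariant_op_cmul:
  assumes "equivariant_op T G r m F"
  shows "equivariant_op T G r m (\<lambda>c. frag_cmul k (F c))"
  using assms unfolding equivariant_op_def additive_def
  by (simp add: singular_chain_cmul frag_cmul_distrib2)

lemma equivariant_op_ident: "equivariant_op T G r r (\<lambda>c. c)"
  unfolding equivariant_op_def additive_def by simp

lemma equivariant_op_boundary: "equivariant_op T G r (r - 1) (chain_boundary r)"
  unfolding equivariant_op_def additive_def
  using singular_chain_boundary chain_boundary_add chain_boundary_chain_map by fastforce

text \<open>The group is a bare set of permutations of the whole type, with \<open>\<circ>\<close>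
  and \<open>id\<close> as operations; fixing a single point of \<open>T\<close> forces equality
  with \<open>id\<close> everywhere.\<close>

locale free_action =
  fixes T :: "'a topology" and G :: "('a \<Rightarrow> 'a) set"
  assumes id_mem: "id \<in> G"
    and comp_mem: "g \<in> G \<Longrightarrow> h \<in> G \<Longrightarrow> g \<circ> h \<in> G"
    and inv_mem: "g \<in> G \<Longrightarrow> \<exists>h\<in>G. h \<circ> g = id \<and> g \<circ> h = id"
    and cont: "g \<in> G \<Longrightarrow> continuous_map T T g"
    and free: "g \<in> G \<Longrightarrow> x \<in> topspace T \<Longrightarrow> g x = x \<Longrightarrow> g = id"
begin

lemma simplex_map_mem: "g \<in> G \<Longrightarrow> singular_simplex r T \<sigma> \<Longrightarrow> singular_simplex r T (simplex_map r g \<sigma>)"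
  using cont singular_simplex_simplex_map by blast

lemma chain_map_mem: "g \<in> G \<Longrightarrow> singular_chain r T c \<Longrightarrow> singular_chain r T (chain_map r g c)"
  using cont singular_chain_chain_map by blast

lemma free2:
  assumes "g \<in> G" "h \<in> G" "x \<in> topspace T" "g x = h x"
  shows "g = h"
proof -
  obtain k where k: "k \<in> G" "k \<circ> h = id" "h \<circ> k = id" using inv_mem assms(2) by blast
  have "(k \<circ> g) x = x" using k(2) assms(4) by (metis comp_apply id_apply)
  then have "k \<circ> g = id" using free comp_mem k(1) assms by blast
  then show ?thesis using k(3) by (metis comp_assoc id_comp comp_id)
qed

text \<open>Evaluating at one point of the standard simplex reduces this to freeness on points. It
  makes the singular simplices a free \<open>G\<close>-set, hence the chains a free module over the
  group ring.\<close>

lemma free_simplex: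
  assumes "g \<in> G" "h \<in> G" "singular_simplex r T \<sigma>" "simplex_map r g \<sigma> = simplex_map r h \<sigma>"
  shows "g = h"
proof -
  obtain v where v: "v \<in> standard_simplex r" using nonempty_standard_simplex by blast
  then have "\<sigma> v \<in> topspace T" using assms(3) by (auto simp: singular_simplex_def continuous_map_def)
  moreover have "g (\<sigma> v) = h (\<sigma> v)" using fun_cong[OF assms(4), of v] v by (simp add: simplex_map_def)
  ultimately show ?thesis using free2 assms by blast
qed

lemma simplex_map_comp: "simplex_map r (g \<circ> h) \<sigma> = simplex_map r g (simplex_map r h \<sigma>)"
  by (simp add: simplex_map_compose)

lemma simplex_map_ident: "singular_simplex r T \<sigma> \<Longrightarrow> simplex_map r id \<sigma> = \<sigma>"
  by (rule simplex_map_id_gen) auto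

lemma act_orbit_self: "singular_simplex r T \<sigma> \<Longrightarrow> \<sigma> \<in> act_orbit G r \<sigma>"
  unfolding act_orbit_def using id_mem simplex_map_ident by force

lemma act_orbit_act:
  assumes "g \<in> G" "singular_simplex r T \<sigma>"
  shows "act_orbit G r (simplex_map r g \<sigma>) = act_orbit G r \<sigma>"
proof -
  obtain k where k: "k \<in> G" "k \<circ> g = id" "g \<circ> k = id" using inv_mem assms(1) by blast
  have 1: "simplex_map r h (simplex_map r g \<sigma>) \<in> act_orbit G r \<sigma>" if "h \<in> G" for h
    using that comp_mem assms unfolding act_orbit_def by (metis imageI simplex_map_comp)
  have 2: "simplex_map r h \<sigma> = simplex_map r (h \<circ> k) (simplex_map r g \<sigma>)" for h
    using k(2) assms by (metis simplex_map_comp simplex_map_ident)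
  show ?thesis using 1 2 comp_mem k(1) unfolding act_orbit_def by blast
qed

lemma act_orbit_eqD:
  assumes "singular_simplex r T \<tau>" "act_orbit G r \<sigma> = act_orbit G r \<tau>"
  shows "\<exists>g\<in>G. \<tau> = simplex_map r g \<sigma>"
  using act_orbit_self[OF assms(1)] assms(2) by (auto simp: act_orbit_def)

text \<open>Simplices with equal orbits differ by a group element, so the kernel of the projection
  is generated by the differences of \<open>g \<sigma>\<close> and \<open>\<sigma>\<close>.\<close>

lemma null_induct [consumes 1, case_names zero diff step]:
  assumes "c \<in> null_chains T G r" and "P 0" and "\<And>x y. P x \<Longrightarrow> P y \<Longrightarrow> P (x - y)"
    and step: "\<And>g \<sigma>. g \<in> G \<Longrightarrow> singular_simplex r T \<sigma> \<Longrightarrow> P (frag_of (simplex_map r g \<sigma>) - frag_of \<sigma>)"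
  shows "P c"
proof (rule frag_kernel_induct[where S = "singular_simplex_set r T" and \<pi> = "act_orbit G r" and P = P and c = c])
  show "Poly_Mapping.keys c \<subseteq> singular_simplex_set r T" "frag_extend (frag_of \<circ> act_orbit G r) c = 0"
    using assms(1) by (auto simp: null_chains_def singular_chain_def)
  show "P (frag_of \<sigma> - frag_of \<tau>)" if "\<sigma> \<in> singular_simplex_set r T" "\<tau> \<in> singular_simplex_set r T"
      "act_orbit G r \<sigma> = act_orbit G r \<tau>" for \<sigma> \<tau>
    using act_orbit_eqD[of r \<sigma> \<tau>] that step by auto
qed (use assms in auto)

lemma null_act:
  assumes "g \<in> G" "singular_chain r T c"
  shows "chain_map r g c - c \<in> null_chains T G r"
proof -
  have "frag_extend (frag_of \<circ> act_orbit G r) (chain_map r g c) = frag_extend (frag_of \<circ> act_orbit G r) c"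
  proof (rule additive_eq_on_chains[OF _ _ _ assms(2)])
    show "additive (\<lambda>c. frag_extend (frag_of \<circ> act_orbit G r) (chain_map r g c))"
      by unfold_locales (simp add: chain_map_add frag_extend_add)
  qed (simp_all add: additive_frag_extend act_orbit_act assms(1))
  then show ?thesis
    using assms chain_map_mem by (simp add: null_chains_def singular_chain_diff frag_extend_diff)
qed

lemma null_equivariant:
  assumes "equivariant_op T G r m F" "c \<in> null_chains T G r"
  shows "F c \<in> null_chains T G m"
proof -
  interpret additive F using equivariant_opD[OF assms(1)] by blast
  show ?thesis
    using assms(2)
  proof (induction rule: null_induct)
    case (step g \<sigma>)
    have "F (frag_of (simplex_map r g \<sigma>)) = chain_map m g (F (frag_of \<sigma>))"
      using equivariant_opD(3)[OF assms(1) step(1), of "frag_of \<sigma>"] step(2) by (simp add: singular_chain_of)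
    then show ?case
      using null_act[OF step(1), of m "F (frag_of \<sigma>)"] equivariant_opD(2)[OF assms(1), of "frag_of \<sigma>"] step(2)
      by (simp add: diff singular_chain_of)
  qed (auto simp: zero diff null_diff)
qed

lemma null_boundary: "c \<in> null_chains T G r \<Longrightarrow> chain_boundary r c \<in> null_chains T G (r - 1)"
  using null_equivariant equivariant_op_boundary by blast

text \<open>Lifting through a surjection from a free module: a filling is chosen for one simplex in
  each orbit and transported to the others by the unique group element that moves the representative
  there.\<close>

lemma equivariant_lift:
  assumes F: "equivariant_op T G r m F"
    and ex: "\<And>\<sigma>. singular_simplex r T \<sigma> \<Longrightarrow> \<exists>w. singular_chain (Suc m) T w \<and> chain_boundary (Suc m) w = F (frag_of \<sigma>)"
  shows "\<exists>h. equivariant_op T G r (Suc m) h \<and>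
            (\<forall>c. singular_chain r T c \<longrightarrow> chain_boundary (Suc m) (h c) = F c)"
proof -
  let ?S = "\<lambda>\<sigma>. singular_simplex r T \<sigma>"
  obtain w where w: "\<And>\<sigma>. ?S \<sigma> \<Longrightarrow> singular_chain (Suc m) T (w \<sigma>)"
      "\<And>\<sigma>. ?S \<sigma> \<Longrightarrow> chain_boundary (Suc m) (w \<sigma>) = F (frag_of \<sigma>)"
    using ex by metis
  \<comment> \<open>The choice depends on the orbit of \<open>\<sigma>\<close> only, so all
    simplices of an orbit share one representative.\<close>
  define \<rho> where "\<rho> \<sigma> = (SOME \<tau>. ?S \<tau> \<and> act_orbit G r \<tau> = act_orbit G r \<sigma>)" for \<sigma>
  have \<rho>: "?S (\<rho> \<sigma>)" "act_orbit G r (\<rho> \<sigma>) = act_orbit G r \<sigma>" if "?S \<sigma>" for \<sigma>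
    using someI[of "\<lambda>\<tau>. ?S \<tau> \<and> act_orbit G r \<tau> = act_orbit G r \<sigma>" \<sigma>] that unfolding \<rho>_def by auto
  have "\<exists>g\<in>G. \<sigma> = simplex_map r g (\<rho> \<sigma>)" if "?S \<sigma>" for \<sigma>
    using act_orbit_eqD[OF that] \<rho>[OF that] by blast
  then obtain \<gamma> where \<gamma>: "\<And>\<sigma>. ?S \<sigma> \<Longrightarrow> \<gamma> \<sigma> \<in> G" "\<And>\<sigma>. ?S \<sigma> \<Longrightarrow> simplex_map r (\<gamma> \<sigma>) (\<rho> \<sigma>) = \<sigma>"
    by metis
  define h where "h = frag_extend (\<lambda>\<sigma>. chain_map (Suc m) (\<gamma> \<sigma>) (w (\<rho> \<sigma>)))"
  have h_add: "additive h" by (simp add: h_def additive_frag_extend)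
  have h_chain: "singular_chain (Suc m) T (h c)" if "singular_chain r T c" for c
    unfolding h_def
  proof (rule singular_chain_extend)
    fix \<sigma> assume "\<sigma> \<in> Poly_Mapping.keys c"
    then have "?S \<sigma>" using that by (auto simp: singular_chain_def)
    then show "singular_chain (Suc m) T (chain_map (Suc m) (\<gamma> \<sigma>) (w (\<rho> \<sigma>)))"
      using chain_map_mem \<gamma>(1) w(1) \<rho>(1) by blast
  qed
  have h_bd: "chain_boundary (Suc m) (h c) = F c" if "singular_chain r T c" for c
  proof (rule additive_eq_on_chains[OF _ _ _ that])
    show "additive (\<lambda>c. chain_boundary (Suc m) (h c))"
      by unfold_locales (simp add: h_def frag_extend_add chain_boundary_add)
    show "additive F" using equivariant_opD[OF F] by blast
    fix \<sigma> assume \<sigma>: "?S \<sigma>"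
    have "chain_boundary (Suc m) (h (frag_of \<sigma>)) = chain_map m (\<gamma> \<sigma>) (F (frag_of (\<rho> \<sigma>)))"
      using chain_boundary_chain_map[OF w(1)[OF \<rho>(1)[OF \<sigma>]]] w(2)[OF \<rho>(1)[OF \<sigma>]] by (simp add: h_def)
    also have "\<dots> = F (frag_of \<sigma>)"
      using equivariant_opD(3)[OF F \<gamma>(1)[OF \<sigma>], of "frag_of (\<rho> \<sigma>)"] \<rho>[OF \<sigma>] \<gamma>(2)[OF \<sigma>]
      by (simp add: singular_chain_of)
    finally show "chain_boundary (Suc m) (h (frag_of \<sigma>)) = F (frag_of \<sigma>)" .
  qed
  have h_eq: "h (chain_map r g c) = chain_map (Suc m) g (h c)" if g: "g \<in> G" and c: "singular_chain r T c" for g c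
  proof (rule additive_eq_on_chains[OF _ _ _ c])
    show "additive (\<lambda>c. h (chain_map r g c))" "additive (\<lambda>c. chain_map (Suc m) g (h c))"
      by (unfold_locales, simp add: h_def frag_extend_add chain_map_add)+
    fix \<sigma> assume \<sigma>: "?S \<sigma>"
    let ?\<tau> = "simplex_map r g \<sigma>"
    have \<tau>: "?S ?\<tau>" using simplex_map_mem g \<sigma> by blast
    have \<rho>eq: "\<rho> ?\<tau> = \<rho> \<sigma>" unfolding \<rho>_def using act_orbit_act[OF g \<sigma>] by simp
    \<comment> \<open>Both elements carry the representative to \<open>?\<tau>\<close>, so freeness
      makes them equal; this cocycle rule is what makes \<open>h\<close> equivariant.\<close>
    have "simplex_map r (\<gamma> ?\<tau>) (\<rho> \<sigma>) = simplex_map r (g \<circ> \<gamma> \<sigma>) (\<rho> \<sigma>)"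
      using \<gamma>(2)[OF \<tau>] \<gamma>(2)[OF \<sigma>] \<rho>eq by (simp add: simplex_map_comp)
    then have "\<gamma> ?\<tau> = g \<circ> \<gamma> \<sigma>"
      using free_simplex[OF \<gamma>(1)[OF \<tau>] comp_mem[OF g \<gamma>(1)[OF \<sigma>]] \<rho>(1)[OF \<sigma>]] by blast
    then show "h (chain_map r g (frag_of \<sigma>)) = chain_map (Suc m) g (h (frag_of \<sigma>))"
      by (simp add: h_def \<rho>eq chain_map_compose)
  qed
  show ?thesis using h_add h_chain h_bd h_eq unfolding equivariant_op_def by blast
qed

text \<open>The acyclic carrier argument. If the homotopy is known below, then \<open>F c\<close>
  minus the sign times \<open>h\<close> of the boundary of \<open>c\<close> is a cycle, and
  acyclicity fills it equivariantly. The sign \<open>\<epsilon>\<close> admits maps that anticommute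
  with the boundary, and \<open>k\<close> is the degree by which \<open>F\<close> raises.\<close>

lemma equivariant_homotopy:
  assumes acyc: "acyclic_space T"
    and F: "\<And>r. equivariant_op T G r (r + k) (F r)"
    and \<epsilon>: "\<epsilon> * \<epsilon> = (1::int)"
    and comm: "\<And>r c. singular_chain (Suc r) T c \<Longrightarrow>
       chain_boundary (Suc r + k) (F (Suc r) c) = frag_cmul \<epsilon> (F r (chain_boundary (Suc r) c))"
    and zero: "\<And>c. singular_chain 0 T c \<Longrightarrow> reduced_cycle T k (F 0 c)"
  shows "\<exists>h. (\<forall>r. equivariant_op T G r (Suc (r + k)) (h r)) \<and>
     (\<forall>r c. singular_chain r T c \<longrightarrow>
        chain_boundary (Suc (r + k)) (h r c) = F r c - frag_cmul \<epsilon> (h (r - 1) (chain_boundary r c)))"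
proof -
  \<comment> \<open>The next degree only applies \<open>h\<close> to boundaries, so \<open>P\<close>
    records the homotopy equation on cycles alone; \<open>Q\<close> is the full equation linking
    consecutive degrees.\<close>
  define P where "P r h \<longleftrightarrow> equivariant_op T G r (Suc (r + k)) h \<and>
      (\<forall>b. singular_chain r T b \<and> chain_boundary r b = 0 \<longrightarrow> chain_boundary (Suc (r + k)) (h b) = F r b)" for r h
  define Q where "Q r h h' \<longleftrightarrow> (\<forall>c. singular_chain (Suc r) T c \<longrightarrow>
      chain_boundary (Suc (Suc r + k)) (h' c) = F (Suc r) c - frag_cmul \<epsilon> (h (chain_boundary (Suc r) c)))"
      for r and h h' :: "'a chain \<Rightarrow> 'a chain"
  have "\<exists>h. P 0 h"
  proof -
    have "\<exists>w. singular_chain (Suc k) T w \<and> chain_boundary (Suc k) w = F 0 (frag_of \<sigma>)" if "singular_simplex 0 T \<sigma>" for \<sigma>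
      using acyc zero[of "frag_of \<sigma>"] that unfolding acyclic_space_def by (simp add: singular_chain_of)
    then show ?thesis using equivariant_lift[of 0 k "F 0"] F[of 0] unfolding P_def by auto
  qed
  moreover have "\<exists>h'. P (Suc r) h' \<and> Q r h h'" if h: "P r h" for r h
  proof -
    have hop: "equivariant_op T G r (Suc r + k) h" using h by (simp add: P_def)
    let ?E = "\<lambda>c. F (Suc r) c - frag_cmul \<epsilon> (h (chain_boundary (Suc r) c))"
    have E: "equivariant_op T G (Suc r) (Suc r + k) ?E"
      using equivariant_op_diff[OF F[of "Suc r"] equivariant_op_cmul[OF equivariant_op_compose[OF _ hop]]]
        equivariant_op_boundary[of T G "Suc r"] by simp
    have "\<exists>w. singular_chain (Suc (Suc r + k)) T w \<and> chain_boundary (Suc (Suc r + k)) w = ?E c"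
      if c: "singular_chain (Suc r) T c" for c
    proof -
      let ?b = "chain_boundary (Suc r) c"
      have b: "singular_chain r T ?b" "chain_boundary r ?b = 0"
        using c singular_chain_boundary_alt chain_boundary_boundary_alt by blast+
      have hb: "chain_boundary (Suc r + k) (h ?b) = F r ?b" using h b unfolding P_def by simp
      have "chain_boundary (Suc r + k) (?E c) = 0"
        by (simp only: chain_boundary_diff chain_boundary_cmul hb comm[OF c]) simp
      then have "reduced_cycle T (Suc r + k) (?E c)"
        using equivariant_opD(2)[OF E c] unfolding reduced_cycle_def by simp
      then show ?thesis using acyc unfolding acyclic_space_def by blast
    qed
    then obtain h' where h': "equivariant_op T G (Suc r) (Suc (Suc r + k)) h'"
        "\<And>c. singular_chain (Suc r) T c \<Longrightarrow> chain_boundary (Suc (Suc r + k)) (h' c) = ?E c"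
      using equivariant_lift[OF E] by (auto simp: singular_chain_of)
    have "h 0 = 0" using additive.zero[OF equivariant_opD(1)[OF hop]] .
    then show ?thesis using h' unfolding P_def Q_def by (intro exI[of _ h']) simp
  qed
  ultimately obtain h where h: "\<And>r. P r (h r)" "\<And>r. Q r (h r) (h (Suc r))"
    using dependent_nat_choice[of P Q] by metis
  have "chain_boundary (Suc (r + k)) (h r c) = F r c - frag_cmul \<epsilon> (h (r - 1) (chain_boundary r c))"
    if c: "singular_chain r T c" for r c
  proof (cases r)
    \<comment> \<open>The truncated index \<open>r - 1\<close> is harmless: the boundary is 0 and
      \<open>h 0\<close> is additive, so the correction term vanishes.\<close>
    case 0
    have "chain_boundary 0 c = 0" by (simp add: chain_boundary_def)
    moreover have "h 0 0 = 0" using h(1)[of 0] additive.zero equivariant_opD(1) unfolding P_def by blast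
    ultimately show ?thesis using h(1)[of 0] c 0 unfolding P_def by simp
  next
    case (Suc r')
    then show ?thesis using h(2)[of r'] c unfolding Q_def by simp
  qed
  then show ?thesis using h(1) unfolding P_def by blast
qed

end

section \<open>The Wang sequence of an extension by an infinite cyclic group\<close>

text \<open>Cycles, boundaries and bases of the homology of the quotient of the singular chains by
  \<open>null_chains\<close>, expressed by representatives in the singular chains of \<open>T\<close>.\<close>

definition hcycle :: "'a topology \<Rightarrow> ('a \<Rightarrow> 'a) set \<Rightarrow> nat \<Rightarrow> 'a chain \<Rightarrow> bool" where
  "hcycle T G r z \<longleftrightarrow> singular_chain r T z \<and> chain_boundary r z \<in> null_chains T G (r - 1)"

definition hzero :: "'a topology \<Rightarrow> ('a \<Rightarrow> 'a) set \<Rightarrow> nat \<Rightarrow> 'a chain \<Rightarrow> bool" where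
  "hzero T G r z \<longleftrightarrow>
     (\<exists>e. singular_chain (Suc r) T e \<and> z - chain_boundary (Suc r) e \<in> null_chains T G r)"

definition lin :: "(nat \<Rightarrow> int) \<Rightarrow> ('s \<Rightarrow>\<^sub>0 int) list \<Rightarrow> ('s \<Rightarrow>\<^sub>0 int)" where
  "lin k es = (\<Sum>i<length es. frag_cmul (k i) (es ! i))"

definition hbasis :: "'a topology \<Rightarrow> ('a \<Rightarrow> 'a) set \<Rightarrow> nat \<Rightarrow> 'a chain list \<Rightarrow> bool" where
  "hbasis T G r es \<longleftrightarrow> (\<forall>e\<in>set es. hcycle T G r e) \<and>
     (\<forall>z. hcycle T G r z \<longrightarrow> (\<exists>k. hzero T G r (z - lin k es))) \<and>
     (\<forall>k. hzero T G r (lin k es) \<longrightarrow> (\<forall>i<length es. k i = 0))"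

lemma lin_append: "lin k (es @ fs) = lin k es + lin (\<lambda>i. k (i + length es)) fs"
proof -
  have "lin k (es @ fs) = (\<Sum>i\<in>{..<length es} \<union> {length es..<length es + length fs}. frag_cmul (k i) ((es @ fs) ! i))"
    unfolding lin_def by (rule sum.cong) auto
  also have "\<dots> = lin k es + (\<Sum>i\<in>{length es..<length es + length fs}. frag_cmul (k i) ((es @ fs) ! i))"
    by (subst sum.union_disjoint) (auto simp: lin_def nth_append intro!: sum.cong)
  also have "(\<Sum>i\<in>{length es..<length es + length fs}. frag_cmul (k i) ((es @ fs) ! i))
     = lin (\<lambda>i. k (i + length es)) fs"
    unfolding lin_def
    using sum.shift_bounds_nat_ivl[of "\<lambda>i. frag_cmul (k i) ((es @ fs) ! i)" 0 "length es" "length fs"]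
    by (simp add: add.commute nth_append lessThan_atLeast0)
  finally show ?thesis .
qed

lemma lin_cong: "(\<And>i. i < length es \<Longrightarrow> k i = l i) \<Longrightarrow> lin k es = lin l es"
  unfolding lin_def by (rule sum.cong) auto

lemma lin_eq_0: "(\<And>i. i < length es \<Longrightarrow> k i = 0) \<Longrightarrow> lin k es = 0"
  unfolding lin_def by simp

lemma lin_map:
  assumes "additive F"
  shows "lin k (map F es) = F (lin k es)"
proof -
  interpret additive F by fact
  show ?thesis unfolding lin_def by (simp add: sum additive_frag_cmul[OF assms])
qed

lemma lin_diff: "lin (\<lambda>i. k i - l i) es = lin k es - lin l es"
  unfolding lin_def by (simp add: frag_cmul_diff_distrib sum_subtractf)

lemma lin_cmul: "lin (\<lambda>i. c * k i) es = frag_cmul c (lin k es)"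
  unfolding lin_def by (simp add: frag_cmul_sum)

lemma lin_closed:
  assumes "P 0" "\<And>x y. P x \<Longrightarrow> P y \<Longrightarrow> P (x + y)" "\<And>x k. P x \<Longrightarrow> P (frag_cmul k x)" "\<And>e. e \<in> set es \<Longrightarrow> P e"
  shows "P (lin k es)"
proof -
  have "P (\<Sum>i\<in>I. frag_cmul (k i) (es ! i))" if "finite I" "I \<subseteq> {..<length es}" for I
    using that by (induction I rule: finite_induct) (auto simp: assms)
  then show ?thesis unfolding lin_def by auto
qed

lemma hcycle_chain: "hcycle T G r z \<Longrightarrow> singular_chain r T z"
  by (simp add: hcycle_def)

lemma hcycle_0 [simp]: "hcycle T G r 0"
  by (simp add: hcycle_def)

lemma hcycle_add: "hcycle T G r x \<Longrightarrow> hcycle T G r y \<Longrightarrow> hcycle T G r (x + y)"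
  by (simp add: hcycle_def chain_boundary_add singular_chain_add null_add)

lemma hcycle_cmul: "hcycle T G r x \<Longrightarrow> hcycle T G r (frag_cmul k x)"
  by (simp add: hcycle_def chain_boundary_cmul singular_chain_cmul null_cmul)

lemma hcycle_lin: "(\<And>e. e \<in> set es \<Longrightarrow> hcycle T G r e) \<Longrightarrow> hcycle T G r (lin k es)"
  by (rule lin_closed) (auto intro: hcycle_add hcycle_cmul)

lemma hzero_null: "z \<in> null_chains T G r \<Longrightarrow> hzero T G r z"
  unfolding hzero_def by (rule exI[of _ 0]) simp

lemma hzero_0 [simp]: "hzero T G r 0"
  by (simp add: hzero_null)

lemma hzero_add:
  assumes "hzero T G r x" "hzero T G r y"
  shows "hzero T G r (x + y)"
proof -
  obtain e f where e: "singular_chain (Suc r) T e" "x - chain_boundary (Suc r) e \<in> null_chains T G r"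
    and f: "singular_chain (Suc r) T f" "y - chain_boundary (Suc r) f \<in> null_chains T G r"
    using assms unfolding hzero_def by blast
  show ?thesis unfolding hzero_def
    using singular_chain_add[OF e(1) f(1)] null_add[OF e(2) f(2)]
    by (intro exI[of _ "e + f"]) (simp add: chain_boundary_add algebra_simps)
qed

lemma frag_cmul_diff: "frag_cmul k (x - y) = frag_cmul k x - frag_cmul k y"
  using frag_cmul_distrib2[of k "x - y" y] by simp

lemma hzero_cmul:
  assumes "hzero T G r x"
  shows "hzero T G r (frag_cmul k x)"
proof -
  obtain e where e: "singular_chain (Suc r) T e" "x - chain_boundary (Suc r) e \<in> null_chains T G r"
    using assms unfolding hzero_def by blast
  show ?thesis unfolding hzero_def
    using singular_chain_cmul[OF e(1)] null_cmul[OF e(2), of k]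
    by (intro exI[of _ "frag_cmul k e"]) (simp add: chain_boundary_cmul frag_cmul_diff)
qed

lemma hzero_minus: "hzero T G r x \<Longrightarrow> hzero T G r (- x)"
  using hzero_cmul[of T G r x "-1"] by simp

lemma hzero_diff: "hzero T G r x \<Longrightarrow> hzero T G r y \<Longrightarrow> hzero T G r (x - y)"
  using hzero_add[of T G r x "- y"] hzero_minus by fastforce

lemma hzero_boundary: "singular_chain (Suc r) T e \<Longrightarrow> hzero T G r (chain_boundary (Suc r) e)"
  unfolding hzero_def by (rule exI[of _ e]) simp

lemma hzero_sum: "(\<And>i. i \<in> I \<Longrightarrow> hzero T G r (f i)) \<Longrightarrow> hzero T G r (sum f I)"
  by (induction I rule: infinite_finite_induct) (auto intro: hzero_add)

lemma hzero_trans: "hzero T G r (x - y) \<Longrightarrow> hzero T G r (y - z) \<Longrightarrow> hzero T G r (x - z)"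
  using hzero_add[of T G r "x - y" "y - z"] by simp

lemma hzero_cong: "hzero T G r (x - y) \<Longrightarrow> hzero T G r x \<longleftrightarrow> hzero T G r y"
  using hzero_add[of T G r "x - y" y] hzero_diff[of T G r x "x - y"] by auto

text \<open>The group \<open>G'\<close> is an extension of the infinite cyclic group generated by \<open>t\<close> by \<open>G\<close>.\<close>

locale cyclic_extension = G: free_action T G + G': free_action T G'
  for T :: "'a topology" and G G' :: "('a \<Rightarrow> 'a) set" +
  fixes t :: "'a \<Rightarrow> 'a"
  assumes sub: "G \<subseteq> G'" and t_mem: "t \<in> G'"
    and normal: "g \<in> G \<Longrightarrow> \<exists>g'\<in>G. t \<circ> g = g' \<circ> t" "g \<in> G \<Longrightarrow> \<exists>g'\<in>G. g \<circ> t = t \<circ> g'"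
    and t_power: "0 < k \<Longrightarrow> t ^^ k \<notin> G"
    and gen: "\<gamma> \<in> G' \<Longrightarrow> \<exists>g\<in>G. \<exists>k. \<gamma> = g \<circ> t ^^ k \<or> t ^^ k \<circ> \<gamma> = g"
begin

abbreviation "null \<equiv> null_chains T G"
abbreviation "null' \<equiv> null_chains T G'"

lemma t_pow_mem: "t ^^ k \<in> G'"
  by (induction k) (simp_all only: funpow.simps G'.id_mem t_mem G'.comp_mem)

lemma tmap_chain: "singular_chain r T c \<Longrightarrow> singular_chain r T (chain_map r t c)"
  using G'.chain_map_mem t_mem by blast

lemma tmap_null: "c \<in> null r \<Longrightarrow> chain_map r t c \<in> null r"
proof (induction rule: G.null_induct)
  case (step g \<sigma>)
  obtain g' where g': "g' \<in> G" "t \<circ> g = g' \<circ> t" using normal(1) step by blast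
  have "simplex_map r t (simplex_map r g \<sigma>) = simplex_map r g' (simplex_map r t \<sigma>)"
    using g'(2) by (metis G.simplex_map_comp)
  then show ?case
    using G.null_act[OF g'(1), of r "frag_of (simplex_map r t \<sigma>)"] G'.simplex_map_mem[OF t_mem step(2)]
    by (simp add: chain_map_diff singular_chain_of)
qed (auto simp: chain_map_diff null_diff)

lemma null_sub: "c \<in> null r \<Longrightarrow> c \<in> null' r"
proof (induction rule: G.null_induct)
  case (step g \<sigma>)
  then show ?case
    using G'.null_act[of g r "frag_of \<sigma>"] sub by (auto simp: singular_chain_of)
qed (auto intro: null_diff)

lemma tdiff_null': "singular_chain r T b \<Longrightarrow> chain_map r t b - b \<in> null' r"
  using G'.null_act t_mem by blast

text \<open>Modulo \<open>G\<close> every element of \<open>G'\<close> is a power of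
  \<open>t\<close>, and a difference \<open>t ^^ k\<close> minus 1 telescopes into a multiple of
  \<open>t\<close> minus 1. So the \<open>G'\<close>-coinvariants are the cokernel of
  \<open>t\<close> minus 1 on the \<open>G\<close>-coinvariants.\<close>

lemma null'_decompose:
  assumes "c \<in> null' r"
  shows "\<exists>b. singular_chain r T b \<and> c - (chain_map r t b - b) \<in> null r"
proof -
  have pow: "\<exists>b. singular_chain r T b \<and> frag_of (simplex_map r (t ^^ k) \<sigma>) - frag_of \<sigma> = chain_map r t b - b"
    if \<sigma>: "singular_simplex r T \<sigma>" for k \<sigma>
  proof (induction k)
    case 0
    show ?case by (rule exI[of _ 0]) (simp only: funpow.simps G.simplex_map_ident[OF \<sigma>], simp)
  next
    case (Suc k)
    then obtain b where b: "singular_chain r T b"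
        "frag_of (simplex_map r (t ^^ k) \<sigma>) - frag_of \<sigma> = chain_map r t b - b" by blast
    \<comment> \<open>The next summand of the telescope, added to \<open>b\<close>.\<close>
    let ?\<tau> = "frag_of (simplex_map r (t ^^ k) \<sigma>)"
    have "singular_chain r T ?\<tau>"
      using G'.simplex_map_mem[OF t_pow_mem \<sigma>] by (simp add: singular_chain_of)
    moreover have "frag_of (simplex_map r (t ^^ Suc k) \<sigma>) = chain_map r t ?\<tau>"
      by (simp add: G.simplex_map_comp)
    moreover have "chain_map r t ?\<tau> - frag_of \<sigma> = chain_map r t (?\<tau> + b) - (?\<tau> + b)"
    proof -
      have "chain_map r t b = b + (?\<tau> - frag_of \<sigma>)" by (simp add: b(2))
      then show ?thesis by (simp only: chain_map_add) simp
    qed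
    ultimately show ?case using singular_chain_add[OF _ b(1), of ?\<tau>] by metis
  qed
  show ?thesis
    using assms
  proof (induction rule: G'.null_induct)
    case zero
    show ?case by (rule exI[of _ 0]) simp
  next
    case (diff x y)
    then obtain b b' where "singular_chain r T b" "x - (chain_map r t b - b) \<in> null r"
      "singular_chain r T b'" "y - (chain_map r t b' - b') \<in> null r" by blast
    moreover have "x - y - (chain_map r t (b - b') - (b - b')) =
      (x - (chain_map r t b - b)) - (y - (chain_map r t b' - b'))"
      by (simp add: chain_map_diff)
    ultimately show ?case by (metis null_diff singular_chain_diff)
  next
    case (step \<gamma> \<sigma>)
    obtain g k where g: "g \<in> G" and disj: "\<gamma> = g \<circ> t ^^ k \<or> t ^^ k \<circ> \<gamma> = g" using gen step(1) by blast
    have \<gamma>\<sigma>: "singular_simplex r T (simplex_map r \<gamma> \<sigma>)" using G'.simplex_map_mem step by blast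
    from disj show ?case
    proof
      assume eq: "\<gamma> = g \<circ> t ^^ k"
      obtain b where b: "singular_chain r T b"
        "frag_of (simplex_map r (t ^^ k) \<sigma>) - frag_of \<sigma> = chain_map r t b - b" using pow[OF step(2)] by blast
      have "chain_map r g (frag_of (simplex_map r (t ^^ k) \<sigma>)) - frag_of (simplex_map r (t ^^ k) \<sigma>) \<in> null r"
        using G.null_act[OF g] G'.simplex_map_mem[OF t_pow_mem step(2)] by (simp only: singular_chain_of)
      then show ?case
        using b by (intro exI[of _ b]) (simp add: eq G.simplex_map_comp flip: b(2))
    next
      \<comment> \<open>A negative power of \<open>t\<close>: the telescope is run on the translate
        of \<open>\<sigma>\<close> by \<open>\<gamma>\<close> and ends at the translate by
        \<open>g\<close>, so \<open>b\<close> enters with the opposite sign.\<close>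
      assume eq: "t ^^ k \<circ> \<gamma> = g"
      obtain b where b: "singular_chain r T b"
        "frag_of (simplex_map r (t ^^ k) (simplex_map r \<gamma> \<sigma>)) - frag_of (simplex_map r \<gamma> \<sigma>) = chain_map r t b - b"
        using pow[OF \<gamma>\<sigma>] by blast
      have 1: "simplex_map r (t ^^ k) (simplex_map r \<gamma> \<sigma>) = simplex_map r g \<sigma>"
        by (simp add: G.simplex_map_comp flip: eq)
      have 2: "chain_map r g (frag_of \<sigma>) - frag_of \<sigma> \<in> null r"
        using G.null_act[OF g] step(2) by (simp only: singular_chain_of)
      have "frag_of (simplex_map r \<gamma> \<sigma>) - frag_of \<sigma> - (chain_map r t (- b) - (- b))
        = chain_map r g (frag_of \<sigma>) - frag_of \<sigma>"
        using b(2) 1 by (simp add: chain_map_minus algebra_simps)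
      then show ?case using b(1) 2 by (metis singular_chain_minus)
    qed
  qed
qed

text \<open>\<open>t\<close> normalizes \<open>G\<close> and is invertible, hence permutes the
  \<open>G\<close>-orbits of simplices injectively.\<close>

lemma act_orbit_t:
  assumes \<sigma>: "singular_simplex r T \<sigma>" and \<tau>: "singular_simplex r T \<tau>"
  shows "act_orbit G r (simplex_map r t \<sigma>) = act_orbit G r (simplex_map r t \<tau>) \<longleftrightarrow> act_orbit G r \<sigma> = act_orbit G r \<tau>"
proof
  assume "act_orbit G r (simplex_map r t \<sigma>) = act_orbit G r (simplex_map r t \<tau>)"
  then obtain g where g: "g \<in> G" "simplex_map r t \<tau> = simplex_map r g (simplex_map r t \<sigma>)"
    using G.act_orbit_eqD[OF G'.simplex_map_mem[OF t_mem \<tau>]] by blast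
  obtain g' where g': "g' \<in> G" "g \<circ> t = t \<circ> g'" using normal(2) g(1) by blast
  have "simplex_map r t \<tau> = simplex_map r t (simplex_map r g' \<sigma>)" using g g' by (metis G.simplex_map_comp)
  moreover obtain s where "s \<circ> t = id" using G'.inv_mem t_mem by blast
  ultimately have "\<tau> = simplex_map r g' \<sigma>"
    using \<tau> G.simplex_map_mem[OF g'(1) \<sigma>] by (metis G.simplex_map_comp G.simplex_map_ident)
  then show "act_orbit G r \<sigma> = act_orbit G r \<tau>" using G.act_orbit_act g'(1) \<sigma> by simp
next
  assume "act_orbit G r \<sigma> = act_orbit G r \<tau>"
  then obtain g where g: "g \<in> G" "\<tau> = simplex_map r g \<sigma>" using G.act_orbit_eqD \<tau> by blast
  obtain g' where g': "g' \<in> G" "t \<circ> g = g' \<circ> t" using normal(1) g(1) by blast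
  have "simplex_map r t \<tau> = simplex_map r g' (simplex_map r t \<sigma>)" using g g' by (metis G.simplex_map_comp)
  then show "act_orbit G r (simplex_map r t \<sigma>) = act_orbit G r (simplex_map r t \<tau>)"
    using G.act_orbit_act[OF g'(1) G'.simplex_map_mem[OF t_mem \<sigma>]] by simp
qed

text \<open>\<open>t\<close> minus 1 is injective on the \<open>G\<close>-coinvariants: a finite
  combination of orbits fixed by \<open>t\<close> would contain with one orbit all its infinitely
  many translates. With \<open>null'_decompose\<close> this gives the short exact sequence whose
  long exact sequence is the Wang sequence.\<close>

lemma tdiff_null_imp:
  assumes c: "singular_chain r T c" and null: "chain_map r t c - c \<in> null r"
  shows "c \<in> null r"
proof -
  define \<pi> where "\<pi> = frag_extend (frag_of \<circ> act_orbit G r)"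
  have lk: "Poly_Mapping.lookup (\<pi> (chain_map r t b)) (act_orbit G r (simplex_map r t \<sigma>))
      = Poly_Mapping.lookup (\<pi> b) (act_orbit G r \<sigma>)"
    if \<sigma>: "singular_simplex r T \<sigma>" and "singular_chain r T b" for \<sigma> b
    using that(2) unfolding singular_chain_def
  proof (induction b rule: frag_induction)
    case (one \<tau>)
    then show ?case using act_orbit_t[of r \<sigma> \<tau>] \<sigma> by (auto simp: \<pi>_def)
  qed (simp_all add: \<pi>_def chain_map_diff frag_extend_diff lookup_minus)
  have eq: "\<pi> (chain_map r t c) = \<pi> c" using null by (simp add: null_chains_def \<pi>_def frag_extend_diff)
  have "\<pi> c = 0"
  proof (rule ccontr)
    assume "\<pi> c \<noteq> 0"
    then obtain q where q: "q \<in> Poly_Mapping.keys (\<pi> c)" by (meson equals0I keys_eq_empty)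
    moreover have "Poly_Mapping.keys (\<pi> c) \<subseteq> (\<Union>x\<in>Poly_Mapping.keys c. {act_orbit G r x})"
      using keys_frag_extend[of "frag_of \<circ> act_orbit G r" c] by (simp add: \<pi>_def)
    ultimately obtain \<sigma> where \<sigma>: "q = act_orbit G r \<sigma>" "singular_simplex r T \<sigma>"
      using c by (auto simp: singular_chain_def)
    have pow_simplex: "singular_simplex r T (simplex_map r (t ^^ k) \<sigma>)" for k
      using G'.simplex_map_mem[OF t_pow_mem \<sigma>(2)] .
    define orb where "orb k = act_orbit G r (simplex_map r (t ^^ k) \<sigma>)" for k
    have "orb k \<in> Poly_Mapping.keys (\<pi> c)" for k
    proof (induction k)
      case 0
      show ?case using q \<sigma> by (simp only: orb_def funpow.simps G.simplex_map_ident)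
    next
      case (Suc k)
      have "orb (Suc k) = act_orbit G r (simplex_map r t (simplex_map r (t ^^ k) \<sigma>))"
        by (simp add: orb_def G.simplex_map_comp)
      then show ?case using lk[OF pow_simplex[of k] c] eq Suc by (simp add: orb_def in_keys_iff)
    qed
    moreover have "inj orb"
    proof (rule linorder_injI)
      fix j k :: nat assume "j < k"
      show "orb j \<noteq> orb k"
      proof
        assume "orb j = orb k"
        then obtain g where g: "g \<in> G" "simplex_map r (t ^^ k) \<sigma> = simplex_map r g (simplex_map r (t ^^ j) \<sigma>)"
          unfolding orb_def using G.act_orbit_eqD pow_simplex by blast
        then have "t ^^ k = g \<circ> t ^^ j"
          using G'.free_simplex[OF t_pow_mem G'.comp_mem[OF _ t_pow_mem] \<sigma>(2)] sub
          by (metis G.simplex_map_comp subsetD)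
        moreover have "t ^^ k = t ^^ (k - j) \<circ> t ^^ j" using \<open>j < k\<close> by (simp flip: funpow_add)
        moreover obtain s where "t ^^ j \<circ> s = id" using G'.inv_mem[OF t_pow_mem] by blast
        ultimately have "t ^^ (k - j) = g" by (metis comp_assoc comp_id)
        then show False using t_power[of "k - j"] \<open>j < k\<close> g(1) by simp
      qed
    qed
    ultimately show False
      by (metis finite_keys finite_subset image_subsetI infinite_UNIV_nat range_inj_infinite)
  qed
  then show ?thesis using c by (simp add: null_chains_def \<pi>_def)
qed

lemma boundary_tmap: "singular_chain r T c \<Longrightarrow>
    chain_boundary r (chain_map r t c - c) = chain_map (r - 1) t (chain_boundary r c) - chain_boundary r c"
  by (simp add: chain_boundary_diff chain_boundary_chain_map)

text \<open>The connecting map of the Wang sequence sends \<open>z\<close> to \<open>b\<close>. That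
  \<open>b\<close> is a cycle follows by taking boundaries and cancelling \<open>t\<close> minus
  1.\<close>

lemma hcycle_connecting:
  assumes "hcycle T G' (Suc s) z"
  shows "\<exists>b. hcycle T G s b \<and> chain_boundary (Suc s) z - (chain_map s t b - b) \<in> null s"
proof -
  obtain b where b: "singular_chain s T b" "chain_boundary (Suc s) z - (chain_map s t b - b) \<in> null s"
    using null'_decompose[of "chain_boundary (Suc s) z" s] assms unfolding hcycle_def by auto
  have "chain_boundary s (chain_boundary (Suc s) z - (chain_map s t b - b)) \<in> null (s - 1)"
    using G.null_boundary[OF b(2)] .
  moreover have "chain_boundary s (chain_boundary (Suc s) z) = 0"
    using assms chain_boundary_boundary_alt unfolding hcycle_def by blast
  ultimately have "- (chain_map (s - 1) t (chain_boundary s b) - chain_boundary s b) \<in> null (s - 1)"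
    by (simp add: chain_boundary_diff chain_boundary_chain_map[OF b(1)])
  then have "chain_map (s - 1) t (chain_boundary s b) - chain_boundary s b \<in> null (s - 1)"
    using null_minus by fastforce
  then have "chain_boundary s b \<in> null (s - 1)"
    using tdiff_null_imp singular_chain_boundary b(1) by (metis One_nat_def)
  then show ?thesis using b unfolding hcycle_def by blast
qed

text \<open>Exactness of the Wang sequence: a class modulo \<open>G\<close> that dies modulo
  \<open>G'\<close> lies in the image of \<open>t\<close> minus 1.\<close>

lemma hzero_connecting:
  assumes z: "hcycle T G r z" "hzero T G' r z"
  shows "\<exists>f. hcycle T G r f \<and> hzero T G r (z - (chain_map r t f - f))"
proof -
  obtain e where e: "singular_chain (Suc r) T e" "z - chain_boundary (Suc r) e \<in> null' r"
    using z(2) unfolding hzero_def by blast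
  obtain f where f: "singular_chain r T f"
      "z - chain_boundary (Suc r) e - (chain_map r t f - f) \<in> null r"
    using null'_decompose[OF e(2)] by blast
  have "chain_boundary r (z - chain_boundary (Suc r) e - (chain_map r t f - f)) \<in> null (r - 1)"
    using G.null_boundary[OF f(2)] .
  then have "chain_boundary r z - (chain_map (r - 1) t (chain_boundary r f) - chain_boundary r f) \<in> null (r - 1)"
    using chain_boundary_boundary_alt[OF e(1)] boundary_tmap[OF f(1)] by (simp add: chain_boundary_diff)
  then have "chain_map (r - 1) t (chain_boundary r f) - chain_boundary r f \<in> null (r - 1)"
    using z(1) null_diff unfolding hcycle_def by fastforce
  then have "hcycle T G r f"
    using tdiff_null_imp singular_chain_boundary f(1) unfolding hcycle_def by (metis One_nat_def)
  moreover have "hzero T G r (z - (chain_map r t f - f))"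
    unfolding hzero_def using e(1) f(2) by (intro exI[of _ e]) (simp add: algebra_simps)
  ultimately show ?thesis by blast
qed

lemma hcycle_sub: "hcycle T G r z \<Longrightarrow> hcycle T G' r z"
  unfolding hcycle_def using null_sub by blast

lemma hzero_sub: "hzero T G r z \<Longrightarrow> hzero T G' r z"
  unfolding hzero_def using null_sub by blast

text \<open>The homotopy \<open>P\<close> makes \<open>t\<close> act trivially on the homology modulo \<open>G\<close>, so the Wang sequence
  splits into short exact sequences; \<open>P\<close> itself splits the connecting map.\<close>

context
  fixes P :: "nat \<Rightarrow> 'a chain \<Rightarrow> 'a chain"
  assumes P_op: "\<And>r. equivariant_op T G r (Suc r) (P r)"
    and P_homotopy: "\<And>r c. singular_chain r T c \<Longrightarrow>
      chain_boundary (Suc r) (P r c) = chain_map r t c - c - P (r - 1) (chain_boundary r c)"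
begin

lemma P_null: "c \<in> null r \<Longrightarrow> P r c \<in> null (Suc r)"
  using G.null_equivariant[OF P_op] .

lemma P_boundary_null: "hcycle T G r f \<Longrightarrow> P (r - 1) (chain_boundary r f) \<in> null r"
proof (cases r)
  case 0
  then show ?thesis using additive.zero[OF equivariant_opD(1)[OF P_op]] by (simp add: chain_boundary_def)
next
  case (Suc s)
  assume "hcycle T G r f"
  then show ?thesis using P_null[of "chain_boundary r f" "r - 1"] Suc unfolding hcycle_def by simp
qed

lemma hzero_tdiff: "hcycle T G r f \<Longrightarrow> hzero T G r (chain_map r t f - f)"
  unfolding hzero_def using P_boundary_null[of r f] P_homotopy[of r f] equivariant_opD(2)[OF P_op, of r f]
  by (intro exI[of _ "P r f"]) (simp add: hcycle_def)

text \<open>Since \<open>P\<close> makes \<open>t\<close> minus 1 vanish in homology, exactness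
  leaves no kernel on passing from \<open>G\<close> to \<open>G'\<close>.\<close>

lemma hzero_imp: "hcycle T G r z \<Longrightarrow> hzero T G' r z \<Longrightarrow> hzero T G r z"
  using hzero_connecting hzero_tdiff hzero_cong by blast

lemma hbasis_extend_0:
  assumes "hbasis T G 0 es"
  shows "hbasis T G' 0 es"
  using assms unfolding hbasis_def
proof (elim conjE, intro conjI allI ballI impI)
  assume cyc: "\<forall>e\<in>set es. hcycle T G 0 e"
    and gen: "\<forall>z. hcycle T G 0 z \<longrightarrow> (\<exists>k. hzero T G 0 (z - lin k es))"
    and uniq: "\<forall>k. hzero T G 0 (lin k es) \<longrightarrow> (\<forall>i<length es. k i = 0)"
  show "hcycle T G' 0 e" if "e \<in> set es" for e using cyc that hcycle_sub by blast
  show "\<exists>k. hzero T G' 0 (z - lin k es)" if "hcycle T G' 0 z" for z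
  proof -
    have "hcycle T G 0 z" using that by (simp add: hcycle_def chain_boundary_def)
    then show ?thesis using gen hzero_sub by blast
  qed
  show "k i = 0" if "hzero T G' 0 (lin k es)" "i < length es" for k i
    using uniq hzero_imp[OF hcycle_lin[of es T G 0 k]] cyc that by blast
qed

text \<open>The boundary of \<open>P s y\<close> is \<open>t y - y\<close> modulo
  \<open>null\<close>, so the connecting map returns \<open>y\<close>: the prisms of
  \<open>fs\<close> split the surjection onto the homology one degree lower, while \<open>es\<close>
  is a basis of its kernel.\<close>

lemma hbasis_extend:
  assumes es: "hbasis T G (Suc s) es" and fs: "hbasis T G s fs"
  shows "hbasis T G' (Suc s) (es @ map (P s) fs)"
proof -
  interpret P: additive "P s" using equivariant_opD[OF P_op] by blast
  have es_cyc: "hcycle T G (Suc s) e" if "e \<in> set es" for e using es that by (simp add: hbasis_def)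
  have fs_cyc: "hcycle T G s e" if "e \<in> set fs" for e using fs that by (simp add: hbasis_def)
  have bd: "chain_boundary (Suc s) (P s y) - (chain_map s t y - y) \<in> null s" if "hcycle T G s y" for y
    using P_homotopy[OF hcycle_chain[OF that]] null_minus[OF P_boundary_null[OF that]] by simp
  have 1: "hcycle T G' (Suc s) (P s f)" if "hcycle T G s f" for f
  proof -
    have "chain_boundary (Suc s) (P s f) \<in> null' s"
      using null_add[OF null_sub[OF bd[OF that]] tdiff_null'[OF hcycle_chain[OF that]]] by simp
    then show ?thesis using equivariant_opD(2)[OF P_op] that by (simp add: hcycle_def)
  qed
  have 2: "\<exists>k. hzero T G' (Suc s) (z - lin k (es @ map (P s) fs))" if z: "hcycle T G' (Suc s) z" for z
  proof -
    obtain b where b: "hcycle T G s b" "chain_boundary (Suc s) z - (chain_map s t b - b) \<in> null s"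
      using hcycle_connecting z by blast
    obtain k where k: "hzero T G s (b - lin k fs)" using fs b unfolding hbasis_def by blast
    then obtain f where f: "singular_chain (Suc s) T f"
      "b - lin k fs - chain_boundary (Suc s) f \<in> null s" unfolding hzero_def by blast
    \<comment> \<open>Subtracting \<open>P s b\<close> removes the image under the connecting map,
      so the rest is a cycle already modulo \<open>G\<close>.\<close>
    have "chain_boundary (Suc s) (z - P s b) \<in> null s"
      using null_diff[OF b(2) bd[OF b(1)]] by (simp add: chain_boundary_diff)
    then have "hcycle T G (Suc s) (z - P s b)"
      using z b(1) equivariant_opD(2)[OF P_op] by (simp add: hcycle_def singular_chain_diff)
    then obtain l where l: "hzero T G (Suc s) (z - P s b - lin l es)" using es unfolding hbasis_def by blast
    \<comment> \<open>By the homotopy equation, \<open>P s\<close> of a boundary is a difference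
      killed modulo \<open>G'\<close> up to a boundary, so \<open>b\<close> may be replaced by its
      coordinates in \<open>fs\<close>.\<close>
    have "P s (b - lin k fs) = P s (b - lin k fs - chain_boundary (Suc s) f) +
       ((chain_map (Suc s) t f - f) - chain_boundary (Suc (Suc s)) (P (Suc s) f))"
      using P_homotopy[OF f(1)] by (simp add: P.diff)
    moreover have "hzero T G' (Suc s) \<dots>"
      using hzero_null[OF null_sub[OF P_null[OF f(2)]]] hzero_null[OF tdiff_null'[OF f(1)]]
        hzero_boundary[OF equivariant_opD(2)[OF P_op f(1)]] hzero_add hzero_diff by blast
    ultimately have "hzero T G' (Suc s) (P s b - P s (lin k fs))" by (simp add: P.diff)
    from hzero_add[OF this hzero_sub[OF l]] have hz: "hzero T G' (Suc s) (z - (lin l es + P s (lin k fs)))"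
      by (simp add: algebra_simps)
    define m where "m i = (if i < length es then l i else k (i - length es))" for i
    have "lin m (es @ map (P s) fs) = lin l es + P s (lin k fs)"
      unfolding lin_append lin_map[OF P.additive_axioms]
      by (intro arg_cong2[of _ _ _ _ "(+)"] arg_cong[of _ _ "P s"] lin_cong) (auto simp: m_def)
    then show ?thesis using hz by (intro exI[of _ m]) simp
  qed
  have 3: "k i = 0" if hz: "hzero T G' (Suc s) (lin k (es @ map (P s) fs))" and i: "i < length (es @ map (P s) fs)" for k i
  proof -
    let ?l = "\<lambda>i. k (i + length es)"
    define y where "y = lin ?l fs"
    have w: "lin k (es @ map (P s) fs) = lin k es + P s y"
      by (simp add: lin_append lin_map P.additive_axioms y_def)
    have y: "hcycle T G s y" unfolding y_def by (rule hcycle_lin) (rule fs_cyc)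
    have les: "hcycle T G (Suc s) (lin k es)" by (rule hcycle_lin) (rule es_cyc)
    obtain e where e: "singular_chain (Suc (Suc s)) T e"
      "lin k es + P s y - chain_boundary (Suc (Suc s)) e \<in> null' (Suc s)"
      using hz unfolding w hzero_def by blast
    obtain f where f: "singular_chain (Suc s) T f"
      "lin k es + P s y - chain_boundary (Suc (Suc s)) e - (chain_map (Suc s) t f - f) \<in> null (Suc s)"
      using null'_decompose[OF e(2)] by blast
    let ?df = "chain_boundary (Suc s) f"
    have "chain_boundary (Suc s) (lin k es + P s y - chain_boundary (Suc (Suc s)) e - (chain_map (Suc s) t f - f)) \<in> null s"
      using G.null_boundary[OF f(2)] by simp
    then have "chain_boundary (Suc s) (lin k es) + chain_boundary (Suc s) (P s y) - (chain_map s t ?df - ?df) \<in> null s"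
      using chain_boundary_boundary_alt[OF e(1)] boundary_tmap[OF f(1)]
      by (simp add: chain_boundary_diff chain_boundary_add)
    \<comment> \<open>Independence starts with the connecting map: cancelling \<open>t\<close> minus
      1 shows that \<open>y\<close> bounds, so the coefficients along \<open>fs\<close> vanish and
      only \<open>lin k es\<close> remains.\<close>
    from null_diff[OF null_diff[OF this] bd[OF y], of "chain_boundary (Suc s) (lin k es)"]
    have "chain_map s t (y - ?df) - (y - ?df) \<in> null s"
      using les by (simp add: hcycle_def chain_map_diff algebra_simps)
    then have "y - ?df \<in> null s"
      using tdiff_null_imp singular_chain_diff[OF hcycle_chain[OF y] singular_chain_boundary_alt[OF f(1)]] by blast
    then have "hzero T G s y" unfolding hzero_def using f(1) by blast
    then have l0: "?l j = 0" if "j < length fs" for j using fs that unfolding hbasis_def y_def by blast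
    then have "y = 0" unfolding y_def by (rule lin_eq_0)
    then have "hzero T G' (Suc s) (lin k es)" using hz w by (simp add: P.zero)
    then have "hzero T G (Suc s) (lin k es)" using hzero_imp les by blast
    then have k0: "\<forall>j<length es. k j = 0" using es unfolding hbasis_def by blast
    show "k i = 0"
    proof (cases "i < length es")
      case False
      then show ?thesis using l0[of "i - length es"] i by simp
    qed (use k0 in blast)
  qed
  show ?thesis unfolding hbasis_def using 1 2 3 es_cyc fs_cyc hcycle_sub by auto
qed

end

end

section \<open>Torsion and relations of a cyclic extension in coordinates\<close>

lemma lin_sum: "finite J \<Longrightarrow> (\<Sum>j\<in>J. lin (f j) es) = lin (\<lambda>i. \<Sum>j\<in>J. f j i) es"
proof (induction J rule: finite_induct)
  case empty
  then show ?case by (simp add: lin_eq_0)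
next
  case (insert x J)
  then show ?case by (simp add: lin_def frag_cmul_distrib sum.distrib)
qed

lemma lin_unit: "j < length es \<Longrightarrow> lin (\<lambda>i. if i = j then 1 else 0) es = es ! j"
proof -
  assume j: "j < length es"
  have "lin (\<lambda>i. if i = j then 1 else 0) es = (\<Sum>i\<in>{..<length es}. if i = j then es ! i else 0)"
    unfolding lin_def by (intro sum.cong) auto
  then show ?thesis using j by simp
qed

context cyclic_extension
begin

lemma tmap_hzero: "hzero T G r z \<Longrightarrow> hzero T G r (chain_map r t z)"
proof -
  assume "hzero T G r z"
  then obtain e where e: "singular_chain (Suc r) T e" "z - chain_boundary (Suc r) e \<in> null r"
    unfolding hzero_def by blast
  have "chain_map r t z - chain_boundary (Suc r) (chain_map (Suc r) t e) \<in> null r"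
    using tmap_null[OF e(2)] by (simp add: chain_map_diff chain_boundary_chain_map[OF e(1)])
  then show ?thesis unfolding hzero_def using tmap_chain[OF e(1)] by blast
qed

lemma tmap_hcycle: "hcycle T G r z \<Longrightarrow> hcycle T G r (chain_map r t z)"
  using tmap_chain[of r z] tmap_null[of "chain_boundary r z" "r - 1"] chain_boundary_chain_map[of r T z t]
  by (simp add: hcycle_def)

text \<open>The connecting map sends a torsion class to a torsion class of homology modulo
  \<open>G\<close>, which is free with basis \<open>fs\<close>. So the image is 0 and the class
  comes from \<open>es\<close>; no homotopy for \<open>t\<close> is assumed here.\<close>

lemma hbasis_torsion_lift:
  assumes es: "hbasis T G r es" and fs: "0 < r \<Longrightarrow> hbasis T G (r - 1) fs"
    and z: "hcycle T G' r z" and n: "0 < n" "hzero T G' r (frag_cmul n z)"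
  shows "\<exists>k. hzero T G' r (z - lin k es)"
proof (cases r)
  case 0
  then have "hcycle T G r z" using z by (simp add: hcycle_def chain_boundary_def)
  then show ?thesis using es hzero_sub unfolding hbasis_def by blast
next
  case (Suc s)
  obtain b where b: "hcycle T G s b" "chain_boundary (Suc s) z - (chain_map s t b - b) \<in> null s"
    using hcycle_connecting z Suc by blast
  obtain e where e: "singular_chain (Suc r) T e" "frag_cmul n z - chain_boundary (Suc r) e \<in> null' r"
    using n(2) unfolding hzero_def by blast
  obtain f where f: "singular_chain r T f"
      "frag_cmul n z - chain_boundary (Suc r) e - (chain_map r t f - f) \<in> null r"
    using null'_decompose[OF e(2)] by blast
  let ?df = "chain_boundary r f"
  have df: "singular_chain s T ?df" using singular_chain_boundary_alt f(1) Suc by blast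
  have "chain_boundary r (frag_cmul n z - chain_boundary (Suc r) e - (chain_map r t f - f)) \<in> null s"
    using G.null_boundary[OF f(2)] Suc by simp
  then have "frag_cmul n (chain_boundary r z) - (chain_map s t ?df - ?df) \<in> null s"
    using chain_boundary_boundary_alt[OF e(1)] boundary_tmap[OF f(1)] Suc
    by (simp add: chain_boundary_diff chain_boundary_cmul)
  from null_diff[OF this null_cmul[OF b(2), of n]]
  have "chain_map s t (frag_cmul n b - ?df) - (frag_cmul n b - ?df) \<in> null s"
    using Suc by (simp add: frag_cmul_diff frag_cmul_distrib2 chain_map_diff algebra_simps)
  then have "frag_cmul n b - ?df \<in> null s"
    using tdiff_null_imp singular_chain_diff[OF singular_chain_cmul[OF hcycle_chain[OF b(1)]] df] by blast
  \<comment> \<open>The class of \<open>b\<close> is torsion; its coordinates in the basis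
    \<open>fs\<close> must vanish.\<close>
  then have nb: "hzero T G s (frag_cmul n b)" unfolding hzero_def using f(1) Suc by blast
  have fs': "hbasis T G s fs" using fs Suc by simp
  obtain k where k: "hzero T G s (b - lin k fs)" using fs' b(1) unfolding hbasis_def by blast
  have "hzero T G s (lin (\<lambda>i. n * k i) fs)"
    using hzero_cong[of T G s "frag_cmul n b" "frag_cmul n (lin k fs)"] hzero_cmul[OF k, of n] nb
    by (simp add: frag_cmul_diff lin_cmul)
  then have "\<forall>i<length fs. n * k i = 0" using fs' unfolding hbasis_def by blast
  then have "lin k fs = 0" using n(1) by (intro lin_eq_0) auto
  then obtain g where g: "singular_chain r T g" "b - chain_boundary r g \<in> null s"
    using k Suc unfolding hzero_def by auto
  let ?dg = "chain_boundary r g"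
  \<comment> \<open>With \<open>b\<close> bounded by \<open>g\<close> modulo \<open>null\<close>,
    the correction by \<open>t g - g\<close>, which is zero modulo \<open>G'\<close>, turns
    \<open>z\<close> into a cycle modulo \<open>G\<close>.\<close>
  have "chain_boundary r (z - (chain_map r t g - g)) =
     (chain_boundary r z - (chain_map s t b - b)) + (chain_map s t (b - ?dg) - (b - ?dg))"
    using boundary_tmap[OF g(1)] Suc by (simp add: chain_boundary_diff chain_map_diff)
  also have "\<dots> \<in> null s"
    using null_add[OF b(2) null_diff[OF tmap_null[OF g(2)] g(2)]] Suc by simp
  finally have "hcycle T G r (z - (chain_map r t g - g))"
    using z g(1) tmap_chain Suc by (simp add: hcycle_def singular_chain_diff)
  then obtain l where l: "hzero T G r (z - (chain_map r t g - g) - lin l es)" using es unfolding hbasis_def by blast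
  have "hzero T G' r (z - lin l es)"
    using hzero_add[OF hzero_sub[OF l] hzero_null[OF tdiff_null'[OF g(1)]]] by simp
  then show ?thesis by blast
qed

lemma tmap_lin:
  assumes A: "\<And>j. j < length es \<Longrightarrow> hzero T G r (chain_map r t (es ! j) - lin (A j) es)"
  shows "hzero T G r (chain_map r t (lin l es) - lin l es -
           lin (\<lambda>i. \<Sum>j<length es. l j * (A j i - (if i = j then 1 else 0))) es)"
proof -
  let ?n = "length es"
  have 1: "lin (\<lambda>i. \<Sum>j<?n. l j * (A j i - (if i = j then 1 else 0))) es =
     (\<Sum>j<?n. frag_cmul (l j) (lin (A j) es - es ! j))"
  proof -
    have "(\<Sum>j<?n. frag_cmul (l j) (lin (A j) es - es ! j)) =
      (\<Sum>j<?n. lin (\<lambda>i. l j * (A j i - (if i = j then 1 else 0))) es)"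
      by (rule sum.cong) (auto simp: lin_cmul lin_diff lin_unit)
    then show ?thesis by (simp add: lin_sum)
  qed
  have 2: "chain_map r t (lin l es) - lin l es = (\<Sum>j<?n. frag_cmul (l j) (chain_map r t (es ! j) - es ! j))"
    unfolding lin_def by (simp add: chain_map_sum frag_cmul_diff sum_subtractf comp_def)
  have "hzero T G r (\<Sum>j<?n. frag_cmul (l j) (chain_map r t (es ! j) - lin (A j) es))"
    by (rule hzero_sum) (auto intro!: hzero_cmul A)
  then show ?thesis unfolding 1 2 sum_subtractf[symmetric] frag_cmul_diff[symmetric] by simp
qed

text \<open>Exactness in coordinates: row \<open>j\<close> of \<open>A\<close> holds the image of
  the \<open>j\<close>-th basis class, so the relations imposed by \<open>G'\<close> are the integer
  combinations of the rows of \<open>A\<close> minus the identity.\<close>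

lemma hbasis_zero_iff:
  assumes es: "hbasis T G r es"
    and A: "\<And>j. j < length es \<Longrightarrow> hzero T G r (chain_map r t (es ! j) - lin (A j) es)"
  shows "hzero T G' r (lin k es) \<longleftrightarrow>
     (\<exists>l. \<forall>i<length es. k i = (\<Sum>j<length es. l j * (A j i - (if i = j then 1 else 0))))"
proof -
  define B where "B l i = (\<Sum>j<length es. l j * (A j i - (if i = j then 1 else 0)))" for l i
  have tm: "hzero T G r (chain_map r t (lin l es) - lin l es - lin (B l) es)" for l
    using tmap_lin[OF A] unfolding B_def by blast
  have cyc: "hcycle T G r (lin l es)" for l
    by (rule hcycle_lin) (use es in \<open>simp add: hbasis_def\<close>)
  have "\<exists>l. \<forall>i<length es. k i = B l i" if "hzero T G' r (lin k es)"
  proof -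
    obtain f where f: "hcycle T G r f" "hzero T G r (lin k es - (chain_map r t f - f))"
      using hzero_connecting[OF cyc \<open>hzero T G' r (lin k es)\<close>] by blast
    obtain l where l: "hzero T G r (f - lin l es)" using es f(1) unfolding hbasis_def by blast
    have "hzero T G r ((lin k es - (chain_map r t f - f)) + (chain_map r t (f - lin l es) - (f - lin l es))
         + (chain_map r t (lin l es) - lin l es - lin (B l) es))"
      by (intro hzero_add hzero_diff f(2) tmap_hzero l tm)
    then have "hzero T G r (lin (\<lambda>i. k i - B l i) es)"
      by (simp add: lin_diff chain_map_diff algebra_simps)
    then have "\<forall>i<length es. k i - B l i = 0" using es unfolding hbasis_def by blast
    then show ?thesis by auto
  qed
  moreover have "hzero T G' r (lin k es)" if "\<forall>i<length es. k i = B l i" for l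
  proof -
    have "hzero T G' r ((chain_map r t (lin l es) - lin l es) - (chain_map r t (lin l es) - lin l es - lin (B l) es))"
      by (intro hzero_diff[of _ _ _ "_ - _" "_ - _ - _"] hzero_sub[OF tm] hzero_null[OF tdiff_null'[OF hcycle_chain[OF cyc]]])
    then show ?thesis using lin_cong[of es k "B l"] that by simp
  qed
  ultimately show ?thesis unfolding B_def by blast
qed

end

section \<open>Prism operators of an abelian group\<close>

text \<open>Since \<open>G\<close> is abelian, every \<open>g \<in> G\<close> acts on the chains by an equivariant map, and an
  equivariant homotopy from the identity to it raises the degree of homology classes modulo \<open>G\<close>.
  These prism operators play the part of the generators of the exterior algebra on \<open>G\<close>.\<close>

locale abelian_action = free_action +
  assumes acyclic: "acyclic_space T"
    and comm: "g \<in> G \<Longrightarrow> h \<in> G \<Longrightarrow> g \<circ> h = h \<circ> g"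
begin

text \<open>A null-homotopy for \<open>F\<close> is itself equivariant, so on a cycle modulo
  \<open>G\<close> its remaining term lies in the null chains. As \<open>0 < k\<close>, the bottom
  values need only be cycles, and no augmentation is involved.\<close>

lemma equivariant_hzero:
  assumes F: "\<And>r. equivariant_op T G r (r + k) (F r)" and k: "0 < k"
    and \<epsilon>: "\<epsilon> * \<epsilon> = (1::int)"
    and comm: "\<And>r c. singular_chain (Suc r) T c \<Longrightarrow>
       chain_boundary (Suc r + k) (F (Suc r) c) = frag_cmul \<epsilon> (F r (chain_boundary (Suc r) c))"
    and zero: "\<And>c. singular_chain 0 T c \<Longrightarrow> chain_boundary k (F 0 c) = 0"
    and z: "hcycle T G r z"
  shows "hzero T G (r + k) (F r z)"
proof -
  have "reduced_cycle T k (F 0 c)" if "singular_chain 0 T c" for c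
    using zero[OF that] k equivariant_opD(2)[OF F[of 0] that] by (simp add: reduced_cycle_def)
  then obtain h where h: "\<And>r. equivariant_op T G r (Suc (r + k)) (h r)"
     "\<And>r c. singular_chain r T c \<Longrightarrow>
        chain_boundary (Suc (r + k)) (h r c) = F r c - frag_cmul \<epsilon> (h (r - 1) (chain_boundary r c))"
    using equivariant_homotopy[OF acyclic F \<epsilon> comm] by metis
  have "h (r - 1) (chain_boundary r z) \<in> null_chains T G (r + k)"
  proof (cases r)
    case 0
    then show ?thesis using additive.zero[OF equivariant_opD(1)[OF h(1)]] by (simp add: chain_boundary_def)
  next
    case (Suc s)
    then show ?thesis using null_equivariant[OF h(1)[of s], of "chain_boundary r z"] z by (simp add: hcycle_def)
  qed
  then have "F r z - chain_boundary (Suc (r + k)) (h r z) \<in> null_chains T G (r + k)"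
    using h(2)[OF hcycle_chain[OF z]] null_cmul by simp
  then show ?thesis unfolding hzero_def using equivariant_opD(2)[OF h(1) hcycle_chain[OF z]] by blast
qed

text \<open>Commutativity enters here: \<open>g\<close> acts equivariantly because it commutes with
  all of \<open>G\<close>.\<close>

lemma equivariant_op_act:
  assumes "g \<in> G"
  shows "equivariant_op T G r r (chain_map r g)"
proof -
  have "chain_map r g (chain_map r h c) = chain_map r h (chain_map r g c)" if "h \<in> G" for h c
    using comm[OF assms that] by (metis chain_map_compose comp_apply)
  then show ?thesis using chain_map_mem[OF assms] by (simp add: equivariant_op_def additive_chain_map)
qed

lemma augmentation_act: "augmentation (chain_map r g c) = augmentation c"
  unfolding augmentation_def chain_map_def frag_extend_compose by (simp add: comp_def)

text \<open>\<open>g\<close> minus 1 commutes with the boundary and preserves no augmentation, its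
  values having augmentation 0, so the equivariant homotopy lemma applies with degree 0 and sign
  1.\<close>

lemma prism_exists:
  assumes g: "g \<in> G"
  shows "\<exists>P. (\<forall>r. equivariant_op T G r (Suc r) (P r)) \<and>
     (\<forall>r c. singular_chain r T c \<longrightarrow>
        chain_boundary (Suc r) (P r c) = chain_map r g c - c - P (r - 1) (chain_boundary r c))"
proof -
  have "equivariant_op T G r (r + 0) (\<lambda>c. chain_map r g c - c)" for r
    using equivariant_op_diff[OF equivariant_op_act[OF g] equivariant_op_ident, of r] by simp
  moreover have "chain_boundary (Suc r + 0) (chain_map (Suc r) g c - c) =
      frag_cmul 1 (chain_map r g (chain_boundary (Suc r) c) - chain_boundary (Suc r) c)"
    if "singular_chain (Suc r) T c" for r c
    using chain_boundary_chain_map[OF that] by (simp add: chain_boundary_diff)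
  moreover have "reduced_cycle T 0 (chain_map 0 g c - c)" if "singular_chain 0 T c" for c
    using that chain_map_mem[OF g] augmentation_act[of 0 g c]
    by (simp add: reduced_cycle_def singular_chain_diff chain_boundary_def augmentation_def frag_extend_diff)
  ultimately show ?thesis
    using equivariant_homotopy[of 0 "\<lambda>r c. chain_map r g c - c" 1] acyclic by simp
qed

text \<open>The homotopy is an arbitrary choice, so the relations between prisms below hold only up
  to \<open>hzero\<close>.\<close>

definition prism :: "('a \<Rightarrow> 'a) \<Rightarrow> nat \<Rightarrow> 'a chain \<Rightarrow> 'a chain" where
  "prism g = (SOME P. (\<forall>r. equivariant_op T G r (Suc r) (P r)) \<and>
     (\<forall>r c. singular_chain r T c \<longrightarrow>
        chain_boundary (Suc r) (P r c) = chain_map r g c - c - P (r - 1) (chain_boundary r c)))"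

lemma prism:
  assumes "g \<in> G"
  shows prism_op: "equivariant_op T G r (Suc r) (prism g r)"
    and prism_boundary: "singular_chain r T c \<Longrightarrow>
       chain_boundary (Suc r) (prism g r c) = chain_map r g c - c - prism g (r - 1) (chain_boundary r c)"
  using someI_ex[OF prism_exists[OF assms]] unfolding prism_def by blast+

lemma prism_additive: "g \<in> G \<Longrightarrow> additive (prism g r)"
  using prism_op equivariant_opD(1) by blast

lemma prism_diff: "g \<in> G \<Longrightarrow> prism g r (x - y) = prism g r x - prism g r y"
  using additive.diff[OF prism_additive] .

lemma prism_add: "g \<in> G \<Longrightarrow> prism g r (x + y) = prism g r x + prism g r y"
  using additive.add[OF prism_additive] .

lemma prism_cmul: "g \<in> G \<Longrightarrow> prism g r (frag_cmul k x) = frag_cmul k (prism g r x)"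
  using additive_frag_cmul[OF prism_additive] .

lemma prism_chain: "g \<in> G \<Longrightarrow> singular_chain r T c \<Longrightarrow> singular_chain (Suc r) T (prism g r c)"
  using prism_op equivariant_opD(2) by blast

lemma prism_act: "g \<in> G \<Longrightarrow> h \<in> G \<Longrightarrow> singular_chain r T c \<Longrightarrow>
    prism g r (chain_map r h c) = chain_map (Suc r) h (prism g r c)"
  using prism_op equivariant_opD(3) by blast

lemma prism_null: "g \<in> G \<Longrightarrow> c \<in> null_chains T G r \<Longrightarrow> prism g r c \<in> null_chains T G (Suc r)"
  using null_equivariant prism_op by blast

lemma prism_boundary_null:
  assumes "g \<in> G" "hcycle T G r z"
  shows "prism g (r - 1) (chain_boundary r z) \<in> null_chains T G r"
proof (cases r)
  case 0
  then show ?thesis using additive.zero[OF prism_additive[OF assms(1)]] by (simp add: chain_boundary_def)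
next
  case (Suc s)
  then show ?thesis using prism_null[OF assms(1), of "chain_boundary r z" s] assms(2) by (simp add: hcycle_def)
qed

lemma prism_hcycle:
  assumes "g \<in> G" "hcycle T G r z"
  shows "hcycle T G (Suc r) (prism g r z)"
  using prism_chain[OF assms(1)] null_diff[OF null_act[OF assms(1)] prism_boundary_null[OF assms]] assms(2)
  by (simp add: hcycle_def prism_boundary[OF assms(1)])

lemma prism_hzero:
  assumes g: "g \<in> G" and z: "hzero T G r z"
  shows "hzero T G (Suc r) (prism g r z)"
proof -
  obtain e where e: "singular_chain (Suc r) T e" "z - chain_boundary (Suc r) e \<in> null_chains T G r"
    using z unfolding hzero_def by blast
  have "prism g r z = prism g r (z - chain_boundary (Suc r) e) +
       ((chain_map (Suc r) g e - e) - chain_boundary (Suc (Suc r)) (prism g (Suc r) e))"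
    using prism_boundary[OF g e(1)] by (simp add: prism_diff[OF g])
  also have "hzero T G (Suc r) \<dots>"
    by (intro hzero_add hzero_diff hzero_null[OF prism_null[OF g e(2)]] hzero_null[OF null_act[OF g e(1)]]
      hzero_boundary[OF prism_chain[OF g e(1)]])
  finally show ?thesis .
qed

lemma prism_comp:
  assumes g: "g \<in> G" and h: "h \<in> G" and z: "hcycle T G r z"
  shows "hzero T G (Suc r) (prism (g \<circ> h) r z - (prism g r z + prism h r z))"
proof -
  have gh: "g \<circ> h \<in> G" using comp_mem g h .
  \<comment> \<open>The third term is twisted by \<open>g\<close> because \<open>g \<circ> h\<close>
    minus 1 is \<open>g\<close> minus 1 plus \<open>h\<close> minus 1 applied after
    \<open>g\<close>; this makes \<open>F\<close> anticommute with the boundary exactly. The twist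
    disappears modulo null chains.\<close>
  define F where "F r c = prism (g \<circ> h) r c - prism g r c - prism h r (chain_map r g c)" for r c
  have hg: "chain_map r (g \<circ> h) c = chain_map r h (chain_map r g c)" for r c
    using comm[OF g h] by (metis chain_map_compose comp_apply)
  have bd: "chain_boundary (Suc r) (F r c) = - F (r - 1) (chain_boundary r c)" if "singular_chain r T c" for r c
    using prism_boundary[OF gh that] prism_boundary[OF g that] prism_boundary[OF h chain_map_mem[OF g that]]
    by (simp add: F_def chain_boundary_diff hg chain_boundary_chain_map[OF that])
  have Fop: "equivariant_op T G r (r + 1) (F r)" for r
    unfolding F_def using equivariant_op_diff[OF equivariant_op_diff[OF prism_op[OF gh] prism_op[OF g]]
        equivariant_op_compose[OF equivariant_op_act[OF g] prism_op[OF h]], of r] by simp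
  have "hzero T G (r + 1) (F r z)"
  proof (rule equivariant_hzero[of 1 F "- 1", OF Fop _ _ _ _ z])
    show "chain_boundary (Suc r + 1) (F (Suc r) c) = frag_cmul (- 1) (F r (chain_boundary (Suc r) c))"
      if "singular_chain (Suc r) T c" for r c using bd[OF that] by simp
    show "chain_boundary 1 (F 0 c) = 0" if "singular_chain 0 T c" for c
      using bd[OF that] additive.zero[OF equivariant_opD(1)[OF Fop]] by (simp add: chain_boundary_def)
  qed simp_all
  moreover have "hzero T G (Suc r) (prism h r (chain_map r g z - z))"
    using hzero_null prism_null[OF h] null_act[OF g hcycle_chain[OF z]] by blast
  ultimately have "hzero T G (Suc r) (F r z + prism h r (chain_map r g z - z))" using hzero_add by simp
  then show ?thesis by (simp add: F_def prism_diff[OF h] algebra_simps)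
qed

text \<open>The boundary of the prism of \<open>g\<close> applied to the prism of \<open>h\<close>
  contains \<open>g\<close> minus 1 on the latter and, with a minus sign, \<open>h\<close> minus 1
  on the prism of \<open>g\<close>. These terms cancel in the symmetric sum, which therefore
  commutes with the boundary.\<close>

lemma prism_swap:
  assumes g: "g \<in> G" and h: "h \<in> G" and z: "hcycle T G r z"
  shows "hzero T G (Suc (Suc r)) (prism g (Suc r) (prism h r z) + prism h (Suc r) (prism g r z))"
proof -
  define F where "F r c = prism g (Suc r) (prism h r c) + prism h (Suc r) (prism g r c)" for r c
  have bd: "chain_boundary (Suc (Suc r)) (F r c) = F (r - 1) (chain_boundary r c)"
    if c: "singular_chain r T c" and r: "r = Suc s \<or> r = 0 \<and> F (r - 1) (chain_boundary r c) = 0" for r c s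
  proof (cases "r = 0")
    case True
    have "prism g 0 0 = 0" "prism h 0 0 = 0" using additive.zero prism_additive g h by blast+
    then show ?thesis
      using True r c prism_boundary[OF g prism_chain[OF h c]] prism_boundary[OF h prism_chain[OF g c]]
        prism_boundary[OF g c] prism_boundary[OF h c] prism_act[OF g h c] prism_act[OF h g c]
      by (simp add: F_def chain_boundary_add prism_diff g h chain_boundary_def[of 0])
  next
    case False
    then obtain s where s: "r = Suc s" by (cases r) auto
    show ?thesis
      using s c prism_boundary[OF g prism_chain[OF h c]] prism_boundary[OF h prism_chain[OF g c]]
        prism_boundary[OF g c] prism_boundary[OF h c] prism_act[OF g h c] prism_act[OF h g c]
      by (simp add: F_def chain_boundary_add prism_diff g h)
  qed
  have Fop: "equivariant_op T G r (r + 2) (F r)" for r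
    unfolding F_def using equivariant_op_add[OF equivariant_op_compose[OF prism_op[OF h] prism_op[OF g]]
        equivariant_op_compose[OF prism_op[OF g] prism_op[OF h]], of r] by (simp add: numeral_2_eq_2)
  have "hzero T G (r + 2) (F r z)"
  proof (rule equivariant_hzero[of 2 F 1, OF Fop _ _ _ _ z])
    show "chain_boundary (Suc r + 2) (F (Suc r) c) = frag_cmul 1 (F r (chain_boundary (Suc r) c))"
      if "singular_chain (Suc r) T c" for r c using bd[OF that, of r] by simp
    have z0: "F (0 - 1) (chain_boundary 0 c) = 0" for c
      using additive.zero[OF equivariant_opD(1)[OF Fop[of 0]]] by (simp add: chain_boundary_def)
    show "chain_boundary 2 (F 0 c) = 0" if "singular_chain 0 T c" for c
      using bd[OF that] z0[of c] by (simp add: numeral_2_eq_2)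
  qed simp_all
  then show ?thesis by (simp add: F_def)
qed

text \<open>For a single \<open>g\<close> the cross terms already cancel in one product.
  Specializing \<open>prism_swap\<close> would only give twice this class.\<close>

lemma prism_square:
  assumes g: "g \<in> G" and z: "hcycle T G r z"
  shows "hzero T G (Suc (Suc r)) (prism g (Suc r) (prism g r z))"
proof -
  define F where "F r c = prism g (Suc r) (prism g r c)" for r c
  have z0: "prism g k 0 = 0" for k using additive.zero prism_additive g by blast
  have bd: "chain_boundary (Suc (Suc r)) (F r c) = (if r = 0 then 0 else F (r - 1) (chain_boundary r c))"
    if c: "singular_chain r T c" for r c
    using c prism_boundary[OF g prism_chain[OF g c]] prism_boundary[OF g c] prism_act[OF g g c]
    by (cases r) (simp_all add: F_def prism_diff g z0 chain_boundary_def[of 0])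
  have Fop: "equivariant_op T G r (r + 2) (F r)" for r
    unfolding F_def using equivariant_op_compose[OF prism_op[OF g] prism_op[OF g], of r] by (simp add: numeral_2_eq_2)
  have "hzero T G (r + 2) (F r z)"
  proof (rule equivariant_hzero[of 2 F 1, OF Fop _ _ _ _ z])
    show "chain_boundary (Suc r + 2) (F (Suc r) c) = frag_cmul 1 (F r (chain_boundary (Suc r) c))"
      if "singular_chain (Suc r) T c" for r c using bd[OF that] by simp
    show "chain_boundary 2 (F 0 c) = 0" if "singular_chain 0 T c" for c
      using bd[OF that] by (simp add: numeral_2_eq_2)
  qed simp_all
  then show ?thesis by (simp add: F_def)
qed

text \<open>Additivity at \<open>id \<circ> id = id\<close> says that the class equals its
  double.\<close>

lemma prism_id:
  assumes "hcycle T G r z"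
  shows "hzero T G (Suc r) (prism id r z)"
  using hzero_minus[OF prism_comp[OF id_mem id_mem assms]] by simp

end

locale abelian_extension = abelian_action T G + cyclic_extension T G G' t for T G G' t
begin

text \<open>Conjugating the prism of \<open>g\<close> by \<open>t\<close> yields another homotopy
  for \<open>g'\<close>, equivariant because \<open>t\<close> normalizes \<open>G\<close>; two
  homotopies for the same element agree on homology.\<close>

lemma prism_conj:
  assumes g: "g \<in> G" "g' \<in> G" "t \<circ> g = g' \<circ> t" and z: "hcycle T G r z"
  shows "hzero T G (Suc r) (chain_map (Suc r) t (prism g r z) - prism g' r (chain_map r t z))"
proof -
  obtain s where s: "s \<in> G'" "s \<circ> t = id" "t \<circ> s = id" using G'.inv_mem t_mem by blast
  have st: "chain_map r s (chain_map r t c) = c" "chain_map r t (chain_map r s c) = c" if "singular_chain r T c" for r c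
    using chain_map_ident[OF that] s(2,3) by (metis chain_map_compose comp_apply)+
  have s_chain: "singular_chain r T (chain_map r s c)" if "singular_chain r T c" for r c
    using G'.chain_map_mem s(1) that by blast
  define F where "F r c = chain_map (Suc r) t (prism g r (chain_map r s c)) - prism g' r c" for r c
  have bd: "chain_boundary (Suc r) (F r c) = - F (r - 1) (chain_boundary r c)" if c: "singular_chain r T c" for r c
  proof -
    have "chain_map r t (chain_map r g (chain_map r s c)) = chain_map r g' c"
      using st(2)[OF c] g(3) by (metis chain_map_compose comp_apply)
    then show ?thesis
      using chain_boundary_chain_map[OF prism_chain[OF g(1) s_chain[OF c]], of t]
        prism_boundary[OF g(1) s_chain[OF c]] prism_boundary[OF g(2) c] chain_boundary_chain_map[OF c, of s]
        st(2)[OF c]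
      by (cases r) (simp_all add: F_def chain_boundary_diff chain_map_diff chain_boundary_def[of 0]
        additive.zero[OF prism_additive] g)
  qed
  have Fop: "equivariant_op T G r (r + 1) (F r)" for r
    unfolding equivariant_op_def
  proof (intro conjI allI impI ballI)
    show "additive (F r)"
      by unfold_locales (simp add: F_def chain_map_add prism_add g)
    show "singular_chain (r + 1) T (F r c)" if "singular_chain r T c" for c
      using that tmap_chain prism_chain[OF g(1)] prism_chain[OF g(2)] s_chain by (simp add: F_def singular_chain_diff)
    fix h c assume h: "h \<in> G" and c: "singular_chain r T c"
    obtain h' where h': "h' \<in> G" "h \<circ> t = t \<circ> h'" using normal(2) h by blast
    have "s \<circ> h = h' \<circ> s" using h'(2) s(2,3) by (metis comp_assoc comp_id id_comp)
    then have "chain_map r s (chain_map r h c) = chain_map r h' (chain_map r s c)"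
      by (metis chain_map_compose comp_apply)
    moreover have "chain_map (Suc r) t (chain_map (Suc r) h' b) = chain_map (Suc r) h (chain_map (Suc r) t b)" for b
      using h'(2) by (metis chain_map_compose comp_apply)
    ultimately show "F r (chain_map r h c) = chain_map (r + 1) h (F r c)"
      using prism_act[OF g(1) h'(1) s_chain[OF c]] prism_act[OF g(2) h c] by (simp add: F_def chain_map_diff)
  qed
  have "hzero T G (r + 1) (F r (chain_map r t z))"
  proof (rule equivariant_hzero[of 1 F "- 1", OF Fop])
    show "chain_boundary (Suc r + 1) (F (Suc r) c) = frag_cmul (- 1) (F r (chain_boundary (Suc r) c))"
      if "singular_chain (Suc r) T c" for r c using bd[OF that] by simp
    show "chain_boundary 1 (F 0 c) = 0" if "singular_chain 0 T c" for c
      using bd[OF that] additive.zero[OF equivariant_opD(1)[OF Fop]] by (simp add: chain_boundary_def)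
    show "hcycle T G r (chain_map r t z)" using tmap_hcycle z .
  qed simp_all
  then show ?thesis using st(1)[OF hcycle_chain[OF z]] by (simp add: F_def)
qed

end

section \<open>Lifting singular simplices\<close>

definition coordinate_convex :: "(nat \<Rightarrow> real) set \<Rightarrow> bool" where
  "coordinate_convex C \<longleftrightarrow>
     (\<forall>x\<in>C. \<forall>y\<in>C. \<forall>u\<in>{0..1}. (\<lambda>i. (1 - u) * x i + u * y i) \<in> C)"

lemma connectedin_coordinate_convex:
  assumes "coordinate_convex C"
  shows "connectedin (powertop_real UNIV) C"
proof -
  define g where "g \<equiv> \<lambda>x y::nat\<Rightarrow>real. \<lambda>u i. (1 - u) * x i + u * y i"
  have "continuous_map (subtopology euclideanreal {0..1}) (powertop_real UNIV) (g x y)" for x y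
    unfolding g_def continuous_map_componentwise by (force intro: continuous_intros)
  moreover have "g x y \<in> {0..1} \<rightarrow> C" "g x y 0 = x" "g x y 1 = y" if "x \<in> C" "y \<in> C" for x y
    using that assms by (auto simp: coordinate_convex_def g_def)
  ultimately have "path_connectedin (powertop_real UNIV) C"
    unfolding path_connectedin_def path_connected_space_def pathin_def
    by (metis continuous_map_in_subtopology euclidean_product_topology top_greatest topspace_euclidean
        topspace_euclidean_subtopology)
  then show ?thesis by (rule path_connectedin_imp_connectedin)
qed

text \<open>The quotient is described by its fibres, so that \<open>X\<close> may be any model of
  the orbit space.\<close>

locale covering_action = free_action T G for T :: "'a topology" and G +
  fixes X :: "'b topology" and p :: "'a \<Rightarrow> 'b"
  assumes discontinuous:
      "x \<in> topspace T \<Longrightarrow> \<exists>U. openin T U \<and> x \<in> U \<and> (\<forall>g\<in>G. g ` U \<inter> U \<noteq> {} \<longrightarrow> g = id)"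
    and quotient: "quotient_map T X p"
    and fibres: "x \<in> topspace T \<Longrightarrow> y \<in> topspace T \<Longrightarrow> p x = p y \<longleftrightarrow> (\<exists>g\<in>G. y = g x)"
begin

lemma act_mem: "g \<in> G \<Longrightarrow> x \<in> topspace T \<Longrightarrow> g x \<in> topspace T"
  using cont[of g] by (auto simp: continuous_map_def)

lemma p_act: "g \<in> G \<Longrightarrow> x \<in> topspace T \<Longrightarrow> p (g x) = p x"
  using fibres[of x "g x"] act_mem[of g x] by auto

lemma continuous_p: "continuous_map T X p"
  by (rule quotient_imp_continuous_map[OF quotient])

lemma p_surj: "p ` topspace T = topspace X"
  by (rule quotient[unfolded quotient_map_def, THEN conjunct1])

lemma open_p: "openin T U \<Longrightarrow> openin X (p ` U)"
proof -
  assume U: "openin T U"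
  have sub: "U \<subseteq> topspace T" using U openin_subset by blast
  have "{x \<in> topspace T. p x \<in> p ` U} = (\<Union>g\<in>G. {x \<in> topspace T. g x \<in> U})"
    using fibres sub by blast
  moreover have "openin T (\<Union>g\<in>G. {x \<in> topspace T. g x \<in> U})"
    using cont openin_continuous_map_preimage U by blast
  moreover have "p ` U \<subseteq> topspace X" using sub p_surj by blast
  ultimately show ?thesis using quotient unfolding quotient_map_def by metis
qed

text \<open>The sets on which \<open>g\<close> is a given translate of \<open>f\<close> are open by
  discontinuity and disjoint by freeness; connectedness leaves only one of them.\<close>

lemma lifts_differ:
  assumes K: "connected_space K"
    and f: "continuous_map K T f" and g: "continuous_map K T g"
    and eq: "\<And>x. x \<in> topspace K \<Longrightarrow> p (f x) = p (g x)"
  shows "\<exists>\<gamma>\<in>G. \<forall>x\<in>topspace K. g x = \<gamma> (f x)"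
proof (cases "topspace K = {}")
  case True
  then show ?thesis using id_mem by blast
next
  case False
  then obtain x0 where x0: "x0 \<in> topspace K" by blast
  have fT: "f x \<in> topspace T" and gT: "g x \<in> topspace T" if "x \<in> topspace K" for x
    using that f g by (auto simp: continuous_map_def)
  define A where "A \<gamma> = {x \<in> topspace K. g x = \<gamma> (f x)}" for \<gamma>
  have ex: "\<exists>\<gamma>\<in>G. x \<in> A \<gamma>" if "x \<in> topspace K" for x
    using that eq fibres fT gT unfolding A_def by blast
  have opn: "openin K (A \<gamma>)" if \<gamma>: "\<gamma> \<in> G" for \<gamma>
  proof (subst openin_subopen, safe)
    fix x assume x: "x \<in> A \<gamma>"
    then have xK: "x \<in> topspace K" by (simp add: A_def)
    from discontinuous[OF fT[OF xK]] obtain U where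
      U': "openin T U \<and> f x \<in> U \<and> (\<forall>g\<in>G. g ` U \<inter> U \<noteq> {} \<longrightarrow> g = id)" ..
    then have U: "openin T U" "f x \<in> U" "\<And>h. h \<in> G \<Longrightarrow> h ` U \<inter> U \<noteq> {} \<Longrightarrow> h = id"
      by simp_all
    obtain \<iota> where \<iota>: "\<iota> \<in> G" "\<iota> \<circ> \<gamma> = id" "\<gamma> \<circ> \<iota> = id" using inv_mem \<gamma> by blast
    \<comment> \<open>Near \<open>x\<close> both \<open>f\<close> and the back-translate of
      \<open>g\<close> stay in \<open>U\<close>, so any \<open>\<delta>\<close> relating them there
      moves \<open>U\<close> to meet \<open>U\<close> after applying \<open>\<iota>\<close>, and
      must be \<open>\<gamma>\<close>.\<close>
    let ?N = "{y \<in> topspace K. f y \<in> U} \<inter> {y \<in> topspace K. (\<iota> \<circ> g) y \<in> U}"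
    have "openin K ?N"
      using openin_continuous_map_preimage[OF f U(1)]
        openin_continuous_map_preimage[OF continuous_map_compose[OF g cont[OF \<iota>(1)]] U(1)] by blast
    moreover have "x \<in> ?N" using x U(2) \<iota>(2) by (auto simp: A_def fun_eq_iff)
    moreover have "?N \<subseteq> A \<gamma>"
    proof
      fix y assume y: "y \<in> ?N"
      then obtain \<delta> where \<delta>: "\<delta> \<in> G" "g y = \<delta> (f y)" using ex unfolding A_def by blast
      then have "(\<iota> \<circ> \<delta>) ` U \<inter> U \<noteq> {}" using y by auto
      then have "\<iota> \<circ> \<delta> = id" using U(3) comp_mem \<iota>(1) \<delta>(1) by blast
      then have "\<delta> = \<gamma>" using \<iota>(3) by (metis comp_assoc comp_id id_comp)
      then show "y \<in> A \<gamma>" using y \<delta>(2) by (simp add: A_def)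
    qed
    ultimately show "\<exists>N. openin K N \<and> x \<in> N \<and> N \<subseteq> A \<gamma>" by blast
  qed
  obtain \<gamma> where \<gamma>: "\<gamma> \<in> G" "x0 \<in> A \<gamma>" using ex x0 by blast
  have "topspace K - A \<gamma> = (\<Union>\<delta>\<in>G - {\<gamma>}. A \<delta>)"
  proof (intro equalityI subsetI)
    fix y assume "y \<in> (\<Union>\<delta>\<in>G - {\<gamma>}. A \<delta>)"
    then obtain \<delta> where \<delta>: "\<delta> \<in> G" "\<delta> \<noteq> \<gamma>" "y \<in> topspace K" "g y = \<delta> (f y)" unfolding A_def by blast
    then have "g y \<noteq> \<gamma> (f y)" using free2[OF \<delta>(1) \<gamma>(1) fT[OF \<delta>(3)]] by auto
    then show "y \<in> topspace K - A \<gamma>" using \<delta>(3) by (simp add: A_def)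
  qed (use ex in \<open>auto simp: A_def\<close>)
  then have "openin K (topspace K - A \<gamma>)" using opn by auto
  then have "closedin K (A \<gamma>)" using openin_subset[OF opn[OF \<gamma>(1)]] by (simp add: closedin_def)
  then have "A \<gamma> = topspace K"
    using K opn[OF \<gamma>(1)] \<gamma>(2) unfolding connected_space_clopen_in by blast
  then show ?thesis using \<gamma>(1) unfolding A_def by blast
qed

text \<open>On an open set that meets none of its nontrivial translates, \<open>p\<close> is
  injective and open, hence a homeomorphism onto its image.\<close>

lemma local_section:
  assumes "y0 \<in> topspace X"
  shows "\<exists>W s. openin X W \<and> y0 \<in> W \<and> continuous_map (subtopology X W) T s \<and> (\<forall>y\<in>W. p (s y) = y)"
proof -
  have "y0 \<in> p ` topspace T" using assms by (simp add: p_surj)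
  then obtain v where v: "v \<in> topspace T" "p v = y0" by auto
  from discontinuous[OF v(1)] obtain U where
    U': "openin T U \<and> v \<in> U \<and> (\<forall>g\<in>G. g ` U \<inter> U \<noteq> {} \<longrightarrow> g = id)" ..
  then have U: "openin T U" "v \<in> U" "\<And>h. h \<in> G \<Longrightarrow> h ` U \<inter> U \<noteq> {} \<Longrightarrow> h = id"
    by simp_all
  have UT: "U \<subseteq> topspace T" using U(1) openin_subset by blast
  let ?W = "p ` U"
  have W: "openin X ?W" using open_p U(1) .
  have WX: "?W \<subseteq> topspace X" using W openin_subset by blast
  have "homeomorphic_map (subtopology T U) (subtopology X ?W) p"
  proof (rule bijective_open_imp_homeomorphic_map)
    show "continuous_map (subtopology T U) (subtopology X ?W) p"
      using continuous_p by (simp add: continuous_map_in_subtopology continuous_map_from_subtopology)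
    show "open_map (subtopology T U) (subtopology X ?W) p"
      unfolding open_map_def using open_p U(1) W by (auto simp: openin_open_subtopology)
    show "p ` topspace (subtopology T U) = topspace (subtopology X ?W)" using UT WX by auto
    show "inj_on p (topspace (subtopology T U))"
    proof (rule inj_onI)
      fix x y assume x: "x \<in> topspace (subtopology T U)" and y: "y \<in> topspace (subtopology T U)" and "p x = p y"
      then obtain g where "g \<in> G" "y = g x" using fibres by auto
      moreover have "g ` U \<inter> U \<noteq> {}" using x y calculation(2) by auto
      ultimately show "x = y" using U(3) by force
    qed
  qed
  then obtain s where s: "homeomorphic_maps (subtopology T U) (subtopology X ?W) p s"
    using homeomorphic_map_maps by blast
  then have "continuous_map (subtopology X ?W) T s"
    unfolding homeomorphic_maps_def by (simp add: continuous_map_in_subtopology)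
  moreover have "\<forall>y\<in>?W. p (s y) = y" using s WX unfolding homeomorphic_maps_def by auto
  moreover have "y0 \<in> ?W" using v U(2) by blast
  ultimately show ?thesis using W by blast
qed

definition liftable :: "((nat \<Rightarrow> real) \<Rightarrow> 'b) \<Rightarrow> (nat \<Rightarrow> real) set \<Rightarrow> bool" where
  "liftable f Q \<longleftrightarrow>
     (\<exists>g. continuous_map (subtopology (powertop_real UNIV) Q) T g \<and> (\<forall>y\<in>Q. p (g y) = f y))"

lemma liftable_mono:
  assumes "liftable f Q" "Q' \<subseteq> Q"
  shows "liftable f Q'"
proof -
  from assms(1) obtain g
    where g: "continuous_map (subtopology (powertop_real UNIV) Q) T g \<and> (\<forall>y\<in>Q. p (g y) = f y)"
    unfolding liftable_def ..
  then have "continuous_map (subtopology (powertop_real UNIV) Q') T g"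
    by (intro continuous_map_from_subtopology_mono[OF _ assms(2)] conjunct1[OF g])
  then show ?thesis unfolding liftable_def using g assms(2) by (intro exI[of _ g]) auto
qed

lemma liftable_empty: "liftable f {}"
  unfolding liftable_def by (rule exI[of _ "\<lambda>_. undefined"]) (simp add: continuous_map_def)

text \<open>On the connected overlap the two lifts differ by one group element; after translating
  one of them they can be pasted along closed sets.\<close>

lemma liftable_Un:
  assumes 1: "liftable f Q1" and 2: "liftable f Q2"
    and closed: "closedin (powertop_real UNIV) Q1" "closedin (powertop_real UNIV) Q2"
    and conn: "connectedin (powertop_real UNIV) (Q1 \<inter> Q2)"
  shows "liftable f (Q1 \<union> Q2)"
proof -
  let ?PT = "powertop_real (UNIV :: nat set)"
  obtain g1 where g1: "continuous_map (subtopology ?PT Q1) T g1" "\<And>y. y \<in> Q1 \<Longrightarrow> p (g1 y) = f y"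
    using 1 unfolding liftable_def by blast
  obtain g2 where g2: "continuous_map (subtopology ?PT Q2) T g2" "\<And>y. y \<in> Q2 \<Longrightarrow> p (g2 y) = f y"
    using 2 unfolding liftable_def by blast
  have "\<exists>\<gamma>\<in>G. \<forall>x\<in>topspace (subtopology ?PT (Q1 \<inter> Q2)). g1 x = \<gamma> (g2 x)"
  proof (rule lifts_differ)
    show "connected_space (subtopology ?PT (Q1 \<inter> Q2))" using conn connectedin_def by blast
    show "continuous_map (subtopology ?PT (Q1 \<inter> Q2)) T g2" "continuous_map (subtopology ?PT (Q1 \<inter> Q2)) T g1"
      using continuous_map_from_subtopology_mono g1(1) g2(1) by (metis Int_lower1 Int_lower2)+
  qed (use g1(2) g2(2) in auto)
  then obtain \<gamma> where \<gamma>: "\<gamma> \<in> G" "\<And>x. x \<in> Q1 \<inter> Q2 \<Longrightarrow> g1 x = \<gamma> (g2 x)" by auto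
  define h where "h x = (if x \<in> Q1 then g1 x else \<gamma> (g2 x))" for x
  have "continuous_map (subtopology ?PT (Q1 \<union> Q2)) T h"
  proof (rule pasting_lemma_closed[of "{True, False}" _ "\<lambda>b. if b then Q1 else Q2" _ "\<lambda>b. if b then g1 else \<gamma> \<circ> g2"])
    show "closedin (subtopology ?PT (Q1 \<union> Q2)) (if b then Q1 else Q2)" for b
      using closed by (auto intro: closedin_subset_topspace)
    have "continuous_map (subtopology ?PT Q2) T (\<gamma> \<circ> g2)" using g2(1) cont[OF \<gamma>(1)] continuous_map_compose by blast
    then show "continuous_map (subtopology (subtopology ?PT (Q1 \<union> Q2)) (if b then Q1 else Q2)) T
        (if b then g1 else \<gamma> \<circ> g2)" for b
      using g1(1) by (simp add: subtopology_subtopology Int_absorb1 Un_Int_distrib2)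
  qed (use \<gamma>(2) in \<open>auto simp: h_def\<close>)
  moreover have "p (h y) = f y" if "y \<in> Q1 \<union> Q2" for y
  proof -
    have "g2 y \<in> topspace T" if "y \<in> Q2" using g2(1) that by (auto simp: continuous_map_def)
    then show ?thesis using that g1(2) g2(2) p_act[OF \<gamma>(1)] by (auto simp: h_def)
  qed
  ultimately show ?thesis unfolding liftable_def by blast
qed

text \<open>Induction on the number of coordinates that are not confined to a small interval: freeing one
  more coordinate amounts to gluing finitely many slabs along their convex overlaps.\<close>

lemma simplex_liftable:
  assumes f: "continuous_map (subtopology (powertop_real UNIV) (standard_simplex r)) X f"
  shows "liftable f (standard_simplex r)"
proof -
  let ?PT = "powertop_real (UNIV :: nat set)"
  let ?\<Delta> = "standard_simplex r"
  \<comment> \<open>Coordinates from \<open>j\<close> to \<open>r\<close> are confined to an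
    interval around \<open>x\<close>, those below \<open>j\<close> are free: \<open>j = 0\<close> is
    a small box and \<open>j = Suc r\<close> the whole simplex.\<close>
  define B where "B j x \<epsilon> = {y \<in> ?\<Delta>. \<forall>i\<in>{j..r}. \<bar>y i - x i\<bar> \<le> \<epsilon>}" for j :: nat and x \<epsilon>
  have closed_\<Delta>: "closed ?\<Delta>"
    using closedin_standard_simplex[of r] by (simp add: euclidean_product_topology)
  \<comment> \<open>Coordinates beyond \<open>r\<close> vanish on the simplex, so the centre is
    extended by 0 and a box in the first \<open>r + 1\<close> coordinates controls a product
    neighbourhood.\<close>
  have small: "\<exists>\<epsilon>>0. B 0 x \<epsilon> \<subseteq> O'" if "openin ?PT O'" "(\<lambda>i. if i \<le> r then x i else 0) \<in> O'" for x O'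
  proof -
    let ?x = "\<lambda>i. if i \<le> r then x i else 0"
    have "\<exists>U. finite {i \<in> UNIV. U i \<noteq> topspace euclideanreal} \<and> (\<forall>i\<in>UNIV. openin euclideanreal (U i)) \<and>
        ?x \<in> Pi\<^sub>E UNIV U \<and> Pi\<^sub>E UNIV U \<subseteq> O'"
      using that unfolding openin_product_topology_alt by (elim ballE[where x = ?x]) auto
    then obtain U where U': "finite {i \<in> UNIV. U i \<noteq> topspace euclideanreal} \<and> (\<forall>i\<in>UNIV. openin euclideanreal (U i)) \<and>
        ?x \<in> Pi\<^sub>E UNIV U \<and> Pi\<^sub>E UNIV U \<subseteq> O'" ..
    then have U: "\<And>i. open (U i)" "?x \<in> Pi\<^sub>E UNIV U" "Pi\<^sub>E UNIV U \<subseteq> O'"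
      using open_openin by blast+
    have "\<exists>\<epsilon>>0. \<forall>z. \<bar>z - x i\<bar> \<le> \<epsilon> \<longrightarrow> z \<in> U i" if "i \<le> r" for i
    proof -
      have "?x i \<in> U i" using U(2) by blast
      then have "x i \<in> U i" using that by simp
      then obtain \<epsilon> where "\<epsilon> > 0" "cball (x i) \<epsilon> \<subseteq> U i" using U(1) open_contains_cball by blast
      then show ?thesis by (intro exI[of _ \<epsilon>]) (auto simp: cball_def dist_real_def abs_minus_commute)
    qed
    then obtain \<epsilon> where \<epsilon>: "\<And>i. i \<le> r \<Longrightarrow> \<epsilon> i > 0" "\<And>i z. i \<le> r \<Longrightarrow> \<bar>z - x i\<bar> \<le> \<epsilon> i \<Longrightarrow> z \<in> U i"
      by metis
    define \<delta> where "\<delta> = Min (\<epsilon> ` {..r})"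
    have \<delta>: "\<delta> > 0" "\<And>i. i \<le> r \<Longrightarrow> \<delta> \<le> \<epsilon> i" using \<epsilon>(1) by (auto simp: \<delta>_def)
    have "B 0 x \<delta> \<subseteq> O'"
    proof
      fix y assume y: "y \<in> B 0 x \<delta>"
      have "y i \<in> U i" for i
      proof (cases "i \<le> r")
        case True
        then show ?thesis using y \<epsilon>(2)[OF True, of "y i"] \<delta>(2)[OF True] by (force simp: B_def)
      next
        case False
        then have "y i = 0" using y by (auto simp: B_def standard_simplex_def)
        moreover have "?x i \<in> U i" using U(2) by blast
        ultimately show ?thesis using False by simp
      qed
      then show "y \<in> O'" using U(3) by blast
    qed
    then show ?thesis using \<delta>(1) by blast
  qed
  have closed: "closedin ?PT (B j x \<epsilon> \<inter> {y. a \<le> y k \<and> y k \<le> b})" for j x \<epsilon> a b k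
  proof -
    have "B j x \<epsilon> \<inter> {y. a \<le> y k \<and> y k \<le> b} =
       ?\<Delta> \<inter> (\<Inter>i\<in>{j..r}. {y. \<bar>y i - x i\<bar> \<le> \<epsilon>}) \<inter> ({y. a \<le> y k} \<inter> {y. y k \<le> b})"
      by (auto simp: B_def)
    moreover have "closed \<dots>"
      by (intro closed_Int closed_INT closed_\<Delta> ballI closed_Collect_le continuous_intros continuous_on_product_coordinates)
    ultimately show ?thesis by (simp add: euclidean_product_topology)
  qed
  have cvx: "coordinate_convex (B j x \<epsilon> \<inter> {y. a \<le> y k \<and> y k \<le> b})" for j x \<epsilon> a b k
  proof -
    have iv: "l \<le> (1 - u) * s + u * t \<and> (1 - u) * s + u * t \<le> m"
      if "l \<le> s" "l \<le> t" "s \<le> m" "t \<le> m" "0 \<le> u" "u \<le> 1" for l m s t u :: real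
      using that convex_bound_le[of s m t "1 - u" u] convex_bound_le[of "- s" "- l" "- t" "1 - u" u] by (simp add: algebra_simps)
    have *: "\<bar>z - c\<bar> \<le> \<epsilon> \<longleftrightarrow> c - \<epsilon> \<le> z \<and> z \<le> c + \<epsilon>" for z c by linarith
    show ?thesis unfolding coordinate_convex_def
    proof (intro ballI)
      fix y z :: "nat \<Rightarrow> real" and u :: real
      assume y: "y \<in> B j x \<epsilon> \<inter> {y. a \<le> y k \<and> y k \<le> b}" and z: "z \<in> B j x \<epsilon> \<inter> {y. a \<le> y k \<and> y k \<le> b}"
        and u: "u \<in> {0..1}"
      let ?w = "\<lambda>i. (1 - u) * y i + u * z i"
      have "?w \<in> ?\<Delta>" using convex_standard_simplex[of y r z u] y z u by (simp add: B_def)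
      moreover have "\<bar>?w i - x i\<bar> \<le> \<epsilon>" if "i \<in> {j..r}" for i
        using iv[of "x i - \<epsilon>" "y i" "z i" "x i + \<epsilon>" u] y z u that unfolding B_def * by simp
      moreover have "a \<le> ?w k \<and> ?w k \<le> b" using iv[of a "y k" "z k" b u] y z u by simp
      ultimately show "?w \<in> B j x \<epsilon> \<inter> {y. a \<le> y k \<and> y k \<le> b}" by (simp add: B_def)
    qed
  qed
  have main: "j \<le> Suc r \<Longrightarrow> \<exists>\<epsilon>>0. liftable f (B j x \<epsilon>)" for j x
  proof (induction j arbitrary: x)
    case 0
    let ?x = "\<lambda>i. if i \<le> r then x i else 0"
    show ?case
    proof (cases "?x \<in> ?\<Delta>")
      case False
      then obtain \<epsilon> where "\<epsilon> > 0" "B 0 x \<epsilon> \<subseteq> - ?\<Delta>"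
        using small[of "- ?\<Delta>" x] closed_\<Delta> by (auto simp: euclidean_product_topology open_Compl)
      then have "B 0 x \<epsilon> = {}" by (auto simp: B_def)
      then show ?thesis using \<open>\<epsilon> > 0\<close> liftable_empty by metis
    next
      case True
      then have "f ?x \<in> topspace X" using f by (auto simp: continuous_map_def)
      then obtain W s where W: "openin X W" "f ?x \<in> W" "continuous_map (subtopology X W) T s" "\<forall>y\<in>W. p (s y) = y"
        using local_section by blast
      have "openin (subtopology ?PT ?\<Delta>) {y \<in> topspace (subtopology ?PT ?\<Delta>). f y \<in> W}"
        using openin_continuous_map_preimage f W(1) by blast
      then obtain O' where O': "openin ?PT O'" "{y \<in> topspace (subtopology ?PT ?\<Delta>). f y \<in> W} = O' \<inter> ?\<Delta>"
        unfolding openin_subtopology by blast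
      have "?x \<in> O'" using True W(2) O'(2) by auto
      then obtain \<epsilon> where \<epsilon>: "\<epsilon> > 0" "B 0 x \<epsilon> \<subseteq> O'" using small O'(1) by blast
      have fW: "f y \<in> W" if "y \<in> B 0 x \<epsilon>" for y using that \<epsilon>(2) O'(2) by (auto simp: B_def)
      have "continuous_map (subtopology ?PT (B 0 x \<epsilon>)) X f"
        using continuous_map_from_subtopology_mono[OF f] by (auto simp: B_def)
      then have "continuous_map (subtopology ?PT (B 0 x \<epsilon>)) (subtopology X W) f"
        using fW by (auto simp: continuous_map_in_subtopology)
      then have "continuous_map (subtopology ?PT (B 0 x \<epsilon>)) T (s \<circ> f)" using W(3) continuous_map_compose by blast
      then show ?thesis using \<epsilon>(1) fW W(4) unfolding liftable_def by (metis comp_apply)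
    qed
  next
    case (Suc j)
    \<comment> \<open>Bolzano's principle is applied to the \<open>j\<close>-th coordinate. The
      width for the other coordinates is existential, since it shrinks whenever two slabs are
      joined.\<close>
    define P where "P a b \<longleftrightarrow> (\<exists>\<epsilon>>0. liftable f (B (Suc j) x \<epsilon> \<inter> {y. a \<le> y j \<and> y j \<le> b}))" for a b
    have "(0::real) \<le> 1" by simp
    then have "P 0 1"
    proof (induction rule: Bolzano)
      case (trans a b c)
      then obtain \<epsilon>1 \<epsilon>2 where \<epsilon>: "\<epsilon>1 > 0" "liftable f (B (Suc j) x \<epsilon>1 \<inter> {y. a \<le> y j \<and> y j \<le> b})"
          "\<epsilon>2 > 0" "liftable f (B (Suc j) x \<epsilon>2 \<inter> {y. b \<le> y j \<and> y j \<le> c})" unfolding P_def by blast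
      let ?\<epsilon> = "min \<epsilon>1 \<epsilon>2"
      let ?Q1 = "B (Suc j) x ?\<epsilon> \<inter> {y. a \<le> y j \<and> y j \<le> b}"
      let ?Q2 = "B (Suc j) x ?\<epsilon> \<inter> {y. b \<le> y j \<and> y j \<le> c}"
      have "liftable f ?Q1" by (rule liftable_mono[OF \<epsilon>(2)]) (auto simp: B_def)
      moreover have "liftable f ?Q2" by (rule liftable_mono[OF \<epsilon>(4)]) (auto simp: B_def)
      \<comment> \<open>The two slabs meet in a convex slice, which is connected as gluing
        demands.\<close>
      moreover have "?Q1 \<inter> ?Q2 = B (Suc j) x ?\<epsilon> \<inter> {y. b \<le> y j \<and> y j \<le> b}"
        using trans by auto
      then have "connectedin ?PT (?Q1 \<inter> ?Q2)" by (simp only: connectedin_coordinate_convex[OF cvx])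
      ultimately have "liftable f (?Q1 \<union> ?Q2)" by (intro liftable_Un closed)
      moreover have "?Q1 \<union> ?Q2 = B (Suc j) x ?\<epsilon> \<inter> {y. a \<le> y j \<and> y j \<le> c}" using trans by auto
      ultimately show ?case unfolding P_def using \<epsilon> by (intro exI[of _ ?\<epsilon>]) auto
    next
      case (local s)
      obtain \<epsilon> where \<epsilon>: "\<epsilon> > 0" "liftable f (B j (x(j := s)) \<epsilon>)" using Suc.IH[of "x(j := s)"] Suc_leD[OF Suc.prems] by blast
      have "P a b" if "a \<le> s \<and> s \<le> b \<and> b - a < \<epsilon>" for a b
      proof -
        have "B (Suc j) x \<epsilon> \<inter> {y. a \<le> y j \<and> y j \<le> b} \<subseteq> B j (x(j := s)) \<epsilon>"
        proof
          fix y assume y: "y \<in> B (Suc j) x \<epsilon> \<inter> {y. a \<le> y j \<and> y j \<le> b}"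
          have "\<bar>y i - (x(j := s)) i\<bar> \<le> \<epsilon>" if "i \<in> {j..r}" for i
          proof (cases "i = j")
            case True
            then show ?thesis using y \<open>a \<le> s \<and> s \<le> b \<and> b - a < \<epsilon>\<close> by auto
          next
            case False
            then show ?thesis using y that by (auto simp: B_def)
          qed
          then show "y \<in> B j (x(j := s)) \<epsilon>" using y by (auto simp: B_def)
        qed
        then show ?thesis unfolding P_def using \<epsilon> liftable_mono by blast
      qed
      then show ?case using \<epsilon>(1) by blast
    qed
    moreover have "B (Suc j) x \<epsilon> \<inter> {y. 0 \<le> y j \<and> y j \<le> 1} = B (Suc j) x \<epsilon>" for \<epsilon>
      by (auto simp: B_def standard_simplex_def)
    ultimately show ?case unfolding P_def by simp
  qed
  obtain \<epsilon> where "liftable f (B (Suc r) (\<lambda>_. 0) \<epsilon>)" using main[of "Suc r"] by blast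
  moreover have "B (Suc r) (\<lambda>_. 0) \<epsilon> = ?\<Delta>" by (auto simp: B_def)
  ultimately show ?thesis by simp
qed

lemma simplex_lift:
  assumes "singular_simplex r X \<tau>"
  shows "\<exists>\<sigma>. singular_simplex r T \<sigma> \<and> simplex_map r p \<sigma> = \<tau>"
proof -
  have "liftable \<tau> (standard_simplex r)"
    by (rule simplex_liftable) (rule assms[unfolded singular_simplex_def, THEN conjunct1])
  then obtain g where g': "continuous_map (subtopology (powertop_real UNIV) (standard_simplex r)) T g \<and>
      (\<forall>y\<in>standard_simplex r. p (g y) = \<tau> y)"
    unfolding liftable_def ..
  then have g: "continuous_map (subtopology (powertop_real UNIV) (standard_simplex r)) T g"
      "\<And>y. y \<in> standard_simplex r \<Longrightarrow> p (g y) = \<tau> y" by auto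
  let ?\<sigma> = "restrict g (standard_simplex r)"
  have "singular_simplex r T ?\<sigma>"
    unfolding singular_simplex_def using continuous_map_eq[OF g(1), of ?\<sigma>] by simp
  moreover have "simplex_map r p ?\<sigma> = \<tau>"
  proof
    show "simplex_map r p ?\<sigma> x = \<tau> x" for x
      using g(2)[of x] assms
      by (cases "x \<in> standard_simplex r") (auto simp: simplex_map_def singular_simplex_def extensional_def)
  qed
  ultimately show ?thesis by blast
qed

lemma simplex_lifts_differ:
  assumes \<sigma>: "singular_simplex r T \<sigma>" and \<tau>: "singular_simplex r T \<tau>" and eq: "simplex_map r p \<sigma> = simplex_map r p \<tau>"
  shows "\<exists>g\<in>G. \<tau> = simplex_map r g \<sigma>"
proof -
  let ?K = "subtopology (powertop_real UNIV) (standard_simplex r)"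
  have "\<exists>\<gamma>\<in>G. \<forall>x\<in>topspace ?K. \<tau> x = \<gamma> (\<sigma> x)"
  proof (rule lifts_differ)
    show "connected_space ?K"
      using connectedin_standard_simplex[of r, unfolded connectedin_def] by (rule conjunct2)
    show "continuous_map ?K T \<sigma>" using \<sigma>[unfolded singular_simplex_def] by (rule conjunct1)
    show "continuous_map ?K T \<tau>" using \<tau>[unfolded singular_simplex_def] by (rule conjunct1)
    show "p (\<sigma> x) = p (\<tau> x)" if "x \<in> topspace ?K" for x
      using fun_cong[OF eq, of x] that by (simp add: simplex_map_def)
  qed
  then obtain \<gamma> where \<gamma>: "\<gamma> \<in> G" "\<And>x. x \<in> standard_simplex r \<Longrightarrow> \<tau> x = \<gamma> (\<sigma> x)"
    unfolding topspace_standard_simplex by blast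
  have "\<tau> = simplex_map r \<gamma> \<sigma>"
  proof
    show "\<tau> x = simplex_map r \<gamma> \<sigma> x" for x
      using \<gamma>(2)[of x] \<tau>
      by (cases "x \<in> standard_simplex r") (auto simp: simplex_map_def singular_simplex_def extensional_def)
  qed
  then show ?thesis using \<gamma>(1) by blast
qed

lemma chain_map_p_surj:
  assumes "singular_chain r X w"
  shows "\<exists>c. singular_chain r T c \<and> chain_map r p c = w"
proof -
  define L where "L \<tau> = (SOME \<sigma>. singular_simplex r T \<sigma> \<and> simplex_map r p \<sigma> = \<tau>)" for \<tau>
  have L: "singular_simplex r T (L \<tau>)" "simplex_map r p (L \<tau>) = \<tau>" if "singular_simplex r X \<tau>" for \<tau>
    using someI_ex[OF simplex_lift[OF that]] unfolding L_def by blast+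
  have "singular_chain r T (frag_extend (frag_of \<circ> L) w)"
    by (rule singular_chain_extend) (use assms L(1) in \<open>auto simp: singular_chain_def\<close>)
  moreover have "chain_map r p (frag_extend (frag_of \<circ> L) w) = w"
    using assms unfolding singular_chain_def
    by (induction w rule: frag_induction) (auto simp: L(2) frag_extend_diff chain_map_diff)
  ultimately show ?thesis by blast
qed

text \<open>Two lifts of a simplex differ by a group element, so the kernel of \<open>p\<close> on
  chains is generated by differences of translates. Together with \<open>chain_map_p_surj\<close>
  this identifies the chains of \<open>X\<close> with the coinvariants.\<close>

lemma chain_map_p_null:
  assumes "singular_chain r T c"
  shows "chain_map r p c = 0 \<longleftrightarrow> c \<in> null_chains T G r"
proof
  assume eq: "chain_map r p c = 0"
  show "c \<in> null_chains T G r"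
  proof (rule frag_kernel_induct[where S = "singular_simplex_set r T" and \<pi> = "simplex_map r p"])
    fix \<sigma> \<tau> assume "\<sigma> \<in> singular_simplex_set r T" "\<tau> \<in> singular_simplex_set r T" "simplex_map r p \<sigma> = simplex_map r p \<tau>"
    then obtain g where g: "g \<in> G" "\<sigma> = simplex_map r g \<tau>" "singular_simplex r T \<tau>"
      using simplex_lifts_differ[of r \<tau> \<sigma>] by auto
    then show "frag_of \<sigma> - frag_of \<tau> \<in> null_chains T G r"
      using null_act[OF g(1), of r "frag_of \<tau>"] by (simp add: singular_chain_of)
  qed (use assms eq null_diff in \<open>auto simp: singular_chain_def chain_map_def\<close>)
next
  assume "c \<in> null_chains T G r"
  then show "chain_map r p c = 0"
  proof (induction rule: null_induct)
    case (step g \<sigma>)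
    have "simplex_map r p (simplex_map r g \<sigma>) = simplex_map r p \<sigma>"
      using step p_act[OF step(1)] by (auto simp: simplex_map_def singular_simplex_def continuous_map_def fun_eq_iff)
    then show ?case by (simp add: chain_map_diff)
  qed (simp_all add: chain_map_diff)
qed

lemma cycle_lift:
  assumes "singular_relcycle r X {} w"
  shows "\<exists>z. hcycle T G r z \<and> chain_map r p z = w"
proof -
  have w: "singular_chain r X w" "chain_boundary r w = 0" using assms by (auto simp: singular_cycle)
  obtain z where z: "singular_chain r T z" "chain_map r p z = w" using chain_map_p_surj w(1) by blast
  have "chain_map (r - 1) p (chain_boundary r z) = 0"
    using chain_boundary_chain_map[OF z(1), of p] z(2) w(2) by simp
  then have "hcycle T G r z"
    using chain_map_p_null[of "r - 1" "chain_boundary r z"] singular_chain_boundary[OF z(1)] z(1) by (simp add: hcycle_def)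
  then show ?thesis using z(2) by blast
qed

lemma cycle_project:
  assumes "hcycle T G r z"
  shows "singular_relcycle r X {} (chain_map r p z)"
  using assms chain_boundary_chain_map[of r T z p] chain_map_p_null[of "r - 1" "chain_boundary r z"]
    singular_chain_boundary[of r T z] singular_chain_chain_map[OF _ continuous_p, of r z]
  by (simp add: hcycle_def singular_cycle)

text \<open>With \<open>cycle_lift\<close> and \<open>cycle_project\<close> it identifies the
  homology of \<open>X\<close> with \<open>hcycle\<close> modulo \<open>hzero\<close>.\<close>

lemma boundary_project:
  assumes z: "singular_chain r T z"
  shows "singular_relboundary r X {} (chain_map r p z) \<longleftrightarrow> hzero T G r z"
proof
  assume "singular_relboundary r X {} (chain_map r p z)"
  then obtain d where d: "singular_chain (Suc r) X d" "chain_boundary (Suc r) d = chain_map r p z"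
    by (auto simp: singular_boundary)
  obtain e where e: "singular_chain (Suc r) T e" "chain_map (Suc r) p e = d" using chain_map_p_surj d(1) by blast
  have "chain_map r p (z - chain_boundary (Suc r) e) = 0"
    using chain_boundary_chain_map[OF e(1), of p] d(2) e(2) by (simp add: chain_map_diff)
  then show "hzero T G r z"
    unfolding hzero_def using chain_map_p_null singular_chain_diff z singular_chain_boundary_alt e(1) by blast
next
  assume "hzero T G r z"
  then obtain e where e: "singular_chain (Suc r) T e" "z - chain_boundary (Suc r) e \<in> null_chains T G r"
    unfolding hzero_def by blast
  have "chain_map r p (z - chain_boundary (Suc r) e) = 0"
    using chain_map_p_null null_chainsD e(2) by blast
  then have "chain_boundary (Suc r) (chain_map (Suc r) p e) = chain_map r p z"
    using chain_boundary_chain_map[OF e(1), of p] by (simp add: chain_map_diff)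
  then show "singular_relboundary r X {} (chain_map r p z)"
    unfolding singular_boundary using singular_chain_chain_map[OF e(1) continuous_p] by blast
qed

end

section \<open>The homology of a lattice of rank 3\<close>

definition unit_vec3 :: "nat \<Rightarrow> nat \<Rightarrow> int" where
  "unit_vec3 i = (\<lambda>j. if j = i then 1 else 0)"

lemma augmentation_boundary:
  assumes "singular_chain (Suc 0) T e"
  shows "augmentation (chain_boundary (Suc 0) e) = 0"
  using assms unfolding singular_chain_def
proof (induction e rule: frag_induction)
  case (one x)
  then show ?case by (simp add: chain_boundary_of augmentation_def frag_extend_diff)
qed (simp_all add: augmentation_def chain_boundary_diff frag_extend_diff)

lemma null_trivial:
  assumes "c \<in> null_chains T {id} r"
  shows "c = 0"
proof -
  interpret free_action T "{id}" by unfold_locales auto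
  show ?thesis using assms
    by (induction rule: null_induct) (simp_all only: singleton_iff simplex_map_ident diff_self)
qed

text \<open>The start of the induction on the rank of the lattice: for the trivial group
  \<open>T\<close> has the homology of a point, and the augmentation reads off the
  coefficient.\<close>

lemma hbasis_trivial_0:
  assumes T: "acyclic_space T" and \<sigma>: "singular_simplex 0 T \<sigma>"
  shows "hbasis T {id} 0 [frag_of \<sigma>]"
  unfolding hbasis_def
proof (intro conjI ballI allI impI)
  show "hcycle T {id} 0 e" if "e \<in> set [frag_of \<sigma>]" for e
    using that \<sigma> by (simp add: hcycle_def singular_chain_of chain_boundary_def)
  show "\<exists>k. hzero T {id} 0 (z - lin k [frag_of \<sigma>])" if "hcycle T {id} 0 z" for z
  proof -
    define k where "k = Poly_Mapping.lookup (augmentation z) ()"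
    have "augmentation (z - frag_cmul k (frag_of \<sigma>)) = 0"
      by (rule poly_mapping_eqI)
        (simp add: augmentation_def frag_extend_diff frag_extend_cmul lookup_minus k_def)
    then have "reduced_cycle T 0 (z - frag_cmul k (frag_of \<sigma>))"
      using hcycle_chain[OF that] \<sigma>
      by (simp add: reduced_cycle_def singular_chain_diff singular_chain_cmul singular_chain_of chain_boundary_def)
    then obtain e where e: "singular_chain (Suc 0) T e \<and> chain_boundary (Suc 0) e = z - frag_cmul k (frag_of \<sigma>)"
      using T unfolding acyclic_space_def by blast
    then have "hzero T {id} 0 (z - lin (\<lambda>_. k) [frag_of \<sigma>])"
      using hzero_boundary[of 0 T e "{id}"] by (simp add: lin_def)
    then show ?thesis by blast
  qed
  fix k i assume "hzero T {id} 0 (lin k [frag_of \<sigma>])" and i: "i < length [frag_of \<sigma>]"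
  then obtain e where e: "singular_chain (Suc 0) T e"
    "lin k [frag_of \<sigma>] - chain_boundary (Suc 0) e \<in> null_chains T {id} 0" unfolding hzero_def by blast
  then have "lin k [frag_of \<sigma>] = chain_boundary (Suc 0) e" using null_trivial by force
  then have "augmentation (frag_cmul (k 0) (frag_of \<sigma>)) = 0"
    using augmentation_boundary[OF e(1)] by (simp add: lin_def)
  then show "k i = 0" using i by (simp add: augmentation_def frag_extend_cmul)
qed

lemma hbasis_trivial_Suc:
  assumes T: "acyclic_space T"
  shows "hbasis T {id} (Suc r) []"
  unfolding hbasis_def
proof (intro conjI ballI allI impI)
  show "\<exists>k. hzero T {id} (Suc r) (z - lin k [])" if z: "hcycle T {id} (Suc r) z" for z
  proof -
    have "chain_boundary (Suc r) z = 0" using z null_trivial unfolding hcycle_def by blast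
    then have "reduced_cycle T (Suc r) z" using hcycle_chain[OF z] by (simp add: reduced_cycle_def)
    then obtain e where "singular_chain (Suc (Suc r)) T e \<and> chain_boundary (Suc (Suc r)) e = z"
      using T unfolding acyclic_space_def by blast
    then show ?thesis using hzero_boundary[of "Suc r" T e "{id}"] by (simp add: lin_def)
  qed
qed simp_all

lemma equivariant_op_mono: "equivariant_op T G r m F \<Longrightarrow> H \<subseteq> G \<Longrightarrow> equivariant_op T H r m F"
  unfolding equivariant_op_def by blast

text \<open>Vectors of the rank 3 lattice are functions on \<open>nat\<close> whose entries beyond
  the third are ignored; \<open>\<tau>_cong\<close> expresses this.\<close>

locale torus_action =
  fixes T :: "'a topology" and \<tau> :: "(nat \<Rightarrow> int) \<Rightarrow> 'a \<Rightarrow> 'a"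
  assumes acyclic_T: "acyclic_space T"
    and \<tau>_add: "\<tau> (\<lambda>i. m i + n i) = \<tau> m \<circ> \<tau> n"
    and \<tau>_cong: "(\<And>i. i < 3 \<Longrightarrow> m i = n i) \<Longrightarrow> \<tau> m = \<tau> n"
    and \<tau>_cont: "continuous_map T T (\<tau> m)"
    and \<tau>_0: "\<tau> (\<lambda>_. 0) = id"
    and \<tau>_free: "x \<in> topspace T \<Longrightarrow> \<tau> m x = x \<Longrightarrow> i < 3 \<Longrightarrow> m i = 0"
begin

definition lattice :: "nat \<Rightarrow> ('a \<Rightarrow> 'a) set" where
  "lattice k = \<tau> ` {m. \<forall>i\<ge>k. m i = 0}"

lemma \<tau>_lattice: "\<tau> m \<in> lattice 3"
  unfolding lattice_def
  by (rule image_eqI[of _ _ "\<lambda>i. if i < 3 then m i else 0"]) (auto intro: \<tau>_cong)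

lemma \<tau>_eq_idD:
  assumes "\<tau> m = id" "topspace T \<noteq> {}" "i < 3"
  shows "m i = 0"
proof -
  obtain x where "x \<in> topspace T" using assms(2) by blast
  then show ?thesis by (rule \<tau>_free[OF _ _ assms(3)]) (simp add: assms(1))
qed

lemma free_lattice: "free_action T (lattice k)"
proof
  show "id \<in> lattice k" unfolding lattice_def by (rule image_eqI[of _ _ "\<lambda>_. 0"]) (auto simp: \<tau>_0)
  show "g \<circ> h \<in> lattice k" if g: "g \<in> lattice k" and h: "h \<in> lattice k" for g h
  proof -
    obtain m n where "g = \<tau> m" "h = \<tau> n" "\<forall>i\<ge>k. m i = 0" "\<forall>i\<ge>k. n i = 0"
      using g h unfolding lattice_def by blast
    then show ?thesis unfolding lattice_def by (intro image_eqI[of _ _ "\<lambda>i. m i + n i"]) (auto simp: \<tau>_add)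
  qed
  show "\<exists>h\<in>lattice k. h \<circ> g = id \<and> g \<circ> h = id" if g: "g \<in> lattice k" for g
  proof -
    obtain m where m: "g = \<tau> m" "\<forall>i\<ge>k. m i = 0" using g unfolding lattice_def by blast
    have "\<tau> (\<lambda>i. - m i) \<in> lattice k" using m(2) unfolding lattice_def by auto
    moreover have "\<tau> (\<lambda>i. - m i) \<circ> g = id \<and> g \<circ> \<tau> (\<lambda>i. - m i) = id"
      using \<tau>_add[of "\<lambda>i. - m i" m] \<tau>_add[of m "\<lambda>i. - m i"] m(1) \<tau>_0 by simp
    ultimately show ?thesis by blast
  qed
  show "continuous_map T T g" if "g \<in> lattice k" for g
    using that \<tau>_cont unfolding lattice_def by blast
  show "g = id" if g: "g \<in> lattice k" and "x \<in> topspace T" "g x = x" for g x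
  proof -
    obtain m where m: "g = \<tau> m" using g unfolding lattice_def by blast
    then have "\<tau> m = \<tau> (\<lambda>_. 0)" using \<tau>_free that by (intro \<tau>_cong) blast
    then show ?thesis using m \<tau>_0 by simp
  qed
qed

sublocale L: abelian_action T "lattice 3"
proof (intro abelian_action.intro free_lattice abelian_action_axioms.intro acyclic_T)
  show "g \<circ> h = h \<circ> g" if g: "g \<in> lattice 3" and h: "h \<in> lattice 3" for g h
  proof -
    obtain m n where "g = \<tau> m" "h = \<tau> n" using g h unfolding lattice_def by blast
    then show ?thesis using \<tau>_add[of m n] \<tau>_add[of n m] by (simp add: add.commute)
  qed
qed

lemma \<tau>_unit_pow: "\<tau> (unit_vec3 k) ^^ n = \<tau> (\<lambda>i. int n * unit_vec3 k i)"
proof (induction n)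
  case (Suc n)
  have "\<tau> (\<lambda>i. int (Suc n) * unit_vec3 k i) = \<tau> (unit_vec3 k) \<circ> \<tau> (\<lambda>i. int n * unit_vec3 k i)"
    unfolding \<tau>_add[symmetric] by (rule \<tau>_cong) (simp add: algebra_simps)
  then show ?case using Suc by (simp only: funpow.simps)
qed (simp only: funpow.simps \<tau>_0[symmetric], simp)

lemma lattice_extension:
  assumes "k < 3" "topspace T \<noteq> {}"
  shows "cyclic_extension T (lattice k) (lattice (Suc k)) (\<tau> (unit_vec3 k))"
proof (intro cyclic_extension.intro free_lattice cyclic_extension_axioms.intro)
  have comm: "\<tau> m \<circ> \<tau> n = \<tau> n \<circ> \<tau> m" for m n
    using \<tau>_add[of m n] \<tau>_add[of n m] by (simp add: add.commute)
  show "lattice k \<subseteq> lattice (Suc k)" unfolding lattice_def by (intro image_mono) auto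
  show "\<tau> (unit_vec3 k) \<in> lattice (Suc k)" unfolding lattice_def unit_vec3_def by auto
  show "\<exists>g'\<in>lattice k. \<tau> (unit_vec3 k) \<circ> g = g' \<circ> \<tau> (unit_vec3 k)"
    "\<exists>g'\<in>lattice k. g \<circ> \<tau> (unit_vec3 k) = \<tau> (unit_vec3 k) \<circ> g'" if "g \<in> lattice k" for g
    using that comm unfolding lattice_def by blast+
  show "\<tau> (unit_vec3 k) ^^ n \<notin> lattice k" if "0 < n" for n
  proof
    assume "\<tau> (unit_vec3 k) ^^ n \<in> lattice k"
    then obtain m where m: "\<tau> (\<lambda>i. int n * unit_vec3 k i) = \<tau> m" "\<forall>i\<ge>k. m i = 0"
      unfolding \<tau>_unit_pow lattice_def by blast
    have "\<tau> (\<lambda>i. int n * unit_vec3 k i + - m i) = id"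
      using \<tau>_add[of "\<lambda>i. int n * unit_vec3 k i" "\<lambda>i. - m i"] \<tau>_add[of m "\<lambda>i. - m i"] m(1) \<tau>_0 by simp
    from \<tau>_eq_idD[OF this assms(2,1)] show False using m(2) that by (simp add: unit_vec3_def)
  qed
  show "\<exists>g\<in>lattice k. \<exists>n. \<gamma> = g \<circ> \<tau> (unit_vec3 k) ^^ n \<or> \<tau> (unit_vec3 k) ^^ n \<circ> \<gamma> = g"
    if \<gamma>: "\<gamma> \<in> lattice (Suc k)" for \<gamma>
  proof -
    obtain m where m: "\<gamma> = \<tau> m" "\<forall>i\<ge>Suc k. m i = 0" using \<gamma> unfolding lattice_def by blast
    define m' where "m' = m(k := 0)"
    have m': "\<tau> m' \<in> lattice k" using m(2) unfolding lattice_def m'_def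
      by (auto intro!: imageI simp: Suc_le_eq)
    show ?thesis
    proof (cases "m k \<ge> 0")
      case True
      have "\<gamma> = \<tau> m' \<circ> \<tau> (unit_vec3 k) ^^ nat (m k)"
        unfolding \<tau>_unit_pow \<tau>_add[symmetric] m(1)
        by (rule \<tau>_cong) (use True in \<open>simp add: m'_def unit_vec3_def\<close>)
      then show ?thesis using m' by blast
    next
      case False
      have "\<tau> (unit_vec3 k) ^^ nat (- m k) \<circ> \<gamma> = \<tau> m'"
        unfolding \<tau>_unit_pow \<tau>_add[symmetric] m(1)
        by (rule \<tau>_cong) (use False in \<open>simp add: m'_def unit_vec3_def\<close>)
      then show ?thesis using m' by blast
    qed
  qed
qed

abbreviation "P i \<equiv> L.prism (\<tau> (unit_vec3 i))"

text \<open>The prisms are built for the full lattice and so are equivariant for every sublattice;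
  one operator serves as the homotopy that adjoins the \<open>k\<close>-th generator.\<close>

lemma hbasis_lattice_extend:
  assumes k: "k < 3" and ne: "topspace T \<noteq> {}"
  shows "hbasis T (lattice k) 0 es \<Longrightarrow> hbasis T (lattice (Suc k)) 0 es"
    and "hbasis T (lattice k) (Suc s) es \<Longrightarrow> hbasis T (lattice k) s fs \<Longrightarrow>
           hbasis T (lattice (Suc k)) (Suc s) (es @ map (P k s) fs)"
proof -
  interpret E: cyclic_extension T "lattice k" "lattice (Suc k)" "\<tau> (unit_vec3 k)"
    by (rule lattice_extension[OF assms])
  have op: "equivariant_op T (lattice k) r (Suc r) (P k r)" for r
    by (rule equivariant_op_mono[OF L.prism_op[OF \<tau>_lattice]]) (use k in \<open>auto simp: lattice_def intro!: image_mono\<close>)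
  note hom = L.prism_boundary[OF \<tau>_lattice]
  show "hbasis T (lattice k) 0 es \<Longrightarrow> hbasis T (lattice (Suc k)) 0 es"
    by (rule E.hbasis_extend_0[OF op hom])
  show "hbasis T (lattice k) (Suc s) es \<Longrightarrow> hbasis T (lattice k) s fs \<Longrightarrow>
           hbasis T (lattice (Suc k)) (Suc s) (es @ map (P k s) fs)"
    by (rule E.hbasis_extend[OF op hom])
qed

text \<open>The exterior products of three generators: the generator adjoined later is the outer
  prism, and the order of the lists is the one produced by \<open>hbasis_extend\<close>.\<close>

fun torus_basis :: "'a chain \<Rightarrow> nat \<Rightarrow> 'a chain list" where
  "torus_basis x 0 = [x]"
| "torus_basis x (Suc 0) = [P 0 0 x, P (Suc 0) 0 x, P (Suc (Suc 0)) 0 x]"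
| "torus_basis x (Suc (Suc 0)) = [P (Suc 0) (Suc 0) (P 0 0 x), P (Suc (Suc 0)) (Suc 0) (P 0 0 x), P (Suc (Suc 0)) (Suc 0) (P (Suc 0) 0 x)]"
| "torus_basis x (Suc (Suc (Suc 0))) = [P (Suc (Suc 0)) (Suc (Suc 0)) (P (Suc 0) (Suc 0) (P 0 0 x))]"
| "torus_basis x (Suc (Suc (Suc (Suc r)))) = []"

lemma lattice_0: "lattice 0 = {id}"
proof -
  have "\<tau> m = id" if "\<forall>i\<ge>0. m i = 0" for m :: "nat \<Rightarrow> int"
    using that \<tau>_cong[of m "\<lambda>_. 0"] \<tau>_0 by simp
  moreover have "id \<in> lattice 0" using free_action.id_mem[OF free_lattice] .
  ultimately show ?thesis unfolding lattice_def by auto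
qed

text \<open>Each generator adds to degree \<open>Suc s\<close> a copy of the basis in degree
  \<open>s\<close>; this is Pascal's rule leading to the ranks 1, 3, 3, 1.\<close>

lemma hbasis_torus:
  assumes \<sigma>: "singular_simplex 0 T \<sigma>"
  shows "hbasis T (lattice 3) r (torus_basis (frag_of \<sigma>) r)"
proof -
  let ?x = "frag_of \<sigma>"
  have ne: "topspace T \<noteq> {}" using \<sigma> singular_simplex_empty by blast
  have a0: "hbasis T (lattice 0) 0 [?x]" and a1: "\<And>r. hbasis T (lattice 0) (Suc r) []"
    using hbasis_trivial_0[OF acyclic_T \<sigma>] hbasis_trivial_Suc[OF acyclic_T] by (simp_all add: lattice_0)
  have less: "0 < (3::nat)" "Suc 0 < 3" "Suc (Suc 0) < 3" by simp_all
  note e1 = hbasis_lattice_extend(1)[OF _ ne] and e2 = hbasis_lattice_extend(2)[OF _ ne]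
  have b0: "hbasis T (lattice (Suc 0)) 0 [?x]" by (rule e1[OF less(1) a0])
  have b1: "hbasis T (lattice (Suc 0)) (Suc 0) [P 0 0 ?x]" using e2[OF less(1) a1 a0] by simp
  have b2: "hbasis T (lattice (Suc 0)) (Suc (Suc r)) []" for r using e2[OF less(1) a1 a1] by simp
  have c0: "hbasis T (lattice (Suc (Suc 0))) 0 [?x]" by (rule e1[OF less(2) b0])
  have c1: "hbasis T (lattice (Suc (Suc 0))) (Suc 0) [P 0 0 ?x, P (Suc 0) 0 ?x]"
    using e2[OF less(2) b1 b0] by simp
  have c2: "hbasis T (lattice (Suc (Suc 0))) (Suc (Suc 0)) [P (Suc 0) (Suc 0) (P 0 0 ?x)]"
    using e2[OF less(2) b2 b1] by simp
  have c3: "hbasis T (lattice (Suc (Suc 0))) (Suc (Suc (Suc r))) []" for r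
    using e2[OF less(2) b2 b2] by simp
  have three: "lattice 3 = lattice (Suc (Suc (Suc 0)))" by (simp add: numeral_3_eq_3)
  show ?thesis
  proof (cases "(?x, r)" rule: torus_basis.cases)
    case (1 x)
    then show ?thesis using e1[OF less(3) c0] by (simp add: three)
  next
    case (2 x)
    then show ?thesis using e2[OF less(3) c1 c0] by (simp add: three)
  next
    case (3 x)
    then show ?thesis using e2[OF less(3) c2 c1] by (simp add: three)
  next
    case (4 x)
    then show ?thesis using e2[OF less(3) c3 c2] by (simp add: three)
  next
    case (5 x s)
    then show ?thesis using e2[OF less(3) c3 c3] by (simp add: three)
  qed
qed

end

section \<open>Exterior powers of 3 by 3 matrices and the action of \<open>t\<close> on the
  basis\<close>

lemma sum_lessThan_3: "(\<Sum>j<3. f j) = f 0 + f (Suc 0) + f (Suc (Suc 0))" for f :: "nat \<Rightarrow> 'b::comm_monoid_add"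
  by (simp add: numeral_3_eq_3)

definition minor2 :: "(nat \<Rightarrow> nat \<Rightarrow> 'b::comm_ring_1) \<Rightarrow> nat \<Rightarrow> nat \<Rightarrow> nat \<Rightarrow> nat \<Rightarrow> 'b" where
  "minor2 N a b k l = N a k * N b l - N a l * N b k"

text \<open>Laplace expansion along the last row, in the form in which the coefficient of the triple
  prism arises in degree 3.\<close>

definition det3 :: "(nat \<Rightarrow> nat \<Rightarrow> 'b::comm_ring_1) \<Rightarrow> 'b" where
  "det3 N = N 2 2 * minor2 N 1 0 1 0 - N 2 1 * minor2 N 1 0 2 0 + N 2 0 * minor2 N 1 0 2 1"

text \<open>The pairs of indices are ordered as (1,0), (2,0), (2,1), matching \<open>torus_basis\<close>.\<close>

definition exterior2 :: "(nat \<Rightarrow> nat \<Rightarrow> 'b::comm_ring_1) \<Rightarrow> nat \<Rightarrow> nat \<Rightarrow> 'b" where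
  "exterior2 N j i = minor2 N (if j = 0 then 1 else 2) (if j = 2 then 1 else 0)
                              (if i = 0 then 1 else 2) (if i = 2 then 1 else 0)"

fun exterior_power :: "(nat \<Rightarrow> nat \<Rightarrow> int) \<Rightarrow> nat \<Rightarrow> nat \<Rightarrow> nat \<Rightarrow> int" where
  "exterior_power N 0 = (\<lambda>j i. 1)"
| "exterior_power N (Suc 0) = N"
| "exterior_power N (Suc (Suc 0)) = exterior2 N"
| "exterior_power N (Suc (Suc (Suc r))) = (\<lambda>j i. det3 N)"

context torus_action
begin

lemma hzero_chain4:
  assumes "hzero T G r (a - b)" "hzero T G r (b - c)" "hzero T G r (c - d)"
  shows "hzero T G r (a - d)"
  using hzero_trans[OF hzero_trans[OF assms(1,2)] assms(3)] .

text \<open>By \<open>prism_comp\<close> the class of the prism is additive in the lattice vector,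
  hence determined by the unit vectors.\<close>

lemma prism_lin:
  assumes z: "hcycle T (lattice 3) r z"
  shows "hzero T (lattice 3) (Suc r) (L.prism (\<tau> m) r z - (\<Sum>j<3. frag_cmul (m j) (P j r z)))"
proof -
  define \<phi> where "\<phi> m = L.prism (\<tau> m) r z" for m
  let ?H = "hzero T (lattice 3) (Suc r)"
  have add: "?H (\<phi> (\<lambda>i. m i + n i) - (\<phi> m + \<phi> n))" for m n
    unfolding \<phi>_def \<tau>_add by (rule L.prism_comp[OF \<tau>_lattice \<tau>_lattice z])
  have zero: "?H (\<phi> (\<lambda>i. 0))"
    unfolding \<phi>_def \<tau>_0 by (rule L.prism_id[OF z])
  have nat: "?H (\<phi> (\<lambda>i. int n * u i) - frag_cmul (int n) (\<phi> u))" for n u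
  proof (induction n)
    case 0
    then show ?case using zero by simp
  next
    case (Suc n)
    have "(\<lambda>i. int (Suc n) * u i) = (\<lambda>i. int n * u i + u i)" by (simp add: algebra_simps)
    then have "?H (\<phi> (\<lambda>i. int (Suc n) * u i) - (\<phi> (\<lambda>i. int n * u i) + \<phi> u))"
      using add[of "\<lambda>i. int n * u i" u] by simp
    from hzero_add[OF this Suc.IH] show ?case by (simp add: frag_cmul_distrib algebra_simps)
  qed
  have int: "?H (\<phi> (\<lambda>i. c * u i) - frag_cmul c (\<phi> u))" for c u
  proof (cases c rule: int_cases2)
    case (nonneg n)
    then show ?thesis using nat by simp
  next
    case (nonpos n)
    have "?H (\<phi> (\<lambda>i. 0) - (\<phi> (\<lambda>i. c * u i) + \<phi> (\<lambda>i. int n * u i)))"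
      using add[of "\<lambda>i. c * u i" "\<lambda>i. int n * u i"] nonpos by simp
    from hzero_diff[OF zero hzero_add[OF this nat[of n u]]] show ?thesis
      using nonpos by (simp add: algebra_simps minus_frag_cmul[symmetric] del: minus_frag_cmul)
  qed
  define u0 u1 u2 where "u0 = unit_vec3 0" and "u1 = unit_vec3 (Suc 0)" and "u2 = unit_vec3 (Suc (Suc 0))"
  have "\<tau> m = \<tau> (\<lambda>i. m 0 * u0 i + m (Suc 0) * u1 i + m (Suc (Suc 0)) * u2 i)"
    by (rule \<tau>_cong) (auto simp: u0_def u1_def u2_def unit_vec3_def numeral_3_eq_3 less_Suc_eq)
  then have "\<phi> m = \<phi> (\<lambda>i. m 0 * u0 i + m (Suc 0) * u1 i + m (Suc (Suc 0)) * u2 i)" by (simp only: \<phi>_def)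
  then have "?H (\<phi> m - (\<phi> (\<lambda>i. m 0 * u0 i + m (Suc 0) * u1 i) + \<phi> (\<lambda>i. m (Suc (Suc 0)) * u2 i)))"
    using add[of "\<lambda>i. m 0 * u0 i + m (Suc 0) * u1 i" "\<lambda>i. m (Suc (Suc 0)) * u2 i"] by simp
  from hzero_add[OF this hzero_add[OF add[of "\<lambda>i. m 0 * u0 i" "\<lambda>i. m (Suc 0) * u1 i"]
      hzero_add[OF hzero_add[OF int[of "m 0" u0] int[of "m (Suc 0)" u1]] int[of "m (Suc (Suc 0))" u2]]]]
  show ?thesis
    by (simp add: sum_lessThan_3 \<phi>_def u0_def u1_def u2_def algebra_simps)
qed

end

text \<open>Lattice vectors are rows, so conjugation by \<open>t\<close> multiplies by
  \<open>N\<close> from the right and row \<open>i\<close> of \<open>N\<close> is the image of the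
  \<open>i\<close>-th generator.\<close>

locale torus_extension = torus_action T \<tau> + E: cyclic_extension T "torus_action.lattice \<tau> 3" G' t
  for T :: "'a topology" and \<tau> G' t +
  fixes N :: "nat \<Rightarrow> nat \<Rightarrow> int"
  assumes t_\<tau>: "t \<circ> \<tau> m = \<tau> (\<lambda>j. \<Sum>i<3. m i * N i j) \<circ> t"
begin

sublocale E: abelian_extension T "lattice 3" G' t ..

abbreviation "H \<equiv> hzero T (lattice 3)"

abbreviation "Z \<equiv> hcycle T (lattice 3)"

lemma P_cycle: "Z r z \<Longrightarrow> Z (Suc r) (P i r z)"
  by (rule L.prism_hcycle[OF \<tau>_lattice])

lemma P_zero: "H r z \<Longrightarrow> H (Suc r) (P i r z)"
  by (rule L.prism_hzero[OF \<tau>_lattice])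

lemma P_add: "P i r (x + y) = P i r x + P i r y"
  by (rule L.prism_add[OF \<tau>_lattice])

lemma P_diff: "P i r (x - y) = P i r x - P i r y"
  by (rule L.prism_diff[OF \<tau>_lattice])

lemma P_cmul: "P i r (frag_cmul k x) = frag_cmul k (P i r x)"
  by (rule L.prism_cmul[OF \<tau>_lattice])

lemma P_swap: "Z r z \<Longrightarrow> H (Suc (Suc r)) (P i (Suc r) (P j r z) + P j (Suc r) (P i r z))"
  by (rule L.prism_swap[OF \<tau>_lattice \<tau>_lattice])

lemma P_square: "Z r z \<Longrightarrow> H (Suc (Suc r)) (P i (Suc r) (P i r z))"
  by (rule L.prism_square[OF \<tau>_lattice])

text \<open>Conjugation carries the prism of the \<open>i\<close>-th generator to that of row
  \<open>i\<close> of \<open>N\<close>; linearity expands it, and \<open>w\<close> may replace the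
  image of \<open>z\<close> because prisms respect \<open>hzero\<close>.\<close>

lemma tmap_P:
  assumes i: "i < 3" and z: "Z r z" and w: "H r (chain_map r t z - w)"
  shows "H (Suc r) (chain_map (Suc r) t (P i r z) - (\<Sum>j<3. frag_cmul (N i j) (P j r w)))"
proof -
  have "t \<circ> \<tau> (unit_vec3 i) = \<tau> (N i) \<circ> t"
  proof -
    have "(\<lambda>j. \<Sum>i'<3. unit_vec3 i i' * N i' j) = N i"
      using i by (auto simp: unit_vec3_def sum_lessThan_3 fun_eq_iff numeral_3_eq_3 less_Suc_eq)
    then show ?thesis using t_\<tau>[of "unit_vec3 i"] by simp
  qed
  then have "H (Suc r) (chain_map (Suc r) t (P i r z) - L.prism (\<tau> (N i)) r (chain_map r t z))"
    by (rule E.prism_conj[OF \<tau>_lattice \<tau>_lattice _ z])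
  moreover have "H (Suc r) (L.prism (\<tau> (N i)) r (chain_map r t z) - (\<Sum>j<3. frag_cmul (N i j) (P j r (chain_map r t z))))"
    by (rule prism_lin[OF E.tmap_hcycle[OF z]])
  moreover have "H (Suc r) ((\<Sum>j<3. frag_cmul (N i j) (P j r (chain_map r t z))) - (\<Sum>j<3. frag_cmul (N i j) (P j r w)))"
    unfolding sum_subtractf[symmetric] frag_cmul_diff[symmetric] P_diff[symmetric]
    by (intro hzero_sum hzero_cmul P_zero w)
  ultimately show ?thesis by (rule hzero_chain4)
qed

lemma tmap_point:
  assumes "singular_simplex 0 T \<sigma>"
  shows "H 0 (chain_map 0 t (frag_of \<sigma>) - frag_of \<sigma>)"
proof -
  have "reduced_cycle T 0 (chain_map 0 t (frag_of \<sigma>) - frag_of \<sigma>)"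
    using assms E.tmap_chain[of 0 "frag_of \<sigma>"]
    by (simp add: reduced_cycle_def singular_chain_of singular_chain_diff chain_boundary_def augmentation_def frag_extend_diff)
  then obtain e where "singular_chain (Suc 0) T e \<and> chain_boundary (Suc 0) e = chain_map 0 t (frag_of \<sigma>) - frag_of \<sigma>"
    using acyclic_T unfolding acyclic_space_def by blast
  then show ?thesis using hzero_boundary[of 0 T e] by simp
qed

lemma tmap_torus_basis:
  assumes \<sigma>: "singular_simplex 0 T \<sigma>"
    and j: "j < length (torus_basis (frag_of \<sigma>) r)"
  shows "H r (chain_map r t (torus_basis (frag_of \<sigma>) r ! j) -
           lin (exterior_power N r j) (torus_basis (frag_of \<sigma>) r))"
proof -
  define x where "x = frag_of \<sigma>"
  have x: "Z 0 x" using \<sigma> by (simp add: x_def hcycle_def singular_chain_of chain_boundary_def)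
  define Q where "Q k l = P k (Suc 0) (P l 0 x)" for k l
  have PQ: "Z (Suc 0) (P k 0 x)" "Z (Suc (Suc 0)) (Q k l)" for k l
    unfolding Q_def by (intro P_cycle x)+
  have deg0: "H 0 (chain_map 0 t x - x)" unfolding x_def by (rule tmap_point[OF \<sigma>])
  have deg1: "H (Suc 0) (chain_map (Suc 0) t (P i 0 x) - (\<Sum>l<3. frag_cmul (N i l) (P l 0 x)))" if "i < 3" for i
    by (rule tmap_P[OF that x deg0])
  have Qk: "H (Suc (Suc 0)) (Q k k)" and Qkl: "H (Suc (Suc 0)) (Q k l + Q l k)" for k l
    unfolding Q_def by (intro P_square P_swap x)+
  have deg2: "H (Suc (Suc 0)) (chain_map (Suc (Suc 0)) t (Q a b) -
     (frag_cmul (minor2 N a b 1 0) (Q 1 0) + frag_cmul (minor2 N a b 2 0) (Q 2 0) + frag_cmul (minor2 N a b 2 1) (Q 2 1)))"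
    if "a < 3" "b < 3" for a b
  proof -
    have 1: "H (Suc (Suc 0)) (chain_map (Suc (Suc 0)) t (Q a b) -
        (\<Sum>k<3. frag_cmul (N a k) (P k (Suc 0) (\<Sum>l<3. frag_cmul (N b l) (P l 0 x)))))"
      unfolding Q_def by (rule tmap_P[OF that(1) PQ(1) deg1[OF that(2)]])
    \<comment> \<open>Adding this zero class removes the squares and reverses the products in
      increasing order, leaving the 2 by 2 minors as coefficients.\<close>
    have "H (Suc (Suc 0)) (frag_cmul (N a 0 * N b 0) (Q 0 0) + frag_cmul (N a 1 * N b 1) (Q 1 1) +
       frag_cmul (N a 2 * N b 2) (Q 2 2) + frag_cmul (N a 0 * N b 1) (Q 0 1 + Q 1 0) +
       frag_cmul (N a 0 * N b 2) (Q 0 2 + Q 2 0) + frag_cmul (N a 1 * N b 2) (Q 1 2 + Q 2 1))"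
      by (intro hzero_add[of _ _ _ "frag_cmul _ _"] hzero_add[of _ _ _ "_ + _" "frag_cmul _ _"] hzero_cmul Qk Qkl)
    from hzero_add[OF 1 this] show ?thesis
      unfolding sum_lessThan_3 P_add P_cmul
      by (simp add: Q_def minor2_def frag_cmul_distrib frag_cmul_distrib2 frag_cmul_diff_distrib numeral_2_eq_2 algebra_simps)
  qed
  define R where "R k l m = P k (Suc (Suc 0)) (Q l m)" for k l m
  have Rsq: "H (Suc (Suc (Suc 0))) (R k k m)" for k m
    unfolding R_def Q_def by (intro P_square PQ)
  have Rswap: "H (Suc (Suc (Suc 0))) (R k l m + R l k m)" for k l m
    unfolding R_def Q_def by (intro P_swap PQ)
  have Rsq': "H (Suc (Suc (Suc 0))) (R k l l)" for k l
    unfolding R_def by (intro P_zero Qk)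
  have Rswap': "H (Suc (Suc (Suc 0))) (R k l m + R k m l)" for k l m
    unfolding R_def P_add[symmetric] by (intro P_zero Qkl)
  have R0: "H (Suc (Suc (Suc 0))) (R k l k)" for k l
    using hzero_diff[OF Rswap[of k l k] Rsq'[of l k]] by simp
  have deg3: "H (Suc (Suc (Suc 0))) (chain_map (Suc (Suc (Suc 0))) t (R 2 1 0) - frag_cmul (det3 N) (R 2 1 0))"
  proof -
    let ?c = "minor2 N 1 0"
    have 1: "H (Suc (Suc (Suc 0))) (chain_map (Suc (Suc (Suc 0))) t (R 2 1 0) -
        (\<Sum>k<3. frag_cmul (N 2 k) (P k (Suc (Suc 0))
         (frag_cmul (?c 1 0) (Q 1 0) + frag_cmul (?c 2 0) (Q 2 0) + frag_cmul (?c 2 1) (Q 2 1)))))"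
      unfolding R_def by (rule tmap_P[OF _ PQ(2) deg2]) simp_all
    \<comment> \<open>An even permutation: two anticommutations carry \<open>R 0 2 1\<close> to
      \<open>R 2 1 0\<close> without a sign.\<close>
    have r021: "H (Suc (Suc (Suc 0))) (R 0 2 1 - R 2 1 0)"
      using hzero_diff[OF Rswap[of 0 2 1] Rswap'[of 2 0 1]] by simp
    have "H (Suc (Suc (Suc 0)))
        (frag_cmul (N 2 0 * ?c 1 0) (R 0 1 0) + frag_cmul (N 2 0 * ?c 2 0) (R 0 2 0) +
         frag_cmul (N 2 1 * ?c 1 0) (R 1 1 0) + frag_cmul (N 2 1 * ?c 2 1) (R 1 2 1) +
         frag_cmul (N 2 2 * ?c 2 0) (R 2 2 0) + frag_cmul (N 2 2 * ?c 2 1) (R 2 2 1) +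
         frag_cmul (N 2 1 * ?c 2 0) (R 1 2 0 + R 2 1 0) + frag_cmul (N 2 0 * ?c 2 1) (R 0 2 1 - R 2 1 0))"
      by (intro hzero_add[of _ _ _ "frag_cmul _ _"] hzero_add[of _ _ _ "_ + _" "frag_cmul _ _"] hzero_cmul
          Rsq R0 Rswap r021)
    from hzero_add[OF 1 this] show ?thesis
      unfolding sum_lessThan_3 P_add P_cmul R_def[symmetric] One_nat_def numeral_2_eq_2
      by (simp add: det3_def frag_cmul_distrib frag_cmul_distrib2 frag_cmul_diff frag_cmul_diff_distrib numeral_2_eq_2
          algebra_simps)
  qed
  show ?thesis
  proof (cases "(frag_of \<sigma>, r)" rule: torus_basis.cases)
    case (1 y)
    then show ?thesis using deg0 j by (simp add: lin_def x_def[symmetric])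
  next
    case (2 y)
    then have "j = 0 \<or> j = Suc 0 \<or> j = Suc (Suc 0)" using j by auto
    then show ?thesis using 2 deg1[of j]
      by (auto simp: lin_def x_def[symmetric] sum_lessThan_3 lessThan_Suc algebra_simps)
  next
    case (3 y)
    then have "j = 0 \<or> j = Suc 0 \<or> j = Suc (Suc 0)" using j by auto
    then show ?thesis using 3 deg2[of 1 0] deg2[of 2 0] deg2[of 2 1]
      by (auto simp: lin_def x_def[symmetric] Q_def exterior2_def lessThan_Suc numeral_2_eq_2 algebra_simps)
  next
    case (4 y)
    then show ?thesis using j deg3
      by (simp add: lin_def x_def[symmetric] Q_def R_def numeral_2_eq_2)
  next
    case (5 y s)
    then show ?thesis using j by simp
  qed
qed

end

text \<open>Up to sign, the value at 1 of the characteristic polynomial of the second exterior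
  power, whose determinant is \<open>det3 N ^ 2\<close> and whose second elementary symmetric
  function is \<open>det3 N\<close> times the trace of \<open>N\<close>. For determinant 1 it is the
  negative of the expression in \<open>det3_minus_1\<close>.\<close>

lemma det3_exterior2:
  "det3 (\<lambda>j i. exterior2 N j i - (if i = j then 1 else 0)) =
     det3 N ^ 2 - det3 N * (N 0 0 + N 1 1 + N 2 2)
       + (minor2 N 1 0 1 0 + minor2 N 2 0 2 0 + minor2 N 2 1 2 1) - (1 :: int)"
  by (simp add: det3_def exterior2_def minor2_def power2_eq_square) (simp add: algebra_simps)

lemma det3_minus_1:
  "det3 (\<lambda>j i. N j i - (if i = j then 1 else 0)) =
     det3 N - (minor2 N 1 0 1 0 + minor2 N 2 0 2 0 + minor2 N 2 1 2 1) + (N 0 0 + N 1 1 + N 2 2) - (1 :: int)"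
  by (simp add: det3_def minor2_def algebra_simps)

section \<open>The index of a sublattice of rank 3\<close>

lemma int_subgroup_cyclic:
  fixes S :: "int set"
  assumes diff: "\<And>x y. x \<in> S \<Longrightarrow> y \<in> S \<Longrightarrow> x - y \<in> S" and d: "d \<in> S" "0 < d"
  shows "\<exists>g>0. g \<in> S \<and> (\<forall>x\<in>S. g dvd x)"
proof -
  define n where "n = (LEAST n. 0 < n \<and> int n \<in> S)"
  have n: "0 < n \<and> int n \<in> S"
    unfolding n_def by (rule LeastI[of _ "nat d"]) (use d in simp)
  have zero: "0 \<in> S" using diff[OF d(1) d(1)] by simp
  have add: "x + y \<in> S" if "x \<in> S" "y \<in> S" for x y
    using diff[OF that(1) diff[OF zero that(2)]] by simp
  have mult: "int k * int n \<in> S" for k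
    by (induction k) (use zero n add in \<open>auto simp: algebra_simps\<close>)
  have mult': "k * int n \<in> S" for k
  proof (cases k rule: int_cases2)
    case (nonpos m)
    then show ?thesis using diff[OF zero mult[of m]] by simp
  qed (use mult in simp)
  have "int n dvd x" if x: "x \<in> S" for x
  proof (rule ccontr)
    assume "\<not> int n dvd x"
    then have m: "0 < x mod int n" using n by (metis dvd_eq_mod_eq_0 le_less pos_mod_sign of_nat_0_less_iff)
    have "x mod int n \<in> S"
      using diff[OF x mult'[of "x div int n"]] by (simp add: minus_div_mult_eq_mod)
    then have "0 < nat (x mod int n) \<and> int (nat (x mod int n)) \<in> S" using m by simp
    then have "n \<le> nat (x mod int n)" unfolding n_def by (rule Least_le)
    then show False using m pos_mod_bound[of "int n" x] n by linarith
  qed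
  then show ?thesis using n by (intro exI[of _ "int n"]) simp
qed

definition diff3 :: "int \<times> int \<times> int \<Rightarrow> int \<times> int \<times> int \<Rightarrow> int \<times> int \<times> int" where
  "diff3 u v = (case u of (x, y, z) \<Rightarrow> case v of (x', y', z') \<Rightarrow> (x - x', y - y', z - z'))"

text \<open>A triangular basis in Hermite form. The three multiples of unit vectors ensure full
  rank, hence positive diagonal entries.\<close>

lemma hermite_basis:
  fixes L :: "(int \<times> int \<times> int) set"
  assumes diff: "\<And>u v. u \<in> L \<Longrightarrow> v \<in> L \<Longrightarrow> diff3 u v \<in> L"
    and d: "0 < d" "(d, 0, 0) \<in> L" "(0, d, 0) \<in> L" "(0, 0, d) \<in> L"
  obtains a b c p q r where "0 < a" "0 < b" "0 < c"
    "\<And>x y z. (x, y, z) \<in> L \<longleftrightarrow>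
       (\<exists>i j k. x = i * a + j * p + k * q \<and> y = j * b + k * r \<and> z = k * c)"
proof -
  have zero: "(0, 0, 0) \<in> L" using diff[OF d(2) d(2)] by (simp add: diff3_def)
  have add: "(x + x', y + y', z + z') \<in> L" if "(x, y, z) \<in> L" "(x', y', z') \<in> L" for x y z x' y' z'
    using diff[OF that(1) diff[OF zero that(2)]] by (simp add: diff3_def)
  have nat_mult: "(int k * x, int k * y, int k * z) \<in> L" if "(x, y, z) \<in> L" for k x y z
  proof (induction k)
    case (Suc k)
    then show ?case using add[OF that Suc] by (simp add: algebra_simps)
  qed (simp add: zero)
  have mult: "(k * x, k * y, k * z) \<in> L" if "(x, y, z) \<in> L" for k x y z
  proof (cases k rule: int_cases2)
    case (nonpos m)
    then show ?thesis using diff[OF zero nat_mult[OF that, of m]] by (simp add: diff3_def)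
  qed (use nat_mult[OF that] in simp)
  have diff': "(x - x', y - y', z - z') \<in> L" if "(x, y, z) \<in> L" "(x', y', z') \<in> L" for x y z x' y' z'
    using diff[OF that] by (simp add: diff3_def)
  \<comment> \<open>Leading entries of the filtration by trailing zeros: generators of these three
    groups of integers become the diagonal, and lifts of them to \<open>L\<close> the rows.\<close>
  define S1 S2 S3 where "S1 = {x. (x, 0, 0) \<in> L}" and "S2 = {y. \<exists>x. (x, y, 0) \<in> L}"
    and "S3 = {z. \<exists>x y. (x, y, z) \<in> L}"
  have "s - t \<in> S3" if st: "s \<in> S3" "t \<in> S3" for s t
  proof -
    obtain x y x' y' where "(x, y, s) \<in> L" "(x', y', t) \<in> L" using st by (auto simp: S3_def)
    from diff'[OF this] show ?thesis by (auto simp: S3_def)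
  qed
  then obtain c where c: "0 < c" "c \<in> S3" "\<forall>z\<in>S3. c dvd z"
    using int_subgroup_cyclic[of S3 d] d by (auto simp: S3_def)
  have "s - t \<in> S2" if st: "s \<in> S2" "t \<in> S2" for s t
  proof -
    obtain x x' where "(x, s, 0) \<in> L" "(x', t, 0) \<in> L" using st by (auto simp: S2_def)
    from diff'[OF this] show ?thesis by (auto simp: S2_def)
  qed
  then obtain b where b: "0 < b" "b \<in> S2" "\<forall>y\<in>S2. b dvd y"
    using int_subgroup_cyclic[of S2 d] d by (auto simp: S2_def)
  have "s - t \<in> S1" if "s \<in> S1" "t \<in> S1" for s t
    using diff'[of s 0 0 t 0 0] that by (simp add: S1_def)
  then obtain a where a: "0 < a" "a \<in> S1" "\<forall>x\<in>S1. a dvd x"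
    using int_subgroup_cyclic[of S1 d] d by (auto simp: S1_def)
  obtain p where p: "(p, b, 0) \<in> L" using b(2) by (auto simp: S2_def)
  obtain q r where q: "(q, r, c) \<in> L" using c(2) by (auto simp: S3_def)
  have "(x, y, z) \<in> L \<longleftrightarrow> (\<exists>i j k. x = i * a + j * p + k * q \<and> y = j * b + k * r \<and> z = k * c)" for x y z
  proof
    assume v: "(x, y, z) \<in> L"
    then have "z \<in> S3" by (auto simp: S3_def)
    then have "c dvd z" using c(3) by blast
    then obtain k where k: "z = k * c" by (metis dvd_div_mult_self)
    have v1: "(x - k * q, y - k * r, 0) \<in> L" using diff[OF v mult[OF q, of k]] k by (simp add: diff3_def)
    then have "y - k * r \<in> S2" by (auto simp: S2_def)
    then have "b dvd (y - k * r)" using b(3) by blast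
    then obtain j where j: "y - k * r = j * b" by (metis dvd_div_mult_self)
    have v2: "(x - k * q - j * p, 0, 0) \<in> L" using diff[OF v1 mult[OF p, of j]] j by (simp add: diff3_def)
    then have "x - k * q - j * p \<in> S1" by (auto simp: S1_def)
    then have "a dvd (x - k * q - j * p)" using a(3) by blast
    then obtain i where i: "x - k * q - j * p = i * a" by (metis dvd_div_mult_self)
    show "\<exists>i j k. x = i * a + j * p + k * q \<and> y = j * b + k * r \<and> z = k * c"
      using i j k by (intro exI[of _ i] exI[of _ j] exI[of _ k]) simp
  next
    assume "\<exists>i j k. x = i * a + j * p + k * q \<and> y = j * b + k * r \<and> z = k * c"
    then obtain i j k where "x = i * a + j * p + k * q" "y = j * b + k * r" "z = k * c" by blast
    then show "(x, y, z) \<in> L"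
      using add[OF add[OF mult[of a 0 0 i] mult[OF p, of j]] mult[OF q, of k]] a(2) by (simp add: S1_def)
  qed
  then show thesis using that a(1) b(1) c(1) by blast
qed

lemma det3_mult: "det3 (\<lambda>i k. \<Sum>j<3. U i j * C j k) = det3 U * det3 (C :: nat \<Rightarrow> nat \<Rightarrow> 'b::comm_ring_1)"
  by (simp add: det3_def minor2_def sum_lessThan_3 numeral_2_eq_2 algebra_simps)

definition row_lattice :: "(nat \<Rightarrow> nat \<Rightarrow> int) \<Rightarrow> (int \<times> int \<times> int) set" where
  "row_lattice C = {(x, y, z). \<exists>l. x = (\<Sum>j<3. l j * C j 0) \<and> y = (\<Sum>j<3. l j * C j 1) \<and> z = (\<Sum>j<3. l j * C j 2)}"

lemma row_lattice_diff: "u \<in> row_lattice C \<Longrightarrow> v \<in> row_lattice C \<Longrightarrow> diff3 u v \<in> row_lattice C"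
proof -
  assume "u \<in> row_lattice C" "v \<in> row_lattice C"
  then obtain l l' where
    "u = ((\<Sum>j<3. l j * C j 0), (\<Sum>j<3. l j * C j 1), (\<Sum>j<3. l j * C j 2))"
    "v = ((\<Sum>j<3. l' j * C j 0), (\<Sum>j<3. l' j * C j 1), (\<Sum>j<3. l' j * C j 2))"
    unfolding row_lattice_def by auto
  then show ?thesis unfolding row_lattice_def
    by (auto simp: diff3_def sum_subtractf left_diff_distrib intro!: exI[of _ "\<lambda>j. l j - l' j"])
qed

text \<open>Cramer's rule: the witness is the given vector times the adjugate of
  \<open>C\<close>.\<close>

lemma row_lattice_det:
  "(det3 C * x, det3 C * y, det3 C * z) \<in> row_lattice C"
proof -
  define l where "l j = (if j = 0 then x * minor2 C 2 1 2 1 - y * minor2 C 2 1 2 0 + z * minor2 C 2 1 1 0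
     else if j = Suc 0 then - x * minor2 C 2 0 2 1 + y * minor2 C 2 0 2 0 - z * minor2 C 2 0 1 0
     else x * minor2 C 1 0 2 1 - y * minor2 C 1 0 2 0 + z * minor2 C 1 0 1 0)" for j :: nat
  have "det3 C * x = (\<Sum>j<3. l j * C j 0)" "det3 C * y = (\<Sum>j<3. l j * C j 1)" "det3 C * z = (\<Sum>j<3. l j * C j 2)"
    by (simp_all add: l_def sum_lessThan_3 det3_def minor2_def numeral_2_eq_2 algebra_simps)
  then show ?thesis unfolding row_lattice_def by blast
qed

text \<open>A Hermite basis gives the box below its diagonal as a set of representatives. Its size
  is the determinant of that basis, which agrees with that of \<open>C\<close> up to sign because
  both matrices span the same lattice.\<close>

theorem row_lattice_index:
  assumes det: "det3 C \<noteq> 0"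
  shows "\<exists>R. finite R \<and> card R = nat \<bar>det3 C\<bar> \<and> (\<forall>v. \<exists>!\<rho>. \<rho> \<in> R \<and> diff3 v \<rho> \<in> row_lattice C)"
proof -
  let ?L = "row_lattice C"
  let ?d = "\<bar>det3 C\<bar>"
  have dL: "(?d * x, ?d * y, ?d * z) \<in> ?L" for x y z
    using row_lattice_det[of C "sgn (det3 C) * x" "sgn (det3 C) * y" "sgn (det3 C) * z"]
    by (simp add: abs_sgn mult.assoc[symmetric])
  obtain a b c p q r where abc: "0 < a" "0 < b" "0 < c"
    and L: "\<And>x y z. (x, y, z) \<in> ?L \<longleftrightarrow>
       (\<exists>i j k. x = i * a + j * p + k * q \<and> y = j * b + k * r \<and> z = k * c)"
    by (rule hermite_basis[of ?L ?d]) (use row_lattice_diff det dL[of 1 0 0] dL[of 0 1 0] dL[of 0 0 1] in auto)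
  define Hm where "Hm i k = (if i = 0 then (if k = 0 then a else 0)
      else if i = Suc 0 then (if k = 0 then p else if k = Suc 0 then b else 0)
      else (if k = 0 then q else if k = Suc 0 then r else c))" for i k :: nat
  have detH: "det3 Hm = a * b * c" by (simp add: det3_def minor2_def Hm_def)
  have "\<exists>l. \<forall>k<3. Hm i k = (\<Sum>j<3. l j * C j k)" for i
  proof -
    have "(Hm i 0, Hm i 1, Hm i 2) \<in> ?L"
      unfolding L
      by (rule exI[of _ "if i = 0 then 1 else 0"], rule exI[of _ "if i = Suc 0 then 1 else 0"],
          rule exI[of _ "if i = 0 \<or> i = Suc 0 then 0 else 1"]) (simp add: Hm_def)
    then obtain l where "Hm i 0 = (\<Sum>j<3. l j * C j 0)" "Hm i 1 = (\<Sum>j<3. l j * C j 1)" "Hm i 2 = (\<Sum>j<3. l j * C j 2)"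
      unfolding row_lattice_def by auto
    then show ?thesis by (intro exI[of _ l]) (auto simp: numeral_3_eq_3 less_Suc_eq numeral_2_eq_2)
  qed
  then obtain U where U: "\<And>i k. k < 3 \<Longrightarrow> Hm i k = (\<Sum>j<3. U i j * C j k)" by metis
  have "\<exists>l. \<forall>k<3. C i k = (\<Sum>j<3. l j * Hm j k)" if "i < 3" for i
  proof -
    have "(C i 0, C i 1, C i 2) \<in> ?L"
      unfolding row_lattice_def using that
      by (auto simp: sum_lessThan_3 numeral_3_eq_3 less_Suc_eq intro!: exI[of _ "\<lambda>j. if j = i then 1 else 0"])
    then obtain l m n where "C i 0 = l * a + m * p + n * q" "C i 1 = m * b + n * r" "C i 2 = n * c"
      unfolding L by blast
    then show ?thesis
      by (intro exI[of _ "\<lambda>j. if j = 0 then l else if j = Suc 0 then m else n"])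
        (auto simp: Hm_def sum_lessThan_3 numeral_3_eq_3 less_Suc_eq numeral_2_eq_2)
  qed
  then obtain V where V: "\<And>i k. i < 3 \<Longrightarrow> k < 3 \<Longrightarrow> C i k = (\<Sum>j<3. V i j * Hm j k)" by metis
  have "det3 Hm = det3 (\<lambda>i k. \<Sum>j<3. U i j * C j k)"
    by (simp add: det3_def minor2_def U del: sum.lessThan_Suc)
  then have 1: "a * b * c = det3 U * det3 C" using det3_mult[of U C] detH by simp
  have "det3 C = det3 (\<lambda>i k. \<Sum>j<3. V i j * Hm j k)"
    using V by (simp add: det3_def minor2_def)
  then have 2: "det3 C = det3 V * (a * b * c)" using det3_mult[of V Hm] detH by simp
  \<comment> \<open>\<open>U\<close> and \<open>V\<close> express each set of rows by the other, so
    their integer determinants are inverse to each other and equal 1 or -1.\<close>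
  have "det3 V * det3 U * det3 C = det3 C" using 1 2 by (simp add: mult.assoc)
  then have "det3 V * det3 U = 1" using det by simp
  then have "\<bar>det3 V\<bar> = 1" by (metis abs_1 dvd_triv_left zdvd1_eq)
  then have card: "\<bar>det3 C\<bar> = a * b * c" using 2 abc by (simp add: abs_mult)
  let ?R = "{0..<a} \<times> {0..<b} \<times> {0..<c}"
  have "card ?R = nat \<bar>det3 C\<bar>" using abc by (simp add: card nat_mult_distrib)
  moreover have "\<exists>!\<rho>. \<rho> \<in> ?R \<and> diff3 v \<rho> \<in> ?L" for v
  proof -
    obtain x y z where v: "v = (x, y, z)" by (cases v)
    \<comment> \<open>Division with remainder from the last coordinate to the first, since each
      basis row affects only its own and earlier coordinates.\<close>
    define k where "k = z div c"
    define j where "j = (y - k * r) div b"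
    define i where "i = (x - k * q - j * p) div a"
    let ?\<rho> = "((x - k * q - j * p) mod a, (y - k * r) mod b, z mod c)"
    have "diff3 v ?\<rho> \<in> ?L"
      unfolding v diff3_def prod.case L
      by (rule exI[of _ i], rule exI[of _ j], rule exI[of _ k])
        (simp add: i_def j_def k_def minus_mod_eq_div_mult[symmetric])
    moreover have "?\<rho> \<in> ?R" using abc by simp
    moreover have "\<rho> = \<rho>'" if \<rho>: "\<rho> \<in> ?R" "diff3 v \<rho> \<in> ?L" "\<rho>' \<in> ?R" "diff3 v \<rho>' \<in> ?L" for \<rho> \<rho>'
    proof -
      obtain x1 y1 z1 x2 y2 z2 where s: "\<rho> = (x1, y1, z1)" "\<rho>' = (x2, y2, z2)" by (cases \<rho>, cases \<rho>')
      have small: "m = 0" if "n * k = m" "0 \<le> s" "s < k" "0 \<le> t" "t < k" "m = s - t" for m n k s t :: int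
      proof -
        have "\<bar>m\<bar> < k" using that by linarith
        moreover have "k dvd m" using that(1) by (metis dvd_triv_right)
        ultimately show ?thesis using zdvd_imp_le[of k "\<bar>m\<bar>"] by fastforce
      qed
      have "diff3 (diff3 v \<rho>') (diff3 v \<rho>) \<in> ?L" using row_lattice_diff \<rho> by blast
      then have "(x1 - x2, y1 - y2, z1 - z2) \<in> ?L" by (simp add: v s diff3_def)
      then obtain i j k where ijk: "x1 - x2 = i * a + j * p + k * q" "y1 - y2 = j * b + k * r" "z1 - z2 = k * c"
        unfolding L by blast
      have "z1 - z2 = 0" using small[OF ijk(3)[symmetric], of z1 z2] \<rho> s by auto
      then have k: "k = 0" using ijk(3) abc by simp
      have "y1 - y2 = 0" using small[of j b "y1 - y2" y1 y2] ijk(2) k \<rho> s by auto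
      then have j: "j = 0" using ijk(2) abc k by simp
      have "x1 - x2 = 0" using small[of i a "x1 - x2" x1 x2] ijk(1) k j \<rho> s by auto
      then show ?thesis using \<open>y1 - y2 = 0\<close> \<open>z1 - z2 = 0\<close> s by simp
    qed
    ultimately show ?thesis by blast
  qed
  ultimately show ?thesis by (intro exI[of _ ?R]) simp
qed

section \<open>Torsion in the homology of the orbit space\<close>

lemma homology_class_hom:
  "(\<lambda>w. homologous_rel_set r X {} w) \<in> hom (relcycle_group r X {}) (homology_group (int r) X)"
proof -
  interpret N: normal "singular_relboundary_set r X {}" "relcycle_group r X {}"
    by (rule normal_subgroup_singular_relboundary_relcycle)
  show ?thesis
    using N.r_coset_hom_Mod unfolding right_coset_singular_relboundary nontrivial_relative_homology_group .
qed

lemma torsion_part_homology_group: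
  "torsion_part (homology_group (int r) X) =
     (\<lambda>w. homologous_rel_set r X {} w) `
       {w. singular_relcycle r X {} w \<and> (\<exists>n>0. singular_relboundary r X {} (frag_cmul (int n) w))}"
proof -
  interpret h: group_hom "relcycle_group r X {}" "homology_group (int r) X" "\<lambda>w. homologous_rel_set r X {} w"
    by (simp add: group_hom_def group_hom_axioms_def homology_class_hom)
  have pow: "w [^]\<^bsub>relcycle_group r X {}\<^esub> n = frag_cmul (int n) w" for w and n :: nat
    by (induction n) (simp_all add: frag_cmul_distrib algebra_simps)
  have "homologous_rel_set r X {} w [^]\<^bsub>homology_group (int r) X\<^esub> n = \<one>\<^bsub>homology_group (int r) X\<^esub>
     \<longleftrightarrow> singular_relboundary r X {} (frag_cmul (int n) w)" if "singular_relcycle r X {} w" for w n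
  proof -
    have "homologous_rel_set r X {} w [^]\<^bsub>homology_group (int r) X\<^esub> n = homologous_rel_set r X {} (frag_cmul (int n) w)"
      using h.hom_nat_pow[of w n] that pow by simp
    then show ?thesis by (simp add: homologous_rel_set_eq_relboundary)
  qed
  then show ?thesis
    unfolding torsion_part_def carrier_relative_homology_group by auto
qed

locale torus_cover = torus_extension T \<tau> G' t N + covering_action T G' X p
  for T :: "'a topology" and \<tau> G' t N and X :: "'b topology" and p +
  assumes nonempty: "topspace T \<noteq> {}" and det_N: "det3 N = 1"
begin

definition point :: "(nat \<Rightarrow> real) \<Rightarrow> 'a" where
  "point = (\<lambda>_\<in>standard_simplex 0. SOME a. a \<in> topspace T)"

lemma point_simplex: "singular_simplex 0 T point"
proof -
  have "(SOME a. a \<in> topspace T) \<in> topspace T" using nonempty by (simp add: some_in_eq)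
  then show ?thesis by (simp add: singular_simplex_def point_def)
qed

abbreviation "es \<equiv> torus_basis (frag_of point)"

text \<open>The image of \<open>t\<close> minus 1 in coordinates. Entries of \<open>k\<close> beyond
  the length of the basis are unconstrained, as \<open>lin\<close> ignores them.\<close>

definition image3 :: "nat \<Rightarrow> (nat \<Rightarrow> int) set" where
  "image3 r = {k. \<exists>l. \<forall>i<length (es r). k i =
     (\<Sum>j<length (es r). l j * (exterior_power N r j i - (if i = j then 1 else 0)))}"

definition cls :: "nat \<Rightarrow> (nat \<Rightarrow> int) \<Rightarrow> 'b chain set" where
  "cls r k = homologous_rel_set r X {} (chain_map r p (lin k (es r)))"

lemma basis_cycle: "Z r (lin k (es r))"
  by (rule hcycle_lin) (use hbasis_torus[OF point_simplex, of r] in \<open>simp add: hbasis_def\<close>)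

lemma boundary_lin:
  "singular_relboundary r X {} (chain_map r p (lin k (es r))) \<longleftrightarrow> k \<in> image3 r"
  using boundary_project[OF hcycle_chain[OF basis_cycle], of r k]
    E.hbasis_zero_iff[OF hbasis_torus[OF point_simplex] tmap_torus_basis[OF point_simplex], of r k]
  unfolding image3_def by simp

lemma cls_eq_iff: "cls r k = cls r k' \<longleftrightarrow> (\<lambda>i. k i - k' i) \<in> image3 r"
  unfolding cls_def homologous_rel_set_eq boundary_lin[symmetric] lin_diff chain_map_diff
  unfolding homologous_rel_def ..

text \<open>By \<open>hbasis_torsion_lift\<close> no torsion class is missed by the lattice basis,
  so torsion can be tested on coordinate vectors.\<close>

lemma torsion_cls:
  "torsion_part (homology_group (int r) X) = cls r ` {k. \<exists>n>0. (\<lambda>i. int n * k i) \<in> image3 r}"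
proof -
  have cyc: "singular_relcycle r X {} (chain_map r p (lin k (es r)))" for k
    by (rule cycle_project[OF E.hcycle_sub[OF basis_cycle]])
  have bd: "singular_relboundary r X {} (frag_cmul (int n) (chain_map r p (lin k (es r)))) \<longleftrightarrow>
      (\<lambda>i. int n * k i) \<in> image3 r" for k n
    using boundary_lin[of r "\<lambda>i. int n * k i"] by (simp add: lin_cmul)
  have "\<exists>k n. 0 < n \<and> (\<lambda>i. int n * k i) \<in> image3 r \<and> homologous_rel_set r X {} w = cls r k"
    if w: "singular_relcycle r X {} w" and n: "0 < n" "singular_relboundary r X {} (frag_cmul (int n) w)" for w n
  proof -
    obtain z where z: "hcycle T G' r z" "chain_map r p z = w" using cycle_lift[OF w] by blast
    have "hzero T G' r (frag_cmul (int n) z)"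
      using boundary_project[OF singular_chain_cmul[OF hcycle_chain[OF z(1)]], of "int n"] n(2) z(2) by simp
    then obtain k where k: "hzero T G' r (z - lin k (es r))"
      using E.hbasis_torsion_lift[OF hbasis_torus[OF point_simplex] hbasis_torus[OF point_simplex] z(1), of "int n"] n(1)
      by auto
    have "singular_relboundary r X {} (w - chain_map r p (lin k (es r)))"
      using boundary_project[OF singular_chain_diff[OF hcycle_chain[OF z(1)] hcycle_chain[OF basis_cycle]], of k] k z(2)
      by (simp add: chain_map_diff)
    then have rel: "homologous_rel r X {} w (chain_map r p (lin k (es r)))" by (simp add: homologous_rel_def)
    have "singular_relboundary r X {} (frag_cmul (int n) w - frag_cmul (int n) (w - chain_map r p (lin k (es r))))"
      by (rule singular_relboundary_diff[OF n(2) singular_relboundary_cmul[OF rel[unfolded homologous_rel_def]]])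
    then have "(\<lambda>i. int n * k i) \<in> image3 r" unfolding bd[symmetric] by (simp add: frag_cmul_diff)
    moreover have "homologous_rel_set r X {} w = cls r k" using rel by (simp add: cls_def homologous_rel_set_eq)
    ultimately show ?thesis using n(1) by blast
  qed
  note lift = this
  show ?thesis
  proof (intro equalityI subsetI)
    fix c assume "c \<in> torsion_part (homology_group (int r) X)"
    then obtain w n where w: "singular_relcycle r X {} w" "0 < n" "singular_relboundary r X {} (frag_cmul (int n) w)"
      and c: "c = homologous_rel_set r X {} w"
      unfolding torsion_part_homology_group by auto
    from lift[OF w] obtain k m where k: "0 < m \<and> (\<lambda>i. int m * k i) \<in> image3 r \<and> homologous_rel_set r X {} w = cls r k"
      by (elim exE)
    show "c \<in> cls r ` {k. \<exists>n>0. (\<lambda>i. int n * k i) \<in> image3 r}"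
      by (rule image_eqI[of _ _ k]) (use k c in auto)
  next
    fix c assume "c \<in> cls r ` {k. \<exists>n>0. (\<lambda>i. int n * k i) \<in> image3 r}"
    then obtain k n where k: "c = cls r k" "0 < n" "(\<lambda>i. int n * k i) \<in> image3 r" by (elim imageE CollectE exE conjE)
    show "c \<in> torsion_part (homology_group (int r) X)"
      unfolding torsion_part_homology_group k(1) cls_def
      by (rule imageI, rule CollectI, intro conjI exI[of _ n]) (use cyc bd k in auto)
  qed
qed

text \<open>In degrees 0 and 3 the action of \<open>t\<close> is 1 and \<open>det3 N = 1\<close>, so
  \<open>image3\<close> is 0 and the cokernel is torsion-free; in higher degrees the basis is
  empty.\<close>

lemma torsion_part_trivial:
  assumes "r \<noteq> 1" "r \<noteq> 2"
  shows "torsion_part (homology_group (int r) X) = {cls r (\<lambda>_. 0)}"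
proof -
  have im: "k \<in> image3 r \<longleftrightarrow> (\<forall>i<length (es r). k i = 0)" for k
  proof (cases "(frag_of point, r)" rule: torus_basis.cases)
    case 1
    then show ?thesis by (simp add: image3_def)
  next
    case (4 x)
    then show ?thesis by (simp add: image3_def det_N)
  qed (use assms in \<open>auto simp: image3_def\<close>)
  have "{k. \<exists>n>0. (\<lambda>i. int n * k i) \<in> image3 r} = image3 r"
    unfolding set_eq_iff mem_Collect_eq im by (auto intro: exI[of _ "1 :: nat"])
  moreover have "cls r ` image3 r = (\<lambda>_. cls r (\<lambda>_. 0)) ` image3 r"
    by (rule image_cong[OF refl]) (simp add: cls_eq_iff)
  moreover have "(\<lambda>_. 0) \<in> image3 r" by (simp add: im)
  then have "image3 r \<noteq> {}" by blast
  ultimately show ?thesis unfolding torsion_cls by (simp add: image_constant_conv)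
qed

text \<open>A nonzero determinant makes the cokernel finite, so every class coming from the lattice
  basis is torsion and the torsion part is the whole cokernel.\<close>

lemma torsion_part_finite_index:
  fixes r :: nat
  defines "C \<equiv> (\<lambda>j i. exterior_power N r j i - (if i = j then 1 else 0))"
  assumes r: "length (es r) = 3" and det: "det3 C \<noteq> 0"
  shows "finite (torsion_part (homology_group (int r) X))"
    and "card (torsion_part (homology_group (int r) X)) = nat \<bar>det3 C\<bar>"
proof -
  \<comment> \<open>\<open>tr\<close> and \<open>\<pi>\<close> pass between coordinate functions and
    the triples of \<open>row_lattice\<close>.\<close>
  define tr :: "int \<times> int \<times> int \<Rightarrow> nat \<Rightarrow> int" where
    "tr v i = (case v of (x, y, z) \<Rightarrow> if i = 0 then x else if i = Suc 0 then y else z)" for v i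
  define \<pi> :: "(nat \<Rightarrow> int) \<Rightarrow> int \<times> int \<times> int" where "\<pi> k = (k 0, k 1, k 2)" for k
  have im: "k \<in> image3 r \<longleftrightarrow> \<pi> k \<in> row_lattice C" for k
    unfolding image3_def row_lattice_def r C_def \<pi>_def
    by (simp add: numeral_3_eq_3 numeral_2_eq_2 All_less_Suc conj_ac)
  obtain R where R: "finite R" "card R = nat \<bar>det3 C\<bar>"
    "\<And>v. \<exists>!\<rho>. \<rho> \<in> R \<and> diff3 v \<rho> \<in> row_lattice C" using row_lattice_index[OF det] by blast
  have \<pi>_diff: "\<pi> (\<lambda>i. k i - k' i) = diff3 (\<pi> k) (\<pi> k')" for k k' by (simp add: \<pi>_def diff3_def)
  have \<pi>_tr: "\<pi> (tr v) = v" for v by (cases v) (simp add: \<pi>_def tr_def)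
  have eq: "cls r k = cls r k' \<longleftrightarrow> diff3 (\<pi> k) (\<pi> k') \<in> row_lattice C" for k k'
    unfolding cls_eq_iff im \<pi>_diff ..
  have "\<exists>n>0. (\<lambda>i. int n * k i) \<in> image3 r" for k
  proof (intro exI conjI)
    show "0 < nat \<bar>det3 C\<bar>" using det by simp
    have "(\<bar>det3 C\<bar> * k 0, \<bar>det3 C\<bar> * k 1, \<bar>det3 C\<bar> * k 2) \<in> row_lattice C"
      using row_lattice_det[of C "sgn (det3 C) * k 0" "sgn (det3 C) * k 1" "sgn (det3 C) * k 2"]
      by (simp add: abs_sgn mult.assoc[symmetric])
    then show "(\<lambda>i. int (nat \<bar>det3 C\<bar>) * k i) \<in> image3 r" by (simp add: im \<pi>_def)
  qed
  then have "torsion_part (homology_group (int r) X) = range (cls r)" unfolding torsion_cls by auto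
  also have "\<dots> = (\<lambda>\<rho>. cls r (tr \<rho>)) ` R"
  proof -
    have "\<exists>\<rho>\<in>R. cls r k = cls r (tr \<rho>)" for k using R(3)[of "\<pi> k"] unfolding eq \<pi>_tr by blast
    then show ?thesis by blast
  qed
  finally have tor: "torsion_part (homology_group (int r) X) = (\<lambda>\<rho>. cls r (tr \<rho>)) ` R" .
  have "inj_on (\<lambda>\<rho>. cls r (tr \<rho>)) R"
  proof (rule inj_onI)
    fix \<rho> \<rho>' assume \<rho>: "\<rho> \<in> R" "\<rho>' \<in> R" "cls r (tr \<rho>) = cls r (tr \<rho>')"
    then have "diff3 \<rho> \<rho>' \<in> row_lattice C" by (simp add: eq \<pi>_tr)
    moreover have "diff3 \<rho> \<rho> \<in> row_lattice C"
      using row_lattice_det[of C 0 0 0] by (simp add: diff3_def split: prod.split)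
    ultimately show "\<rho> = \<rho>'" using R(3)[of \<rho>] \<rho> by blast
  qed
  then show "finite (torsion_part (homology_group (int r) X))"
    "card (torsion_part (homology_group (int r) X)) = nat \<bar>det3 C\<bar>"
    unfolding tor using R(1,2) by (auto simp: card_image)
qed

theorem torsion_homology:
  assumes det: "det3 (\<lambda>j i. N j i - (if i = j then 1 else 0)) \<noteq> 0" and r: "0 \<le> r"
  shows "finite (torsion_part (homology_group r X))"
    and "torsion_order r X =
      (if r = 1 \<or> r = 2 then nat \<bar>det3 (\<lambda>j i. N j i - (if i = j then 1 else 0))\<bar> else 1)"
proof -
  let ?B = "\<lambda>j i. N j i - (if i = j then 1 else 0)"
  have e1: "exterior_power N 1 = N" and e2: "exterior_power N 2 = exterior2 N"
    by (simp_all add: numeral_2_eq_2)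
  have "det3 (\<lambda>j i. exterior2 N j i - (if i = j then 1 else 0)) = - det3 ?B"
    unfolding det3_exterior2 det3_minus_1 det_N by simp
  moreover have "length (es 1) = 3" "length (es 2) = 3" by (simp_all add: numeral_2_eq_2)
  ultimately have 12: "finite (torsion_part (homology_group (int s) X)) \<and>
      card (torsion_part (homology_group (int s) X)) = nat \<bar>det3 ?B\<bar>" if "s = 1 \<or> s = 2" for s
    using that torsion_part_finite_index[of 1] torsion_part_finite_index[of 2] det e1 e2 by auto
  have 0: "finite (torsion_part (homology_group (int s) X)) \<and> card (torsion_part (homology_group (int s) X)) = 1"
    if "\<not> (s = 1 \<or> s = 2)" for s
    using that torsion_part_trivial[of s] by simp
  obtain s where s: "r = int s" using r nonneg_int_cases by blast
  show "finite (torsion_part (homology_group r X))"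
    "torsion_order r X = (if r = 1 \<or> r = 2 then nat \<bar>det3 ?B\<bar> else 1)"
    using 12[of s] 0[of s] unfolding torsion_order_def s by auto
qed

end

section \<open>The contractible space \<open>HxC\<close> and its groups of translations and
  dilations\<close>

lemma contractible_imp_acyclic:
  assumes T: "contractible_space T"
  shows "acyclic_space T"
  unfolding acyclic_space_def
proof (intro allI impI)
  fix m c assume c: "reduced_cycle T m c"
  show "\<exists>e. singular_chain (Suc m) T e \<and> chain_boundary (Suc m) e = c"
  proof (cases "m = 0")
    case True
    have conn: "path_connected_space T" using T contractible_imp_path_connected_space by blast
    have "singular_relboundary 0 T {} c"
    \<comment> \<open>The augmentation is the projection with a single fibre, so its kernel is
      generated by differences of points, which path-connectedness makes boundaries.\<close>
    proof (rule frag_kernel_induct[where S = "singular_simplex_set 0 T" and \<pi> = "\<lambda>_. ()"])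
      show "Poly_Mapping.keys c \<subseteq> singular_simplex_set 0 T" "frag_extend (frag_of \<circ> (\<lambda>_. ())) c = 0"
        using c True by (auto simp: reduced_cycle_def singular_chain_def augmentation_def comp_def)
      show "singular_relboundary 0 T {} (frag_of \<sigma> - frag_of \<tau>)"
        if "\<sigma> \<in> singular_simplex_set 0 T" "\<tau> \<in> singular_simplex_set 0 T" for \<sigma> \<tau>
        using iso_integer_zeroth_homology_group_aux[OF conn, of \<sigma> \<tau>] that by (simp add: homologous_rel_def)
    qed (auto intro: singular_relboundary_diff)
    then show ?thesis using True by (simp add: singular_boundary)
  next
    case False
    have "trivial_group (homology_group (int m) T)"
      using trivial_reduced_homology_group_contractible_space[OF T, of "int m"] False by (simp add: un_reduced_homology_group)
    moreover have "homologous_rel_set m T {} c \<in> carrier (homology_group (int m) T)"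
      unfolding carrier_relative_homology_group using c by (intro imageI) (simp add: reduced_cycle_def singular_cycle)
    ultimately have "homologous_rel_set m T {} c = singular_relboundary_set m T {}"
      unfolding trivial_group_def by simp
    then show ?thesis unfolding homologous_rel_set_eq_relboundary singular_boundary .
  qed
qed

lemma convex_HxC: "convex HxC"
  unfolding HxC_def by (intro convex_Times convex_UNIV convex_halfspace_Im_gt)

lemma acyclic_HxC: "acyclic_space (top_of_set HxC)"
  by (intro contractible_imp_acyclic) (simp add: contractible_space_top_of_set convex_imp_contractible convex_HxC)

lemma HxC_nonempty: "HxC \<noteq> {}"
proof -
  have "(\<i>, 0) \<in> HxC" by (simp add: HxC_def)
  then show ?thesis by blast
qed

definition lattice_shift :: "(nat \<Rightarrow> 'c::ring_1) \<Rightarrow> (nat \<Rightarrow> int) \<Rightarrow> 'c" where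
  "lattice_shift a m = (\<Sum>i<3. of_int (m i) * a i)"

lemma lattice_shift_add: "lattice_shift a (\<lambda>i. m i + n i) = lattice_shift a m + lattice_shift a n"
  by (simp add: lattice_shift_def sum.distrib distrib_right)

lemma lattice_shift_0 [simp]: "lattice_shift a (\<lambda>_. 0) = 0"
  by (simp add: lattice_shift_def)

lemma lattice_shift_cong: "(\<And>i. i < 3 \<Longrightarrow> m i = n i) \<Longrightarrow> lattice_shift a m = lattice_shift a n"
  by (simp add: lattice_shift_def)

text \<open>The common description of both families: \<open>\<rho>\<close> and \<open>\<theta>\<close> are the factors of the dilation, the
  vectors \<open>(a i, b i)\<close> span the lattice of translations, and \<open>N\<close> is the matrix by which the
  dilation acts on this lattice.\<close>

locale solv_data =
  fixes \<rho> :: real and \<theta> :: complex and a :: "nat \<Rightarrow> real" and b :: "nat \<Rightarrow> complex" and N :: "nat \<Rightarrow> nat \<Rightarrow> int"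
  assumes \<rho>: "0 < \<rho>" "\<rho> \<noteq> 1" and \<theta>: "\<theta> \<noteq> 0"
    and eigen_a: "i < 3 \<Longrightarrow> (\<Sum>j<3. of_int (N i j) * a j) = \<rho> * a i"
    and eigen_b: "i < 3 \<Longrightarrow> (\<Sum>j<3. of_int (N i j) * b j) = \<theta> * b i"
    and det_N: "det3 N = 1"
    and discrete: "\<exists>\<delta>>0. \<forall>m. \<bar>lattice_shift a m\<bar> < \<delta> \<and> norm (lattice_shift b m) < \<delta> \<longrightarrow> (\<forall>i<3. m i = 0)"
begin

definition shift :: "(nat \<Rightarrow> int) \<Rightarrow> complex \<times> complex \<Rightarrow> complex \<times> complex" where
  "shift m = (\<lambda>(w, z). (w + complex_of_real (lattice_shift a m), z + lattice_shift b m))"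

definition scale :: "int \<Rightarrow> complex \<times> complex \<Rightarrow> complex \<times> complex" where
  "scale k = (\<lambda>(w, z). (complex_of_real (\<rho> powi k) * w, \<theta> powi k * z))"

definition \<Gamma> :: "(complex \<times> complex \<Rightarrow> complex \<times> complex) set" where
  "\<Gamma> = {shift m \<circ> scale k | m k. True}"

lemma scale_add: "scale (j + k) = scale j \<circ> scale k"
  using \<rho> \<theta> by (auto simp: scale_def fun_eq_iff power_int_add)

lemma scale_0: "scale 0 = id"
  by (auto simp: scale_def fun_eq_iff)

lemma shift_add: "shift (\<lambda>i. m i + n i) = shift m \<circ> shift n"
  by (auto simp: shift_def fun_eq_iff lattice_shift_add)

lemma shift_0: "shift (\<lambda>_. 0) = id"
  by (auto simp: shift_def fun_eq_iff)

lemma shift_cong: "(\<And>i. i < 3 \<Longrightarrow> m i = n i) \<Longrightarrow> shift m = shift n"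
  unfolding shift_def by (simp cong: lattice_shift_cong)

lemma lattice_shift_N:
  "lattice_shift a (\<lambda>j. \<Sum>i<3. m i * N i j) = \<rho> * lattice_shift a m"
  "lattice_shift b (\<lambda>j. \<Sum>i<3. m i * N i j) = \<theta> * lattice_shift b m"
proof -
  have *: "(\<Sum>j<3. of_int (\<Sum>i<3. m i * N i j) * c j) = (\<Sum>i<3. of_int (m i) * (\<Sum>j<3. of_int (N i j) * c j))"
    for c :: "nat \<Rightarrow> 'c::comm_ring_1"
    by (simp add: sum_lessThan_3 algebra_simps)
  show "lattice_shift a (\<lambda>j. \<Sum>i<3. m i * N i j) = \<rho> * lattice_shift a m"
    unfolding lattice_shift_def * using eigen_a by (simp add: sum_distrib_left mult_ac)
  show "lattice_shift b (\<lambda>j. \<Sum>i<3. m i * N i j) = \<theta> * lattice_shift b m"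
    unfolding lattice_shift_def * using eigen_b by (simp add: sum_distrib_left mult_ac)
qed

lemma scale_shift: "scale 1 \<circ> shift m = shift (\<lambda>j. \<Sum>i<3. m i * N i j) \<circ> scale 1"
  by (simp add: scale_def shift_def fun_eq_iff lattice_shift_N distrib_left)

text \<open>As \<open>det3 N = 1\<close>, \<open>row_lattice_det\<close> puts every integer vector
  into the row lattice of \<open>N\<close>, so \<open>N\<close> can be inverted on
  translations.\<close>

lemma shift_scale: "\<exists>n. shift m \<circ> scale 1 = scale 1 \<circ> shift n"
proof -
  have "(m 0, m 1, m 2) \<in> row_lattice N"
    using row_lattice_det[of N "m 0" "m 1" "m 2"] det_N by simp
  then obtain n where "m 0 = (\<Sum>j<3. n j * N j 0)" "m 1 = (\<Sum>j<3. n j * N j 1)" "m 2 = (\<Sum>j<3. n j * N j 2)"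
    unfolding row_lattice_def by auto
  then have "shift m = shift (\<lambda>j. \<Sum>i<3. n i * N i j)"
    by (intro shift_cong) (auto simp: numeral_3_eq_3 less_Suc_eq numeral_2_eq_2)
  then show ?thesis using scale_shift[of n] by metis
qed

lemma scale_shift_int: "\<exists>n. scale k \<circ> shift m = shift n \<circ> scale k"
proof (induction k arbitrary: m rule: int_induct[of _ 0])
  case base
  show ?case by (intro exI[of _ m]) (simp add: scale_0)
next
  case (step1 k)
  obtain n where n: "scale k \<circ> shift m = shift n \<circ> scale k" using step1(2) by blast
  have "scale (k + 1) \<circ> shift m = scale 1 \<circ> (scale k \<circ> shift m)" by (simp add: scale_add add.commute[of k] comp_assoc)
  also have "\<dots> = (scale 1 \<circ> shift n) \<circ> scale k" by (simp only: n comp_assoc)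
  also have "\<dots> = shift (\<lambda>j. \<Sum>i<3. n i * N i j) \<circ> scale (k + 1)"
    by (simp only: scale_shift comp_assoc scale_add add.commute[of k])
  finally show ?case by blast
next
  case (step2 k)
  obtain n where n: "scale k \<circ> shift m = shift n \<circ> scale k" using step2(2) by blast
  obtain n' where n': "shift n \<circ> scale 1 = scale 1 \<circ> shift n'" using shift_scale by blast
  have inv: "scale (- 1) \<circ> scale 1 = id" "scale 1 \<circ> scale (- 1) = id" by (simp_all flip: scale_add add: scale_0)
  have eq: "scale (k - 1) = scale (- 1) \<circ> scale k" using scale_add[of "- 1" k] by simp
  have "scale (- 1) \<circ> shift n = scale (- 1) \<circ> (shift n \<circ> scale 1) \<circ> scale (- 1)" by (simp only: comp_assoc inv comp_id)
  also have "\<dots> = (scale (- 1) \<circ> scale 1) \<circ> (shift n' \<circ> scale (- 1))" by (simp only: n' comp_assoc)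
  finally have "scale (- 1) \<circ> shift n = shift n' \<circ> scale (- 1)" by (simp only: inv id_comp)
  then have "scale (k - 1) \<circ> shift m = shift n' \<circ> scale (k - 1)" by (metis eq n comp_assoc)
  then show ?case by blast
qed

text \<open>Translations move the first coordinate by a real number, so the imaginary part detects
  the power of the dilation.\<close>

lemma Im_shift_scale: "Im (fst ((shift m \<circ> scale k) x)) = \<rho> powi k * Im (fst x)"
  by (cases x) (simp add: shift_def scale_def del: of_real_power_int)

lemma \<rho>_powi_pos: "0 < \<rho> powi k"
  using \<rho> by simp

lemma ln_\<rho>_powi: "ln (\<rho> powi k) = of_int k * ln \<rho>"
  using \<rho> by (cases k rule: int_cases2) (simp_all add: power_int_minus ln_realpow ln_inverse)

lemma \<Gamma>_maps:
  assumes "g \<in> \<Gamma>" "x \<in> HxC"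
  shows "g x \<in> HxC"
proof -
  obtain m k where g: "g = shift m \<circ> scale k" using assms(1) unfolding \<Gamma>_def by blast
  have "0 < Im (fst (g x))"
    unfolding g Im_shift_scale using assms(2) by (auto simp: HxC_def \<rho>_powi_pos)
  then show ?thesis by (simp add: HxC_def mem_Times_iff)
qed

lemma \<Gamma>_continuous: "g \<in> \<Gamma> \<Longrightarrow> continuous_map (top_of_set HxC) (top_of_set HxC) g"
proof -
  assume g: "g \<in> \<Gamma>"
  then obtain m k where mk: "g = shift m \<circ> scale k" unfolding \<Gamma>_def by blast
  have "g = (\<lambda>x. (complex_of_real (\<rho> powi k) * fst x + complex_of_real (lattice_shift a m),
                    \<theta> powi k * snd x + lattice_shift b m))"
    unfolding mk by (auto simp: shift_def scale_def fun_eq_iff)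
  then have "continuous_on HxC g" by (simp add: continuous_intros)
  then show ?thesis using \<Gamma>_maps[OF g] by (auto simp: continuous_map_in_subtopology)
qed

lemma powi_small:
  assumes "\<bar>ln (\<rho> powi k)\<bar> < \<bar>ln \<rho>\<bar>"
  shows "k = 0"
proof -
  have pos: "0 < \<bar>ln \<rho>\<bar>" using \<rho> by simp
  have "\<bar>real_of_int k\<bar> * \<bar>ln \<rho>\<bar> < 1 * \<bar>ln \<rho>\<bar>" using assms by (simp add: ln_\<rho>_powi abs_mult)
  then have "\<bar>real_of_int k\<bar> < 1" by (simp only: mult_less_cancel_right_pos[OF pos])
  then show ?thesis by linarith
qed

lemma \<Gamma>_discontinuous:
  assumes x: "x \<in> HxC"
  shows "\<exists>U. openin (top_of_set HxC) U \<and> x \<in> U \<and> (\<forall>g\<in>\<Gamma>. g ` U \<inter> U \<noteq> {} \<longrightarrow> g = id)"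
proof -
  obtain \<delta> where \<delta>: "\<delta> > 0"
      "\<forall>m. \<bar>lattice_shift a m\<bar> < \<delta> \<and> norm (lattice_shift b m) < \<delta> \<longrightarrow> (\<forall>i<3. m i = 0)"
    using discrete by blast
  \<comment> \<open>Chosen so that two imaginary parts in \<open>V\<close> have ratio below
    \<open>s ^ 2 = exp \<bar>ln \<rho>\<bar>\<close>, the smallest factor of a nontrivial
    dilation.\<close>
  define s where "s = exp (\<bar>ln \<rho>\<bar> / 2)"
  have s: "s > 1" unfolding s_def using \<rho> by simp
  obtain w z where wz: "x = (w, z)" and w: "0 < Im w" using x by (cases x) (auto simp: HxC_def)
  \<comment> \<open>Radius \<open>\<delta> / 2\<close> makes any translation between two points of
    \<open>V\<close> shorter than \<open>\<delta>\<close> in both coordinates, so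
    \<open>discrete\<close> applies once the dilation is trivial.\<close>
  define V where "V = {y. Im w / s < Im (fst y) \<and> Im (fst y) < Im w * s \<and>
     \<bar>Re (fst y) - Re w\<bar> < \<delta> / 2 \<and> norm (snd y - z) < \<delta> / 2}"
  have "open V" unfolding V_def
    by (intro open_Collect_conj open_Collect_less continuous_intros)
  then have op: "openin (top_of_set HxC) (HxC \<inter> V)" by (simp add: openin_open_Int)
  have xV: "x \<in> HxC \<inter> V" using x \<delta>(1) w s by (simp add: V_def wz field_simps)
  have "g = id" if g: "g \<in> \<Gamma>" and meet: "g ` (HxC \<inter> V) \<inter> (HxC \<inter> V) \<noteq> {}" for g
  proof -
    obtain y where y: "y \<in> HxC" "y \<in> V" "g y \<in> V" "g y \<in> HxC" using meet by blast
    obtain m k where mk: "g = shift m \<circ> scale k" using g unfolding \<Gamma>_def by blast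
    have lnV: "\<bar>ln (Im (fst y)) - ln (Im w)\<bar> < \<bar>ln \<rho>\<bar> / 2" if "y \<in> V" "y \<in> HxC" for y
    proof -
      have pos: "0 < Im (fst y)" using that by (auto simp: HxC_def)
      have "ln (Im w / s) < ln (Im (fst y))" "ln (Im (fst y)) < ln (Im w * s)"
        using that w s pos by (auto simp: V_def)
      then have "ln (Im w) - \<bar>ln \<rho>\<bar> / 2 < ln (Im (fst y))" "ln (Im (fst y)) < ln (Im w) + \<bar>ln \<rho>\<bar> / 2"
        using w s by (simp_all add: ln_div ln_mult s_def)
      then show ?thesis by linarith
    qed
    have pos: "0 < Im (fst y)" using y by (auto simp: HxC_def)
    have "ln (Im (fst (g y))) = ln (\<rho> powi k) + ln (Im (fst y))"
      unfolding mk Im_shift_scale by (rule ln_mult_pos[OF \<rho>_powi_pos pos])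
    then have k: "\<bar>ln (\<rho> powi k)\<bar> < \<bar>ln \<rho>\<bar>"
      using lnV[OF y(2,1)] lnV[OF y(3,4)] by linarith
    have k0: "k = 0" by (rule powi_small[OF k])
    have gy: "fst (g y) = fst y + complex_of_real (lattice_shift a m)" "snd (g y) = snd y + lattice_shift b m"
      unfolding mk k0 scale_0 by (cases y, simp add: shift_def)+
    have "\<bar>lattice_shift a m\<bar> < \<delta>" proof -
      have "\<bar>Re (fst y) - Re w\<bar> < \<delta> / 2" "\<bar>Re (fst y) + lattice_shift a m - Re w\<bar> < \<delta> / 2"
        using y(2,3) gy(1) unfolding V_def by simp_all
      then show ?thesis by linarith
    qed
    moreover have "norm (lattice_shift b m) < \<delta>"
    proof -
      have "lattice_shift b m = (snd (g y) - z) - (snd y - z)" using gy(2) by simp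
      then have "norm (lattice_shift b m) \<le> norm (snd (g y) - z) + norm (snd y - z)" by (metis norm_triangle_ineq4)
      then show ?thesis using y(2,3) unfolding V_def by simp
    qed
    ultimately have "\<forall>i<3. m i = 0" using \<delta>(2) by simp
    then have "shift m = id" using shift_cong[of m "\<lambda>_. 0"] shift_0 by simp
    then show ?thesis by (simp add: mk k0 scale_0)
  qed
  then show ?thesis using op xV by blast
qed

lemma \<Gamma>_free:
  assumes g: "g \<in> \<Gamma>" and x: "x \<in> HxC" and fix_x: "g x = x"
  shows "g = id"
proof -
  obtain U where "x \<in> U \<and> (\<forall>g\<in>\<Gamma>. g ` U \<inter> U \<noteq> {} \<longrightarrow> g = id)" using \<Gamma>_discontinuous[OF x] by blast
  then show ?thesis using g fix_x by (metis IntI empty_iff imageI)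
qed

lemma shift_\<Gamma>: "shift m \<in> \<Gamma>"
  unfolding \<Gamma>_def using scale_0 by (metis (mono_tags, lifting) comp_id mem_Collect_eq)

lemma scale_\<Gamma>: "scale k \<in> \<Gamma>"
  unfolding \<Gamma>_def using shift_0 by (metis (mono_tags, lifting) id_comp mem_Collect_eq)

lemma \<Gamma>_comp: "g \<in> \<Gamma> \<Longrightarrow> h \<in> \<Gamma> \<Longrightarrow> g \<circ> h \<in> \<Gamma>"
proof -
  assume "g \<in> \<Gamma>" "h \<in> \<Gamma>"
  then obtain m k n l where gh: "g = shift m \<circ> scale k" "h = shift n \<circ> scale l" unfolding \<Gamma>_def by blast
  obtain n' where n': "scale k \<circ> shift n = shift n' \<circ> scale k" using scale_shift_int by blast
  have "g \<circ> h = shift m \<circ> (scale k \<circ> shift n) \<circ> scale l" by (simp only: gh comp_assoc)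
  also have "\<dots> = shift (\<lambda>i. m i + n' i) \<circ> scale (k + l)" by (simp only: n' comp_assoc shift_add scale_add)
  finally show ?thesis unfolding \<Gamma>_def by blast
qed

lemma \<Gamma>_inv: "g \<in> \<Gamma> \<Longrightarrow> \<exists>h\<in>\<Gamma>. h \<circ> g = id \<and> g \<circ> h = id"
proof -
  assume "g \<in> \<Gamma>"
  then obtain m k where g: "g = shift m \<circ> scale k" unfolding \<Gamma>_def by blast
  have s: "shift (\<lambda>i. - m i) \<circ> shift m = id" "shift m \<circ> shift (\<lambda>i. - m i) = id"
    "scale (- k) \<circ> scale k = id" "scale k \<circ> scale (- k) = id"
    by (simp_all flip: shift_add scale_add add: shift_0 scale_0)
  let ?h = "scale (- k) \<circ> shift (\<lambda>i. - m i)"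
  have "?h \<circ> g = scale (- k) \<circ> (shift (\<lambda>i. - m i) \<circ> shift m) \<circ> scale k" by (simp only: g comp_assoc)
  then have 1: "?h \<circ> g = id" by (simp only: s comp_id)
  have "g \<circ> ?h = shift m \<circ> (scale k \<circ> scale (- k)) \<circ> shift (\<lambda>i. - m i)" by (simp only: g comp_assoc)
  then have 2: "g \<circ> ?h = id" by (simp only: s comp_id)
  show ?thesis using 1 2 \<Gamma>_comp[OF scale_\<Gamma> shift_\<Gamma>] by blast
qed

sublocale F: free_action "top_of_set HxC" \<Gamma>
proof
  show "id \<in> \<Gamma>" using shift_\<Gamma>[of "\<lambda>_. 0"] by (simp add: shift_0)
qed (use \<Gamma>_comp \<Gamma>_inv \<Gamma>_continuous \<Gamma>_free topspace_euclidean_subtopology[of HxC] in blast)+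

lemma shift_fixes:
  assumes x: "x \<in> HxC" and fix_x: "shift m x = x" and "i < 3"
  shows "m i = 0"
proof -
  have "lattice_shift a m = 0 \<and> lattice_shift b m = 0"
    using fix_x by (cases x) (simp add: shift_def)
  then show ?thesis using discrete assms(3) by fastforce
qed

sublocale torus_action "top_of_set HxC" shift
proof
  show "continuous_map (top_of_set HxC) (top_of_set HxC) (shift m)" for m
    by (rule \<Gamma>_continuous[OF shift_\<Gamma>])
  show "m i = 0" if "x \<in> topspace (top_of_set HxC)" "shift m x = x" "i < 3" for x m i
    using shift_fixes that by simp
  show "shift m = shift n" if "\<And>i. i < 3 \<Longrightarrow> m i = n i" for m n
    by (rule shift_cong) (rule that)
qed (rule acyclic_HxC shift_add shift_0)+

lemma lattice_3: "lattice 3 = range shift"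
  using \<tau>_lattice by (auto simp: lattice_def)

lemma scale_pow: "scale 1 ^^ n = scale (int n)"
proof (induction n)
  case 0
  show ?case by (simp add: funpow.simps(1) scale_0 del: id_apply)
next
  case (Suc n)
  then show ?case by (simp only: funpow.simps of_nat_Suc scale_add)
qed

sublocale torus_extension "top_of_set HxC" shift \<Gamma> "scale 1" N
proof (intro torus_extension.intro cyclic_extension.intro cyclic_extension_axioms.intro torus_extension_axioms.intro)
  show "torus_action (top_of_set HxC) shift" by (rule torus_action_axioms)
  show "free_action (top_of_set HxC) (lattice 3)" by (rule free_lattice)
  show "free_action (top_of_set HxC) \<Gamma>" by (rule F.free_action_axioms)
  show "lattice 3 \<subseteq> \<Gamma>" using lattice_3 shift_\<Gamma> by auto
  show "scale 1 \<in> \<Gamma>" by (rule scale_\<Gamma>)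
  show "\<exists>g'\<in>lattice 3. scale 1 \<circ> g = g' \<circ> scale 1" if "g \<in> lattice 3" for g
    using that scale_shift unfolding lattice_3 by auto
  show "\<exists>g'\<in>lattice 3. g \<circ> scale 1 = scale 1 \<circ> g'" if "g \<in> lattice 3" for g
    using that shift_scale unfolding lattice_3 by auto
  show "scale 1 ^^ k \<notin> lattice 3" if "0 < k" for k
  proof
    assume "scale 1 ^^ k \<in> lattice 3"
    then obtain m where m: "scale (int k) = shift m" unfolding lattice_3 scale_pow by blast
    have "\<rho> powi int k * Im (fst (\<i>, 0)) = Im (fst (shift m (\<i>, 0)))"
      unfolding m[symmetric] by (simp add: scale_def)
    then have "\<rho> ^ k = 1" by (simp add: shift_def)
    then have "int k = 0" by (intro powi_small) (use \<rho> in simp)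
    then show False using that by simp
  qed
  show "\<exists>g\<in>lattice 3. \<exists>k. \<gamma> = g \<circ> scale 1 ^^ k \<or> scale 1 ^^ k \<circ> \<gamma> = g" if \<gamma>: "\<gamma> \<in> \<Gamma>" for \<gamma>
  proof -
    obtain m k where mk: "\<gamma> = shift m \<circ> scale k" using \<gamma> unfolding \<Gamma>_def by blast
    show ?thesis
    proof (cases k rule: int_cases2)
      case (nonneg n)
      then have "\<gamma> = shift m \<circ> scale 1 ^^ n" by (simp add: mk scale_pow)
      then show ?thesis unfolding lattice_3 by blast
    next
      case (nonpos n)
      obtain n' where n': "scale (int n) \<circ> shift m = shift n' \<circ> scale (int n)" using scale_shift_int by blast
      have "scale 1 ^^ n \<circ> \<gamma> = shift n' \<circ> (scale (int n) \<circ> scale k)"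
        unfolding mk scale_pow comp_assoc[symmetric] n' ..
      also have "\<dots> = shift n'" using nonpos by (simp flip: scale_add add: scale_0)
      finally show ?thesis unfolding lattice_3 by blast
    qed
  qed
  show "scale 1 \<circ> shift m = shift (\<lambda>j. \<Sum>i<3. m i * N i j) \<circ> scale 1" for m by (rule scale_shift)
qed

lemma \<Gamma>_orbit: "(\<exists>g\<in>\<Gamma>. y = g x) \<longleftrightarrow> (\<exists>k m. y = shift m (scale k x))"
proof
  assume "\<exists>g\<in>\<Gamma>. y = g x"
  then obtain m k where "y = (shift m \<circ> scale k) x" unfolding \<Gamma>_def by blast
  then show "\<exists>k m. y = shift m (scale k x)" by (intro exI[of _ k] exI[of _ m]) simp
next
  assume "\<exists>k m. y = shift m (scale k x)"
  then obtain k m where "y = (shift m \<circ> scale k) x" by auto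
  then show "\<exists>g\<in>\<Gamma>. y = g x" unfolding \<Gamma>_def by blast
qed

theorem torsion_homology_orbit_space:
  fixes X :: "'b topology"
  assumes quotient: "quotient_map (top_of_set HxC) X p"
    and fibres: "\<And>x y. x \<in> HxC \<Longrightarrow> y \<in> HxC \<Longrightarrow> p x = p y \<longleftrightarrow> (\<exists>k m. y = shift m (scale k x))"
    and det: "det3 (\<lambda>j i. N j i - (if i = j then 1 else 0)) \<noteq> 0" and r: "0 \<le> r"
  shows "finite (torsion_part (homology_group r X))"
    and "torsion_order r X =
      (if r = 1 \<or> r = 2 then nat \<bar>det3 (\<lambda>j i. N j i - (if i = j then 1 else 0))\<bar> else 1)"
proof -
  interpret torus_cover "top_of_set HxC" shift \<Gamma> "scale 1" N X p
  proof (intro torus_cover.intro torus_extension_axioms covering_action.intro F.free_action_axioms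
      covering_action_axioms.intro torus_cover_axioms.intro)
    show "p x = p y \<longleftrightarrow> (\<exists>g\<in>\<Gamma>. y = g x)"
      if "x \<in> topspace (top_of_set HxC)" "y \<in> topspace (top_of_set HxC)" for x y
      unfolding \<Gamma>_orbit by (rule fibres) (use that in simp_all)
  qed (use \<Gamma>_discontinuous quotient HxC_nonempty det_N in auto)
  show "finite (torsion_part (homology_group r X))"
    "torsion_order r X = (if r = 1 \<or> r = 2 then nat \<bar>det3 (\<lambda>j i. N j i - (if i = j then 1 else 0))\<bar> else 1)"
    by (rule torsion_homology[OF det r])+
qed

end

section \<open>Spectral data and growth\<close>

text \<open>The adjugate: multiplying a row vector by \<open>C\<close> and then by
  \<open>adj3 C\<close> scales it by \<open>det3 C\<close>, as \<open>mult_adj3\<close>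
  states.\<close>

definition adj3 :: "(nat \<Rightarrow> nat \<Rightarrow> 'b::comm_ring_1) \<Rightarrow> nat \<Rightarrow> nat \<Rightarrow> 'b" where
  "adj3 C k j =
     (if j = 0 then (if k = 0 then minor2 C 2 1 2 1 else if k = 1 then - minor2 C 2 1 2 0 else minor2 C 2 1 1 0)
      else if j = 1 then (if k = 0 then - minor2 C 2 0 2 1 else if k = 1 then minor2 C 2 0 2 0 else - minor2 C 2 0 1 0)
      else (if k = 0 then minor2 C 1 0 2 1 else if k = 1 then - minor2 C 1 0 2 0 else minor2 C 1 0 1 0))"

lemma less_3_iff: "i < 3 \<longleftrightarrow> i = 0 \<or> i = Suc 0 \<or> i = (2::nat)"
  by auto

lemma mult_adj3:
  "i < 3 \<Longrightarrow> (\<Sum>s<3. (\<Sum>j<3. m j * C j s) * adj3 C s i) = m i * det3 (C :: nat \<Rightarrow> nat \<Rightarrow> 'b::comm_ring_1)"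
  unfolding less_3_iff
  by (elim disjE) (simp_all add: sum_lessThan_3 adj3_def det3_def minor2_def numeral_2_eq_2 algebra_simps)

text \<open>The columns of \<open>P\<close> are eigenvectors, so \<open>N\<close> times
  \<open>P\<close> is \<open>P\<close> times a diagonal matrix; determinants are compared and
  \<open>det3 P\<close> is cancelled.\<close>

lemma det3_eigen:
  fixes N P :: "nat \<Rightarrow> nat \<Rightarrow> 'b::idom"
  assumes "\<And>i s. i < 3 \<Longrightarrow> s < 3 \<Longrightarrow> (\<Sum>j<3. N i j * P j s) = d s * P i s" and "det3 P \<noteq> 0"
  shows "det3 N = d 0 * d 1 * d 2"
proof -
  have "det3 N * det3 P = det3 (\<lambda>i s. \<Sum>j<3. N i j * P j s)" by (simp add: det3_mult)
  also have "\<dots> = det3 (\<lambda>i s. d s * P i s)"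
    using assms(1) by (simp add: det3_def minor2_def)
  also have "\<dots> = d 0 * d 1 * d 2 * det3 P"
    by (simp add: det3_def minor2_def algebra_simps)
  finally show ?thesis using assms(2) by simp
qed

lemma det_3_conv_det3:
  assumes A: "A \<in> carrier_mat 3 3"
  shows "Determinant.det A = det3 (\<lambda>i j. A $$ (i, j))"
proof -
  have d2: "Determinant.det B = B $$ (0, 0) * B $$ (1, 1) - B $$ (0, 1) * B $$ (1, 0)" if "B \<in> carrier_mat 2 2" for B :: "'a mat"
  proof -
    have "Determinant.det B = (\<Sum>j<2. B $$ (0, j) * cofactor B 0 j)"
      by (rule laplace_expansion_row[OF that]) simp
    also have "\<dots> = B $$ (0, 0) * B $$ (1, 1) - B $$ (0, 1) * B $$ (1, 0)"
      using that by (simp add: numeral_2_eq_2 cofactor_def mat_delete_def det_single)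
    finally show ?thesis .
  qed
  have "Determinant.det A = (\<Sum>j<3. A $$ (0, j) * cofactor A 0 j)"
    by (rule laplace_expansion_row[OF A]) simp
  also have "\<dots> = det3 (\<lambda>i j. A $$ (i, j))"
    using A by (simp add: sum_lessThan_3 cofactor_def d2 mat_delete_def det3_def minor2_def numeral_2_eq_2 algebra_simps)
  finally show ?thesis .
qed

lemma det3_eq_0_kernel:
  fixes P :: "nat \<Rightarrow> nat \<Rightarrow> 'b::field"
  assumes "det3 P = 0"
  shows "\<exists>c. (\<exists>s<3. c s \<noteq> 0) \<and> (\<forall>i<3. (\<Sum>s<3. P i s * c s) = 0)"
proof -
  let ?A = "Matrix.mat 3 3 (\<lambda>(i, j). P i j)"
  have A: "?A \<in> carrier_mat 3 3" by simp
  have "Determinant.det ?A = 0"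
    using assms unfolding det_3_conv_det3[OF A] by (simp add: det3_def minor2_def)
  then obtain v where v: "v \<in> carrier_vec 3" "v \<noteq> 0\<^sub>v 3" "?A *\<^sub>v v = 0\<^sub>v 3"
    using det_0_iff_vec_prod_zero_field[OF A] by blast
  have "\<exists>s<3. v $ s \<noteq> 0" using v(1,2) by (metis carrier_vecD eq_vecI index_zero_vec(1,2))
  moreover have "(\<Sum>s<3. P i s * v $ s) = 0" if "i < 3" for i
  proof -
    have "(?A *\<^sub>v v) $ i = 0" using v(3) that by simp
    then show ?thesis using that v(1) by (simp add: scalar_prod_def lessThan_atLeast0)
  qed
  ultimately show ?thesis by (intro exI[of _ "\<lambda>s. v $ s"]) blast
qed

lemma eigenvectors_independent:
  fixes P :: "nat \<Rightarrow> nat \<Rightarrow> 'b::field"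
  assumes eig: "\<And>i s. i < 3 \<Longrightarrow> s < 3 \<Longrightarrow> (\<Sum>j<3. N i j * P j s) = d s * P i s"
    and nz: "\<And>s. s < 3 \<Longrightarrow> \<exists>i<3. P i s \<noteq> 0"
    and dist: "d 0 \<noteq> d 1" "d 0 \<noteq> d 2" "d 1 \<noteq> d 2"
  shows "det3 P \<noteq> 0"
proof
  assume "det3 P = 0"
  then obtain c where c: "\<exists>s<3. c s \<noteq> 0" and ker: "\<And>i. i < 3 \<Longrightarrow> (\<Sum>s<3. P i s * c s) = 0"
    using det3_eq_0_kernel by metis
  have step: "(\<Sum>s<3. d s * (P i s * e s)) = 0" if e: "\<And>i. i < 3 \<Longrightarrow> (\<Sum>s<3. P i s * e s) = 0" and "i < 3" for e i
  proof -
    have "(\<Sum>s<3. d s * (P i s * e s)) = (\<Sum>s<3. (\<Sum>j<3. N i j * P j s) * e s)"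
      using eig[OF \<open>i < 3\<close>] by (intro sum.cong) (auto simp: mult.assoc)
    also have "\<dots> = (\<Sum>j<3. N i j * (\<Sum>s<3. P j s * e s))"
      by (simp add: sum_lessThan_3 algebra_simps)
    also have "\<dots> = 0" using e by simp
    finally show ?thesis .
  qed
  have 1: "(\<Sum>s<3. d s * (P i s * c s)) = 0" if "i < 3" for i by (rule step[OF ker that])
  have 2: "(\<Sum>s<3. d s * (P i s * (d s * c s))) = 0" if "i < 3" for i
    by (rule step[OF _ that]) (use 1 in \<open>simp add: mult.left_commute\<close>)
  \<comment> \<open>A Vandermonde elimination: combining the relation with its images under
    \<open>N\<close> and \<open>N ^ 2\<close> amounts to applying the product of
    \<open>N - v\<close> and \<open>N - w\<close>, which isolates the component for
    \<open>u\<close>.\<close>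
  have vander: "x = 0 \<and> y = 0 \<and> z = 0"
    if "x + y + z = 0" "u * x + v * y + w * z = 0" "u * (u * x) + v * (v * y) + w * (w * z) = 0"
      "u \<noteq> v" "u \<noteq> w" "v \<noteq> w" for x y z u v w :: 'b
  proof -
    have "(u - v) * (u - w) * x =
        (u * (u * x) + v * (v * y) + w * (w * z)) - (v + w) * (u * x + v * y + w * z) + v * w * (x + y + z)"
      by (simp add: algebra_simps)
    then have 1: "(u - v) * (u - w) * x = 0" unfolding that(1-3) by simp
    have "(v - u) * (v - w) * y =
        (u * (u * x) + v * (v * y) + w * (w * z)) - (u + w) * (u * x + v * y + w * z) + u * w * (x + y + z)"
      by (simp add: algebra_simps)
    then have 2: "(v - u) * (v - w) * y = 0" unfolding that(1-3) by simp
    have "(w - u) * (w - v) * z =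
        (u * (u * x) + v * (v * y) + w * (w * z)) - (u + v) * (u * x + v * y + w * z) + u * v * (x + y + z)"
      by (simp add: algebra_simps)
    then have 3: "(w - u) * (w - v) * z = 0" unfolding that(1-3) by simp
    show ?thesis using 1 2 3 that(4-6) by simp
  qed
  have "P i s * c s = 0" if i: "i < 3" and s: "s < 3" for i s
  proof -
    have "P i 0 * c 0 = 0 \<and> P i 1 * c 1 = 0 \<and> P i 2 * c 2 = 0"
      by (rule vander[of _ _ _ "d 0" "d 1" "d 2"])
        (use ker[OF i] 1[OF i] 2[OF i] dist in \<open>simp_all add: sum_lessThan_3 numeral_2_eq_2 mult.left_commute\<close>)
    then show ?thesis using s unfolding less_3_iff by auto
  qed
  note prod0 = this
  obtain s where s: "s < 3" "c s \<noteq> 0" using c by blast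
  obtain i where i: "i < 3" "P i s \<noteq> 0" using nz[OF s(1)] by blast
  show False using prod0[OF i(1) s(1)] i s by simp
qed

section \<open>Powers of the integer matrix and the growth of
  \<open>det3 (mpow M n - 1)\<close>\<close>

fun mpow :: "(nat \<Rightarrow> nat \<Rightarrow> int) \<Rightarrow> nat \<Rightarrow> nat \<Rightarrow> nat \<Rightarrow> int" where
  "mpow M 0 = (\<lambda>i j. if i = j then 1 else 0)"
| "mpow M (Suc n) = (\<lambda>i k. \<Sum>j<3. mpow M n i j * M j k)"

lemma det3_mpow: "det3 (mpow M n) = det3 M ^ n"
proof (induction n)
  case 0
  show ?case by (simp add: det3_def minor2_def)
next
  case (Suc n)
  then show ?case using det3_mult[of "mpow M n" M] by (simp add: mult.commute)
qed

lemma mpow_eigen: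
  fixes a :: "nat \<Rightarrow> 'b::comm_ring_1"
  assumes eig: "\<And>i. i < 3 \<Longrightarrow> (\<Sum>j<3. of_int (M i j) * a j) = d * a i" and "i < 3"
  shows "(\<Sum>j<3. of_int (mpow M n i j) * a j) = d ^ n * a i"
  using assms(2)
proof (induction n arbitrary: i)
  case 0
  then show ?case unfolding less_3_iff by (elim disjE) (simp_all add: sum_lessThan_3 numeral_2_eq_2)
next
  case (Suc n)
  have "(\<Sum>k<3. of_int (mpow M (Suc n) i k) * a k) = (\<Sum>j<3. of_int (mpow M n i j) * (\<Sum>k<3. of_int (M j k) * a k))"
    by (simp add: sum_lessThan_3 algebra_simps)
  also have "\<dots> = d * (\<Sum>j<3. of_int (mpow M n i j) * a j)"
    using eig by (simp add: sum_distrib_left mult_ac)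
  finally show ?case using Suc by (simp add: mult.assoc)
qed

lemma of_int_det3: "of_int (det3 N) = det3 (\<lambda>i j. of_int (N i j) :: 'b::comm_ring_1)"
  by (simp add: det3_def minor2_def)

text \<open>Inside the unit circle \<open>z ^ n - 1\<close> tends to -1; outside, factoring out
  \<open>z ^ n\<close> reduces to the inverse of \<open>z\<close>. Avoiding the circle keeps
  \<open>z ^ n\<close> away from 1 eventually.\<close>

lemma tendsto_ln_norm_power_minus_1:
  fixes z :: complex
  assumes "norm z \<noteq> 1" "z \<noteq> 0"
  shows "(\<lambda>n. ln (norm (z ^ n - 1)) / real n) \<longlonglongrightarrow> max 0 (ln (norm z))"
proof -
  have small: "(\<lambda>n. ln (norm (y ^ n - 1))) \<longlonglongrightarrow> 0" if "norm y < 1" for y :: complex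
  proof -
    have "(\<lambda>n. norm (y ^ n - 1)) \<longlonglongrightarrow> norm (0 - 1 :: complex)"
      by (intro tendsto_norm tendsto_diff LIMSEQ_power_zero that tendsto_const)
    from tendsto_ln[OF this] show ?thesis by simp
  qed
  have inv: "(\<lambda>n. 1 / real n) \<longlonglongrightarrow> 0" by (rule lim_const_over_n)
  show ?thesis
  proof (cases "norm z < 1")
    case True
    then have "max 0 (ln (norm z)) = 0" using assms(2) by simp
    moreover have "(\<lambda>n. ln (norm (z ^ n - 1)) * (1 / real n)) \<longlonglongrightarrow> 0 * 0"
      by (intro tendsto_mult small[OF True] inv)
    ultimately show ?thesis by simp
  next
    case False
    then have gt: "norm z > 1" using assms(1) by simp
    have "(\<lambda>n. ln (norm z) + ln (norm (inverse z ^ n - 1)) * (1 / real n)) \<longlonglongrightarrow> ln (norm z) + 0 * 0"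
      by (intro tendsto_add tendsto_mult tendsto_const small inv) (use gt in \<open>simp add: norm_inverse inverse_less_1_iff\<close>)
    moreover have "eventually (\<lambda>n. ln (norm z) + ln (norm (inverse z ^ n - 1)) * (1 / real n) = ln (norm (z ^ n - 1)) / real n) sequentially"
      using eventually_gt_at_top[of 0]
    proof eventually_elim
      case (elim n)
      have "z ^ n - 1 = - (z ^ n * (inverse z ^ n - 1))"
        using assms(2) by (simp add: algebra_simps flip: power_mult_distrib)
      then have eq: "norm (z ^ n - 1) = norm z ^ n * norm (inverse z ^ n - 1)"
        by (simp add: norm_mult norm_power)
      have "norm z ^ n \<noteq> 1" using gt elim by (metis one_less_power less_irrefl)
      then have "z ^ n \<noteq> 1" by (metis norm_one norm_power)
      then have "norm (inverse z ^ n - 1) > 0" using assms(2) by (simp add: power_inverse)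
      moreover have "0 < norm z ^ n" using gt by (intro zero_less_power) linarith
      ultimately have "ln (norm (z ^ n - 1)) = real n * ln (norm z) + ln (norm (inverse z ^ n - 1))"
        unfolding eq using gt by (subst ln_mult_pos) (simp_all add: ln_realpow)
      then show ?case using elim by (simp add: add_divide_distrib)
    qed
    ultimately show ?thesis using gt by (simp add: tendsto_cong)
  qed
qed

text \<open>Only \<open>\<alpha> \<noteq> 1\<close> is required beside positivity: a generator of
  \<open>U\<close> may have real embedding below 1, whereas an Inoue surface has
  \<open>\<alpha> > 1\<close>.\<close>

locale spectral_data =
  fixes M :: "nat \<Rightarrow> nat \<Rightarrow> int" and \<alpha> :: real and \<beta> :: complex and a :: "nat \<Rightarrow> real" and b :: "nat \<Rightarrow> complex"
  assumes \<alpha>: "0 < \<alpha>" "\<alpha> \<noteq> 1" and \<beta>: "\<beta> \<notin> \<real>"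
    and eig_a: "i < 3 \<Longrightarrow> (\<Sum>j<3. of_int (M i j) * a j) = \<alpha> * a i"
    and eig_b: "i < 3 \<Longrightarrow> (\<Sum>j<3. of_int (M i j) * b j) = \<beta> * b i"
    and nz_a: "\<exists>i<3. a i \<noteq> 0" and nz_b: "\<exists>i<3. b i \<noteq> 0"
    and det_M: "det3 M = 1"
begin

definition Pm :: "nat \<Rightarrow> nat \<Rightarrow> complex" where
  "Pm j s = (if s = 0 then complex_of_real (a j) else if s = 1 then b j else cnj (b j))"

definition spec :: "nat \<Rightarrow> complex" where
  "spec s = (if s = 0 then complex_of_real \<alpha> else if s = 1 then \<beta> else cnj \<beta>)"

lemma Pm_eigen:
  assumes "i < 3" "s < 3"
  shows "(\<Sum>j<3. of_int (M i j) * Pm j s) = spec s * Pm i s"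
proof -
  have "(\<Sum>j<3. of_int (M i j) * complex_of_real (a j)) = complex_of_real (\<Sum>j<3. of_int (M i j) * a j)" by simp
  also have "\<dots> = complex_of_real \<alpha> * complex_of_real (a i)" unfolding eig_a[OF assms(1)] by simp
  finally have 0: "(\<Sum>j<3. of_int (M i j) * complex_of_real (a j)) = complex_of_real \<alpha> * complex_of_real (a i)" .
  have "(\<Sum>j<3. of_int (M i j) * cnj (b j)) = cnj (\<Sum>j<3. of_int (M i j) * b j)" by simp
  then have 2: "(\<Sum>j<3. of_int (M i j) * cnj (b j)) = cnj \<beta> * cnj (b i)" unfolding eig_b[OF assms(1)] by simp
  show ?thesis
    using assms(2) 0 2 eig_b[OF assms(1)] unfolding less_3_iff by (elim disjE) (simp_all add: Pm_def spec_def)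
qed

lemma \<beta>_cnj: "\<beta> \<noteq> cnj \<beta>" "complex_of_real \<alpha> \<noteq> \<beta>" "complex_of_real \<alpha> \<noteq> cnj \<beta>"
proof -
  show "\<beta> \<noteq> cnj \<beta>" using \<beta> by (metis Reals_cnj_iff)
  show "complex_of_real \<alpha> \<noteq> \<beta>" using \<beta> by auto
  show "complex_of_real \<alpha> \<noteq> cnj \<beta>" using \<beta> by (metis Reals_of_real complex_cnj_cnj complex_cnj_complex_of_real)
qed

lemma det_Pm: "det3 Pm \<noteq> 0"
proof -
  have nz: "\<exists>i<3. Pm i s \<noteq> 0" for s
  proof -
    obtain i j where "i < 3" "a i \<noteq> 0" "j < 3" "b j \<noteq> 0" using nz_a nz_b by blast
    then show ?thesis
      by (cases "s = 0") (auto simp: Pm_def intro: exI[of _ i] exI[of _ j])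
  qed
  have dist: "spec 0 \<noteq> spec 1" "spec 0 \<noteq> spec 2" "spec 1 \<noteq> spec 2" by (simp_all add: spec_def \<beta>_cnj)
  show ?thesis
    by (rule eigenvectors_independent[where N = "\<lambda>i j. of_int (M i j)" and d = spec, OF _ nz dist]) (rule Pm_eigen)
qed

text \<open>The determinant 1 is the product of \<open>\<alpha>\<close>, \<open>\<beta>\<close> and
  \<open>cnj \<beta>\<close>; hence \<open>\<alpha> \<noteq> 1\<close> keeps \<open>\<beta>\<close>
  off the unit circle.\<close>

lemma norm_\<beta>: "\<alpha> * norm \<beta> ^ 2 = 1"
proof -
  have "complex_of_int (det3 M) = complex_of_real \<alpha> * \<beta> * cnj \<beta>"
    unfolding of_int_det3 using det3_eigen[OF Pm_eigen det_Pm] by (simp add: spec_def)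
  then have "complex_of_real (\<alpha> * norm \<beta> ^ 2) = complex_of_real 1"
    using complex_norm_square[of \<beta>] by (simp add: det_M mult.assoc)
  then show ?thesis by (simp only: of_real_eq_iff)
qed

lemma \<beta>_nz: "\<beta> \<noteq> 0"
  using \<beta> Reals_0 by metis

lemma norm_\<beta>_neq: "norm \<beta> \<noteq> 1"
proof
  assume "norm \<beta> = 1"
  then show False using norm_\<beta> \<alpha>(2) by simp
qed

lemma \<alpha>_pow_neq:
  assumes "0 < n"
  shows "\<alpha> ^ n \<noteq> 1"
proof
  assume "\<alpha> ^ n = 1"
  then have "\<alpha> ^ n = 1 ^ n" by simp
  then have "\<alpha> = 1" by (rule power_eq_imp_eq_base) (use assms \<alpha>(1) in simp_all)
  then show False using \<alpha>(2) by simp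
qed

text \<open>The eigenvectors of \<open>M\<close> diagonalize \<open>mpow M n\<close> minus the
  identity as well, with eigenvalues \<open>spec s ^ n - 1\<close>.\<close>

lemma det_mpow_minus_1:
  "real_of_int (det3 (\<lambda>i j. mpow M n i j - (if j = i then 1 else 0))) = (\<alpha> ^ n - 1) * norm (\<beta> ^ n - 1) ^ 2"
proof -
  let ?B = "\<lambda>i j. mpow M n i j - (if j = i then 1 else 0)"
  have "(\<Sum>j<3. complex_of_int (?B i j) * Pm j s) = (spec s ^ n - 1) * Pm i s" if i: "i < 3" and s: "s < 3" for i s
  proof -
    have "(\<Sum>j<3. complex_of_int (?B i j) * Pm j s) =
       (\<Sum>j<3. complex_of_int (mpow M n i j) * Pm j s) - (\<Sum>j<3. (if j = i then 1 else 0) * Pm j s)"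
      unfolding sum_subtractf[symmetric] by (intro sum.cong) (auto simp: algebra_simps)
    also have "(\<Sum>j<3. (if j = i then 1 else 0) * Pm j s) = Pm i s"
      using i unfolding less_3_iff by (elim disjE) (simp_all add: sum_lessThan_3 numeral_2_eq_2)
    finally show ?thesis using mpow_eigen[OF Pm_eigen[OF _ s] i, of n] by (simp add: algebra_simps)
  qed
  then have "complex_of_int (det3 ?B) = (spec 0 ^ n - 1) * (spec 1 ^ n - 1) * (spec 2 ^ n - 1)"
    unfolding of_int_det3 by (rule det3_eigen[OF _ det_Pm])
  also have "\<dots> = complex_of_real (\<alpha> ^ n - 1) * ((\<beta> ^ n - 1) * cnj (\<beta> ^ n - 1))"
    by (simp add: spec_def mult.assoc)
  also have "\<dots> = complex_of_real ((\<alpha> ^ n - 1) * norm (\<beta> ^ n - 1) ^ 2)"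
    using complex_norm_square[of "\<beta> ^ n - 1"] by simp
  finally have "complex_of_real (real_of_int (det3 ?B)) = complex_of_real ((\<alpha> ^ n - 1) * norm (\<beta> ^ n - 1) ^ 2)" by simp
  then show ?thesis by (simp only: of_real_eq_iff)
qed

lemma \<beta>_pow_neq: "0 < n \<Longrightarrow> \<beta> ^ n \<noteq> 1"
proof
  assume n: "0 < n" and "\<beta> ^ n = 1"
  then have "norm \<beta> ^ n = 1" by (metis norm_one norm_power)
  then have "norm \<beta> ^ n = 1 ^ n" by simp
  then have "norm \<beta> = 1" by (rule power_eq_imp_eq_base) (use n in simp_all)
  then show False using norm_\<beta>_neq by simp
qed

lemma discrete:
  "\<exists>\<delta>>0. \<forall>m. \<bar>lattice_shift a m\<bar> < \<delta> \<and> norm (lattice_shift b m) < \<delta> \<longrightarrow> (\<forall>i<3. m i = 0)"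
proof -
  define K where "K = (\<Sum>i<3. \<Sum>s<3. norm (adj3 Pm s i))"
  have K: "0 \<le> K" unfolding K_def by (intro sum_nonneg) simp
  \<comment> \<open>\<open>K\<close> bounds the adjugate of \<open>Pm\<close>, so with this radius
    Cramer's rule gives each integer \<open>m i\<close> absolute value below 1; the added 1 makes
    the inequality strict.\<close>
  define \<delta> where "\<delta> = norm (det3 Pm) / (K + 1)"
  have \<delta>: "\<delta> > 0" using det_Pm K by (simp add: \<delta>_def)
  have "m i = 0" if m: "\<bar>lattice_shift a m\<bar> < \<delta>" "norm (lattice_shift b m) < \<delta>" and i: "i < 3" for m i
  proof -
    define v where "v s = (\<Sum>j<3. complex_of_int (m j) * Pm j s)" for s
    have v: "norm (v s) \<le> \<delta>" if "s < 3" for s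
    proof -
      have "v 0 = complex_of_real (lattice_shift a m)" "v 1 = lattice_shift b m" "v 2 = cnj (lattice_shift b m)"
        by (simp_all add: v_def Pm_def lattice_shift_def)
      then show ?thesis using that m unfolding less_3_iff by (elim disjE) simp_all
    qed
    have "(\<Sum>s<3. v s * adj3 Pm s i) = complex_of_int (m i) * det3 Pm"
      unfolding v_def by (rule mult_adj3[OF i])
    then have "norm (complex_of_int (m i) * det3 Pm) = norm (\<Sum>s<3. v s * adj3 Pm s i)" by simp
    also have "\<dots> \<le> (\<Sum>s<3. norm (v s) * norm (adj3 Pm s i))"
      by (rule order_trans[OF norm_sum]) (simp add: norm_mult)
    also have "\<dots> \<le> (\<Sum>s<3. \<delta> * norm (adj3 Pm s i))"
      by (intro sum_mono mult_right_mono v) auto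
    also have "\<dots> = \<delta> * (\<Sum>s<3. norm (adj3 Pm s i))" by (simp add: sum_distrib_left)
    also have "\<dots> \<le> \<delta> * K"
    proof (rule mult_left_mono)
      show "(\<Sum>s<3. norm (adj3 Pm s i)) \<le> K"
        unfolding K_def by (rule member_le_sum) (use i in \<open>auto intro: sum_nonneg\<close>)
    qed (use \<delta> in simp)
    also have "\<dots> < \<delta> * (K + 1)" using \<delta> by simp
    also have "\<dots> = norm (det3 Pm)" using K by (simp add: \<delta>_def)
    finally have "\<bar>real_of_int (m i)\<bar> * norm (det3 Pm) < 1 * norm (det3 Pm)" by (simp add: norm_mult)
    then have "\<bar>real_of_int (m i)\<bar> < 1" using det_Pm by (simp only: mult_less_cancel_right_pos zero_less_norm_iff not_False_eq_True)
    then show ?thesis by linarith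
  qed
  then show ?thesis using \<delta> by (intro exI[of _ \<delta>]) simp
qed

lemma solv_data_power:
  assumes n: "1 \<le> n"
  shows "solv_data (\<alpha> ^ n) (\<beta> ^ n) a b (mpow M n)"
proof
  show "0 < \<alpha> ^ n" using \<alpha>(1) by simp
  show "\<alpha> ^ n \<noteq> 1" by (rule \<alpha>_pow_neq) (use n in simp)
  show "\<beta> ^ n \<noteq> 0" using \<beta>_nz by simp
  show "(\<Sum>j<3. of_int (mpow M n i j) * a j) = \<alpha> ^ n * a i" if "i < 3" for i
    by (rule mpow_eigen[OF eig_a that])
  show "(\<Sum>j<3. of_int (mpow M n i j) * b j) = \<beta> ^ n * b i" if "i < 3" for i
    by (rule mpow_eigen[OF eig_b that])
  show "det3 (mpow M n) = 1" by (simp add: det3_mpow det_M)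
qed (rule discrete)

definition growth :: real where "growth = max 1 \<alpha> * (max 1 (norm \<beta>) ^ 2)"

lemma ln_growth: "ln growth = max 0 (ln \<alpha>) + 2 * max 0 (ln (norm \<beta>))"
proof -
  have *: "ln (max 1 x) = max 0 (ln x)" if "0 < x" for x :: real
    using that by (simp add: max_def)
  show ?thesis unfolding growth_def
    by (subst ln_mult_pos) (use \<alpha> \<beta>_nz in \<open>simp_all add: * ln_realpow less_max_iff_disj\<close>)
qed

text \<open>By \<open>norm_\<beta>\<close> and \<open>\<alpha> \<noteq> 1\<close>, one of
  \<open>\<alpha>\<close> and \<open>norm \<beta>\<close> exceeds 1.\<close>

lemma growth_gt_1: "1 < growth"
proof (cases "\<alpha> > 1")
  case True
  have "1 < max 1 \<alpha> * 1" using True by simp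
  also have "\<dots> \<le> growth" unfolding growth_def by (intro mult_left_mono one_le_power) auto
  finally show ?thesis .
next
  case False
  then have "\<alpha> < 1" using \<alpha> by simp
  have "norm \<beta> > 1"
  proof (rule ccontr)
    assume "\<not> norm \<beta> > 1"
    then have "norm \<beta> ^ 2 \<le> 1" by (intro power_le_one) auto
    then have "\<alpha> * norm \<beta> ^ 2 \<le> \<alpha> * 1" using \<alpha> by (intro mult_left_mono) auto
    then show False using norm_\<beta> \<open>\<alpha> < 1\<close> by simp
  qed
  then have "1 < max 1 (norm \<beta>) ^ 2" by (intro one_less_power) auto
  also have "\<dots> = 1 * max 1 (norm \<beta>) ^ 2" by simp
  also have "\<dots> \<le> growth" unfolding growth_def by (intro mult_right_mono) auto
  finally show ?thesis .
qed

definition ord :: "nat \<Rightarrow> nat" where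
  "ord n = nat \<bar>det3 (\<lambda>i j. mpow M n i j - (if j = i then 1 else 0))\<bar>"

lemma real_ord: "real (ord n) = \<bar>\<alpha> ^ n - 1\<bar> * norm (\<beta> ^ n - 1) ^ 2"
proof -
  have "real (ord n) = \<bar>real_of_int (det3 (\<lambda>i j. mpow M n i j - (if j = i then 1 else 0)))\<bar>" by (simp add: ord_def)
  then show ?thesis unfolding det_mpow_minus_1 by (simp add: abs_mult)
qed

lemma ord_growth: "(\<lambda>n. ln (real (ord n)) / real n) \<longlonglongrightarrow> ln growth"
proof -
  have "(\<lambda>n. ln (norm (complex_of_real \<alpha> ^ n - 1)) / real n + 2 * (ln (norm (\<beta> ^ n - 1)) / real n)) \<longlonglongrightarrow>
     max 0 (ln (norm (complex_of_real \<alpha>))) + 2 * max 0 (ln (norm \<beta>))"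
    by (intro tendsto_add tendsto_mult tendsto_const tendsto_ln_norm_power_minus_1)
      (use \<alpha> \<beta>_nz norm_\<beta>_neq in auto)
  moreover have "eventually (\<lambda>n. ln (norm (complex_of_real \<alpha> ^ n - 1)) / real n + 2 * (ln (norm (\<beta> ^ n - 1)) / real n)
      = ln (real (ord n)) / real n) sequentially"
    using eventually_gt_at_top[of 0]
  proof eventually_elim
    case (elim n)
    have "norm (complex_of_real \<alpha> ^ n - 1) = \<bar>\<alpha> ^ n - 1\<bar>"
      by (metis norm_of_real of_real_1 of_real_diff of_real_power)
    moreover have "0 < \<bar>\<alpha> ^ n - 1\<bar>" "0 < norm (\<beta> ^ n - 1) ^ 2" using \<alpha>_pow_neq[OF elim] \<beta>_pow_neq[OF elim] by simp_all
    moreover from this have "ln (real (ord n)) = ln \<bar>\<alpha> ^ n - 1\<bar> + 2 * ln (norm (\<beta> ^ n - 1))"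
      unfolding real_ord by (subst ln_mult_pos) (simp_all add: ln_realpow)
    ultimately show ?case by (simp add: add_divide_distrib)
  qed
  ultimately show ?thesis unfolding ln_growth using \<alpha> by (simp add: tendsto_cong)
qed

lemma ord_nz:
  assumes "1 \<le> n"
  shows "det3 (\<lambda>i j. mpow M n i j - (if j = i then 1 else 0)) \<noteq> 0"
proof
  assume eq: "det3 (\<lambda>i j. mpow M n i j - (if j = i then 1 else 0)) = 0"
  have n: "0 < n" using assms by simp
  have "(\<alpha> ^ n - 1) * norm (\<beta> ^ n - 1) ^ 2 = 0"
    using det_mpow_minus_1[of n] unfolding eq by simp
  moreover have "\<alpha> ^ n - 1 \<noteq> 0" using \<alpha>_pow_neq[OF n] by simp
  moreover have "norm (\<beta> ^ n - 1) ^ 2 \<noteq> 0" using \<beta>_pow_neq[OF n] by simp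
  ultimately show False using mult_eq_0_iff by blast
qed

lemma mahler_measure_growth:
  assumes "map_poly of_rat f = [:- complex_of_real \<alpha>, 1:] * [:- \<beta>, 1:] * [:- cnj \<beta>, 1:]"
  shows "mahler_measure_poly (map_poly of_rat f) = growth"
  unfolding assms measure_eq_prod mahler_measure_factor
  using \<alpha> by (simp add: growth_def power2_eq_square)

theorem torsion_growth:
  fixes X :: "nat \<Rightarrow> 'b topology" and f :: "rat poly"
  assumes f: "map_poly of_rat f = [:- complex_of_real \<alpha>, 1:] * [:- \<beta>, 1:] * [:- cnj \<beta>, 1:]"
    and quot: "\<And>n. 1 \<le> n \<Longrightarrow> quotient_map (top_of_set HxC) (X n) (p n)"
    and fibres: "\<And>n x y. 1 \<le> n \<Longrightarrow> x \<in> HxC \<Longrightarrow> y \<in> HxC \<Longrightarrow> p n x = p n y \<longleftrightarrow>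
      (\<exists>k m. y = (complex_of_real ((\<alpha> ^ n) powi k) * fst x + complex_of_real (lattice_shift a m),
                   (\<beta> ^ n) powi k * snd x + lattice_shift b m))"
  shows
    "(\<forall>n\<ge>1. \<forall>r\<in>{0..4}. finite (torsion_part (homology_group r (X n)))) \<and>
     (\<forall>r\<in>{1, 2}. (\<lambda>n. ln (real (torsion_order r (X n))))
        \<sim>[at_top] (\<lambda>n. real n * ln (mahler_measure_poly (map_poly of_rat f)))) \<and>
     (\<forall>r\<in>{0, 3, 4}. (\<lambda>n. ln (real (torsion_order r (X n)))) \<sim>[at_top] (\<lambda>n. 0)) \<and>
     1 < mahler_measure_poly (map_poly of_rat f) \<and>
     (\<forall>r\<in>{1, 2}. \<exists>C D::real. 1 < C \<and>
        (\<forall>\<^sub>F n in at_top. C ^ n \<le> real (torsion_order r (X n)) \<and>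
                           real (torsion_order r (X n)) \<le> D ^ n))"
proof -
  \<comment> \<open>The \<open>n\<close>-th cover has dilation factors \<open>\<alpha> ^ n\<close>
    and \<open>\<beta> ^ n\<close> and the same translations, on which it acts by
    \<open>mpow M n\<close>.\<close>
  have tor: "finite (torsion_part (homology_group r (X n))) \<and> torsion_order r (X n) = (if r = 1 \<or> r = 2 then ord n else 1)"
    if n: "1 \<le> n" and r: "0 \<le> r" for n r
  proof -
    interpret S: solv_data "\<alpha> ^ n" "\<beta> ^ n" a b "mpow M n" by (rule solv_data_power[OF n])
    have fib: "p n x = p n y \<longleftrightarrow> (\<exists>k m. y = S.shift m (S.scale k x))" if "x \<in> HxC" "y \<in> HxC" for x y
      unfolding fibres[OF n that] S.shift_def S.scale_def by (simp add: case_prod_beta)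
    have "(\<lambda>j i. mpow M n j i - (if i = j then 1 else 0)) = (\<lambda>i j. mpow M n i j - (if j = i then 1 else 0))" ..
    then show ?thesis
      using S.torsion_homology_orbit_space[OF quot[OF n] fib ord_nz[OF n] r] by (simp only: ord_def)
  qed
  have ev: "eventually (\<lambda>n. torsion_order r (X n) = (if r = 1 \<or> r = 2 then ord n else 1)) at_top" if "0 \<le> r" for r
    using eventually_ge_at_top[of 1] by eventually_elim (use tor that in blast)
  have L: "0 < ln growth" using growth_gt_1 by simp
  have "(\<lambda>n. ln (real (ord n)) / (real n * ln growth)) \<longlonglongrightarrow> ln growth / ln growth"
    using tendsto_divide[OF ord_growth tendsto_const, of "ln growth"] L by simp
  then have asy: "(\<lambda>n. ln (real (ord n))) \<sim>[at_top] (\<lambda>n. real n * ln growth)"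
    using L by (intro asymp_equivI') simp
  \<comment> \<open>The exponential rate tends to \<open>ln growth\<close>, which is positive; half
    and twice the limit are safe bounds on the two sides.\<close>
  have bounds: "eventually (\<lambda>n. exp (ln growth / 2) ^ n \<le> real (ord n) \<and> real (ord n) \<le> exp (2 * ln growth) ^ n) at_top"
  proof -
    have "eventually (\<lambda>n. ln growth / 2 < ln (real (ord n)) / real n) at_top"
      using order_tendstoD(1)[OF ord_growth, of "ln growth / 2"] L by simp
    moreover have "eventually (\<lambda>n. ln (real (ord n)) / real n < 2 * ln growth) at_top"
      using order_tendstoD(2)[OF ord_growth, of "2 * ln growth"] L by simp
    ultimately show ?thesis
      using eventually_ge_at_top[of 1]
    proof eventually_elim
      case (elim n)
      have pos: "0 < real (ord n)" using ord_nz[OF elim(3)] by (simp add: ord_def)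
      have "real n * (ln growth / 2) \<le> ln (real (ord n))" "ln (real (ord n)) \<le> real n * (2 * ln growth)"
        using elim by (simp_all add: field_simps)
      then have "exp (real n * (ln growth / 2)) \<le> exp (ln (real (ord n)))"
        "exp (ln (real (ord n))) \<le> exp (real n * (2 * ln growth))" by (simp_all only: exp_le_cancel_iff)
      then show ?case unfolding exp_of_nat_mult exp_ln[OF pos] by blast
    qed
  qed
  have M: "mahler_measure_poly (map_poly of_rat f) = growth" by (rule mahler_measure_growth[OF f])
  show ?thesis unfolding M
  proof (intro conjI ballI allI impI)
    show "finite (torsion_part (homology_group r (X n)))" if "1 \<le> n" "r \<in> {0..4}" for n r
      using tor that by simp
    show "(\<lambda>n. ln (real (torsion_order r (X n)))) \<sim>[at_top] (\<lambda>n. real n * ln growth)" if "r \<in> {1, 2}" for r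
    proof (rule asymp_equiv_transfer[OF asy])
      have "eventually (\<lambda>n. torsion_order r (X n) = ord n) at_top" using ev[of r] that by auto
      then show "\<forall>\<^sub>F n in at_top. ln (real (ord n)) = ln (real (torsion_order r (X n)))"
        by eventually_elim simp
    qed simp
    show "(\<lambda>n. ln (real (torsion_order r (X n)))) \<sim>[at_top] (\<lambda>n. 0)" if r: "r \<in> {0, 3, 4}" for r
    proof (rule asymp_equiv_transfer[OF asymp_equiv_refl[of "\<lambda>_. 0 :: real"]])
      have "eventually (\<lambda>n. torsion_order r (X n) = 1) at_top" using ev[of r] r by auto
      then show "\<forall>\<^sub>F n in at_top. 0 = ln (real (torsion_order r (X n)))"
        by eventually_elim simp
    qed simp
    show "1 < growth" by (rule growth_gt_1)
    show "\<exists>C D::real. 1 < C \<and> (\<forall>\<^sub>F n in at_top. C ^ n \<le> real (torsion_order r (X n)) \<and> real (torsion_order r (X n)) \<le> D ^ n)"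
      if r: "r \<in> {1, 2}" for r
    proof (intro exI conjI)
      show "1 < exp (ln growth / 2)" using L by simp
      have "eventually (\<lambda>n. torsion_order r (X n) = ord n) at_top" using ev[of r] r by auto
      then show "\<forall>\<^sub>F n in at_top. exp (ln growth / 2) ^ n \<le> real (torsion_order r (X n)) \<and>
          real (torsion_order r (X n)) \<le> exp (2 * ln growth) ^ n"
        using bounds by eventually_elim simp
    qed
  qed
qed

end

section \<open>Characteristic polynomials, minimal polynomials and orbits of the covers\<close>

definition charpoly3 :: "(nat \<Rightarrow> nat \<Rightarrow> int) \<Rightarrow> rat poly" where
  "charpoly3 M = [:- of_int (det3 M), of_int (minor2 M 1 0 1 0 + minor2 M 2 0 2 0 + minor2 M 2 1 2 1),
                   - of_int (M 0 0 + M 1 1 + M 2 2), 1:]"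

lemma mpow_2: "r < 3 \<Longrightarrow> mpow M (Suc (Suc 0)) r c = M r 0 * M 0 c + M r 1 * M 1 c + M r 2 * M 2 c"
  unfolding less_3_iff by (elim disjE) (simp_all add: sum_lessThan_3 numeral_2_eq_2)

lemma mpow_1: "r < 3 \<Longrightarrow> mpow M (Suc 0) r c = M r c"
  unfolding less_3_iff by (elim disjE) (simp_all add: sum_lessThan_3 numeral_2_eq_2)

lemma mpow_3:
  assumes "r < 3"
  shows "mpow M (Suc (Suc (Suc 0))) r c = mpow M (Suc (Suc 0)) r 0 * M 0 c + mpow M (Suc (Suc 0)) r 1 * M 1 c
     + mpow M (Suc (Suc 0)) r 2 * M 2 c"
  by (subst mpow.simps(2)) (simp only: sum_lessThan_3 numeral_2_eq_2 One_nat_def)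

text \<open>Checked entry by entry; it bounds the degree of the minimal polynomial of the matrix by
  3.\<close>

lemma cayley_hamilton3:
  assumes "r < 3" "c < 3"
  shows "(\<Sum>i\<le>degree (charpoly3 M). poly.coeff (charpoly3 M) i * of_int (mpow M i r c)) = (0 :: rat)"
proof -
  have "(\<Sum>i\<le>degree (charpoly3 M). poly.coeff (charpoly3 M) i * of_int (mpow M i r c)) =
    of_int (mpow M (Suc (Suc (Suc 0))) r c - (M 0 0 + M 1 1 + M 2 2) * mpow M (Suc (Suc 0)) r c
      + (minor2 M 1 0 1 0 + minor2 M 2 0 2 0 + minor2 M 2 1 2 1) * mpow M (Suc 0) r c - det3 M * mpow M 0 r c)"
    by (simp add: charpoly3_def algebra_simps del: mpow.simps)
  also have "mpow M (Suc (Suc (Suc 0))) r c - (M 0 0 + M 1 1 + M 2 2) * mpow M (Suc (Suc 0)) r c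
      + (minor2 M 1 0 1 0 + minor2 M 2 0 2 0 + minor2 M 2 1 2 1) * mpow M (Suc 0) r c - det3 M * mpow M 0 r c = 0"
    using assms(1) unfolding mpow_3[OF assms(1)] mpow_2[OF assms(1)] mpow_1[OF assms(1)]
    using assms(2) unfolding less_3_iff
    by (elim disjE) (simp_all add: det3_def minor2_def numeral_2_eq_2 algebra_simps)
  finally show ?thesis by simp
qed

lemma monic_cubic_roots:
  fixes F :: "'b::field poly"
  assumes monic: "lead_coeff F = 1" and deg: "degree F \<le> 3"
    and roots: "poly F x = 0" "poly F y = 0" "poly F z = 0" and dist: "x \<noteq> y" "x \<noteq> z" "y \<noteq> z"
  shows "F = [:- x, 1:] * [:- y, 1:] * [:- z, 1:]"
proof -
  obtain q where q: "F = [:- x, 1:] * q" using roots(1) unfolding poly_eq_0_iff_dvd by (elim dvdE)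
  have "poly q y = 0" "poly q z = 0" using roots(2,3) dist unfolding q by (simp_all only: poly_mult mult_eq_0_iff, simp_all)
  then obtain r where r: "q = [:- y, 1:] * r" unfolding poly_eq_0_iff_dvd by (elim dvdE)
  have "poly r z = 0" using \<open>poly q z = 0\<close> dist unfolding r by (simp only: poly_mult mult_eq_0_iff) simp
  then obtain s where s: "r = [:- z, 1:] * s" unfolding poly_eq_0_iff_dvd by (elim dvdE)
  have F: "F = [:- x, 1:] * [:- y, 1:] * [:- z, 1:] * s" by (simp only: q r s mult.assoc)
  let ?Q = "[:- x, 1:] * [:- y, 1:] * [:- z, 1:]"
  have Q: "degree ?Q = 3" "lead_coeff ?Q = 1" by (simp_all add: degree_mult_eq)
  have "s \<noteq> 0" using F monic by auto
  then have "degree F = 3 + degree s" unfolding F using Q by (subst degree_mult_eq) auto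
  then have "degree s = 0" using deg by simp
  then obtain k where k: "s = [:k:]" using degree_eq_zeroE by blast
  have "lead_coeff F = lead_coeff s"
    by (simp only: F lead_coeff_mult[of ?Q s] Q(2) mult_1_left)
  moreover have "lead_coeff s = k" by (simp add: k)
  ultimately have "k = 1" using monic by simp
  then have "s = 1" unfolding k by (simp add: pCons_one)
  then show ?thesis using F by simp
qed

context solv_data
begin

lemma orbit_eq_iff:
  "{shift m (scale k x) | m k. True} = {shift m (scale k y) | m k. True} \<longleftrightarrow> (\<exists>k m. y = shift m (scale k x))"
proof -
  have orb: "{shift m (scale k x) | m k. True} = {g x | g. g \<in> \<Gamma>}" for x
  proof -
    have "u \<in> {shift m (scale k x) | m k. True} \<longleftrightarrow> u \<in> {g x | g. g \<in> \<Gamma>}" for u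
      using \<Gamma>_orbit[of u x] by blast
    then show ?thesis by blast
  qed
  have "{g x | g. g \<in> \<Gamma>} = {g y | g. g \<in> \<Gamma>} \<longleftrightarrow> (\<exists>g\<in>\<Gamma>. y = g x)"
  proof
    assume eq: "{g x | g. g \<in> \<Gamma>} = {g y | g. g \<in> \<Gamma>}"
    have "y \<in> {g y | g. g \<in> \<Gamma>}" using F.id_mem by (intro CollectI exI[of _ id]) simp
    then show "\<exists>g\<in>\<Gamma>. y = g x" unfolding eq[symmetric] by blast
  next
    assume "\<exists>g\<in>\<Gamma>. y = g x"
    then obtain g where g: "g \<in> \<Gamma>" "y = g x" by blast
    obtain h where h: "h \<in> \<Gamma>" "h \<circ> g = id" using \<Gamma>_inv g(1) by blast
    have x: "x = h y" using h(2) g(2) by (metis comp_apply id_apply)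
    show "{g x | g. g \<in> \<Gamma>} = {g y | g. g \<in> \<Gamma>}"
    proof (intro equalityI subsetI)
      fix u assume "u \<in> {g x | g. g \<in> \<Gamma>}"
      then obtain k where "k \<in> \<Gamma>" "u = (k \<circ> h) y" using x by auto
      then show "u \<in> {g y | g. g \<in> \<Gamma>}" using \<Gamma>_comp h(1) by blast
    next
      fix u assume "u \<in> {g y | g. g \<in> \<Gamma>}"
      then obtain k where "k \<in> \<Gamma>" "u = (k \<circ> g) x" using g(2) by auto
      then show "u \<in> {g x | g. g \<in> \<Gamma>}" using \<Gamma>_comp g(1) by blast
    qed
  qed
  then show ?thesis unfolding orb \<Gamma>_orbit .
qed

end

context spectral_data
begin

lemma solv_data_1: "solv_data \<alpha> \<beta> a b M"
proof
  show "0 < \<alpha>" "\<alpha> \<noteq> 1" "\<beta> \<noteq> 0" by (rule \<alpha> \<beta>_nz)+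
  show "(\<Sum>j<3. of_int (M i j) * a j) = \<alpha> * a i" if "i < 3" for i by (rule eig_a[OF that])
  show "(\<Sum>j<3. of_int (M i j) * b j) = \<beta> * b i" if "i < 3" for i by (rule eig_b[OF that])
  show "det3 M = 1" by (rule det_M)
qed (rule discrete)

sublocale S: solv_data \<alpha> \<beta> a b M by (rule solv_data_1)

lemma spec_distinct: "complex_of_real \<alpha> \<noteq> \<beta>" "complex_of_real \<alpha> \<noteq> cnj \<beta>" "\<beta> \<noteq> cnj \<beta>"
  using \<beta>_cnj by blast+

text \<open>Dilation exponents divisible by \<open>n\<close> are arbitrary exponents for the data
  \<open>\<alpha> ^ n\<close>, \<open>\<beta> ^ n\<close>, \<open>mpow M n\<close> with the same
  lattice. So orbits of the index \<open>n\<close> subgroup are the fibres required by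
  \<open>torsion_growth\<close>.\<close>

lemma torsion_growth_orbits:
  fixes X :: "nat \<Rightarrow> (complex \<times> complex) set topology" and f :: "rat poly" and G :: "nat \<Rightarrow> ('g, 'h) monoid_scheme"
  assumes f: "map_poly of_rat f = [:- complex_of_real \<alpha>, 1:] * [:- \<beta>, 1:] * [:- cnj \<beta>, 1:]"
    and X: "\<And>n. X n = orbit_space (top_of_set HxC) (G n) \<phi>"
    and orb: "\<And>n x. 1 \<le> n \<Longrightarrow> x \<in> HxC \<Longrightarrow> orbit (G n) \<phi> x = {S.shift m (S.scale (int n * k) x) | m k. True}"
  shows
    "(\<forall>n\<ge>1. \<forall>r\<in>{0..4}. finite (torsion_part (homology_group r (X n)))) \<and>
     (\<forall>r\<in>{1, 2}. (\<lambda>n. ln (real (torsion_order r (X n))))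
        \<sim>[at_top] (\<lambda>n. real n * ln (mahler_measure_poly (map_poly of_rat f)))) \<and>
     (\<forall>r\<in>{0, 3, 4}. (\<lambda>n. ln (real (torsion_order r (X n)))) \<sim>[at_top] (\<lambda>n. 0)) \<and>
     1 < mahler_measure_poly (map_poly of_rat f) \<and>
     (\<forall>r\<in>{1, 2}. \<exists>C D::real. 1 < C \<and>
        (\<forall>\<^sub>F n in at_top. C ^ n \<le> real (torsion_order r (X n)) \<and>
                           real (torsion_order r (X n)) \<le> D ^ n))"
proof (rule torsion_growth[OF f, where p = "\<lambda>n. orbit (G n) \<phi>"])
  show "quotient_map (top_of_set HxC) (X n) (orbit (G n) \<phi>)" for n
    unfolding X by (rule quotient_map_orbit_space)
  fix n :: nat and x y assume n: "1 \<le> n" and xy: "x \<in> HxC" "y \<in> HxC"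
  interpret N: solv_data "\<alpha> ^ n" "\<beta> ^ n" a b "mpow M n" by (rule solv_data_power[OF n])
  have scale: "S.scale (int n * k) = N.scale k" for k
    by (simp add: S.scale_def N.scale_def power_int_mult)
  have "orbit (G n) \<phi> x = orbit (G n) \<phi> y \<longleftrightarrow> (\<exists>k m. y = N.shift m (N.scale k x))"
    unfolding orb[OF n xy(1)] orb[OF n xy(2)] scale by (rule N.orbit_eq_iff)
  also have "\<dots> \<longleftrightarrow> (\<exists>k m. y = (complex_of_real ((\<alpha> ^ n) powi k) * fst x + complex_of_real (lattice_shift a m),
                   (\<beta> ^ n) powi k * snd x + lattice_shift b m))"
    unfolding N.shift_def N.scale_def by (simp add: case_prod_beta)
  finally show "orbit (G n) \<phi> x = orbit (G n) \<phi> y \<longleftrightarrow> \<dots>" .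
qed

end

section \<open>Inoue surfaces\<close>

lemma eigenvector_sum:
  assumes A: "A \<in> carrier_mat 3 3" and ev: "eigenvector A v k" and i: "i < 3"
  shows "(\<Sum>j<3. A $$ (i, j) * v $ j) = k * v $ i"
proof -
  have v: "v \<in> carrier_vec 3" "A *\<^sub>v v = k \<cdot>\<^sub>v v" using A ev by (auto simp: eigenvector_def)
  have "(A *\<^sub>v v) $ i = (k \<cdot>\<^sub>v v) $ i" using v(2) by simp
  then show ?thesis using i v(1) A by (simp add: scalar_prod_def lessThan_atLeast0)
qed

lemma eigenvector_nonzero:
  assumes A: "A \<in> carrier_mat 3 3" and ev: "eigenvector A v k"
  shows "\<exists>i<3. v $ i \<noteq> 0"
proof (rule ccontr)
  assume "\<not> (\<exists>i<3. v $ i \<noteq> 0)"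
  then have "v = 0\<^sub>v 3" using A ev by (intro eq_vecI) (auto simp: eigenvector_def)
  then show False using A ev by (auto simp: eigenvector_def)
qed

lemma inoue_spectral_data:
  assumes "inoue_data M \<alpha> \<beta> a b"
  shows "spectral_data (\<lambda>i j. M $$ (i, j)) \<alpha> \<beta> (\<lambda>i. a $ i) (\<lambda>i. b $ i)"
proof
  have M: "M \<in> carrier_mat 3 3" and det: "Determinant.det M = 1"
    and a: "eigenvector (map_mat real_of_int M) a \<alpha>" and b: "eigenvector (map_mat complex_of_int M) b \<beta>"
    using assms by (auto simp: inoue_data_def)
  have Ma: "map_mat real_of_int M \<in> carrier_mat 3 3" and Mb: "map_mat complex_of_int M \<in> carrier_mat 3 3" using M by auto
  show "0 < \<alpha>" "\<alpha> \<noteq> 1" "\<beta> \<notin> \<real>" using assms by (auto simp: inoue_data_def)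
  show "(\<Sum>j<3. of_int (M $$ (i, j)) * a $ j) = \<alpha> * a $ i" if "i < 3" for i
    using eigenvector_sum[OF Ma a that] that M by simp
  show "(\<Sum>j<3. of_int (M $$ (i, j)) * b $ j) = \<beta> * b $ i" if "i < 3" for i
    using eigenvector_sum[OF Mb b that] that M by simp
  show "\<exists>i<3. a $ i \<noteq> 0" by (rule eigenvector_nonzero[OF Ma a])
  show "\<exists>i<3. b $ i \<noteq> 0" by (rule eigenvector_nonzero[OF Mb b])
  show "det3 (\<lambda>i j. M $$ (i, j)) = 1" using det_3_conv_det3[OF M] det by simp
qed

lemma pow_mat_mpow:
  assumes M: "M \<in> carrier_mat 3 3" and "r < 3" "c < 3"
  shows "(map_mat rat_of_int M ^\<^sub>m k) $$ (r, c) = of_int (mpow (\<lambda>i j. M $$ (i, j)) k r c)"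
  using assms(2,3)
proof (induction k arbitrary: r c)
  case 0
  then show ?case using M by simp
next
  case (Suc k)
  have d: "map_mat rat_of_int M ^\<^sub>m k \<in> carrier_mat 3 3" using M by (intro pow_carrier_mat) simp
  have "(map_mat rat_of_int M ^\<^sub>m Suc k) $$ (r, c) = (\<Sum>j<3. (map_mat rat_of_int M ^\<^sub>m k) $$ (r, j) * rat_of_int (M $$ (j, c)))"
    using d M Suc.prems by (simp add: scalar_prod_def lessThan_atLeast0)
  also have "\<dots> = (\<Sum>j<3. of_int (mpow (\<lambda>i j. M $$ (i, j)) k r j) * rat_of_int (M $$ (j, c)))"
    using Suc.IH[OF Suc.prems(1)] by (intro sum.cong) auto
  finally show ?case by simp
qed

lemma matrix_poly_zero_iff:
  assumes M: "M \<in> carrier_mat 3 3"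
  shows "matrix_poly (map_mat rat_of_int M) p = 0\<^sub>m (dim_row M) (dim_row M) \<longleftrightarrow>
    (\<forall>r<3. \<forall>c<3. (\<Sum>i\<le>degree p. poly.coeff p i * of_int (mpow (\<lambda>i j. M $$ (i, j)) i r c)) = 0)"
proof -
  have "matrix_poly (map_mat rat_of_int M) p $$ (r, c) =
      (\<Sum>i\<le>degree p. poly.coeff p i * of_int (mpow (\<lambda>i j. M $$ (i, j)) i r c))" if "r < 3" "c < 3" for r c
    unfolding matrix_poly_def using that M pow_mat_mpow[OF M that] by simp
  moreover have "dim_row (matrix_poly (map_mat rat_of_int M) p) = 3" "dim_col (matrix_poly (map_mat rat_of_int M) p) = 3"
    using M by (auto simp: matrix_poly_def)
  ultimately show ?thesis using M by (auto simp: mat_eq_iff)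
qed

context spectral_data
begin

text \<open>Row \<open>r\<close> of \<open>f\<close> evaluated at the matrix, applied to an
  eigenvector, is the value of \<open>f\<close> at the eigenvalue times the \<open>r\<close>-th
  entry, which is chosen nonzero.\<close>

lemma poly_root_of_annihilates:
  fixes f :: "rat poly"
  assumes ann: "\<And>r c. r < 3 \<Longrightarrow> c < 3 \<Longrightarrow> (\<Sum>i\<le>degree f. poly.coeff f i * of_int (mpow M i r c)) = 0"
    and s: "s < 3"
  shows "poly (map_poly of_rat f) (spec s) = 0"
proof -
  obtain r where r: "r < 3" "Pm r s \<noteq> 0"
    using nz_a nz_b that by (cases "s = 0") (auto simp: Pm_def)
  have "(\<Sum>i\<le>degree f. of_rat (poly.coeff f i) * complex_of_int (mpow M i r c)) = 0" if "c < 3" for c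
  proof -
    have "complex_of_rat (\<Sum>i\<le>degree f. poly.coeff f i * of_int (mpow M i r c)) = 0" using ann[OF r(1) that] by simp
    then show ?thesis by (simp add: of_rat_sum of_rat_mult)
  qed
  then have "0 = (\<Sum>c<3. (\<Sum>i\<le>degree f. of_rat (poly.coeff f i) * complex_of_int (mpow M i r c)) * Pm c s)" by simp
  also have "\<dots> = (\<Sum>i\<le>degree f. of_rat (poly.coeff f i) * (\<Sum>c<3. complex_of_int (mpow M i r c) * Pm c s))"
    unfolding sum_distrib_left sum_distrib_right by (subst sum.swap) (simp add: mult.assoc)
  also have "\<dots> = (\<Sum>i\<le>degree f. of_rat (poly.coeff f i) * spec s ^ i) * Pm r s"
    unfolding sum_distrib_right using mpow_eigen[OF Pm_eigen[OF _ s] r(1)] by (simp add: mult.assoc)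
  also have "(\<Sum>i\<le>degree f. of_rat (poly.coeff f i) * spec s ^ i) = poly (map_poly of_rat f) (spec s)"
    by (simp add: poly_altdef coeff_map_poly degree_map_poly)
  finally show ?thesis using r(2) by simp
qed

text \<open>Three distinct eigenvalues as roots determine a monic polynomial of degree at most
  3.\<close>

lemma min_poly_factorization:
  fixes f :: "rat poly"
  assumes monic: "lead_coeff f = 1" and deg: "degree f \<le> 3"
    and roots: "\<And>s. s < 3 \<Longrightarrow> poly (map_poly of_rat f) (spec s) = 0"
  shows "map_poly of_rat f = [:- complex_of_real \<alpha>, 1:] * [:- \<beta>, 1:] * [:- cnj \<beta>, 1:]"
proof (rule monic_cubic_roots)
  show "lead_coeff (map_poly complex_of_rat f) = 1" "degree (map_poly complex_of_rat f) \<le> 3"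
    using monic deg by (simp_all add: coeff_map_poly degree_map_poly)
  show "poly (map_poly of_rat f) (complex_of_real \<alpha>) = 0" "poly (map_poly of_rat f) \<beta> = 0"
    "poly (map_poly of_rat f) (cnj \<beta>) = 0"
    using roots[of 0] roots[of 1] roots[of 2] by (simp_all add: spec_def)
qed (rule spec_distinct)+

end

lemma charpoly3_props: "charpoly3 M \<noteq> 0" "degree (charpoly3 M) = 3"
  by (simp_all add: charpoly3_def)

lemma inoue_min_poly:
  assumes data: "inoue_data M \<alpha> \<beta> a b" and f: "matrix_minimal_poly M f"
  shows "map_poly of_rat f = [:- complex_of_real \<alpha>, 1:] * [:- \<beta>, 1:] * [:- cnj \<beta>, 1:]"
proof -
  have M: "M \<in> carrier_mat 3 3" using data by (simp add: inoue_data_def)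
  interpret spectral_data "\<lambda>i j. M $$ (i, j)" \<alpha> \<beta> "\<lambda>i. a $ i" "\<lambda>i. b $ i"
    by (rule inoue_spectral_data[OF data])
  let ?Z = "\<lambda>g. \<forall>r<3. \<forall>c<3. (\<Sum>i\<le>degree g. poly.coeff g i * of_int (mpow (\<lambda>i j. M $$ (i, j)) i r c)) = (0 :: rat)"
  have f': "lead_coeff f = 1 \<and> ?Z f \<and> (\<forall>g. g \<noteq> 0 \<and> ?Z g \<longrightarrow> degree f \<le> degree g)"
    using f unfolding matrix_minimal_poly_def is_minimal_poly_def matrix_poly_zero_iff[OF M] .
  have "?Z (charpoly3 (\<lambda>i j. M $$ (i, j)))" using cayley_hamilton3 by simp
  with charpoly3_props(1) have "degree f \<le> degree (charpoly3 (\<lambda>i j. M $$ (i, j)))"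
    by (rule f'[THEN conjunct2, THEN conjunct2, THEN HOL.spec, THEN mp, OF conjI])
  then have deg: "degree f \<le> 3" unfolding charpoly3_props(2) .
  show ?thesis
  proof (rule min_poly_factorization[OF conjunct1[OF f'] deg])
    show "poly (map_poly of_rat f) (spec s) = 0" if "s < 3" for s
      by (rule poly_root_of_annihilates[OF _ that]) (use f' in simp)
  qed
qed

section \<open>The group generated by the dilation and the three unit translations\<close>

context solv_data
begin

text \<open>Elements of \<open>BijGroup\<close> are extensional, that is, undefined outside
  \<open>HxC\<close>; \<open>R\<close> turns the global maps in \<open>\<Gamma>\<close> into such
  elements.\<close>

definition R :: "(complex \<times> complex \<Rightarrow> complex \<times> complex) \<Rightarrow> complex \<times> complex \<Rightarrow> complex \<times> complex" where
  "R g = restrict g HxC"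

definition generators :: "(complex \<times> complex \<Rightarrow> complex \<times> complex) set" where
  "generators = insert (R (scale 1)) ((\<lambda>i. R (shift (unit_vec3 i))) ` {..<3})"

abbreviation "BG \<equiv> BijGroup HxC"

lemma BG_group: "group BG"
  by (rule group_BijGroup)

lemma R_Bij:
  assumes g: "g \<in> \<Gamma>"
  shows "R g \<in> carrier BG"
proof -
  obtain h where h: "h \<in> \<Gamma>" "h \<circ> g = id" "g \<circ> h = id" using \<Gamma>_inv g by blast
  have "bij_betw g HxC HxC"
  proof (rule bij_betw_byWitness[where f' = h])
    show "\<forall>x\<in>HxC. h (g x) = x" using fun_cong[OF h(2)] by simp
    show "\<forall>x\<in>HxC. g (h x) = x" using fun_cong[OF h(3)] by simp
    show "g ` HxC \<subseteq> HxC" "h ` HxC \<subseteq> HxC" using \<Gamma>_maps g h(1) by auto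
  qed
  then have "bij_betw (R g) HxC HxC" unfolding R_def by (rule bij_betw_cong[THEN iffD1, rotated]) simp
  then show ?thesis by (simp add: BijGroup_def Bij_def R_def)
qed

lemma R_mult: "g \<in> \<Gamma> \<Longrightarrow> h \<in> \<Gamma> \<Longrightarrow> R g \<otimes>\<^bsub>BG\<^esub> R h = R (g \<circ> h)"
proof -
  assume g: "g \<in> \<Gamma>" and h: "h \<in> \<Gamma>"
  have "R g \<otimes>\<^bsub>BG\<^esub> R h = compose HxC (R g) (R h)"
    using R_Bij[OF g] R_Bij[OF h] by (simp add: BijGroup_def)
  also have "\<dots> = R (g \<circ> h)"
    using \<Gamma>_maps[OF h] by (auto simp: compose_def R_def fun_eq_iff)
  finally show ?thesis .
qed

lemma R_one: "\<one>\<^bsub>BG\<^esub> = R id"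
  by (simp add: BijGroup_def R_def id_def)

lemma R_inv:
  assumes "g \<in> \<Gamma>" "h \<in> \<Gamma>" "h \<circ> g = id"
  shows "inv\<^bsub>BG\<^esub> R g = R h"
  by (rule group.inv_equality[OF BG_group]) (simp_all add: R_mult R_one R_Bij assms)

lemma R_subgroup: "subgroup (R ` \<Gamma>) BG"
proof (rule group.subgroupI[OF BG_group])
  show "R ` \<Gamma> \<subseteq> carrier BG" using R_Bij by auto
  show "R ` \<Gamma> \<noteq> {}" using shift_\<Gamma> by blast
  show "inv\<^bsub>BG\<^esub> x \<in> R ` \<Gamma>" if x: "x \<in> R ` \<Gamma>" for x
  proof -
    obtain g where g: "g \<in> \<Gamma>" "x = R g" using x by auto
    obtain h where h: "h \<in> \<Gamma>" "h \<circ> g = id" using \<Gamma>_inv g(1) by blast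
    show ?thesis unfolding g(2) R_inv[OF g(1) h] using h(1) by (rule imageI)
  qed
  show "x \<otimes>\<^bsub>BG\<^esub> y \<in> R ` \<Gamma>" if xy: "x \<in> R ` \<Gamma>" "y \<in> R ` \<Gamma>" for x y
  proof -
    obtain g h where g: "g \<in> \<Gamma>" "x = R g" and h: "h \<in> \<Gamma>" "y = R h" using xy by auto
    show ?thesis unfolding g(2) h(2) R_mult[OF g(1) h(1)] by (rule imageI) (rule \<Gamma>_comp[OF g(1) h(1)])
  qed
qed

abbreviation "Gr \<equiv> subgroup_generated BG generators"

lemma generators_sub: "generators \<subseteq> R ` \<Gamma>"
  unfolding generators_def using scale_\<Gamma> shift_\<Gamma> by auto

lemma carrier_Gr: "carrier Gr = generate BG generators"
proof -
  have "carrier BG \<inter> generators = generators" using generators_sub R_Bij by auto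
  then show ?thesis unfolding carrier_subgroup_generated by simp
qed

lemma Gr_subgroup: "subgroup (carrier Gr) BG"
  unfolding carrier_Gr by (rule group.generate_is_subgroup[OF BG_group]) (use generators_sub R_Bij in auto)

context
  fixes q
  assumes hom: "q \<in> hom Gr integer_group" and q_scale: "q (R (scale 1)) = 1"
    and q_shift: "\<And>i. i < 3 \<Longrightarrow> q (R (shift (unit_vec3 i))) = 0"
begin

text \<open>Membership in the generated group and the value of \<open>q\<close> are carried along
  together, as both are preserved by composition and inversion.\<close>

definition good :: "int \<Rightarrow> (complex \<times> complex \<Rightarrow> complex \<times> complex) \<Rightarrow> bool" where
  "good k g \<longleftrightarrow> g \<in> \<Gamma> \<and> R g \<in> carrier Gr \<and> q (R g) = k"

lemma q_mult: "x \<in> carrier Gr \<Longrightarrow> y \<in> carrier Gr \<Longrightarrow> q (x \<otimes>\<^bsub>BG\<^esub> y) = q x + q y"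
  using hom_mult[OF hom] by simp

lemma good_comp:
  assumes "good k g" "good l h"
  shows "good (k + l) (g \<circ> h)"
proof -
  have gh: "g \<in> \<Gamma>" "h \<in> \<Gamma>" "R g \<in> carrier Gr" "R h \<in> carrier Gr" using assms by (auto simp: good_def)
  have "R g \<otimes>\<^bsub>BG\<^esub> R h \<in> carrier Gr" by (rule subgroup.m_closed[OF Gr_subgroup gh(3,4)])
  moreover have "q (R g \<otimes>\<^bsub>BG\<^esub> R h) = k + l" using q_mult[OF gh(3,4)] assms by (simp add: good_def)
  ultimately show ?thesis using \<Gamma>_comp[OF gh(1,2)] by (simp add: good_def R_mult[OF gh(1,2)])
qed

lemma good_id: "good 0 id"
proof -
  have one: "R id \<in> carrier Gr" using subgroup.one_closed[OF Gr_subgroup] by (simp add: R_one)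
  have "q (R id \<otimes>\<^bsub>BG\<^esub> R id) = q (R id) + q (R id)" by (rule q_mult[OF one one])
  then have "q (R id) = 0" by (simp add: R_mult F.id_mem)
  then show ?thesis using one F.id_mem by (simp add: good_def)
qed

lemma good_inv:
  assumes g: "good k g" and h: "h \<in> \<Gamma>" "h \<circ> g = id"
  shows "good (- k) h"
proof -
  have g': "g \<in> \<Gamma>" "R g \<in> carrier Gr" "q (R g) = k" using g by (auto simp: good_def)
  have Rh: "R h \<in> carrier Gr"
    using subgroup.m_inv_closed[OF Gr_subgroup g'(2)] unfolding R_inv[OF g'(1) h] .
  have "q (R h \<otimes>\<^bsub>BG\<^esub> R g) = q (R h) + k" using q_mult[OF Rh g'(2)] g'(3) by simp
  then have "q (R id) = q (R h) + k" by (simp add: R_mult g' h)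
  then show ?thesis using good_id Rh h(1) by (simp add: good_def)
qed

lemma good_scale: "good k (scale k)"
proof -
  have 1: "good 1 (scale 1)"
  proof -
    have "R (scale 1) \<in> carrier Gr" unfolding carrier_Gr by (rule generate.incl) (simp add: generators_def)
    then show ?thesis by (simp add: good_def scale_\<Gamma> q_scale)
  qed
  have m1: "good (- 1) (scale (- 1))"
    by (rule good_inv[OF 1 scale_\<Gamma>]) (simp flip: scale_add add: scale_0)
  show ?thesis
  proof (induction k rule: int_induct[of _ 0])
    case base
    show ?case using good_id by (simp only: scale_0)
  next
    case (step1 k)
    show ?case unfolding scale_add by (rule good_comp[OF step1(2) 1])
  next
    case (step2 k)
    have "good (k + - 1) (scale (k + - 1))" unfolding scale_add by (rule good_comp[OF step2(2) m1])
    then show ?case by simp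
  qed
qed

lemma good_shift_unit:
  assumes i: "i < 3"
  shows "good 0 (shift (\<lambda>j. c * unit_vec3 i j))"
proof -
  have 1: "good 0 (shift (unit_vec3 i))"
  proof -
    have "R (shift (unit_vec3 i)) \<in> carrier Gr"
      unfolding carrier_Gr by (rule generate.incl) (use i in \<open>simp add: generators_def\<close>)
    then show ?thesis by (simp add: good_def shift_\<Gamma> q_shift[OF i])
  qed
  have "good (- 0) (shift (\<lambda>j. - unit_vec3 i j))"
    by (rule good_inv[OF 1 shift_\<Gamma>]) (simp flip: shift_add add: shift_0)
  then have m1: "good 0 (shift (\<lambda>j. - unit_vec3 i j))" by simp
  show ?thesis
  proof (induction c rule: int_induct[of _ 0])
    case base
    show ?case using good_id by (simp only: mult_zero_left shift_0)
  next
    case (step1 c)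
    then show ?case using good_comp[OF step1(2) 1] by (simp flip: shift_add add: distrib_right)
  next
    case (step2 c)
    then show ?case using good_comp[OF step2(2) m1] by (simp flip: shift_add add: left_diff_distrib)
  qed
qed

lemma good_shift: "good 0 (shift m)"
proof -
  have "good (0 + (0 + 0)) (shift (\<lambda>j. m 0 * unit_vec3 0 j) \<circ>
     (shift (\<lambda>j. m 1 * unit_vec3 1 j) \<circ> shift (\<lambda>j. m 2 * unit_vec3 2 j)))"
    by (intro good_comp good_shift_unit) simp_all
  then have "good 0 (shift (\<lambda>j. m 0 * unit_vec3 0 j + (m 1 * unit_vec3 1 j + m 2 * unit_vec3 2 j)))"
    by (simp flip: shift_add)
  moreover have "shift (\<lambda>j. m 0 * unit_vec3 0 j + (m 1 * unit_vec3 1 j + m 2 * unit_vec3 2 j)) = shift m"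
    by (rule shift_cong) (auto simp: unit_vec3_def less_3_iff)
  ultimately show ?thesis by simp
qed

text \<open>The generators therefore produce all of \<open>\<Gamma>\<close>, and \<open>q\<close> is
  forced to read off the exponent of the dilation.\<close>

lemma good_all: "good k (shift m \<circ> scale k)"
proof -
  have "good (0 + k) (shift m \<circ> scale k)" by (rule good_comp[OF good_shift good_scale])
  then show ?thesis by simp
qed

lemma orbit_Gr:
  assumes n: "1 \<le> n" and x: "x \<in> HxC"
  shows "orbit (Gr\<lparr>carrier := {g \<in> carrier Gr. int n dvd q g}\<rparr>) (\<lambda>g. g) x =
     {shift m (scale (int n * k) x) | m k. True}"
proof (intro equalityI subsetI)
  fix y assume "y \<in> orbit (Gr\<lparr>carrier := {g \<in> carrier Gr. int n dvd q g}\<rparr>) (\<lambda>g. g) x"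
  then obtain g where g: "g \<in> carrier Gr" "int n dvd q g" "y = g x" by (auto simp: orbit_def)
  have "carrier Gr \<subseteq> R ` \<Gamma>"
    unfolding carrier_Gr by (rule group.generate_subgroup_incl[OF BG_group generators_sub R_subgroup])
  then obtain \<gamma> where \<gamma>: "\<gamma> \<in> \<Gamma>" "g = R \<gamma>" using g(1) by auto
  obtain m l where ml: "\<gamma> = shift m \<circ> scale l" using \<gamma>(1) unfolding \<Gamma>_def by auto
  have "good l (shift m \<circ> scale l)" by (rule good_all)
  then have "q g = l" unfolding good_def \<gamma>(2) ml by simp
  then obtain k where "l = int n * k" using g(2) by (auto elim: dvdE)
  then have "y = shift m (scale (int n * k) x)" using g(3) x by (simp add: \<gamma>(2) ml R_def)
  then show "y \<in> {shift m (scale (int n * k) x) | m k. True}" by blast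
next
  fix y assume "y \<in> {shift m (scale (int n * k) x) | m k. True}"
  then obtain m k where y: "y = shift m (scale (int n * k) x)" by auto
  let ?g = "R (shift m \<circ> scale (int n * k))"
  have "good (int n * k) (shift m \<circ> scale (int n * k))" by (rule good_all)
  then have "?g \<in> carrier Gr" "q ?g = int n * k" by (auto simp: good_def)
  moreover have "y = ?g x" using x y by (simp add: R_def)
  ultimately show "y \<in> orbit (Gr\<lparr>carrier := {g \<in> carrier Gr. int n dvd q g}\<rparr>) (\<lambda>g. g) x"
    unfolding orbit_def by (intro CollectI exI[of _ ?g]) simp
qed

end

end

lemma inoue_torsion_growth:
  fixes X :: "nat \<Rightarrow> (complex \<times> complex) set topology" and f :: "rat poly"
  assumes data: "inoue_data M \<alpha> \<beta> a b" and q: "inoue_q \<alpha> \<beta> a b q"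
    and X: "X = cyclic_cover (top_of_set HxC) (inoue_group \<alpha> \<beta> a b) (\<lambda>g. g) q"
    and f: "matrix_minimal_poly M f"
  shows
    "(\<forall>n\<ge>1. \<forall>r\<in>{0..4}. finite (torsion_part (homology_group r (X n)))) \<and>
     (\<forall>r\<in>{1, 2}. (\<lambda>n. ln (real (torsion_order r (X n))))
        \<sim>[at_top] (\<lambda>n. real n * ln (mahler_measure_poly (map_poly of_rat f)))) \<and>
     (\<forall>r\<in>{0, 3, 4}. (\<lambda>n. ln (real (torsion_order r (X n)))) \<sim>[at_top] (\<lambda>n. 0)) \<and>
     1 < mahler_measure_poly (map_poly of_rat f) \<and>
     (\<forall>r\<in>{1, 2}. \<exists>C D::real. 1 < C \<and>
        (\<forall>\<^sub>F n in at_top. C ^ n \<le> real (torsion_order r (X n)) \<and>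
                           real (torsion_order r (X n)) \<le> D ^ n))"
proof -
  interpret spectral_data "\<lambda>i j. M $$ (i, j)" \<alpha> \<beta> "\<lambda>i. a $ i" "\<lambda>i. b $ i"
    by (rule inoue_spectral_data[OF data])
  have dil: "inoue_dilation \<alpha> \<beta> = S.R (S.scale 1)"
    by (simp add: inoue_dilation_def S.R_def S.scale_def)
  have trans: "inoue_translation (a $ i) (b $ i) = S.R (S.shift (unit_vec3 i))" if "i < 3" for i
  proof -
    have "lattice_shift (\<lambda>i. a $ i) (unit_vec3 i) = a $ i" "lattice_shift (\<lambda>i. b $ i) (unit_vec3 i) = b $ i"
      using that unfolding less_3_iff
      by (elim disjE; simp add: lattice_shift_def unit_vec3_def sum_lessThan_3 numeral_2_eq_2)+
    then show ?thesis by (simp add: inoue_translation_def S.R_def S.shift_def)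
  qed
  have gens: "insert (inoue_dilation \<alpha> \<beta>) ((\<lambda>i. inoue_translation (a $ i) (b $ i)) ` {..<3}) = S.generators"
    unfolding S.generators_def dil using trans by (intro arg_cong2[of _ _ _ _ insert] image_cong) auto
  have grp: "inoue_group \<alpha> \<beta> a b = S.Gr" unfolding inoue_group_def gens ..
  have hom: "q \<in> hom S.Gr integer_group" and q1: "q (S.R (S.scale 1)) = 1"
    and q0: "\<And>i. i < 3 \<Longrightarrow> q (S.R (S.shift (unit_vec3 i))) = 0"
    using q trans unfolding inoue_q_def grp dil by auto
  show ?thesis
  proof (rule torsion_growth_orbits[OF inoue_min_poly[OF data f]])
    show "X n = orbit_space (top_of_set HxC) (S.Gr\<lparr>carrier := {g \<in> carrier S.Gr. int n dvd q g}\<rparr>) (\<lambda>g. g)" for n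
      unfolding X cyclic_cover_def grp ..
    show "orbit (S.Gr\<lparr>carrier := {g \<in> carrier S.Gr. int n dvd q g}\<rparr>) (\<lambda>g. g) x =
        {S.shift m (S.scale (int n * k) x) | m k. True}" if "1 \<le> n" "x \<in> HxC" for n x
      by (rule S.orbit_Gr[OF hom q1 q0 that])
  qed
qed

section \<open>Algebraic integers\<close>

definition int_span :: "'k::field_char_0 set \<Rightarrow> 'k set" where
  "int_span G = {x. \<exists>c. x = (\<Sum>g\<in>G. of_int (c g) * g)}"

lemma int_span_add: "x \<in> int_span G \<Longrightarrow> y \<in> int_span G \<Longrightarrow> x + y \<in> int_span G"
proof -
  assume "x \<in> int_span G" "y \<in> int_span G"
  then obtain c d where "x = (\<Sum>g\<in>G. of_int (c g) * g)" "y = (\<Sum>g\<in>G. of_int (d g) * g)"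
    by (auto simp: int_span_def)
  then have "x + y = (\<Sum>g\<in>G. of_int (c g + d g) * g)" by (simp add: sum.distrib distrib_right)
  then show ?thesis unfolding int_span_def by (intro CollectI exI[of _ "\<lambda>g. c g + d g"])
qed

lemma int_span_scale: "x \<in> int_span G \<Longrightarrow> of_int k * x \<in> int_span G"
proof -
  assume "x \<in> int_span G"
  then obtain c where "x = (\<Sum>g\<in>G. of_int (c g) * g)" by (auto simp: int_span_def)
  then have "of_int k * x = (\<Sum>g\<in>G. of_int (k * c g) * g)" by (simp add: sum_distrib_left mult.assoc)
  then show ?thesis unfolding int_span_def by (intro CollectI exI[of _ "\<lambda>g. k * c g"])
qed

lemma int_span_sum: "(\<And>i. i \<in> I \<Longrightarrow> f i \<in> int_span G) \<Longrightarrow> sum f I \<in> int_span G"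
proof (induction I rule: infinite_finite_induct)
  case (insert i I)
  then show ?case by (simp add: int_span_add)
qed (auto simp: int_span_def intro!: exI[of _ "\<lambda>g. 0"])

lemma int_span_incl:
  assumes "finite G" "x \<in> G"
  shows "x \<in> int_span G"
proof -
  have "(\<Sum>g\<in>G. of_int (if g = x then 1 else 0) * g) = (\<Sum>g\<in>G. if g = x then g else 0)"
    by (intro sum.cong) auto
  also have "\<dots> = x" using assms by simp
  finally show ?thesis unfolding int_span_def by (intro CollectI exI) (rule sym)
qed

text \<open>The determinant trick: an element stabilizing a finitely generated group is a root of the
  characteristic polynomial of an integer matrix.\<close>

lemma algebraic_int_stable_int_span:
  fixes z :: "'k::field_char_0"
  assumes fin: "finite G" and nz: "g0 \<in> G" "g0 \<noteq> 0" and stable: "\<And>g. g \<in> G \<Longrightarrow> z * g \<in> int_span G"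
  shows "algebraic_int z"
proof -
  obtain e where e: "bij_betw e {0..<card G} G" using ex_bij_betw_nat_finite[OF fin] by blast
  have "\<forall>g\<in>G. \<exists>c. z * g = (\<Sum>h\<in>G. of_int (c h) * h)"
    using stable by (auto simp: int_span_def)
  then obtain c where c: "\<And>g. g \<in> G \<Longrightarrow> z * g = (\<Sum>h\<in>G. of_int (c g h) * h)" by metis
  define n where "n = card G"
  define A :: "int mat" where "A = Matrix.mat n n (\<lambda>(i, j). c (e i) (e j))"
  define w :: "'k Matrix.vec" where "w = Matrix.vec n e"
  have A: "A \<in> carrier_mat n n" "map_mat (of_int :: int \<Rightarrow> 'k) A \<in> carrier_mat n n" by (simp_all add: A_def)
  have eG: "i < n \<Longrightarrow> e i \<in> G" for i using e by (auto simp: n_def bij_betw_def)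
  have "(map_mat of_int A *\<^sub>v w) $ i = (z \<cdot>\<^sub>v w) $ i" if i: "i < n" for i
  proof -
    have "(map_mat of_int A *\<^sub>v w) $ i = (\<Sum>j\<in>{0..<n}. of_int (c (e i) (e j)) * e j)"
      using i by (simp add: A_def w_def scalar_prod_def)
    also have "\<dots> = (\<Sum>h\<in>G. of_int (c (e i) h) * h)"
      unfolding n_def by (rule sum.reindex_bij_betw[OF e])
    also have "\<dots> = z * e i" using c[OF eG[OF i]] by simp
    finally show ?thesis using i by (simp add: w_def)
  qed
  then have "map_mat of_int A *\<^sub>v w = z \<cdot>\<^sub>v w" by (intro eq_vecI) (auto simp: A_def w_def)
  moreover have "w \<noteq> 0\<^sub>v n"
  proof
    assume w0: "w = 0\<^sub>v n"
    have "g0 \<in> e ` {0..<n}" using bij_betw_imp_surj_on[OF e] nz(1) by (simp add: n_def)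
    then obtain i where i: "i < n" "e i = g0" by (elim imageE) simp
    have "w $ i = 0" using w0 i by simp
    then show False using i nz(2) by (simp add: w_def)
  qed
  ultimately have "eigenvalue (map_mat of_int A) z"
    unfolding eigenvalue_def eigenvector_def using A by (intro exI[of _ w]) (simp add: w_def)
  then have "poly (char_poly (map_mat of_int A)) z = 0" using eigenvalue_root_char_poly[OF A(2)] by simp
  then have "poly (map_poly of_int (char_poly A)) z = 0" by (simp add: of_int_hom.char_poly_hom[OF A(1)])
  moreover have "lead_coeff (char_poly A) = 1" using degree_monic_char_poly[OF A(1)] by simp
  ultimately show ?thesis unfolding algebraic_int_altdef_ipoly by blast
qed

lemma algebraic_int_power_expansion:
  fixes x :: "'k::field_char_0"
  assumes "algebraic_int x"
  obtains m c where "0 < m" "x ^ m = (\<Sum>i<m. of_int (c i) * x ^ i)"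
proof -
  obtain p where p: "poly (map_poly of_int p) x = 0" "lead_coeff p = (1::int)"
    using assms unfolding algebraic_int_altdef_ipoly by blast
  have "poly (map_poly of_int p) x = (\<Sum>i\<le>degree p. of_int (poly.coeff p i) * x ^ i)"
    by (simp add: poly_altdef coeff_map_poly degree_map_poly)
  also have "\<dots> = (\<Sum>i<degree p. of_int (poly.coeff p i) * x ^ i) + x ^ degree p"
    using p(2) by (simp add: lessThan_Suc_atMost[symmetric])
  finally have eq: "x ^ degree p = (\<Sum>i<degree p. of_int (- poly.coeff p i) * x ^ i)"
    using p(1) by (simp add: sum_negf eq_neg_iff_add_eq_0 add.commute)
  \<comment> \<open>In degree 0 the sum is empty and the equation would read 1 = 0.\<close>
  have "degree p \<noteq> 0" using eq by (cases "degree p = 0") auto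
  then show thesis using that[OF _ eq] by blast
qed

text \<open>The monomials with exponents below the degrees of the two monic relations generate the
  ring of \<open>x\<close> and \<open>y\<close> as a group; a power that becomes too large is
  rewritten by its relation.\<close>

lemma algebraic_int_common_module:
  fixes x y :: "'k::field_char_0"
  assumes x: "algebraic_int x" and y: "algebraic_int y"
  shows "\<exists>G. finite G \<and> 1 \<in> G \<and> (\<forall>g\<in>G. x * g \<in> int_span G \<and> y * g \<in> int_span G)"
proof -
  obtain m c where m: "0 < m" "x ^ m = (\<Sum>i<m. of_int (c i) * x ^ i)" by (rule algebraic_int_power_expansion[OF x])
  obtain n d where n: "0 < n" "y ^ n = (\<Sum>j<n. of_int (d j) * y ^ j)" by (rule algebraic_int_power_expansion[OF y])
  define G where "G = (\<lambda>(i, j). x ^ i * y ^ j) ` ({..<m} \<times> {..<n})"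
  have fin: "finite G" by (simp add: G_def)
  have mem: "x ^ i * y ^ j \<in> int_span G" if "i < m" "j < n" for i j
    by (rule int_span_incl[OF fin]) (use that in \<open>auto simp: G_def\<close>)
  have mem_x: "x ^ i * y ^ j \<in> int_span G" if "i \<le> m" "j < n" for i j
  proof (cases "i = m")
    case True
    have "x ^ i * y ^ j = (\<Sum>i<m. of_int (c i) * (x ^ i * y ^ j))"
      unfolding True m(2) by (simp add: sum_distrib_right mult.assoc)
    also have "\<dots> \<in> int_span G" using that by (intro int_span_sum int_span_scale mem) auto
    finally show ?thesis .
  qed (use that mem in auto)
  have mem_y: "x ^ i * y ^ j \<in> int_span G" if "i < m" "j \<le> n" for i j
  proof (cases "j = n")
    case True
    have "x ^ i * y ^ j = (\<Sum>j<n. of_int (d j) * (x ^ i * y ^ j))"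
      unfolding True n(2) by (simp add: sum_distrib_left mult_ac)
    also have "\<dots> \<in> int_span G" using that by (intro int_span_sum int_span_scale mem) auto
    finally show ?thesis .
  qed (use that mem in auto)
  show ?thesis
  proof (intro exI[of _ G] conjI ballI fin)
    show "1 \<in> G" unfolding G_def using m(1) n(1) by (intro image_eqI[of _ _ "(0, 0)"]) auto
    fix g assume "g \<in> G"
    then obtain i j where ij: "i < m" "j < n" "g = x ^ i * y ^ j" by (auto simp: G_def)
    have x': "x * g = x ^ Suc i * y ^ j" by (simp add: ij mult.assoc)
    show "x * g \<in> int_span G" unfolding x' by (rule mem_x) (use ij(1,2) in simp_all)
    have y': "y * g = x ^ i * y ^ Suc j" by (simp add: ij mult.left_commute)
    show "y * g \<in> int_span G" unfolding y' by (rule mem_y) (use ij(1,2) in simp_all)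
  qed
qed

text \<open>Sum and product stabilize the common module of \<open>x\<close> and \<open>y\<close>, so
  the determinant trick applies to both.\<close>

lemma algebraic_int_add_mult:
  fixes x y :: "'k::field_char_0"
  assumes x: "algebraic_int x" and y: "algebraic_int y"
  shows algebraic_int_add: "algebraic_int (x + y)" and algebraic_int_mult: "algebraic_int (x * y)"
proof -
  obtain G where fin: "finite G" and one: "1 \<in> G" and Gxy: "\<forall>g\<in>G. x * g \<in> int_span G \<and> y * g \<in> int_span G"
    using algebraic_int_common_module[OF x y] by (elim exE conjE)
  have Gx: "x * g \<in> int_span G" and Gy: "y * g \<in> int_span G" if "g \<in> G" for g using Gxy that by simp_all
  show "algebraic_int (x + y)"
    by (rule algebraic_int_stable_int_span[OF fin one one_neq_zero])
      (simp add: distrib_right int_span_add Gx Gy)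
  show "algebraic_int (x * y)"
  proof (rule algebraic_int_stable_int_span[OF fin one one_neq_zero])
    fix g assume "g \<in> G"
    then obtain c where c: "y * g = (\<Sum>h\<in>G. of_int (c h) * h)" using Gy by (auto simp: int_span_def)
    have "x * y * g = (\<Sum>h\<in>G. of_int (c h) * (x * h))"
      unfolding mult.assoc c sum_distrib_left by (simp add: mult.left_commute)
    also have "\<dots> \<in> int_span G" by (intro int_span_sum int_span_scale Gx)
    finally show "x * y * g \<in> int_span G" .
  qed
qed

lemma algebraic_int_diff:
  fixes x y :: "'k::field_char_0"
  assumes "algebraic_int x" "algebraic_int y"
  shows "algebraic_int (x - y)"
  using algebraic_int_add[of x "- y"] assms by simp

lemma field_hom_of_rat:
  fixes \<sigma> :: "'a::field_char_0 \<Rightarrow> 'b::field_char_0"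
  assumes "field_hom \<sigma>"
  shows "\<sigma> (of_rat r) = of_rat r"
proof -
  interpret field_hom \<sigma> by fact
  have int: "\<sigma> (of_int k) = of_int k" for k by (rule hom_of_int)
  obtain a b where ab: "quotient_of r = (a, b)" by (cases "quotient_of r")
  show ?thesis unfolding quotient_of_div[OF ab] of_rat_divide of_rat_of_int_eq
    by (simp only: divide_inverse hom_mult hom_inverse int)
qed

lemma field_hom_poly_root:
  fixes \<sigma> :: "'a::field_char_0 \<Rightarrow> 'b::field_char_0" and g :: "rat poly"
  assumes hom: "field_hom \<sigma>" and root: "poly (map_poly of_rat g) x = 0"
  shows "poly (map_poly of_rat g) (\<sigma> x) = 0"
proof -
  interpret field_hom \<sigma> by fact
  have "0 = \<sigma> (poly (map_poly of_rat g) x)" using root by simp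
  also have "\<dots> = \<sigma> (\<Sum>i\<le>degree g. of_rat (poly.coeff g i) * x ^ i)"
    by (simp add: poly_altdef coeff_map_poly degree_map_poly)
  also have "\<dots> = (\<Sum>i\<le>degree g. of_rat (poly.coeff g i) * \<sigma> x ^ i)"
    by (simp only: hom_sum hom_mult hom_power field_hom_of_rat[OF hom])
  also have "\<dots> = poly (map_poly of_rat g) (\<sigma> x)"
    by (simp add: poly_altdef coeff_map_poly degree_map_poly)
  finally show ?thesis ..
qed

lemma field_hom_algebraic_int:
  fixes \<sigma> :: "'a::field_char_0 \<Rightarrow> 'b::field_char_0"
  assumes hom: "field_hom \<sigma>" and x: "algebraic_int x"
  shows "algebraic_int (\<sigma> x)"
proof -
  obtain p where p: "poly (map_poly of_int p) x = 0" "lead_coeff p = (1::int)"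
    using x unfolding algebraic_int_altdef_ipoly by blast
  have rat: "map_poly of_int p = map_poly of_rat (map_poly rat_of_int p :: rat poly)" for p
    by (simp add: map_poly_map_poly o_def)
  show ?thesis
    unfolding algebraic_int_altdef_ipoly
    using field_hom_poly_root[OF hom, of "map_poly rat_of_int p" x] p unfolding rat[symmetric] by (intro exI[of _ p]) simp
qed

section \<open>Units of cubic fields\<close>

lemma dim_3_relation:
  fixes x :: "nat \<Rightarrow> 'k::field_char_0"
  assumes dim: "vector_space.dim (\<lambda>(c::rat) (x::'k). of_rat c * x) UNIV = 3"
  shows "\<exists>r. (\<exists>i<4. r i \<noteq> (0::rat)) \<and> (\<Sum>i<4. of_rat (r i) * x i) = 0"
proof (cases "inj_on x {..<4}")
  case True
  interpret V: vector_space "\<lambda>(c::rat) (x::'k). of_rat c * x"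
    by unfold_locales (simp_all add: of_rat_add of_rat_mult algebra_simps)
  obtain B where B: "UNIV \<subseteq> V.span B" "card B = V.dim UNIV"
    by (rule V.basis_exists[of UNIV]) blast
  have card: "card B = 3" using B(2) dim by simp
  then have "finite B" using card.infinite by fastforce
  have "\<not> V.independent (x ` {..<4})"
  proof
    assume "V.independent (x ` {..<4})"
    then have "card (x ` {..<4}) \<le> card B"
      using V.independent_span_bound[OF \<open>finite B\<close>] B(1) by blast
    then show False using card_image[OF True] card by simp
  qed
  then obtain u where u: "\<exists>w\<in>x ` {..<4}. u w \<noteq> 0" "(\<Sum>w\<in>x ` {..<4}. of_rat (u w) * w) = 0"
    using V.dependent_finite[of "x ` {..<4}"] by auto
  have "(\<Sum>i<4. of_rat (u (x i)) * x i) = 0" using u(2) by (simp add: sum.reindex[OF True])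
  with u(1) show ?thesis by (intro exI[of _ "\<lambda>i. u (x i)"]) auto
next
  \<comment> \<open>A repeated value of the family gives the relation with coefficients 1 and
    -1.\<close>
  case False
  then obtain i j where ij: "i < 4" "j < 4" "i \<noteq> j" "x i = x j" by (auto simp: inj_on_def)
  have "(\<Sum>k<4. of_rat (if k = i then 1 else if k = j then - 1 else 0) * x k) =
      (\<Sum>k<4. (if k = i then x k else 0) - (if k = j then x k else 0))"
    using ij(3) by (intro sum.cong) auto
  also have "\<dots> = x i - x j" using ij(1,2) by (simp add: sum_subtractf)
  finally show ?thesis
    using ij(1,4) by (intro exI[of _ "\<lambda>k. if k = i then 1 else if k = j then - 1 else 0"]) auto
qed

lemma dim_3_not_spanned:
  fixes x y :: "'k::field_char_0"
  assumes dim: "vector_space.dim (\<lambda>(c::rat) (x::'k). of_rat c * x) UNIV = 3"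
  shows "\<exists>z. \<forall>r s. z \<noteq> of_rat r * x + of_rat s * y"
proof (rule ccontr)
  interpret V: vector_space "\<lambda>(c::rat) (x::'k). of_rat c * x"
    by unfold_locales (simp_all add: of_rat_add of_rat_mult algebra_simps)
  assume span: "\<not> (\<exists>z. \<forall>r s. z \<noteq> of_rat r * x + of_rat s * y)"
  have "z \<in> V.span {x, y}" for z
  proof -
    obtain r s where z: "z = of_rat r * x + of_rat s * y" using span by blast
    show ?thesis unfolding z by (intro V.span_add V.span_scale V.span_base) auto
  qed
  then have "V.dim UNIV \<le> card {x, y}" by (intro V.dim_le_card) auto
  then show False using dim card_insert_le_m1[of 2 "{y}" x] by simp
qed

lemma of_int_adj3: "of_int (adj3 C k j) = (adj3 (\<lambda>i j. of_int (C i j)) k j :: 'b::comm_ring_1)"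
  by (simp add: adj3_def minor2_def)

lemma algebraic_int_power: "algebraic_int x \<Longrightarrow> algebraic_int (x ^ n)" for x :: "'k::field_char_0"
  by (induction n) (simp_all add: algebraic_int_mult)

lemma sum_lessThan_4: "(\<Sum>j<4. f j) = f 0 + f (Suc 0) + f 2 + f 3" for f :: "nat \<Rightarrow> 'b::comm_monoid_add"
  by (simp add: numeral_eq_Suc)

lemma solve_for_last:
  fixes z0 :: "'a::ab_group_add"
  assumes "z0 + z1 + z2 + z3 = 0"
  shows "z3 = - z0 - z1 - z2"
proof -
  have "z3 = (z0 + z1 + z2 + z3) - z0 - z1 - z2" by (simp add: algebra_simps)
  then show ?thesis unfolding assms by simp
qed

locale cubic_unit =
  fixes \<sigma>1 :: "'k::field_char_0 \<Rightarrow> real" and \<sigma>2 :: "'k \<Rightarrow> complex" and v :: 'k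
  assumes cubic: "cubic_field_data \<sigma>1 \<sigma>2"
    and v_int: "algebraic_int v" and v_inv: "algebraic_int (inverse v)"
    and v_pos: "0 < \<sigma>1 v" and v_neq: "v \<noteq> 1"
begin

lemma dim: "vector_space.dim (\<lambda>(c::rat) (x::'k). of_rat c * x) UNIV = 3"
  and hom1: "field_hom \<sigma>1" and hom2: "field_hom \<sigma>2" and \<sigma>2_nonreal: "\<sigma>2 \<noteq> cnj \<circ> \<sigma>2"
  using cubic by (auto simp: cubic_field_data_def)

definition emb :: "nat \<Rightarrow> 'k \<Rightarrow> complex" where
  "emb s = (if s = 0 then complex_of_real \<circ> \<sigma>1 else if s = 1 then \<sigma>2 else cnj \<circ> \<sigma>2)"

lemma emb_hom: "field_hom (emb s)"
proof -
  have "{complex_of_real \<circ> \<sigma>1, \<sigma>2, cnj \<circ> \<sigma>2} = {\<tau>. field_hom \<tau>}"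
    using cubic by (simp add: cubic_field_data_def)
  moreover have "emb s \<in> {complex_of_real \<circ> \<sigma>1, \<sigma>2, cnj \<circ> \<sigma>2}" by (simp add: emb_def)
  ultimately have "emb s \<in> {\<tau>. field_hom \<tau>}" by simp
  then show ?thesis by (rule CollectD)
qed

lemma emb_add: "emb s (x + y) = emb s x + emb s y"
  and emb_mult: "emb s (x * y) = emb s x * emb s y"
  and emb_power: "emb s (x ^ n) = emb s x ^ n"
  and emb_1: "emb s 1 = 1"
  and emb_of_int: "emb s (of_int k) = of_int k"
  and emb_eq_0_iff: "emb s x = 0 \<longleftrightarrow> x = 0"
  and emb_sum: "emb s (sum f A) = (\<Sum>a\<in>A. emb s (f a))"
proof -
  interpret field_hom "emb s" by (rule emb_hom)
  show "emb s (x + y) = emb s x + emb s y" "emb s (x * y) = emb s x * emb s y"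
    "emb s 1 = 1" "emb s (x ^ n) = emb s x ^ n" "emb s (of_int k) = of_int k"
    "emb s (sum f A) = (\<Sum>a\<in>A. emb s (f a))"
    by (rule hom_add hom_mult hom_one hom_power hom_of_int hom_sum)+
  show "emb s x = 0 \<longleftrightarrow> x = 0" by (rule hom_0_iff)
qed

lemma emb_of_rat: "emb s (of_rat r) = of_rat r"
  by (rule field_hom_of_rat[OF emb_hom])

lemma v_nz: "v \<noteq> 0"
proof
  interpret field_hom \<sigma>1 by (rule hom1)
  assume "v = 0"
  then show False using v_pos by simp
qed

text \<open>A rational unit is 1 or -1; positivity of \<open>\<sigma>1 v\<close> excludes -1 and
  \<open>v_neq\<close> excludes 1.\<close>

lemma v_irrational: "v \<notin> \<rat>"
proof
  assume rat: "v \<in> \<rat>"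
  then have rat': "inverse v \<in> \<rat>" by simp
  obtain m where m: "v = of_int m" using rational_algebraic_int_is_int[OF v_int rat] by (rule Ints_cases)
  obtain k where k: "inverse v = of_int k" using rational_algebraic_int_is_int[OF v_inv rat'] by (rule Ints_cases)
  note mk = m k
  have "of_int (m * k) = (1::'k)" using right_inverse[OF v_nz] unfolding mk(2) by (simp only: mk(1) of_int_mult)
  then have "m * k = 1" by (simp only: of_int_eq_1_iff)
  then have "m = 1 \<or> m = - 1" by (simp only: zmult_eq_1_iff) blast
  moreover have "m \<noteq> 1" using v_neq mk(1) by auto
  ultimately have "m = - 1" by simp
  moreover have "\<sigma>1 v = of_int m"
  proof -
    interpret field_hom \<sigma>1 by (rule hom1)
    show ?thesis unfolding mk(1) by (rule hom_of_int)
  qed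
  ultimately show False using v_pos by simp
qed

lemma v_linear_independent:
  assumes "of_rat p + of_rat q * v = 0"
  shows "p = 0 \<and> q = 0"
proof (cases "q = 0")
  case False
  have "of_rat q * v = of_rat (- p)"
    using solve_for_last[of 0 0 "of_rat p" "of_rat q * v"] assms by (simp add: of_rat_minus)
  then have "v = of_rat (- p) / of_rat q" using False by (simp add: nonzero_eq_divide_eq mult.commute)
  also have "\<dots> = of_rat (- p / q)" by (simp only: of_rat_divide)
  finally have "v \<in> \<rat>" by (simp only: Rats_of_rat)
  with v_irrational show ?thesis by (rule notE)
qed (use assms in simp)

text \<open>A quadratic \<open>v\<close> would span a subfield of dimension 2, and the dimension of the field over the
  rationals would be even.\<close>

lemma v_not_quadratic: "v ^ 2 \<noteq> of_rat p + of_rat q * v"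
proof
  assume quad: "v ^ 2 = of_rat p + of_rat q * v"
  \<comment> \<open>With \<open>y\<close> outside the span of 1 and \<open>v\<close>, the elements
    1, \<open>v\<close>, \<open>y\<close> and \<open>v * y\<close> are four vectors in dimension 3;
    every relation among them will put \<open>y\<close> back into that span.\<close>
  obtain y where "\<forall>r s. y \<noteq> of_rat r * 1 + of_rat s * v" using dim_3_not_spanned[OF dim, of 1 v] by (elim exE)
  then have y: "y \<noteq> of_rat r * 1 + of_rat s * v" for r s by (elim allE)
  obtain r :: "nat \<Rightarrow> rat" where rr: "(\<exists>i<4. r i \<noteq> 0) \<and>
      (\<Sum>i<4. of_rat (r i) * (if i = 0 then 1 else if i = 1 then v else if i = 2 then y else v * y)) = 0"
    using dim_3_relation[OF dim, of "\<lambda>i. if i = 0 then 1 else if i = 1 then v else if i = 2 then y else v * y"] ..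
  note r = conjunct1[OF rr] conjunct2[OF rr]
  have rel: "of_rat (r 0) + of_rat (r 1) * v + of_rat (r 2) * y + of_rat (r 3) * (v * y) = 0"
    using r(2) by (simp add: sum_lessThan_4)
  show False
  proof (cases "r 3 = 0")
    case True
    show False
    proof (cases "r 2 = 0")
      case True
      with \<open>r 3 = 0\<close> rel have "r 0 = 0 \<and> r 1 = 0" by (intro v_linear_independent) simp
      with \<open>r 3 = 0\<close> True show False using r(1) by (auto simp: numeral_eq_Suc less_Suc_eq)
    next
      case False
      have "of_rat (r 2) * y = - of_rat (r 0) - of_rat (r 1) * v"
        using solve_for_last[of 0 "of_rat (r 0)" "of_rat (r 1) * v" "of_rat (r 2) * y"] rel True by simp
      then have "y = (- of_rat (r 0) - of_rat (r 1) * v) / of_rat (r 2)"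
        using False by (simp add: nonzero_eq_divide_eq mult.commute)
      then have "y = of_rat (- r 0 / r 2) * 1 + of_rat (- r 1 / r 2) * v"
        by (simp add: of_rat_divide of_rat_minus diff_divide_distrib)
      from y this show False by (rule notE)
    qed
  next
    case False
    define a b c where "a = - r 0 / r 3" and "b = - r 1 / r 3" and "c = - r 2 / r 3"
    define t where "t = p - c\<^sup>2 + c * q"
    have abc: "- r 0 = a * r 3" "- r 1 = b * r 3" "- r 2 = c * r 3" using False by (simp_all add: a_def b_def c_def)
    have "of_rat (r 3) * (v * y) = of_rat (- r 0) + of_rat (- r 1) * v + of_rat (- r 2) * y"
      using solve_for_last[OF rel] by (simp add: of_rat_minus)
    then have "of_rat (r 3) * (v * y) = of_rat (r 3) * (of_rat a + of_rat b * v + of_rat c * y)"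
      unfolding abc by (simp add: of_rat_mult algebra_simps)
    then have "v * y = of_rat a + of_rat b * v + of_rat c * y" using False by simp
    then have vy: "(v - of_rat c) * y = of_rat a + of_rat b * v" by (simp add: algebra_simps)
    \<comment> \<open>The second factor is, up to sign, the conjugate of the first in the quadratic
      field, so the product is rational and dividing by \<open>v - of_rat c\<close> stays in the
      span of 1 and \<open>v\<close>.\<close>
    have "(v - of_rat c) * (v + of_rat (c - q)) = v ^ 2 - of_rat q * v - of_rat (c * (c - q))"
      by (simp add: algebra_simps power2_eq_square of_rat_mult of_rat_diff)
    also have "\<dots> = of_rat t" unfolding quad t_def
      by (simp add: of_rat_mult of_rat_diff of_rat_add algebra_simps power2_eq_square)
    finally have t: "(v - of_rat c) * (v + of_rat (c - q)) = of_rat t" .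
    have "v - of_rat c \<noteq> 0" using v_linear_independent[of "- c" 1] by (auto simp: of_rat_minus)
    moreover have "v + of_rat (c - q) \<noteq> 0" using v_linear_independent[of "c - q" 1] by (auto simp: add.commute)
    ultimately have "t \<noteq> 0" using t by auto
    have "of_rat t * y = (of_rat a + of_rat b * v) * (v + of_rat (c - q))"
      unfolding t[symmetric] vy[symmetric] by (simp add: mult_ac)
    also have "\<dots> = of_rat a * of_rat (c - q) + (of_rat a + of_rat b * of_rat (c - q)) * v + of_rat b * v ^ 2"
      by (simp add: algebra_simps power2_eq_square)
    also have "\<dots> = of_rat (a * (c - q) + b * p) + of_rat (a + b * c) * v"
      unfolding quad by (simp add: of_rat_mult of_rat_diff of_rat_add algebra_simps)
    finally have "y = (of_rat (a * (c - q) + b * p) + of_rat (a + b * c) * v) / of_rat t"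
      using \<open>t \<noteq> 0\<close> by (simp add: nonzero_eq_divide_eq mult.commute)
    moreover have "(of_rat A + of_rat B * v) / of_rat t = of_rat (A / t) * 1 + of_rat (B / t) * v" for A B
      by (simp add: of_rat_divide add_divide_distrib)
    ultimately have "y = of_rat ((a * (c - q) + b * p) / t) * 1 + of_rat ((a + b * c) / t) * v" by (simp only:)
    from y this show False by (rule notE)
  qed
qed

text \<open>1, \<open>v\<close> and the square of \<open>v\<close> are independent, so a relation
  with a fourth element must involve that element.\<close>

lemma v_span: "\<exists>p q r. x = of_rat p + of_rat q * v + of_rat r * v ^ 2"
proof -
  obtain r :: "nat \<Rightarrow> rat" where rr: "(\<exists>i<4. r i \<noteq> 0) \<and>
      (\<Sum>i<4. of_rat (r i) * (if i = 0 then 1 else if i = 1 then v else if i = 2 then v ^ 2 else x)) = 0"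
    using dim_3_relation[OF dim, of "\<lambda>i. if i = 0 then 1 else if i = 1 then v else if i = 2 then v ^ 2 else x"] ..
  note r = conjunct1[OF rr] conjunct2[OF rr]
  have rel: "of_rat (r 0) + of_rat (r 1) * v + of_rat (r 2) * v ^ 2 + of_rat (r 3) * x = 0"
    using r(2) by (simp add: sum_lessThan_4)
  have r3: "r 3 \<noteq> 0"
  proof
    assume r3: "r 3 = 0"
    show False
    proof (cases "r 2 = 0")
      case True
      with r3 rel have "r 0 = 0 \<and> r 1 = 0" by (intro v_linear_independent) simp
      with r3 True show False using r(1) by (auto simp: numeral_eq_Suc less_Suc_eq)
    next
      case False
      have "of_rat (r 2) * v ^ 2 = - of_rat (r 0) - of_rat (r 1) * v"
        using solve_for_last[of 0 "of_rat (r 0)" "of_rat (r 1) * v" "of_rat (r 2) * v ^ 2"] rel r3 by simp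
      then have "v ^ 2 = (- of_rat (r 0) - of_rat (r 1) * v) / of_rat (r 2)"
        using False by (simp add: nonzero_eq_divide_eq mult.commute)
      then have "v ^ 2 = of_rat (- r 0 / r 2) + of_rat (- r 1 / r 2) * v"
        by (simp add: of_rat_divide of_rat_minus diff_divide_distrib)
      from v_not_quadratic this show False by (rule notE)
    qed
  qed
  have "of_rat (r 3) * x = - of_rat (r 0) - of_rat (r 1) * v - of_rat (r 2) * v ^ 2"
    by (rule solve_for_last[OF rel])
  then have "x = (- of_rat (r 0) - of_rat (r 1) * v - of_rat (r 2) * v ^ 2) / of_rat (r 3)"
    using r3 by (simp add: nonzero_eq_divide_eq mult.commute)
  then have "x = of_rat (- r 0 / r 3) + of_rat (- r 1 / r 3) * v + of_rat (- r 2 / r 3) * v ^ 2"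
    by (simp add: of_rat_divide of_rat_minus diff_divide_distrib)
  then show ?thesis by (intro exI)
qed

text \<open>By \<open>v_span\<close> the element \<open>v\<close> generates the field, so a real
  value at \<open>v\<close> would make \<open>\<sigma>2\<close> equal to its conjugate.\<close>

lemma \<sigma>2_v: "\<sigma>2 v \<notin> \<real>"
proof
  assume real: "\<sigma>2 v \<in> \<real>"
  have "\<sigma>2 x = cnj (\<sigma>2 x)" for x
  proof -
    obtain p q r where x: "x = of_rat p + of_rat q * v + of_rat r * v ^ 2" using v_span[of x] by (elim exE)
    have "emb 1 x = of_rat p + of_rat q * emb 1 v + of_rat r * emb 1 v ^ 2"
      unfolding x by (simp only: emb_add emb_mult emb_power emb_of_rat)
    moreover have rat: "complex_of_rat s \<in> \<real>" for s
    proof -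
      have "complex_of_real (of_rat s) = of_rat s" by (rule field_hom_of_rat[OF of_real_hom.field_hom_axioms])
      then show ?thesis by (rule subst) (rule Reals_of_real)
    qed
    moreover have "emb 1 v \<in> \<real>" using real by (simp add: emb_def)
    ultimately have "emb 1 x \<in> \<real>" by (simp only: Reals_add Reals_mult Reals_power rat)
    then show ?thesis by (simp add: emb_def Reals_cnj_iff)
  qed
  then have "\<sigma>2 = cnj \<circ> \<sigma>2" by (intro ext) simp
  then show False using \<sigma>2_nonreal by blast
qed

lemma emb_v_distinct: "emb 0 v \<noteq> emb 1 v" "emb 0 v \<noteq> emb 2 v" "emb 1 v \<noteq> emb 2 v"
proof -
  show "emb 0 v \<noteq> emb 1 v" using \<sigma>2_v by (auto simp: emb_def) (metis Reals_of_real)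
  show "emb 1 v \<noteq> emb 2 v" using \<sigma>2_v by (simp add: emb_def) (metis Reals_cnj_iff)
  show "emb 0 v \<noteq> emb 2 v" using \<sigma>2_v by (simp add: emb_def) (metis Reals_of_real complex_cnj_cnj complex_cnj_complex_of_real)
qed

section \<open>The trace and an integral basis of the field\<close>

lemma cubic_polynomial: "\<exists>g :: rat poly. lead_coeff g = 1 \<and> degree g = 3 \<and> poly (map_poly of_rat g) v = 0"
proof -
  obtain p q r where v3: "v ^ 3 = of_rat p + of_rat q * v + of_rat r * v ^ 2" using v_span[of "v ^ 3"] by (elim exE)
  have "poly (map_poly of_rat [:- p, - q, - r, 1:]) v = v ^ 3 - (of_rat p + of_rat q * v + of_rat r * v ^ 2)"
    by (simp add: map_poly_pCons of_rat_minus algebra_simps power2_eq_square power3_eq_cube)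
  also have "\<dots> = 0" using v3 by simp
  finally show ?thesis by (intro exI[of _ "[:- p, - q, - r, 1:]"]) simp
qed

text \<open>The field trace as a sum over the three embeddings; that its values are rational is
  proved below by symmetric functions.\<close>

definition tr :: "'k \<Rightarrow> complex" where
  "tr x = (\<Sum>s<3. emb s x)"

lemma v_power_sums_rational: "tr v \<in> \<rat>" "tr (v ^ 2) \<in> \<rat>"
proof -
  obtain g :: "rat poly" where g: "lead_coeff g = 1 \<and> degree g = 3 \<and> poly (map_poly of_rat g) v = 0"
    using cubic_polynomial by (elim exE)
  let ?x = "emb 0 v" and ?y = "emb 1 v" and ?z = "emb 2 v"
  have root: "poly (map_poly of_rat g) (emb s v) = 0" for s
    using field_hom_poly_root[OF emb_hom] g by simp
  have "map_poly complex_of_rat g = [:- ?x, 1:] * [:- ?y, 1:] * [:- ?z, 1:]"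
  proof (rule monic_cubic_roots[OF _ _ root root root emb_v_distinct])
    have deg: "degree (map_poly complex_of_rat g) = degree g" by (simp add: degree_map_poly)
    show "lead_coeff (map_poly complex_of_rat g) = 1"
      unfolding deg by (simp add: coeff_map_poly conjunct1[OF g])
    show "degree (map_poly complex_of_rat g) \<le> 3" unfolding deg using g by simp
  qed
  also have "\<dots> = [:- (?x * ?y * ?z), ?x * ?y + ?x * ?z + ?y * ?z, - (?x + ?y + ?z), 1:]"
    by (simp add: algebra_simps)
  finally have F: "map_poly complex_of_rat g = [:- (?x * ?y * ?z), ?x * ?y + ?x * ?z + ?y * ?z, - (?x + ?y + ?z), 1:]" .
  have rat: "poly.coeff (map_poly complex_of_rat g) i \<in> \<rat>" for i by (simp add: coeff_map_poly)
  have e1: "- (?x + ?y + ?z) \<in> \<rat>" using rat[of 2] unfolding F by (simp add: numeral_2_eq_2)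
  have e2: "?x * ?y + ?x * ?z + ?y * ?z \<in> \<rat>" using rat[of 1] unfolding F by simp
  have tr: "tr v = - (- (?x + ?y + ?z))" by (simp add: tr_def sum_lessThan_3 numeral_2_eq_2)
  show "tr v \<in> \<rat>" unfolding tr by (intro Rats_minus_iff[THEN iffD2] e1)
  \<comment> \<open>Newton's identity for the second power sum; the elementary symmetric functions
    are coefficients of a rational polynomial.\<close>
  have "tr (v ^ 2) = (- (?x + ?y + ?z)) ^ 2 - 2 * (?x * ?y + ?x * ?z + ?y * ?z)"
    by (simp add: tr_def sum_lessThan_3 numeral_2_eq_2[symmetric] emb_power emb_mult power2_eq_square algebra_simps)
  also have "\<dots> \<in> \<rat>" by (intro Rats_diff Rats_power Rats_mult e1 e2) simp
  finally show "tr (v ^ 2) \<in> \<rat>" .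
qed

lemma tr_linear: "tr (\<Sum>i\<in>I. of_rat (c i) * x i) = (\<Sum>i\<in>I. of_rat (c i) * tr (x i))"
  unfolding tr_def emb_sum emb_mult emb_of_rat sum_distrib_left by (rule sum.swap)

lemma v_coordinates: "\<exists>c. x = (\<Sum>i<3. of_rat (c i) * v ^ i)"
proof -
  obtain p q r where "x = of_rat p + of_rat q * v + of_rat r * v ^ 2" using v_span[of x] by (elim exE)
  then show ?thesis
    by (intro exI[of _ "\<lambda>i. if i = 0 then p else if i = 1 then q else r"]) (simp add: sum_lessThan_3 numeral_2_eq_2[symmetric])
qed

lemma tr_rational: "tr x \<in> \<rat>"
proof -
  obtain c where c: "x = (\<Sum>i<3. of_rat (c i) * v ^ i)" using v_coordinates[of x] by (elim exE)
  have "tr (v ^ i) \<in> \<rat>" if "i < 3" for i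
  proof -
    have "tr (v ^ 0) = 3" by (simp add: tr_def emb_1)
    then have "tr (v ^ 0) \<in> \<rat>" by simp
    then show ?thesis using that v_power_sums_rational unfolding less_3_iff by (elim disjE) simp_all
  qed
  then show ?thesis unfolding c tr_linear by (intro Rats_sum Rats_mult Rats_of_rat) simp
qed

lemma tr_integral:
  assumes "algebraic_int x"
  obtains k where "tr x = of_int k"
proof -
  have "algebraic_int (emb s x)" for s by (rule field_hom_algebraic_int[OF emb_hom assms])
  then have "algebraic_int (tr x)" unfolding tr_def sum_lessThan_3 by (intro algebraic_int_add)
  then have "tr x \<in> \<int>" using tr_rational by (rule rational_algebraic_int_is_int)
  then show thesis using that by (rule Ints_cases)
qed

text \<open>Cramer's rule for the Gram matrix of the trace form on the powers of \<open>v\<close>, which is an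
  integer matrix whose determinant is the square of a Vandermonde determinant.\<close>

lemma common_denominator:
  obtains d :: int where "0 < d"
    "\<And>x. algebraic_int x \<Longrightarrow> \<exists>m. of_int d * x = (\<Sum>i<3. of_int (m i) * v ^ i)"
proof -
  have "\<exists>k. tr (v ^ (j + s)) = of_int k" for j s
    using tr_integral[OF algebraic_int_power[OF v_int, of "j + s"]] by metis
  then obtain T where T: "\<And>j s. tr (v ^ (j + s)) = of_int (T j s)" by metis
  \<comment> \<open>The Vandermonde matrix of the conjugates of \<open>v\<close>; the Gram matrix is
    this matrix times its transpose.\<close>
  define P where "P j s = emb s v ^ j" for j s
  have "of_int (det3 T) = det3 (\<lambda>i k. complex_of_int (T i k))" by (rule of_int_det3)
  also have "\<dots> = det3 (\<lambda>i k. \<Sum>s<3. P i s * P k s)"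
    by (simp add: T[symmetric] tr_def P_def emb_power emb_mult power_add)
  also have "\<dots> = det3 P * det3 (\<lambda>s k. P k s)" by (rule det3_mult)
  also have "det3 (\<lambda>s k. P k s) = det3 P" by (simp add: det3_def minor2_def algebra_simps)
  also have "det3 P = (emb 1 v - emb 0 v) * (emb 2 v - emb 0 v) * (emb 2 v - emb 1 v)"
    by (simp add: det3_def minor2_def P_def algebra_simps power2_eq_square)
  finally have nz: "det3 T \<noteq> 0" using emb_v_distinct by auto
  have "\<exists>m. of_int (det3 T) * x = (\<Sum>i<3. of_int (m i) * v ^ i)" if x: "algebraic_int x" for x
  proof -
    obtain c where c: "x = (\<Sum>i<3. of_rat (c i) * v ^ i)" using v_coordinates[of x] by (elim exE)
    \<comment> \<open>Pairing \<open>x\<close> with powers of \<open>v\<close> under the trace gives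
      integers, so the rational coordinates of \<open>x\<close> solve a linear system with integer
      right-hand side.\<close>
    have "\<exists>k. (\<Sum>j<3. c j * rat_of_int (T j s)) = of_int k" for s
    proof -
      obtain k where k: "tr (x * v ^ s) = of_int k"
        by (rule tr_integral[OF algebraic_int_mult[OF x algebraic_int_power[OF v_int]]])
      have "x * v ^ s = (\<Sum>j<3. of_rat (c j) * v ^ (j + s))"
        unfolding c sum_distrib_right by (simp add: power_add mult.assoc)
      then have "tr (x * v ^ s) = (\<Sum>j<3. of_rat (c j) * of_int (T j s))"
        by (simp only: tr_linear T)
      also have "\<dots> = of_rat (\<Sum>j<3. c j * rat_of_int (T j s))" by (simp add: of_rat_sum of_rat_mult)
      finally have "complex_of_rat (\<Sum>j<3. c j * rat_of_int (T j s)) = of_rat (of_int k)" by (simp add: k)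
      then show ?thesis by (intro exI[of _ k]) (simp only: of_rat_eq_iff)
    qed
    then obtain n where n: "\<And>s. (\<Sum>j<3. c j * rat_of_int (T j s)) = of_int (n s)" by metis
    have m: "c i * of_int (det3 T) = of_int (\<Sum>s<3. n s * adj3 T s i)" if "i < 3" for i
      using mult_adj3[OF that, of c "\<lambda>j s. rat_of_int (T j s)"] unfolding n of_int_det3[symmetric] of_int_adj3[symmetric]
      by simp
    have "of_int (det3 T) * x = (\<Sum>i<3. of_rat (c i * of_int (det3 T)) * v ^ i)"
      unfolding c sum_distrib_left by (simp add: of_rat_mult mult_ac)
    also have "\<dots> = (\<Sum>i<3. of_int (\<Sum>s<3. n s * adj3 T s i) * v ^ i)"
      using m by (intro sum.cong) (simp_all only: lessThan_iff of_rat_of_int_eq)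
    finally show ?thesis by (intro exI)
  qed
  note D = this
  show thesis
  proof (rule that)
    show "0 < \<bar>det3 T\<bar>" using nz by simp
    fix x :: 'k assume x: "algebraic_int x"
    obtain m where m: "of_int (det3 T) * x = (\<Sum>i<3. of_int (m i) * v ^ i)" using D[OF x] by (elim exE)
    have "of_int \<bar>det3 T\<bar> * x = of_int (sgn (det3 T)) * (of_int (det3 T) * x)"
      by (simp add: abs_sgn mult_ac)
    also have "\<dots> = (\<Sum>i<3. of_int (sgn (det3 T) * m i) * v ^ i)"
      unfolding m sum_distrib_left by (simp add: mult.assoc)
    finally show "\<exists>m. of_int \<bar>det3 T\<bar> * x = (\<Sum>i<3. of_int (m i) * v ^ i)" by (intro exI)
  qed
qed

text \<open>The common denominator places the algebraic integers between the span of 1,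
  \<open>v\<close>, \<open>v ^ 2\<close> and that span divided by \<open>d\<close>; a Hermite basis
  of the corresponding integer lattice is an integral basis.\<close>

lemma integral_basis:
  obtains h :: "nat \<Rightarrow> 'k" where "h 0 \<noteq> 0"
    "\<And>x. algebraic_int x \<longleftrightarrow> (\<exists>m. x = (\<Sum>i<3. of_int (m i) * h i))"
proof -
  obtain d where d: "0 < d" and denom: "\<And>x. algebraic_int x \<Longrightarrow> \<exists>m. of_int d * x = (\<Sum>i<3. of_int (m i) * v ^ i)"
    by (rule common_denominator) blast
  define w where "w x y z = (of_int x + of_int y * v + of_int z * v ^ 2) / of_int d" for x y z :: int
  define L where "L = {(x, y, z). algebraic_int (w x y z)}"
  have dnz: "of_int d \<noteq> (0::'k)" using d by simp
  have diff: "diff3 s t \<in> L" if st: "s \<in> L" "t \<in> L" for s t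
  proof -
    obtain x y z x' y' z' where xyz: "s = (x, y, z)" "t = (x', y', z')" by (metis prod_cases3)
    have "w (x - x') (y - y') (z - z') = w x y z - w x' y' z'"
      by (simp add: w_def algebra_simps diff_divide_distrib add_divide_distrib)
    then show ?thesis using st by (auto simp: xyz L_def diff3_def intro: algebraic_int_diff)
  qed
  have units: "(d, 0, 0) \<in> L" "(0, d, 0) \<in> L" "(0, 0, d) \<in> L"
    using dnz v_int algebraic_int_power[OF v_int, of 2] by (simp_all add: L_def w_def)
  have "\<exists>a b c p q r. 0 < a \<and> (\<forall>x y z. (x, y, z) \<in> L \<longleftrightarrow>
       (\<exists>i j k. x = i * a + j * p + k * q \<and> y = j * b + k * r \<and> z = k * c))"
  proof (rule hermite_basis[OF diff d units], goal_cases)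
    case (3 a b c p q r)
    then show ?case by (intro exI[of _ a] exI[of _ b] exI[of _ c] exI[of _ p] exI[of _ q] exI[of _ r] conjI allI)
  qed
  then obtain a b c p q r where pos: "0 < a" and L': "\<forall>x y z. (x, y, z) \<in> L \<longleftrightarrow>
       (\<exists>i j k. x = i * a + j * p + k * q \<and> y = j * b + k * r \<and> z = k * c)"
    by (elim exE conjE) (rule that)
  have L: "(x, y, z) \<in> L \<longleftrightarrow> (\<exists>i j k. x = i * a + j * p + k * q \<and> y = j * b + k * r \<and> z = k * c)" for x y z
    using L' by (elim allE)
  \<comment> \<open>The rows of the Hermite basis, divided by \<open>d\<close>; the first one is
    \<open>a / d\<close>, which is visibly nonzero.\<close>
  define h where "h i = (if i = 0 then w a 0 0 else if i = 1 then w p b 0 else w q r c)" for i :: nat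
  have comb: "(\<Sum>n<3. of_int (m n) * h n) =
      w (m 0 * a + m 1 * p + m 2 * q) (m 1 * b + m 2 * r) (m 2 * c)" for m
    using dnz by (simp add: h_def w_def sum_lessThan_3 numeral_2_eq_2[symmetric] field_simps)
  show thesis
  proof (rule that)
    show "h 0 \<noteq> 0" using pos dnz by (simp add: h_def w_def)
    fix x :: 'k
    show "algebraic_int x \<longleftrightarrow> (\<exists>m. x = (\<Sum>i<3. of_int (m i) * h i))"
    proof
      assume x: "algebraic_int x"
      obtain m where m: "of_int d * x = (\<Sum>i<3. of_int (m i) * v ^ i)" using denom[OF x] by (elim exE)
      have xw: "x = w (m 0) (m 1) (m 2)"
        using m dnz by (simp add: w_def sum_lessThan_3 numeral_2_eq_2[symmetric] nonzero_eq_divide_eq mult.commute)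
      then have "(m 0, m 1, m 2) \<in> L" using x by (simp add: L_def)
      then obtain i j k where ijk: "m 0 = i * a + j * p + k * q" "m 1 = j * b + k * r" "m 2 = k * c"
        unfolding L by (elim exE conjE)
      show "\<exists>m. x = (\<Sum>i<3. of_int (m i) * h i)"
        by (rule exI[of _ "\<lambda>n. if n = 0 then i else if n = 1 then j else k"])
          (simp only: comb, simp add: xw ijk(1,3) ijk(2)[unfolded One_nat_def])
    next
      assume "\<exists>m. x = (\<Sum>i<3. of_int (m i) * h i)"
      then obtain m where m: "x = (\<Sum>i<3. of_int (m i) * h i)" by (elim exE)
      have "(m 0 * a + m 1 * p + m 2 * q, m 1 * b + m 2 * r, m 2 * c) \<in> L" unfolding L by blast
      then show "algebraic_int x" unfolding m comb L_def by simp
    qed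
  qed
qed

lemma unit_matrix:
  fixes h :: "nat \<Rightarrow> 'k"
  assumes h: "\<And>x. algebraic_int x \<longleftrightarrow> (\<exists>m. x = (\<Sum>i<3. of_int (m i) * h i))" and u: "algebraic_int u"
  obtains N where "\<And>i. i < 3 \<Longrightarrow> (\<Sum>j<3. of_int (N i j) * h j) = u * h i"
proof -
  have "\<exists>m. u * h i = (\<Sum>j<3. of_int (m j) * h j)" if i: "i < 3" for i
  proof -
    have "h i = (\<Sum>j<3. of_int (if j = i then 1 else 0) * h j)"
      using i unfolding less_3_iff by (elim disjE) (simp_all add: sum_lessThan_3 numeral_2_eq_2)
    then have "algebraic_int (h i)" unfolding h by (intro exI)
    then have "algebraic_int (u * h i)" by (rule algebraic_int_mult[OF u])
    then show ?thesis unfolding h .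
  qed
  then have "\<forall>i. \<exists>m. i < 3 \<longrightarrow> u * h i = (\<Sum>j<3. of_int (m j) * h j)" by blast
  then obtain N where "\<forall>i. i < 3 \<longrightarrow> u * h i = (\<Sum>j<3. of_int (N i j) * h j)" by metis
  then show thesis using that[of N] by simp
qed

lemma emb_unit_matrix:
  fixes h :: "nat \<Rightarrow> 'k"
  assumes "\<And>i. i < 3 \<Longrightarrow> (\<Sum>j<3. of_int (N i j) * h j) = u * h i" and "i < 3"
  shows "(\<Sum>j<3. of_int (N i j) * emb s (h j)) = emb s u * emb s (h i)"
proof -
  have "emb s (\<Sum>j<3. of_int (N i j) * h j) = emb s (u * h i)" using assms by simp
  then show ?thesis by (simp only: emb_sum emb_mult emb_of_int)
qed

text \<open>The determinant of multiplication is the norm. The norms of \<open>v\<close> and its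
  inverse are integers with product 1, and \<open>\<sigma>1 v\<close> times a square is not
  negative, so the determinant is 1.\<close>

lemma unit_spectral_data:
  obtains h :: "nat \<Rightarrow> 'k" and M where "\<And>x. algebraic_int x \<longleftrightarrow> (\<exists>m. x = (\<Sum>i<3. of_int (m i) * h i))"
    "spectral_data M (\<sigma>1 v) (\<sigma>2 v) (\<lambda>i. \<sigma>1 (h i)) (\<lambda>i. \<sigma>2 (h i))"
proof -
  obtain h :: "nat \<Rightarrow> 'k" where h0: "h 0 \<noteq> 0" and h: "\<And>x. algebraic_int x \<longleftrightarrow> (\<exists>m. x = (\<Sum>i<3. of_int (m i) * h i))"
    by (rule integral_basis) (rule that)
  obtain M where M: "\<And>i. i < 3 \<Longrightarrow> (\<Sum>j<3. of_int (M i j) * h j) = v * h i"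
    by (rule unit_matrix[OF h v_int]) (rule that)
  obtain N where N: "\<And>i. i < 3 \<Longrightarrow> (\<Sum>j<3. of_int (N i j) * h j) = inverse v * h i"
    by (rule unit_matrix[OF h v_inv]) (rule that)
  let ?P = "\<lambda>i s. emb s (h i)"
  have P: "det3 ?P \<noteq> 0"
  proof (rule eigenvectors_independent[where N = "\<lambda>i j. of_int (M i j)" and d = "\<lambda>s. emb s v", OF _ _ emb_v_distinct])
    show "(\<Sum>j<3. of_int (M i j) * emb s (h j)) = emb s v * emb s (h i)" if "i < 3" "s < 3" for i s
      by (rule emb_unit_matrix[OF M that(1)])
    show "\<exists>i<3. emb s (h i) \<noteq> 0" if "s < 3" for s
      using h0 by (intro exI[of _ 0]) (simp add: emb_eq_0_iff)
  qed
  have norm: "complex_of_int (det3 A) = emb 0 u * emb 1 u * emb 2 u"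
    if A: "\<And>i. i < 3 \<Longrightarrow> (\<Sum>j<3. of_int (A i j) * h j) = u * h i" for A u
    unfolding of_int_det3 by (rule det3_eigen[OF emb_unit_matrix[OF A] P])
  have "complex_of_int (det3 M * det3 N) = (emb 0 v * emb 0 (inverse v)) * (emb 1 v * emb 1 (inverse v)) * (emb 2 v * emb 2 (inverse v))"
    by (simp add: norm[OF M] norm[OF N])
  also have "\<dots> = 1" unfolding emb_mult[symmetric] right_inverse[OF v_nz] by (simp add: emb_1)
  finally have "det3 M * det3 N = 1" by (simp only: of_int_eq_1_iff)
  then have "det3 M = 1 \<or> det3 M = - 1" by (simp only: zmult_eq_1_iff) blast
  moreover have "complex_of_real (of_int (det3 M)) = complex_of_real (\<sigma>1 v * norm (\<sigma>2 v) ^ 2)"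
    using norm[OF M] complex_norm_square[of "\<sigma>2 v"] by (simp add: emb_def mult.assoc)
  then have "of_int (det3 M) = \<sigma>1 v * norm (\<sigma>2 v) ^ 2" by (simp only: of_real_eq_iff)
  then have "0 \<le> real_of_int (det3 M)" using v_pos by simp
  ultimately have det: "det3 M = 1" by auto
  interpret h1: field_hom \<sigma>1 by (rule hom1)
  interpret h2: field_hom \<sigma>2 by (rule hom2)
  have "spectral_data M (\<sigma>1 v) (\<sigma>2 v) (\<lambda>i. \<sigma>1 (h i)) (\<lambda>i. \<sigma>2 (h i))"
  proof
    show "0 < \<sigma>1 v" by (rule v_pos)
    show "\<sigma>1 v \<noteq> 1" using h1.eq_iff[of v 1] v_neq by simp
    show "\<sigma>2 v \<notin> \<real>" by (rule \<sigma>2_v)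
    show "(\<Sum>j<3. of_int (M i j) * \<sigma>1 (h j)) = \<sigma>1 v * \<sigma>1 (h i)" if "i < 3" for i
    proof -
      have "\<sigma>1 (\<Sum>j<3. of_int (M i j) * h j) = \<sigma>1 (v * h i)" using M[OF that] by simp
      then show ?thesis by (simp only: h1.hom_sum h1.hom_mult h1.hom_of_int)
    qed
    show "(\<Sum>j<3. of_int (M i j) * \<sigma>2 (h j)) = \<sigma>2 v * \<sigma>2 (h i)" if "i < 3" for i
      using emb_unit_matrix[OF M that, of 1] by (simp add: emb_def)
    show "\<exists>i<3. \<sigma>1 (h i) \<noteq> 0" "\<exists>i<3. \<sigma>2 (h i) \<noteq> 0"
      using h0 by (auto intro!: exI[of _ "0::nat"])
    show "det3 M = 1" by (rule det)
  qed
  with h show thesis by (rule that)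
qed

lemma unit_min_poly:
  assumes f: "element_minimal_poly v f" and spectral: "spectral_data M (\<sigma>1 v) (\<sigma>2 v) a b"
  shows "map_poly of_rat f = [:- complex_of_real (\<sigma>1 v), 1:] * [:- \<sigma>2 v, 1:] * [:- cnj (\<sigma>2 v), 1:]"
proof -
  interpret spectral_data M "\<sigma>1 v" "\<sigma>2 v" a b by (rule spectral)
  have monic: "lead_coeff f = 1" and root: "poly (map_poly of_rat f) v = 0"
    and min: "\<And>g. g \<noteq> 0 \<Longrightarrow> poly (map_poly of_rat g) v = 0 \<Longrightarrow> degree f \<le> degree g"
    using f by (auto simp: element_minimal_poly_def is_minimal_poly_def)
  obtain g :: "rat poly" where g: "lead_coeff g = 1" "degree g = 3" "poly (map_poly of_rat g) v = 0"
    using cubic_polynomial by (elim exE conjE)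
  have "g \<noteq> 0" using g(2) by auto
  then have "degree f \<le> 3" using min[OF _ g(3)] g(2) by simp
  show ?thesis
  proof (rule min_poly_factorization[OF monic \<open>degree f \<le> 3\<close>])
    have "spec s = emb s v" for s by (simp add: spec_def emb_def)
    then show "poly (map_poly of_rat f) (spec s) = 0" if "s < 3" for s
      using field_hom_poly_root[OF emb_hom root, of s] by simp
  qed
qed

end

section \<open>Oeljeklaus--Toma manifolds\<close>

lemma group_positive_units:
  assumes "field_hom \<sigma>1"
  shows "group (positive_units \<sigma>1)"
proof -
  interpret field_hom \<sigma>1 by fact
  show ?thesis
  proof (rule groupI)
    fix x assume x: "x \<in> carrier (positive_units \<sigma>1)"
    then have "inverse x \<in> carrier (positive_units \<sigma>1)" by (auto simp: positive_units_def hom_inverse)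
    then show "\<exists>y\<in>carrier (positive_units \<sigma>1). y \<otimes>\<^bsub>positive_units \<sigma>1\<^esub> x = \<one>\<^bsub>positive_units \<sigma>1\<^esub>"
      using x by (intro bexI[of _ "inverse x"]) (auto simp: positive_units_def)
  qed (auto simp: positive_units_def hom_mult algebraic_int_mult)
qed

lemma generate_positive_units:
  assumes hom: "field_hom \<sigma>1" and v: "v \<in> carrier (positive_units \<sigma>1)"
  shows "generate (positive_units \<sigma>1) {v} = range (\<lambda>j. v powi j)"
proof -
  let ?G = "positive_units \<sigma>1"
  interpret G: group ?G by (rule group_positive_units[OF hom])
  have nz: "v \<noteq> 0" using v by (simp add: positive_units_def)
  have inv: "inv\<^bsub>?G\<^esub> v = inverse v"
    by (rule G.inv_equality) (use v in \<open>auto simp: positive_units_def field_hom.hom_inverse[OF hom]\<close>)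
  have mult: "x \<otimes>\<^bsub>?G\<^esub> y = x * y" for x y by (simp add: positive_units_def)
  show ?thesis
  proof (intro equalityI subsetI)
    fix x assume "x \<in> generate ?G {v}"
    then show "x \<in> range (\<lambda>j. v powi j)"
    proof (induction rule: generate.induct)
      case one
      have "\<one>\<^bsub>?G\<^esub> = v powi 0" by (simp add: positive_units_def)
      then show ?case by (rule range_eqI)
    next
      case (incl h)
      then have "h = v powi 1" by simp
      then show ?case by (rule range_eqI)
    next
      case (inv h)
      then have "inv\<^bsub>?G\<^esub> h = v powi (- 1)" using \<open>inv\<^bsub>?G\<^esub> v = inverse v\<close> by (simp add: power_int_minus)
      then show ?case by (rule range_eqI)
    next
      case (eng h1 h2)
      then obtain i j where "h1 = v powi i" "h2 = v powi j" by auto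
      then have "h1 \<otimes>\<^bsub>?G\<^esub> h2 = v powi (i + j)" using nz by (simp add: mult power_int_add)
      then show ?case by (rule range_eqI)
    qed
  next
    fix x assume "x \<in> range (\<lambda>j. v powi j)"
    then obtain j where x: "x = v powi j" by auto
    have "v powi j \<in> generate ?G {v}"
    proof (induction j rule: int_induct[of _ 0])
      case base
      show ?case using generate.one[of ?G "{v}"] by (simp add: positive_units_def)
    next
      case (step1 j)
      have "v powi j \<otimes>\<^bsub>?G\<^esub> v \<in> generate ?G {v}"
        by (rule generate.eng[OF step1(2)]) (rule generate.incl, simp)
      then show ?case using nz by (simp add: mult power_int_add)
    next
      case (step2 j)
      have "v powi j \<otimes>\<^bsub>?G\<^esub> (inv\<^bsub>?G\<^esub> v) \<in> generate ?G {v}"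
        by (rule generate.eng[OF step2(2)]) (rule generate.inv, simp)
      then show ?case using nz by (simp add: mult inv power_int_diff divide_inverse)
    qed
    then show "x \<in> generate ?G {v}" by (simp only: x)
  qed
qed

lemma OT_cubic_unit:
  assumes cubic: "cubic_field_data \<sigma>1 \<sigma>2" and U: "OT_unit_data \<sigma>1 U v" and q: "OT_q U v q"
  shows "cubic_unit \<sigma>1 \<sigma>2 v" and "U = range (\<lambda>j. v powi j)"
proof -
  have hom: "field_hom \<sigma>1" using cubic by (simp add: cubic_field_data_def)
  have "subgroup U (positive_units \<sigma>1)" "v \<in> U" and gen: "U = generate (positive_units \<sigma>1) {v}"
    using U by (auto simp: OT_unit_data_def)
  then have v: "v \<in> carrier (positive_units \<sigma>1)" using subgroup.mem_carrier by metis
  show "U = range (\<lambda>j. v powi j)" unfolding gen by (rule generate_positive_units[OF hom v])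
  show "cubic_unit \<sigma>1 \<sigma>2 v"
  proof
    show "v \<noteq> 1"
    proof
      \<comment> \<open>\<open>q\<close> separates the powers \<open>v powi 1\<close> and
        \<open>v powi 0\<close>, which would coincide.\<close>
      assume v1: "v = 1"
      have "q (0, v powi 1) = 1" "q (0, v powi 0) = 0" using q unfolding OT_q_def by blast+
      then show False unfolding v1 by simp
    qed
  qed (use cubic v in \<open>simp_all add: positive_units_def\<close>)
qed

lemma OT_torsion_growth:
  fixes X :: "nat \<Rightarrow> (complex \<times> complex) set topology" and f :: "rat poly" and v :: "'k::field_char_0"
  assumes data: "cubic_field_data \<sigma>1 \<sigma>2" "OT_unit_data \<sigma>1 U v" and q: "OT_q U v q"
    and X: "X = cyclic_cover (top_of_set HxC) (OT_group U) (OT_action \<sigma>1 \<sigma>2) q"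
    and f: "element_minimal_poly v f"
  shows
    "(\<forall>n\<ge>1. \<forall>r\<in>{0..4}. finite (torsion_part (homology_group r (X n)))) \<and>
     (\<forall>r\<in>{1, 2}. (\<lambda>n. ln (real (torsion_order r (X n))))
        \<sim>[at_top] (\<lambda>n. real n * ln (mahler_measure_poly (map_poly of_rat f)))) \<and>
     (\<forall>r\<in>{0, 3, 4}. (\<lambda>n. ln (real (torsion_order r (X n)))) \<sim>[at_top] (\<lambda>n. 0)) \<and>
     1 < mahler_measure_poly (map_poly of_rat f) \<and>
     (\<forall>r\<in>{1, 2}. \<exists>C D::real. 1 < C \<and>
        (\<forall>\<^sub>F n in at_top. C ^ n \<le> real (torsion_order r (X n)) \<and>
                           real (torsion_order r (X n)) \<le> D ^ n))"
proof -
  interpret cubic_unit \<sigma>1 \<sigma>2 v by (rule OT_cubic_unit(1)[OF data q])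
  have U: "U = range (\<lambda>j. v powi j)" by (rule OT_cubic_unit(2)[OF data q])
  obtain h M where h: "\<And>x. algebraic_int x \<longleftrightarrow> (\<exists>m. x = (\<Sum>i<3. of_int (m i) * h i))"
    and spectral: "spectral_data M (\<sigma>1 v) (\<sigma>2 v) (\<lambda>i. \<sigma>1 (h i)) (\<lambda>i. \<sigma>2 (h i))"
    by (rule unit_spectral_data) (rule that)
  interpret D: spectral_data M "\<sigma>1 v" "\<sigma>2 v" "\<lambda>i. \<sigma>1 (h i)" "\<lambda>i. \<sigma>2 (h i)" by (rule spectral)
  interpret h1: field_hom \<sigma>1 by (rule hom1)
  interpret h2: field_hom \<sigma>2 by (rule hom2)
  have pow1: "\<sigma>1 (v powi j) = \<sigma>1 v powi j" and pow2: "\<sigma>2 (v powi j) = \<sigma>2 v powi j" for j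
    by (simp_all only: power_int_def h1.hom_power h2.hom_power h1.hom_inverse h2.hom_inverse if_distrib[of \<sigma>1] if_distrib[of \<sigma>2])
  have act: "OT_action \<sigma>1 \<sigma>2 (\<Sum>i<3. of_int (m i) * h i, v powi j) x = D.S.shift m (D.S.scale j x)" if "x \<in> HxC" for m j x
  proof -
    have "\<sigma>1 (\<Sum>i<3. of_int (m i) * h i) = lattice_shift (\<lambda>i. \<sigma>1 (h i)) m"
      "\<sigma>2 (\<Sum>i<3. of_int (m i) * h i) = lattice_shift (\<lambda>i. \<sigma>2 (h i)) m"
      by (simp_all add: lattice_shift_def h1.hom_sum h1.hom_mult h1.hom_of_int h2.hom_sum h2.hom_mult h2.hom_of_int)
    then show ?thesis
      using that by (simp add: OT_action_def D.S.shift_def D.S.scale_def pow1 pow2 case_prod_beta add.commute)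
  qed
  have q_eq: "q (y, v powi j) = j" if "algebraic_int y" for y j using q that by (simp add: OT_q_def)
  show ?thesis
  proof (rule D.torsion_growth_orbits[OF unit_min_poly[OF f spectral]])
    show "X n = orbit_space (top_of_set HxC) ((OT_group U)\<lparr>carrier := {g \<in> carrier (OT_group U). int n dvd q g}\<rparr>) (OT_action \<sigma>1 \<sigma>2)" for n
      unfolding X cyclic_cover_def ..
    fix n :: nat and x :: "complex \<times> complex" assume n: "1 \<le> n" and x: "x \<in> HxC"
    show "orbit ((OT_group U)\<lparr>carrier := {g \<in> carrier (OT_group U). int n dvd q g}\<rparr>) (OT_action \<sigma>1 \<sigma>2) x =
        {D.S.shift m (D.S.scale (int n * k) x) | m k. True}"
    proof (intro equalityI subsetI)
      fix y assume "y \<in> orbit ((OT_group U)\<lparr>carrier := {g \<in> carrier (OT_group U). int n dvd q g}\<rparr>) (OT_action \<sigma>1 \<sigma>2) x"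
      then obtain z u where g: "algebraic_int z" "u \<in> U" "int n dvd q (z, u)" "y = OT_action \<sigma>1 \<sigma>2 (z, u) x"
        by (auto simp: orbit_def OT_group_def)
      obtain m where m: "z = (\<Sum>i<3. of_int (m i) * h i)" using g(1) unfolding h by (elim exE)
      obtain j where j: "u = v powi j" using g(2) unfolding U by (rule rangeE)
      have "int n dvd j" using g(3) unfolding j q_eq[OF g(1)] .
      then obtain k where k: "j = int n * k" by (rule dvdE)
      have "y = D.S.shift m (D.S.scale (int n * k) x)" unfolding g(4) m j k by (rule act[OF x])
      then show "y \<in> {D.S.shift m (D.S.scale (int n * k) x) | m k. True}" by (intro CollectI exI conjI TrueI)
    next
      fix y assume "y \<in> {D.S.shift m (D.S.scale (int n * k) x) | m k. True}"
      then obtain m k where y: "y = D.S.shift m (D.S.scale (int n * k) x)" by (elim CollectE exE conjE)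
      let ?g = "(\<Sum>i<3. of_int (m i) * h i, v powi (int n * k))"
      have int: "algebraic_int (\<Sum>i<3. of_int (m i) * h i)" unfolding h by (intro exI[of _ m] refl)
      have "?g \<in> carrier (OT_group U)" using int by (simp add: OT_group_def U)
      moreover have "q ?g = int n * k" by (rule q_eq[OF int])
      ultimately have "?g \<in> {g \<in> carrier (OT_group U). int n dvd q g}" by simp
      moreover have "y = OT_action \<sigma>1 \<sigma>2 ?g x" unfolding y by (rule act[OF x, symmetric])
      ultimately show "y \<in> orbit ((OT_group U)\<lparr>carrier := {g \<in> carrier (OT_group U). int n dvd q g}\<rparr>) (OT_action \<sigma>1 \<sigma>2) x"
        unfolding orbit_def by (intro CollectI exI[of _ ?g] conjI) simp_all
    qed
  qed
qed

theorem theorem1: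
  fixes X :: "nat \<Rightarrow> (complex \<times> complex) set topology"
    and f :: "rat poly"
    and M :: "int mat" and \<alpha> :: real and \<beta> :: complex
    and a :: "real Matrix.vec" and b :: "complex Matrix.vec"
    and q :: "(complex \<times> complex \<Rightarrow> complex \<times> complex) \<Rightarrow> int"
    and \<sigma>1 :: "'k::field_char_0 \<Rightarrow> real" and \<sigma>2 :: "'k \<Rightarrow> complex"
    and U :: "'k set" and v :: 'k and q' :: "'k \<times> 'k \<Rightarrow> int"
  assumes
    "(inoue_data M \<alpha> \<beta> a b \<and> inoue_q \<alpha> \<beta> a b q \<and>
      X = cyclic_cover (top_of_set HxC) (inoue_group \<alpha> \<beta> a b) (\<lambda>g. g) q \<and>
      matrix_minimal_poly M f)
     \<or>
     (cubic_field_data \<sigma>1 \<sigma>2 \<and> OT_unit_data \<sigma>1 U v \<and> OT_q U v q' \<and>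
      X = cyclic_cover (top_of_set HxC) (OT_group U) (OT_action \<sigma>1 \<sigma>2) q' \<and>
      element_minimal_poly v f)"
  shows
    "(\<forall>n\<ge>1. \<forall>r\<in>{0..4}. finite (torsion_part (homology_group r (X n)))) \<and>
     (\<forall>r\<in>{1, 2}. (\<lambda>n. ln (real (torsion_order r (X n))))
        \<sim>[at_top] (\<lambda>n. real n * ln (mahler_measure_poly (map_poly of_rat f)))) \<and>
     (\<forall>r\<in>{0, 3, 4}. (\<lambda>n. ln (real (torsion_order r (X n)))) \<sim>[at_top] (\<lambda>n. 0)) \<and>
     1 < mahler_measure_poly (map_poly of_rat f) \<and>
     (\<forall>r\<in>{1, 2}. \<exists>C D::real. 1 < C \<and>
        (\<forall>\<^sub>F n in at_top. C ^ n \<le> real (torsion_order r (X n)) \<and>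
                           real (torsion_order r (X n)) \<le> D ^ n))"
  using assms
proof (elim disjE conjE)
  assume "inoue_data M \<alpha> \<beta> a b" "inoue_q \<alpha> \<beta> a b q"
    "X = cyclic_cover (top_of_set HxC) (inoue_group \<alpha> \<beta> a b) (\<lambda>g. g) q" "matrix_minimal_poly M f"
  then show ?thesis by (rule inoue_torsion_growth)
next
  assume "cubic_field_data \<sigma>1 \<sigma>2" "OT_unit_data \<sigma>1 U v" "OT_q U v q'"
    "X = cyclic_cover (top_of_set HxC) (OT_group U) (OT_action \<sigma>1 \<sigma>2) q'" "element_minimal_poly v f"
  then show ?thesis by (rule OT_torsion_growth)
qed

end
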